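(* Let $D\subset\mathbb{R}^n$ be a convex domain, $E=D\times\mathbb{R}^r$ the flat (trivial) vector bundle over $D$, $1\le q\le n$, and $g$ a Riemannian metric on $E$ (a $C^2$ map into $\mathrm{Sym}^+_r(\mathbb{R})$). Assume $(E,g)$ is Nakano $q$-semipositive. Then for every $d$-closed $E$-valued $q$-form $f$ smooth up to the boundary, $f\in\wedge^q(\bar D,E)\cap\mathrm{Ker}(d)\cap\mathrm{Dom}(d^* )$, with $$\int_D\langle\Theta_E^{-1}f,f\rangle_g\,d\lambda<+\infty,$$ the equation $du=f$ has a solution $u\in L^2_{q-1}(D,E)$ satisfying $$\int_D|u|_g^2\,d\lambda\le\int_D\langle\Theta_E^{-1}f,f\rangle_g\,d\lambda.$$
   Context: For $E$-valued forms $\alpha=\sum_\tau(\sum_{|I|=q}\alpha_{I,\tau}dx_I)\otimes e_\tau$, $\langle\alpha,\beta\rangle_g=\sum_{\tau,\xi}\sum_I\alpha_{I,\tau}\beta_{I,\xi}g_{\tau\xi}$, $|\alpha|_g^2=\langle\alpha,\alpha\rangle_g$; $L^2_{q}(D,E)$ is the completion of smooth $E$-valued $q$-forms under $\int_D\langle\cdot,\cdot\rangle_g\,d\lambda$, $d$ denotes the maximal (weak) exterior derivative between these spaces and $d^*$ its Hilbert space adjoint. The curvature operator is $\Theta_E=-\sum_{i,j=1}^n\frac{\partial}{\partial x_i}\big(g^{-1}\frac{\partial g}{\partial x_j}\big)\,dx_i\wedge\big(\frac{\partial}{\partial x_j}\lrcorner\,\cdot\big)$ (matrix acting on fiber coefficients),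 and $(E,g)$ is Nakano $q$-semipositive if $\langle\Theta_E\alpha,\alpha\rangle_g\ge0$ pointwise for all $E$-valued $q$-forms $\alpha$. *)

theory Defs
  imports "HOL-Analysis.Analysis"
begin

text \<open>Points of R^n are vectors real^'n with a finite, linearly ordered index type 'n
  (the order fixes the increasing ordering of multi-indices). The fibre R^r is indexed by
  the finite type 'r. An E-valued p-form at a point is given by its coefficients
  a I tau, where I ranges over the subsets of 'n of cardinality p (increasing multi-indices);
  values at other sets are irrelevant.\<close>

type_synonym ('n, 'r) coeffs = "'n set \<Rightarrow> 'r \<Rightarrow> real"

definition sgnpos :: "'n::linorder \<Rightarrow> 'n set \<Rightarrow> real" where
  "sgnpos i J = (-1) ^ card {k\<in>J. k < i}"

definition gip :: "real^'r^'r \<Rightarrow> nat \<Rightarrow> ('n::finite, 'r::finite) coeffs \<Rightarrow> ('n, 'r) coeffs \<Rightarrow> real" where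
  "gip G p a b = (\<Sum>I\<in>{I::'n set. card I = p}. \<Sum>\<tau>\<in>UNIV. \<Sum>\<xi>\<in>UNIV. a I \<tau> * b I \<xi> * G $ \<tau> $ \<xi>)"

definition contr :: "'n::linorder \<Rightarrow> ('n, 'r) coeffs \<Rightarrow> ('n, 'r) coeffs" where
  "contr j a J \<tau> = (if j \<notin> J then sgnpos j J * a (insert j J) \<tau> else 0)"

definition wedge :: "'n::linorder \<Rightarrow> ('n, 'r) coeffs \<Rightarrow> ('n, 'r) coeffs" where
  "wedge i b K \<tau> = (if i \<in> K then sgnpos i (K - {i}) * b (K - {i}) \<tau> else 0)"

definition matact :: "real^'r^'r \<Rightarrow> ('n, 'r::finite) coeffs \<Rightarrow> ('n, 'r) coeffs" where
  "matact M a I \<tau> = (\<Sum>\<sigma>\<in>UNIV. M $ \<tau> $ \<sigma> * a I \<sigma>)"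

definition pd :: "'n::finite \<Rightarrow> (real^'n \<Rightarrow> 'b::real_normed_vector) \<Rightarrow> real^'n \<Rightarrow> 'b" where
  "pd j F x = vector_derivative (\<lambda>t. F (x + t *\<^sub>R axis j 1)) (at 0)"

fun Ck_on :: "nat \<Rightarrow> (real^('n::finite)) set \<Rightarrow> (real^'n \<Rightarrow> 'b::real_normed_vector) \<Rightarrow> bool" where
  "Ck_on 0 S F = continuous_on S F"
| "Ck_on (Suc k) S F = (continuous_on S F \<and>
      (\<forall>j. \<forall>x\<in>S. (\<lambda>t. F (x + t *\<^sub>R axis j 1)) differentiable (at 0)) \<and>
      (\<forall>j. Ck_on k S (pd j F)))"

definition Cinf_on :: "(real^('n::finite)) set \<Rightarrow> (real^'n \<Rightarrow> 'b::real_normed_vector) \<Rightarrow> bool" where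
  "Cinf_on S F = (\<forall>k. Ck_on k S F)"

definition riem_metric :: "(real^('n::finite)) set \<Rightarrow> (real^'n \<Rightarrow> real^('r::finite)^'r) \<Rightarrow> bool" where
  "riem_metric D g = (Ck_on 2 D g \<and>
     (\<forall>x\<in>D. transpose (g x) = g x \<and> (\<forall>v. v \<noteq> 0 \<longrightarrow> v \<bullet> (g x *v v) > 0)))"

definition curv_mat :: "(real^('n::finite) \<Rightarrow> real^('r::finite)^'r) \<Rightarrow> 'n \<Rightarrow> 'n \<Rightarrow> real^'n \<Rightarrow> real^'r^'r" where
  "curv_mat g i j x = pd i (\<lambda>y. matrix_inv (g y) ** pd j g y) x"

definition Theta :: "((real,'n::{finite,linorder}) vec \<Rightarrow> real^('r::finite)^'r) \<Rightarrow> (real,'n) vec \<Rightarrow> ('n, 'r) coeffs \<Rightarrow> ('n, 'r) coeffs" where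
  "Theta g x a K \<tau> = - (\<Sum>i\<in>UNIV. \<Sum>j\<in>UNIV. matact (curv_mat g i j x) (wedge i (contr j a)) K \<tau>)"

definition nakano_q_semipositive :: "((real,'n::{finite,linorder}) vec) set \<Rightarrow> ((real,'n) vec \<Rightarrow> real^('r::finite)^'r) \<Rightarrow> nat \<Rightarrow> bool" where
  "nakano_q_semipositive D g q = (\<forall>x\<in>D. \<forall>a. gip (g x) q (Theta g x a) a \<ge> 0)"

text \<open>Pointwise value of <Theta_E^{-1} f, f>_g (standard convention, possibly +infinity):
  the least c with <f,a>_g^2 \<le> c <Theta_E a, a>_g for all q-forms a.\<close>
definition theta_inv :: "((real,'n::{finite,linorder}) vec \<Rightarrow> real^('r::finite)^'r) \<Rightarrow> nat \<Rightarrow> (real,'n) vec \<Rightarrow> ('n, 'r) coeffs \<Rightarrow> ennreal" where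
  "theta_inv g q x f = Inf {c. \<forall>a. ennreal ((gip (g x) q f a)\<^sup>2) \<le> c * ennreal (gip (g x) q (Theta g x a) a)}"

definition L2 :: "(real^('n::finite)) set \<Rightarrow> (real^'n \<Rightarrow> real^('r::finite)^'r) \<Rightarrow> nat \<Rightarrow> (real^'n \<Rightarrow> ('n, 'r) coeffs) \<Rightarrow> bool" where
  "L2 D g p u = ((\<forall>I \<tau>. card I = p \<longrightarrow> (\<lambda>x. u x I \<tau>) \<in> borel_measurable (lebesgue_on D)) \<and>
     (\<integral>\<^sup>+x\<in>D. ennreal (gip (g x) p (u x) (u x)) \<partial>lebesgue) < \<infinity>)"

definition L2norm_sq :: "(real^('n::finite)) set \<Rightarrow> (real^'n \<Rightarrow> real^('r::finite)^'r) \<Rightarrow> nat \<Rightarrow> (real^'n \<Rightarrow> ('n, 'r) coeffs) \<Rightarrow> ennreal" where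
  "L2norm_sq D g p u = (\<integral>\<^sup>+x\<in>D. ennreal (gip (g x) p (u x) (u x)) \<partial>lebesgue)"

definition test_fun :: "(real^('n::finite)) set \<Rightarrow> (real^'n \<Rightarrow> real) \<Rightarrow> bool" where
  "test_fun D \<phi> = (Cinf_on UNIV \<phi> \<and> (\<exists>K. compact K \<and> K \<subseteq> D \<and> (\<forall>x. x \<notin> K \<longrightarrow> \<phi> x = 0)))"

text \<open>Weak (distributional) exterior derivative: d u = v on D, u a p-form, v a (p+1)-form
  (d acts componentwise on the fibre coefficients since E is flat).\<close>
definition weak_d :: "((real,'n::{finite,linorder}) vec) set \<Rightarrow> nat \<Rightarrow> ((real,'n) vec \<Rightarrow> ('n, 'r) coeffs) \<Rightarrow> ((real,'n) vec \<Rightarrow> ('n, 'r) coeffs) \<Rightarrow> bool" where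
  "weak_d D p u v = (\<forall>I \<tau> \<phi>. card I = Suc p \<longrightarrow> test_fun D \<phi> \<longrightarrow>
      integrable (lebesgue_on D) (\<lambda>x. v x I \<tau> * \<phi> x) \<and>
      (\<forall>i\<in>I. integrable (lebesgue_on D) (\<lambda>x. u x (I - {i}) \<tau> * pd i \<phi> x)) \<and>
      integral\<^sup>L (lebesgue_on D) (\<lambda>x. v x I \<tau> * \<phi> x) =
        - (\<Sum>i\<in>I. sgnpos i (I - {i}) * integral\<^sup>L (lebesgue_on D) (\<lambda>x. u x (I - {i}) \<tau> * pd i \<phi> x)))"

definition dom_d :: "((real,'n::{finite,linorder}) vec) set \<Rightarrow> ((real,'n) vec \<Rightarrow> real^('r::finite)^'r) \<Rightarrow> nat \<Rightarrow> ((real,'n) vec \<Rightarrow> ('n, 'r) coeffs) \<Rightarrow> bool" where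
  "dom_d D g p u = (L2 D g p u \<and> (\<exists>w. L2 D g (Suc p) w \<and> weak_d D p u w))"

definition dom_dstar :: "((real,'n::{finite,linorder}) vec) set \<Rightarrow> ((real,'n) vec \<Rightarrow> real^('r::finite)^'r) \<Rightarrow> nat \<Rightarrow> ((real,'n) vec \<Rightarrow> ('n, 'r) coeffs) \<Rightarrow> bool" where
  "dom_dstar D g q f = (L2 D g q f \<and> (\<exists>C. \<forall>u w. L2 D g (q - 1) u \<longrightarrow> L2 D g q w \<longrightarrow> weak_d D (q - 1) u w \<longrightarrow>
      \<bar>integral\<^sup>L (lebesgue_on D) (\<lambda>x. gip (g x) q (w x) (f x))\<bar> \<le> C * sqrt (enn2real (L2norm_sq D g (q - 1) u))))"

definition smooth_upto_boundary :: "(real^('n::finite)) set \<Rightarrow> (real^'n \<Rightarrow> ('n, 'r) coeffs) \<Rightarrow> bool" where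
  "smooth_upto_boundary D f = (\<exists>U F. open U \<and> closure D \<subseteq> U \<and>
      (\<forall>I \<tau>. Cinf_on U (\<lambda>x. F x I \<tau>) \<and> (\<forall>x\<in>closure D. F x I \<tau> = f x I \<tau>)))"

end

theory Submission
  imports Defs "HOL-Computational_Algebra.Polynomial"
begin

text \<open>By Riesz, solving \<open>du = f\<close> with the stated bound amounts to
  \<open>\<langle>f, \<alpha>\<rangle>\<^sup>2 \<le> A \<parallel>d\<^sup>*\<alpha>\<parallel>\<^sup>2\<close> for compactly supported test forms \<open>\<alpha>\<close>, where \<open>A\<close> is the integral of
  \<open>\<langle>\<Theta>\<^sup>-\<^sup>1f, f\<rangle>\<close>. If \<open>\<alpha>\<close> were closed, the Bochner identity
  \<open>\<parallel>d\<alpha>\<parallel>\<^sup>2 + \<parallel>d\<^sup>*\<alpha>\<parallel>\<^sup>2 = \<parallel>\<nabla>\<alpha>\<parallel>\<^sup>2 + \<integral>\<langle>\<Theta>\<alpha>, \<alpha>\<rangle>\<close> and the Cauchy-Schwarz inequality for the form \<open>\<Theta>\<close> would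
  finish. So \<open>\<alpha>\<close> is replaced by its projection onto closed forms, which loses the compact support.
  To regain it, one changes the metric on a bounded open polytope between the support of \<open>\<alpha>\<close> and \<open>D\<close>
  by convex weights that vanish on the support of \<open>\<alpha>\<close> and blow up at the boundary of the polytope
  (the several-weights trick of Hoermander and Demailly; here convexity of \<open>D\<close> enters). They make cut-off
  functions followed by mollification approximate the projection in the graph norm, at the cost of a
  factor arbitrarily close to 1.\<close>

section \<open>Partial derivatives\<close>

text \<open>Cutting off the projection a by \<eta>_n creates the exterior product of d\<eta>_n with
  a, and cut-offs that exhaust a bounded set have unbounded gradients. Two functions handle this:
  |d\<eta>_n|^2 \<le> C exp \<psi>, q-forms are measured with exp (\<psi> - \<phi>) g and their
  derivatives with the smaller exp (-\<phi>) g, so the error is dominated by the norm of a and tends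
  to 0. The price is a mismatch: the codifferential belongs to the first metric, the Bochner
  identity is applied in the second, and the two codifferentials differ by the contraction with
  d\<psi>. This fixes how strongly convex \<phi> must be compared with \<psi>. The metric is only
  C^2 and the projection only square-integrable. Hence test forms carry one derivative, d d = 0 is
  used under the integral sign, and second derivatives occur only for mollified forms, which take
  them from the kernel. Test forms are recorded as v = G \<alpha>: the pairing of \<alpha> with u in
  the metric G is then the Euclidean one of v with u, and the adjoint of d involves no derivative of
  G.\<close>

definition hpd :: "'n::finite \<Rightarrow> (real^'n \<Rightarrow> 'b::real_normed_vector) \<Rightarrow> 'b \<Rightarrow> real^'n \<Rightarrow> bool" where
  "hpd j F F' x \<longleftrightarrow> ((\<lambda>t. F (x + t *\<^sub>R axis j 1)) has_vector_derivative F') (at 0)"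

lemma hpd_imp_pd: "hpd j F F' x \<Longrightarrow> pd j F x = F'"
  unfolding hpd_def pd_def by (rule vector_derivative_at)

text \<open>\<open>pd\<close> returns some value even where no derivative exists. \<open>hpd\<close>
  carries the existence, and this equivalence links it to the differentiability clause of
  \<open>Ck_on\<close>.\<close>

lemma hpd_iff_differentiable:
  "hpd j F (pd j F x) x \<longleftrightarrow> (\<lambda>t. F (x + t *\<^sub>R axis j 1)) differentiable (at 0)"
  unfolding hpd_def pd_def by (rule vector_derivative_works[symmetric])

lemma hpd_const [simp]: "hpd j (\<lambda>x. c) 0 x"
  by (simp add: hpd_def)

lemma hpd_add: "hpd j F F' x \<Longrightarrow> hpd j G G' x \<Longrightarrow> hpd j (\<lambda>x. F x + G x) (F' + G') x"
  unfolding hpd_def by (rule has_vector_derivative_add)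

lemma hpd_diff: "hpd j F F' x \<Longrightarrow> hpd j G G' x \<Longrightarrow> hpd j (\<lambda>x. F x - G x) (F' - G') x"
  unfolding hpd_def by (rule has_vector_derivative_diff)

lemma hpd_sum:
  "(\<And>i. i \<in> I \<Longrightarrow> hpd j (F i) (F' i) x) \<Longrightarrow> hpd j (\<lambda>x. \<Sum>i\<in>I. F i x) (\<Sum>i\<in>I. F' i) x"
  unfolding hpd_def by (rule has_vector_derivative_sum)

lemma hpd_linear: "bounded_linear L \<Longrightarrow> hpd j F F' x \<Longrightarrow> hpd j (\<lambda>x. L (F x)) (L F') x"
  unfolding hpd_def by (rule bounded_linear.has_vector_derivative)

lemma hpd_bilinear:
  assumes "bounded_bilinear P" "hpd j F F' x" "hpd j G G' x"
  shows "hpd j (\<lambda>x. P (F x) (G x)) (P (F x) G' + P F' (G x)) x"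
  using bounded_bilinear.has_vector_derivative[OF assms(1) assms(2)[unfolded hpd_def] assms(3)[unfolded hpd_def]]
  by (simp add: hpd_def)

lemma hpd_compose_real:
  assumes "hpd j F F' x" "(h has_real_derivative h') (at (F x))"
  shows "hpd j (\<lambda>x. h (F x)) (h' * F') x"
proof -
  have "((\<lambda>t. F (x + t *\<^sub>R axis j 1)) has_real_derivative F') (at 0)"
    using assms(1) by (simp add: hpd_def has_real_derivative_iff_has_vector_derivative)
  from DERIV_chain2[of h h' "\<lambda>t. F (x + t *\<^sub>R axis j 1)" 0, OF _ this]
  show ?thesis using assms(2)
    by (simp add: hpd_def has_real_derivative_iff_has_vector_derivative[symmetric])
qed

lemma hpd_coord: "hpd j (\<lambda>x. x $ k) (if k = j then 1 else 0) x"
proof -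
  have "((\<lambda>t. (x + t *\<^sub>R axis j 1) $ k) has_real_derivative (if k = j then 1 else 0)) (at 0)"
    by (auto intro!: derivative_eq_intros simp: axis_def)
  then show ?thesis by (simp add: hpd_def has_real_derivative_iff_has_vector_derivative)
qed

lemma hpd_inner_id: "hpd j (\<lambda>x. c \<bullet> x) (c $ j) x"
proof -
  have "((\<lambda>t. c \<bullet> (x + t *\<^sub>R axis j 1)) has_vector_derivative (c \<bullet> axis j 1)) (at 0)"
    unfolding inner_add_right inner_scaleR_right
    by (auto intro!: derivative_eq_intros simp: has_real_derivative_iff_has_vector_derivative[symmetric])
  then show ?thesis by (simp add: hpd_def inner_axis)
qed

lemma hpd_cong:
  assumes "open S" "x \<in> S" "\<And>y. y \<in> S \<Longrightarrow> F y = G y"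
  shows "hpd j F F' x \<longleftrightarrow> hpd j G F' x"
proof -
  let ?l = "\<lambda>t. x + t *\<^sub>R axis j (1::real)"
  have o: "open (?l -` S)" by (intro open_vimage assms continuous_intros)
  have z: "(0::real) \<in> ?l -` S" using assms by simp
  have *: "(P has_vector_derivative F') (at 0) \<Longrightarrow> (Q has_vector_derivative F') (at 0)"
    if "\<And>t. t \<in> ?l -` S \<Longrightarrow> P t = Q t" for P Q :: "real \<Rightarrow> 'b"
    by (rule has_vector_derivative_transform_within_open[OF _ o z that])
  show ?thesis unfolding hpd_def
    using *[of "\<lambda>t. F (?l t)" "\<lambda>t. G (?l t)"] *[of "\<lambda>t. G (?l t)" "\<lambda>t. F (?l t)"] assms(3)
    by auto
qed

lemma hpd_line:
  assumes "hpd j F F' (x + t *\<^sub>R axis j 1)"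
  shows "((\<lambda>t. F (x + t *\<^sub>R axis j 1)) has_vector_derivative F') (at t)"
proof -
  have "((\<lambda>s. F (x + t *\<^sub>R axis j 1 + (s - t) *\<^sub>R axis j 1)) has_vector_derivative 1 *\<^sub>R F') (at t)"
    using assms unfolding hpd_def
    by (intro vector_diff_chain_at[where g="\<lambda>u. F (x + t *\<^sub>R axis j 1 + u *\<^sub>R axis j 1)" and f="\<lambda>s. s - t", unfolded o_def])
       (auto intro!: derivative_eq_intros)
  then show ?thesis by (simp add: algebra_simps)
qed

lemma hpd_reflect:
  assumes "hpd j F F' (c - x)" shows "hpd j (\<lambda>x. F (c - x)) (- F') x"
proof -
  have "((\<lambda>s. F (c - x + (- s) *\<^sub>R axis j 1)) has_vector_derivative (-1) *\<^sub>R F') (at 0)"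
    using assms unfolding hpd_def
    by (intro vector_diff_chain_at[where g="\<lambda>u. F (c - x + u *\<^sub>R axis j 1)" and f="\<lambda>s. - s", unfolded o_def])
       (auto intro!: derivative_eq_intros)
  then show ?thesis by (simp add: hpd_def algebra_simps)
qed

section \<open>Continuous differentiability, one coordinate direction at a time\<close>

definition C1 :: "(real^'n::finite) set \<Rightarrow> (real^'n \<Rightarrow> 'b::real_normed_vector) \<Rightarrow> bool" where
  "C1 S F \<longleftrightarrow> continuous_on S F \<and> (\<forall>j. continuous_on S (pd j F)) \<and> (\<forall>j. \<forall>x\<in>S. hpd j F (pd j F x) x)"

lemma C1I:
  assumes "continuous_on S F" "\<And>j. continuous_on S (F' j)" "\<And>j x. x \<in> S \<Longrightarrow> hpd j F (F' j x) x"
  shows "C1 S F"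
proof -
  have *: "\<And>j x. x \<in> S \<Longrightarrow> pd j F x = F' j x" using assms(3) hpd_imp_pd by blast
  show ?thesis unfolding C1_def using assms(1,3) continuous_on_cong[OF refl *] assms(2) * by simp
qed

lemma C1_cont: "C1 S F \<Longrightarrow> continuous_on S F" and C1_cont_pd: "C1 S F \<Longrightarrow> continuous_on S (pd j F)"
  and C1_hpd: "C1 S F \<Longrightarrow> x \<in> S \<Longrightarrow> hpd j F (pd j F x) x"
  by (auto simp: C1_def)

lemma C1_subset: "C1 S F \<Longrightarrow> T \<subseteq> S \<Longrightarrow> C1 T F"
  unfolding C1_def using continuous_on_subset by blast

lemma Ck_on_1_C1: "Ck_on (Suc k) S F \<Longrightarrow> C1 S F"
proof (cases k)
  case (Suc m)
  then show "Ck_on (Suc k) S F \<Longrightarrow> C1 S F" by (auto simp: C1_def hpd_iff_differentiable)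
qed (auto simp: C1_def hpd_iff_differentiable)

lemma Ck_on_2_C1: "Ck_on 2 S F \<Longrightarrow> C1 S F \<and> (\<forall>j. C1 S (pd j F))"
  using Ck_on_1_C1[of 1 S F] Ck_on_1_C1[of 0 S "pd j F" for j] by (simp add: numeral_2_eq_2)

lemma C1_const [simp]: "C1 S (\<lambda>x. c)"
  by (rule C1I[where F'="\<lambda>j x. 0"]) auto

lemma C1_add: "C1 S F \<Longrightarrow> C1 S G \<Longrightarrow> C1 S (\<lambda>x. F x + G x)"
  by (rule C1I[where F'="\<lambda>j x. pd j F x + pd j G x"])
     (auto simp: C1_def intro!: continuous_on_add hpd_add)

lemma C1_diff: "C1 S F \<Longrightarrow> C1 S G \<Longrightarrow> C1 S (\<lambda>x. F x - G x)"
  by (rule C1I[where F'="\<lambda>j x. pd j F x - pd j G x"])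
     (auto simp: C1_def intro!: continuous_on_diff hpd_diff)

lemma C1_sum: "(\<And>i. i \<in> I \<Longrightarrow> C1 S (F i)) \<Longrightarrow> C1 S (\<lambda>x. \<Sum>i\<in>I. F i x)"
  by (rule C1I[where F'="\<lambda>j x. \<Sum>i\<in>I. pd j (F i) x"])
     (auto simp: C1_def intro!: continuous_on_sum hpd_sum)

lemma C1_linear:
  assumes "bounded_linear L" "C1 S F"
  shows "C1 S (\<lambda>x. L (F x))"
proof (rule C1I[where F'="\<lambda>j x. L (pd j F x)"])
  show "continuous_on S (\<lambda>x. L (F x))"
    by (rule bounded_linear.continuous_on[OF assms(1) C1_cont[OF assms(2)]])
  show "continuous_on S (\<lambda>x. L (pd j F x))" for j
    by (rule bounded_linear.continuous_on[OF assms(1) C1_cont_pd[OF assms(2)]])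
  show "hpd j (\<lambda>x. L (F x)) (L (pd j F x)) x" if "x \<in> S" for j x
    by (rule hpd_linear[OF assms(1) C1_hpd[OF assms(2) that]])
qed

lemma C1_bilinear:
  assumes "bounded_bilinear P" "C1 S F" "C1 S G"
  shows "C1 S (\<lambda>x. P (F x) (G x))"
proof (rule C1I[where F'="\<lambda>j x. P (F x) (pd j G x) + P (pd j F x) (G x)"])
  note c = bounded_bilinear.continuous_on[OF assms(1)]
  show "continuous_on S (\<lambda>x. P (F x) (G x))"
    by (rule c[OF C1_cont[OF assms(2)] C1_cont[OF assms(3)]])
  show "continuous_on S (\<lambda>x. P (F x) (pd j G x) + P (pd j F x) (G x))" for j
    by (rule continuous_on_add[OF c[OF C1_cont[OF assms(2)] C1_cont_pd[OF assms(3)]]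
          c[OF C1_cont_pd[OF assms(2)] C1_cont[OF assms(3)]]])
  show "hpd j (\<lambda>x. P (F x) (G x)) (P (F x) (pd j G x) + P (pd j F x) (G x)) x" if "x \<in> S" for j x
    by (rule hpd_bilinear[OF assms(1) C1_hpd[OF assms(2) that] C1_hpd[OF assms(3) that]])
qed

lemma C1_compose_real:
  assumes "C1 S F" "\<And>x. x \<in> S \<Longrightarrow> (h has_real_derivative h' (F x)) (at (F x))" "continuous_on (F ` S) h'"
  shows "C1 S (\<lambda>x. h (F x))"
proof (rule C1I[where F'="\<lambda>j x. h' (F x) * pd j F x"])
  have "continuous_on (F ` S) h"
    by (rule DERIV_continuous_on[where D=h']) (auto intro: has_field_derivative_at_within assms(2))
  then show "continuous_on S (\<lambda>x. h (F x))"
    using continuous_on_compose[of S F h] C1_cont[OF assms(1)] by (simp add: o_def)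
  show "continuous_on S (\<lambda>x. h' (F x) * pd j F x)" for j
    using continuous_on_compose[of S F h'] C1_cont[OF assms(1)] C1_cont_pd[OF assms(1)] assms(3)
    by (auto intro!: continuous_on_mult simp: o_def)
  show "hpd j (\<lambda>x. h (F x)) (h' (F x) * pd j F x) x" if "x \<in> S" for j x
    by (rule hpd_compose_real[OF C1_hpd[OF assms(1) that] assms(2)[OF that]])
qed

lemma C1_cong:
  assumes "open S" "\<And>y. y \<in> S \<Longrightarrow> F y = G y" "C1 S G"
  shows "C1 S F"
proof (rule C1I[where F'="\<lambda>j. pd j G"])
  show "continuous_on S F" using continuous_on_cong[of S S F G] assms(2) C1_cont[OF assms(3)] by auto
  show "hpd j F (pd j G x) x" if "x \<in> S" for j x
    using hpd_cong[OF assms(1) that, of F G] assms(2) C1_hpd[OF assms(3) that] by auto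
qed (use assms C1_cont_pd in auto)

lemma pd_cong:
  assumes "open S" "x \<in> S" "\<And>y. y \<in> S \<Longrightarrow> F y = G y" "C1 S G"
  shows "pd j F x = pd j G x"
  by (rule hpd_imp_pd) (use hpd_cong[OF assms(1,2), of F G] assms(3) C1_hpd[OF assms(4,2)] in auto)

lemma pd_zero_outside:
  assumes "closed K" "\<And>x. x \<notin> K \<Longrightarrow> F x = 0" "x \<notin> K"
  shows "hpd j F 0 x"
  using hpd_cong[of "-K" x F "\<lambda>x. 0" j 0] assms by auto

text \<open>\<open>S\<close> and the complement of \<open>K\<close> are open and cover the space.
  The extension agrees with \<open>F\<close> on the first and with 0 on the second, so derivatives
  and their continuity are inherited locally.\<close>

lemma C1_extend:
  assumes "open S" "C1 S F" "closed K" "K \<subseteq> S" "\<And>x. x \<in> S - K \<Longrightarrow> F x = 0"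
  shows "C1 UNIV (\<lambda>x. if x \<in> K then F x else 0)"
    and "pd j (\<lambda>x. if x \<in> K then F x else 0) x = (if x \<in> K then pd j F x else 0)"
proof -
  let ?F = "\<lambda>x. if x \<in> K then F x else 0" let ?F' = "\<lambda>j x. if x \<in> K then pd j F x else 0"
  have 1: "hpd j ?F (?F' j x) x" for j x
  proof (cases "x \<in> K")
    case True
    with assms have "hpd j ?F (pd j F x) x \<longleftrightarrow> hpd j F (pd j F x) x"
      by (intro hpd_cong[of S]) auto
    with True assms show ?thesis using C1_hpd[OF assms(2), of x j] by auto
  qed (use pd_zero_outside[of K ?F] assms in auto)
  have 0: "pd j F x = 0" if "x \<in> S - K" for x j
  proof -
    have "hpd j F 0 x \<longleftrightarrow> hpd j (\<lambda>x. 0::'b) 0 x" 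
      by (rule hpd_cong[of "S - K" x F "\<lambda>x. 0"]) (use assms that in auto)
    then have "hpd j F 0 x" by simp
    then show ?thesis by (rule hpd_imp_pd)
  qed
  have c: "continuous_on UNIV (\<lambda>x. if x \<in> K then H x else 0)"
    if "continuous_on S H" "\<And>x. x \<in> S - K \<Longrightarrow> H x = 0" for H :: "(real, 'a) vec \<Rightarrow> 'b"
  proof -
    have "continuous_on (S \<union> (-K)) (\<lambda>x. if x \<in> K then H x else 0)"
    proof (rule continuous_on_open_Un)
      show "continuous_on S (\<lambda>x. if x \<in> K then H x else 0)"
        by (rule iffD2[OF continuous_on_cong[OF refl, of S _ H] that(1)]) (use that(2) in auto)
      show "continuous_on (-K) (\<lambda>x. if x \<in> K then H x else 0)"
        by (rule iffD2[OF continuous_on_cong[OF refl, of "-K" _ "\<lambda>x. 0"] continuous_on_const]) auto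
    qed (use assms in auto)
    moreover have "S \<union> -K = UNIV" using assms by auto
    ultimately show ?thesis by simp
  qed
  show "C1 UNIV ?F"
  proof (rule C1I[where F'="?F'"])
    show "continuous_on UNIV ?F" by (rule c) (use assms C1_cont in auto)
    show "continuous_on UNIV (?F' j)" for j by (rule c) (use 0 assms C1_cont_pd in auto)
  qed (rule 1)
  show "pd j ?F x = ?F' j x" by (rule hpd_imp_pd, rule 1)
qed

lemma pd_eq_0_outside:
  assumes "closed K" "\<And>x. x \<notin> K \<Longrightarrow> F x = 0" "x \<notin> K"
  shows "pd j F x = 0"
  by (rule hpd_imp_pd, rule pd_zero_outside) (use assms in auto)

section \<open>Integration by parts\<close>

lemma
  fixes f :: "'a::euclidean_space \<Rightarrow> 'b::{banach, second_countable_topology}"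
  assumes "f \<in> borel_measurable borel"
  shows integral_shift: "integral\<^sup>L lborel (\<lambda>x. f (x + c)) = integral\<^sup>L lborel f"
    and integrable_shift: "integrable lborel (\<lambda>x. f (x + c)) \<longleftrightarrow> integrable lborel f"
proof -
  have e: "lborel = distr lborel borel ((+) c)" by (rule lborel_distr_plus[symmetric])
  show "integral\<^sup>L lborel (\<lambda>x. f (x + c)) = integral\<^sup>L lborel f"
    by (subst (2) e, subst integral_distr) (use assms in \<open>auto simp: add.commute\<close>)
  show "integrable lborel (\<lambda>x. f (x + c)) \<longleftrightarrow> integrable lborel f"
    by (subst (2) e, subst integrable_distr_eq) (use assms in \<open>auto simp: add.commute\<close>)
qed

lemma continuous_compact_support_integrable:
  fixes f :: "'a::euclidean_space \<Rightarrow> 'b::{banach, second_countable_topology}"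
  assumes "continuous_on UNIV f" "compact K" "\<And>x. x \<notin> K \<Longrightarrow> f x = 0"
  shows "integrable lborel f"
proof -
  have "integrable lborel (\<lambda>x. indicator K x *\<^sub>R f x)"
    using assms by (intro borel_integrable_compact) (auto intro: continuous_on_subset)
  also have "(\<lambda>x. indicator K x *\<^sub>R f x) = f" using assms(3) by (auto simp: fun_eq_iff indicator_def)
  finally show ?thesis .
qed

lemma continuous_compact_support_bounded:
  fixes f :: "'a::euclidean_space \<Rightarrow> 'b::real_normed_vector"
  assumes "continuous_on UNIV f" "compact K" "\<And>x. x \<notin> K \<Longrightarrow> f x = 0"
  obtains M where "M > 0" "\<And>x. norm (f x) \<le> M"
proof -
  have "bounded (f ` K)" using assms by (meson compact_continuous_image compact_imp_bounded continuous_on_subset subset_UNIV)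
  then obtain M where "M > 0" "\<And>x. x \<in> K \<Longrightarrow> norm (f x) \<le> M" by (auto simp: bounded_pos)
  then show thesis using assms(3) by (intro that[of M]) (metis less_imp_le norm_zero)+
qed

section \<open>Difference quotients and integrals of derivatives\<close>

definition dq :: "'n::finite \<Rightarrow> real \<Rightarrow> (real^'n \<Rightarrow> 'b::real_normed_vector) \<Rightarrow> real^'n \<Rightarrow> 'b" where
  "dq j h F x = (1/h) *\<^sub>R (F (x + h *\<^sub>R axis j 1) - F x)"

lemma dq_tendsto:
  assumes "hpd j F F' x" "h \<longlonglongrightarrow> 0" "\<And>n. h n \<noteq> 0"
  shows "(\<lambda>n. dq j (h n) F x) \<longlonglongrightarrow> F'"
proof -
  have "((\<lambda>t. norm (F (x + t *\<^sub>R axis j 1) - F x - t *\<^sub>R F') / norm t) \<longlongrightarrow> 0) (at 0)"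
    using assms(1) unfolding hpd_def has_vector_derivative_def has_derivative_at by simp
  moreover have "filterlim h (at 0) sequentially"
    using assms by (simp add: filterlim_at)
  ultimately have "((\<lambda>n. norm (F (x + h n *\<^sub>R axis j 1) - F x - h n *\<^sub>R F') / norm (h n)) \<longlongrightarrow> 0) sequentially"
    by (rule filterlim_compose)
  moreover have "norm (F (x + h n *\<^sub>R axis j 1) - F x - h n *\<^sub>R F') / norm (h n) = norm (dq j (h n) F x - F')" for n
  proof -
    have "dq j (h n) F x - F' = (1 / h n) *\<^sub>R (F (x + h n *\<^sub>R axis j 1) - F x - h n *\<^sub>R F')"
      using assms(3)[of n] by (simp add: dq_def algebra_simps)
    then show ?thesis by (simp add: divide_inverse_commute)
  qed
  ultimately show ?thesis
    by (subst Lim_null, subst tendsto_norm_zero_iff[symmetric]) simp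
qed

lemma dq_bound:
  assumes "\<And>y. hpd j F (F' y) y" "\<And>y. norm (F' y) \<le> M"
  shows "norm (dq j h F x) \<le> M"
proof -
  let ?l = "\<lambda>t. F (x + t *\<^sub>R axis j 1)"
  have M: "0 \<le> M" using assms(2)[of x] norm_ge_zero order_trans by blast
  have "norm (?l h - ?l 0) \<le> M * norm (h - 0)"
  proof (rule differentiable_bound[of UNIV ?l "\<lambda>t s. s *\<^sub>R F' (x + t *\<^sub>R axis j 1)"])
    show "(?l has_derivative (\<lambda>s. s *\<^sub>R F' (x + t *\<^sub>R axis j 1))) (at t within UNIV)" for t
      using hpd_line[OF assms(1)] by (simp add: has_vector_derivative_def)
    show "onorm (\<lambda>s. s *\<^sub>R F' (x + t *\<^sub>R axis j 1)) \<le> M" for t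
      by (rule onorm_le) (use assms(2) in \<open>auto simp: mult.commute[of M] intro: mult_left_mono\<close>)
  qed auto
  then have "norm (F (x + h *\<^sub>R axis j 1) - F x) \<le> M * \<bar>h\<bar>" by simp
  moreover have "norm (dq j h F x) = norm (F (x + h *\<^sub>R axis j 1) - F x) / \<bar>h\<bar>"
    unfolding dq_def norm_scaleR by (simp add: field_simps)
  ultimately show ?thesis using M by (cases "h = 0") (simp_all add: pos_divide_le_eq)
qed

lemma dq_support:
  assumes "\<And>y. r < norm y \<Longrightarrow> F y = 0" "\<bar>h\<bar> \<le> 1" "r + 1 < norm x"
  shows "dq j h F x = 0"
proof -
  have "norm x \<le> norm (x + h *\<^sub>R axis j 1) + norm (h *\<^sub>R axis j (1::real))"
    by (metis add_diff_cancel norm_triangle_ineq4)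
  then have "r < norm (x + h *\<^sub>R axis j 1)" using assms(2,3) by (simp add: norm_axis_1)
  then show ?thesis using assms(1)[of x] assms(1)[of "x + h *\<^sub>R axis j 1"] assms(3) by (simp add: dq_def)
qed

lemma compact_support_radius:
  assumes "compact K"
  obtains r where "\<And>x. x \<in> K \<Longrightarrow> norm x \<le> r"
  using compact_imp_bounded[OF assms] that unfolding bounded_iff by blast

text \<open>Translation invariance makes the integral of every difference quotient vanish, and
  dominated convergence carries this to the derivative. Steps of length at most 1 keep all quotients
  supported in the ball of radius \<open>r + 1\<close>.\<close>

lemma integral_pd_eq_0_UNIV:
  fixes F :: "real^'n::finite \<Rightarrow> 'b::euclidean_space"
  assumes "C1 UNIV F" "compact K" "\<And>x. x \<notin> K \<Longrightarrow> F x = 0"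
  shows "integral\<^sup>L lborel (pd j F) = 0"
proof -
  obtain r where r: "\<And>x. x \<in> K \<Longrightarrow> norm x \<le> r" using compact_support_radius[OF assms(2)] by blast
  obtain M where M: "\<And>x. norm (pd j F x) \<le> M"
    using continuous_compact_support_bounded[OF C1_cont_pd[OF assms(1)] assms(2)]
      pd_eq_0_outside[of K F] compact_imp_closed assms(2,3) by metis
  define h where "h n = 1 / real (Suc n)" for n
  have h: "h \<longlonglongrightarrow> 0" "\<And>n. h n \<noteq> 0" "\<And>n. \<bar>h n\<bar> \<le> 1"
    unfolding h_def using LIMSEQ_inverse_real_of_nat by (auto simp: inverse_eq_divide)
  have m [measurable]: "F \<in> borel_measurable borel"
    using C1_cont[OF assms(1)] by (rule borel_measurable_continuous_onI)
  have int: "integrable lborel F"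
    using continuous_compact_support_integrable[OF C1_cont[OF assms(1)] assms(2,3)] by blast
  have [measurable]: "dq j (h n) F \<in> borel_measurable borel" for n
    unfolding dq_def by measurable
  have "(\<lambda>n. integral\<^sup>L lborel (dq j (h n) F)) \<longlonglongrightarrow> integral\<^sup>L lborel (pd j F)"
  proof (rule integral_dominated_convergence[where w="\<lambda>x. indicator (cball 0 (r+1)) x *\<^sub>R M"])
    show "integrable lborel (\<lambda>x::real^'n. indicator (cball 0 (r+1)) x *\<^sub>R M)"
      by (rule borel_integrable_compact) auto
    show "AE x in lborel. (\<lambda>n. dq j (h n) F x) \<longlonglongrightarrow> pd j F x"
      using dq_tendsto[OF C1_hpd[OF assms(1)] h(1,2)] by simp
    have *: "norm (dq j (h n) F x) \<le> indicator (cball 0 (r+1)) x *\<^sub>R M" for n x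
    proof (cases "norm x \<le> r + 1")
      case True then show ?thesis using dq_bound[OF C1_hpd[OF assms(1)] M] by simp
    next
      case False
      then have "dq j (h n) F x = 0" using dq_support[of r F "h n" x j] assms(3) r h(3) by force
      then show ?thesis using False by simp
    qed
    then show "AE x in lborel. norm (dq j (h n) F x) \<le> indicator (cball 0 (r+1)) x *\<^sub>R M" for n
      by simp
  qed (auto intro: borel_measurable_continuous_onI C1_cont_pd[OF assms(1)])
  moreover have "integral\<^sup>L lborel (dq j (h n) F) = 0" for n
    using int integral_shift[OF m, of "h n *\<^sub>R axis j 1"] integrable_shift[OF m, of "h n *\<^sub>R axis j 1"]
    unfolding dq_def by simp
  ultimately show ?thesis by (simp add: LIMSEQ_const_iff)
qed

lemma integral_pd_eq_0:
  fixes F :: "real^'n::finite \<Rightarrow> 'b::euclidean_space"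
  assumes "open S" "C1 S F" "compact K" "K \<subseteq> S" "\<And>x. x \<in> S - K \<Longrightarrow> F x = 0"
  shows "(LINT x:K|lborel. pd j F x) = 0"
proof -
  note e = C1_extend[OF assms(1,2) compact_imp_closed[OF assms(3)] assms(4,5)]
  have "integral\<^sup>L lborel (pd j (\<lambda>x. if x \<in> K then F x else 0)) = 0"
    using integral_pd_eq_0_UNIV[OF e(1) assms(3)] by auto
  moreover have "pd j (\<lambda>x. if x \<in> K then F x else 0) = (\<lambda>x. indicator K x *\<^sub>R pd j F x)"
    using e(2) by (auto simp: fun_eq_iff)
  ultimately show ?thesis by (simp add: set_lebesgue_integral_def)
qed

text \<open>Only first derivatives are needed to see that mixed partials commute weakly:
  the difference quotients are moved across by translation invariance.\<close>
lemma integral_pd_pd_commute: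
  fixes b u :: "real^'n::finite \<Rightarrow> 'b::euclidean_space"
  assumes b: "C1 UNIV b" "compact K" "\<And>x. x \<notin> K \<Longrightarrow> b x = 0"
    and u: "C1 UNIV u" "compact L" "\<And>x. x \<notin> L \<Longrightarrow> u x = 0"
  shows "(LINT x|lborel. pd i b x \<bullet> pd j u x) = (LINT x|lborel. pd j b x \<bullet> pd i u x)"
proof -
  obtain r where r: "\<And>x. x \<in> K \<Longrightarrow> norm x \<le> r" using compact_support_radius[OF b(2)] by blast
  have C1b: "C1 UNIV b" and C1u: "C1 UNIV u" by fact+
  have bd: "\<exists>M>0. \<forall>x. norm (pd k b x) \<le> M" "\<exists>M>0. \<forall>x. norm (pd k u x) \<le> M" for k
    using continuous_compact_support_bounded[OF C1_cont_pd[OF b(1)] b(2), of k]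
      continuous_compact_support_bounded[OF C1_cont_pd[OF u(1)] u(2), of k]
      pd_eq_0_outside[of K b] pd_eq_0_outside[of L u] compact_imp_closed b u by metis+
  have mb [measurable]: "b \<in> borel_measurable borel" and mu [measurable]: "u \<in> borel_measurable borel"
    using C1_cont[OF b(1)] C1_cont[OF u(1)] by (auto intro: borel_measurable_continuous_onI)
  have md [measurable]: "dq k h b \<in> borel_measurable borel" "dq k h u \<in> borel_measurable borel" for k h
    unfolding dq_def by measurable
  have mpd [measurable]: "pd k b \<in> borel_measurable borel" "pd k u \<in> borel_measurable borel" for k
    using C1_cont_pd[OF b(1)] C1_cont_pd[OF u(1)] by (auto intro: borel_measurable_continuous_onI)
  have lim: "(\<lambda>n. LINT x|lborel. dq k (h n) b x \<bullet> dq l (h n) u x) \<longlonglongrightarrow> (LINT x|lborel. pd k b x \<bullet> pd l u x)"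
    if h: "h \<longlonglongrightarrow> 0" "\<And>n. h n \<noteq> 0" "\<And>n. \<bar>h n\<bar> \<le> 1" for k l h
  proof -
    obtain M where M: "M > 0" "\<And>x. norm (pd k b x) \<le> M" using bd(1) by blast
    obtain N where N: "N > 0" "\<And>x. norm (pd l u x) \<le> N" using bd(2) by blast
    show ?thesis
    proof (rule integral_dominated_convergence[where w="\<lambda>x. indicator (cball 0 (r+1)) x *\<^sub>R (M * N)"])
      show "integrable lborel (\<lambda>x::real^'n. indicator (cball 0 (r+1)) x *\<^sub>R (M * N))"
        by (rule borel_integrable_compact) auto
      show "AE x in lborel. (\<lambda>n. dq k (h n) b x \<bullet> dq l (h n) u x) \<longlonglongrightarrow> pd k b x \<bullet> pd l u x"
        by (intro AE_I2 tendsto_inner dq_tendsto[OF C1_hpd[OF C1b] h(1,2)] dq_tendsto[OF C1_hpd[OF C1u] h(1,2)]) auto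
      have *: "norm (dq k (h n) b x \<bullet> dq l (h n) u x) \<le> indicator (cball 0 (r+1)) x *\<^sub>R (M*N)" for n x
      proof (cases "norm x \<le> r + 1")
        case True
        have "norm (dq k (h n) b x) * norm (dq l (h n) u x) \<le> M * N"
          using dq_bound[OF C1_hpd[OF C1b] M(2)] dq_bound[OF C1_hpd[OF C1u] N(2)] M(1)
          by (intro mult_mono) auto
        then show ?thesis using True Cauchy_Schwarz_ineq2 order_trans by fastforce
      next
        case False
        then have "dq k (h n) b x = 0" using dq_support[of r b "h n" x k] b(3) r h(3) by force
        then show ?thesis using False by simp
      qed
      then show "AE x in lborel. norm (dq k (h n) b x \<bullet> dq l (h n) u x) \<le> indicator (cball 0 (r+1)) x *\<^sub>R (M*N)" for n
        by simp
    qed auto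
  qed
  \<comment> \<open>Each side expands into four integrals of b (x + s) \<bullet> u (x + t), which
    depend only on t - s. Changing the sign of h exchanges the roles of the two directions, and the
    four differences match in pairs.\<close>
  have shift: "(LINT x|lborel. dq k h b x \<bullet> dq l h u x) = (LINT x|lborel. dq l (-h) b x \<bullet> dq k (-h) u x)"
    if "h \<noteq> 0" for k l h
  proof -
    let ?e = "h *\<^sub>R axis k (1::real)" and ?f = "h *\<^sub>R axis l (1::real)"
    define P where "P s t = (\<lambda>x. b (x + s) \<bullet> u (x + t))" for s t
    have mP [measurable]: "P s t \<in> borel_measurable borel" for s t unfolding P_def by measurable
    have P0: "integrable lborel (P 0 t)" for t
    proof (rule continuous_compact_support_integrable[OF _ b(2)])
      show "continuous_on UNIV (P 0 t)" unfolding P_def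
        using C1_cont[OF b(1)] C1_cont[OF u(1)]
        by (auto intro!: continuous_intros intro: continuous_on_compose2)
    qed (use b(3) in \<open>simp add: P_def\<close>)
    have Psh: "(\<lambda>x. P s t (x + c)) = P (s + c) (t + c)" for s t c
      by (simp add: P_def add_ac)
    have P: "integrable lborel (P s t)" for s t
      using integrable_shift[OF mP, of 0 "t - s" s] P0[of "t - s"] by (simp add: Psh[of 0 "t - s" s])
    have I: "integral\<^sup>L lborel (P (s + c) (t + c)) = integral\<^sup>L lborel (P s t)" for s t c
      using integral_shift[OF mP, of s t c] by (simp add: Psh[of s t c])
    have sq: "(1/a) *\<^sub>R (p - p') \<bullet> (1/a) *\<^sub>R (q - q') = (1/a^2) * (p \<bullet> q - p \<bullet> q' - p' \<bullet> q + p' \<bullet> q')"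
      for a :: real and p p' q q' :: 'b
      by (simp only: inner_scaleR_left inner_scaleR_right inner_diff_left inner_diff_right power2_eq_square)
         (simp add: diff_divide_distrib add_divide_distrib)
    have 1: "dq k h b x \<bullet> dq l h u x = (1/h^2) * (P ?e ?f x - P ?e 0 x - P 0 ?f x + P 0 0 x)" for x
      unfolding dq_def P_def sq by simp
    have 2: "dq l (-h) b x \<bullet> dq k (-h) u x = (1/h^2) * (P (-?f) (-?e) x - P (-?f) 0 x - P 0 (-?e) x + P 0 0 x)" for x
      unfolding dq_def P_def sq by simp
    have "integral\<^sup>L lborel (P ?e ?f) = integral\<^sup>L lborel (P (-?f) (-?e))"
      using I[of "-?f" "?e + ?f" "-?e"] by (simp add: algebra_simps)
    moreover have "integral\<^sup>L lborel (P ?e 0) = integral\<^sup>L lborel (P 0 (-?e))"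
      using I[of 0 ?e "-?e"] by simp
    moreover have "integral\<^sup>L lborel (P 0 ?f) = integral\<^sup>L lborel (P (-?f) 0)"
      using I[of "-?f" ?f 0] by simp
    ultimately show ?thesis unfolding 1 2 using P by simp
  qed
  define h where "h n = 1 / real (Suc n)" for n
  have h: "h \<longlonglongrightarrow> 0" "\<And>n. h n \<noteq> 0" "\<And>n. \<bar>h n\<bar> \<le> 1"
    unfolding h_def using LIMSEQ_inverse_real_of_nat by (auto simp: inverse_eq_divide)
  have h': "(\<lambda>n. - h n) \<longlonglongrightarrow> 0" using tendsto_minus[OF h(1)] by simp
  have sh: "(LINT x|lborel. dq i (h n) b x \<bullet> dq j (h n) u x)
      = (LINT x|lborel. dq j (- h n) b x \<bullet> dq i (- h n) u x)" for n
    by (rule shift[OF h(2)])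
  have "(\<lambda>n. LINT x|lborel. dq j (- h n) b x \<bullet> dq i (- h n) u x) \<longlonglongrightarrow> (LINT x|lborel. pd i b x \<bullet> pd j u x)"
    unfolding sh[symmetric] by (rule lim[OF h])
  moreover have "(\<lambda>n. LINT x|lborel. dq j (- h n) b x \<bullet> dq i (- h n) u x) \<longlonglongrightarrow> (LINT x|lborel. pd j b x \<bullet> pd i u x)"
    by (rule lim[OF h']) (use h in auto)
  ultimately show ?thesis by (rule LIMSEQ_unique)
qed

section \<open>Bump functions\<close>

text \<open>One term of a series with nonnegative terms is at most its sum. It lets exp (-v) absorb
  any power of v = 1/(1 - t^2) near the edge of a bump.\<close>

lemma pow_exp_le: "0 \<le> (v::real) \<Longrightarrow> v ^ n * exp (- v) \<le> fact n"
proof -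
  assume v: "0 \<le> v"
  have "(\<Sum>k<Suc n. v ^ k /\<^sub>R fact k) \<le> exp v"
    using summable_exp_generic[of v] v unfolding exp_def
    by (intro sum_le_suminf) auto
  moreover have "v ^ n /\<^sub>R fact n \<le> (\<Sum>k<Suc n. v ^ k /\<^sub>R fact k)"
    by (rule member_le_sum) (use v in auto)
  ultimately have "v ^ n /\<^sub>R fact n \<le> exp v" by linarith
  then have "v ^ n \<le> fact n * exp v" by (simp add: field_simps)
  then show ?thesis by (simp add: exp_minus field_simps)
qed

text \<open>The standard bump is the case p = 1, m = 0. Polynomial factors and powers of 1/(1 - t^2)
  are included to make the family closed under differentiation, so that smoothness becomes an
  induction on the order.\<close>

definition bmp :: "real poly \<Rightarrow> nat \<Rightarrow> real \<Rightarrow> real" where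
  "bmp p m t = (if \<bar>t\<bar> < 1 then poly p t * (1/(1-t^2))^m * exp (- (1/(1-t^2))) else 0)"

text \<open>With v = 1/(1 - t^2) one has v' = 2 t v^2. Differentiating p v^m exp (-v) and factoring
  out v^(m+2) exp (-v) leaves this polynomial.\<close>

definition bmp_step :: "real poly \<Rightarrow> nat \<Rightarrow> real poly" where
  "bmp_step p m = pderiv p * [:1,0,-1:]^2 + smult (2 * real m) ([:0,1:] * p * [:1,0,-1:]) - smult 2 ([:0,1:] * p)"

text \<open>Serves at the points where two pieces of a definition meet: the edge of a bump and the
  knot of a truncated power.\<close>

lemma DERIV_quadratic_bound:
  fixes f :: "real \<Rightarrow> real"
  assumes "\<And>s. \<bar>f s\<bar> \<le> C * (s - t)^2"
  shows "(f has_real_derivative 0) (at t)"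
proof -
  have f0: "f t = 0" using assms[of t] by simp
  have "((\<lambda>h. C * \<bar>h\<bar>) \<longlongrightarrow> C * \<bar>0\<bar>) (at 0)" by (intro tendsto_intros)
  then have "((\<lambda>h. C * \<bar>h\<bar>) \<longlongrightarrow> 0) (at 0)" by simp
  then have "((\<lambda>h. (f (t + h) - f t) / h) \<longlongrightarrow> 0) (at 0)"
  proof (rule Lim_null_comparison[rotated])
    have "norm ((f (t + h) - f t) / h) \<le> C * \<bar>h\<bar>" if "h \<noteq> 0" for h
      using assms[of "t + h"] f0 that
      by (simp add: pos_divide_le_eq power2_eq_square abs_mult_self_eq mult.assoc)
    then show "\<forall>\<^sub>F h in at 0. norm ((f (t + h) - f t) / h) \<le> C * \<bar>h\<bar>"
      by (auto simp: eventually_at intro: exI[of _ 1])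
  qed
  then show ?thesis by (simp add: DERIV_def)
qed

text \<open>The exponential absorbs m + 2 powers of 1/(1 - s^2) although only m are present. The two
  spare ones leave (1 - s^2)^2, which is quadratic in the distance to the edge.\<close>

lemma bmp_edge:
  assumes "\<bar>t\<bar> = 1"
  shows "(bmp p m has_real_derivative 0) (at t)"
proof -
  have "compact (poly p ` {-1..1})" by (intro compact_continuous_image continuous_on_poly) auto
  then obtain B where B: "B > 0" "\<And>s. \<bar>s\<bar> \<le> 1 \<Longrightarrow> \<bar>poly p s\<bar> \<le> B"
    using compact_imp_bounded[of "poly p ` {-1..1}"] unfolding bounded_pos by (auto simp: abs_le_iff)
  have "\<bar>bmp p m s\<bar> \<le> (4 * B * fact (m+2)) * (s - t)^2" for s
  proof (cases "\<bar>s\<bar> < 1")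
    case True
    define w where "w = 1 - s^2"
    have w: "w > 0" using True by (simp add: w_def abs_square_less_1)
    have w2: "w \<le> 2 * \<bar>s - t\<bar>"
    proof -
      have "w = \<bar>s - t\<bar> * \<bar>s + t\<bar>"
      proof -
        have "\<bar>s - t\<bar> * \<bar>s + t\<bar> = \<bar>s^2 - t^2\<bar>" by (simp add: abs_mult[symmetric] power2_eq_square algebra_simps)
        moreover have "t^2 = 1" using assms by (simp add: abs_square_eq_1)
        ultimately show ?thesis using w by (simp add: w_def)
      qed
      also have "\<dots> \<le> \<bar>s - t\<bar> * 2" by (rule mult_left_mono) (use assms True in auto)
      finally show ?thesis by simp
    qed
    have "(1/w)^(m+2) * exp (-(1/w)) \<le> fact (m+2)" by (rule pow_exp_le) (use w in simp)
    then have "((1/w)^(m+2) * exp (-(1/w))) * w^2 \<le> fact (m+2) * w^2" by (rule mult_right_mono) simp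
    moreover have "((1/w)^(m+2) * exp (-(1/w))) * w^2 = (1/w)^m * exp (-(1/w))"
      using w by (simp add: power_add power2_eq_square)
    ultimately have "(1/w)^m * exp (-(1/w)) \<le> fact (m+2) * w^2" by simp
    also have "\<dots> \<le> fact (m+2) * (2 * \<bar>s - t\<bar>)^2"
      by (intro mult_left_mono power_mono) (use w w2 in auto)
    finally have 1: "(1/w)^m * exp (-(1/w)) \<le> fact (m+2) * (4 * (s - t)^2)"
      by (simp add: power_mult_distrib)
    have "\<bar>bmp p m s\<bar> = \<bar>poly p s\<bar> * ((1/w)^m * exp (-(1/w)))"
      using True w by (simp add: bmp_def w_def[symmetric] abs_mult)
    also have "\<dots> \<le> B * (fact (m+2) * (4 * (s - t)^2))"
      by (rule mult_mono) (use B(2)[of s] 1 True B w in auto)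
    finally show ?thesis by (simp add: algebra_simps)
  next
    case False
    then show ?thesis using B by (simp add: bmp_def)
  qed
  then show ?thesis by (rule DERIV_quadratic_bound)
qed

lemma bmp_DERIV: "(bmp p m has_real_derivative bmp (bmp_step p m) (m+2) t) (at t)"
proof -
  consider "\<bar>t\<bar> < 1" | "\<bar>t\<bar> = 1" | "\<bar>t\<bar> > 1" by linarith
  then show ?thesis
  proof cases
    case 1
    define v where "v = (\<lambda>s::real. 1/(1 - s^2))"
    have w: "1 - t^2 > 0" using 1 by (simp add: abs_square_less_1)
    have dv: "(v has_real_derivative 2 * t * (v t)^2) (at t)"
      unfolding v_def using w by (auto intro!: derivative_eq_intros simp: power2_eq_square field_simps)
    have dvm: "((\<lambda>s. v s ^ m) has_real_derivative (2 * t * real m * v t^(m+1))) (at t)"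
    proof (cases m)
      case (Suc k)
      show ?thesis using DERIV_power[OF dv, of m] Suc by (simp add: power2_eq_square algebra_simps)
    qed simp
    have de: "((\<lambda>s. exp (- v s)) has_real_derivative (exp (- v t) * (- (2 * t * (v t)^2)))) (at t)"
      by (rule DERIV_fun_exp, rule DERIV_minus, rule dv)
    have D: "((\<lambda>s. poly p s * v s^m * exp (- v s)) has_real_derivative
       ((poly p t * v t^m) * (exp (- v t) * (- (2 * t * (v t)^2)))
        + (poly p t * (2 * t * real m * v t^(m+1)) + poly (pderiv p) t * v t^m) * exp (- v t))) (at t)"
      using DERIV_mult'[OF DERIV_mult'[OF poly_DERIV[of p t] dvm] de] by (simp add: algebra_simps)
    have vw: "(1 - t^2) * v t = 1" using w by (simp add: v_def)
    have vw2: "(1 - t^2)^2 * v t^(m+2) = v t^m"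
    proof -
      have "(1 - t^2)^2 * v t^(m+2) = ((1 - t^2) * v t)^2 * v t^m" by (simp add: power_mult_distrib power_add power2_eq_square mult_ac)
      then show ?thesis by (simp only: vw) simp
    qed
    have vw1: "(1 - t^2) * v t^(m+2) = v t^(m+1)"
    proof -
      have "(1 - t^2) * v t^(m+2) = ((1 - t^2) * v t) * v t^(m+1)" by (simp add: mult_ac)
      then show ?thesis by (simp only: vw mult_1)
    qed
    have "bmp (bmp_step p m) (m+2) t = poly (bmp_step p m) t * v t^(m+2) * exp (- v t)"
      using 1 by (simp add: bmp_def v_def)
    also have "poly (bmp_step p m) t * v t^(m+2) = poly (pderiv p) t * ((1 - t^2)^2 * v t^(m+2))
        + 2 * real m * t * poly p t * ((1 - t^2) * v t^(m+2)) - 2 * t * poly p t * v t^(m+2)"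
      by (simp add: bmp_step_def power2_eq_square algebra_simps)
    finally have e: "bmp (bmp_step p m) (m+2) t = ((poly p t * v t^m) * (exp (- v t) * (- (2 * t * (v t)^2)))
        + (poly p t * (2 * t * real m * v t^(m+1)) + poly (pderiv p) t * v t^m) * exp (- v t))"
      unfolding vw1 vw2 by (simp add: power_add power2_eq_square algebra_simps)
    show ?thesis unfolding e
      by (rule has_field_derivative_transform_within_open[OF D, of "{-1<..<1}"])
         (use 1 in \<open>auto simp: bmp_def v_def\<close>)
  next
    case 2
    then show ?thesis using bmp_edge[OF 2] by (simp add: bmp_def)
  next
    case 3
    have "((\<lambda>s. 0::real) has_real_derivative 0) (at t)" by simp
    then have "(bmp p m has_real_derivative 0) (at t)"
      by (rule has_field_derivative_transform_within_open[of _ _ _ "{s. \<bar>s\<bar> > 1}"])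
         (use 3 in \<open>auto simp: bmp_def intro!: open_Collect_less continuous_intros\<close>)
    then show ?thesis using 3 by (simp add: bmp_def)
  qed
qed

text \<open>A product over the coordinates instead of a radial bump: a partial derivative then
  changes the data of one factor only, and mixed partials commute because function updates at
  different places do.\<close>

definition pbump :: "real^'n::finite \<Rightarrow> real \<Rightarrow> ('n \<Rightarrow> real poly) \<Rightarrow> ('n \<Rightarrow> nat) \<Rightarrow> real^'n \<Rightarrow> real" where
  "pbump c s p m x = (\<Prod>k\<in>UNIV. bmp (p k) (m k) ((x $ k - c $ k) / s))"

lemma pbump_hpd:
  "hpd j (pbump c s p m) (pbump c s (p(j := smult (1/s) (bmp_step (p j) (m j)))) (m(j := m j + 2)) x) x"
proof -
  let ?b = "\<lambda>k x. bmp (p k) (m k) ((x $ k - c $ k) / s)"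
  let ?R = "\<Prod>k\<in>UNIV - {j}. ?b k x"
  have "hpd j (\<lambda>x. (x $ j - c $ j) / s) (1/s) x"
    using hpd_linear[OF bounded_linear_divide[of s] hpd_diff[OF hpd_coord[of j j x] hpd_const[of j "c $ j"]]]
    by simp
  from hpd_compose_real[OF this bmp_DERIV[of "p j" "m j"]]
  have "hpd j (\<lambda>x. ?b j x * ?R) (bmp (bmp_step (p j) (m j)) (m j + 2) ((x $ j - c $ j) / s) * (1/s) * ?R) x"
    using hpd_linear[OF bounded_linear_mult_left[of ?R]] by fastforce
  moreover have "bmp (bmp_step (p j) (m j)) (m j + 2) ((x $ j - c $ j) / s) * (1/s)
      = bmp (smult (1/s) (bmp_step (p j) (m j))) (m j + 2) ((x $ j - c $ j) / s)"
    by (simp add: bmp_def)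
  moreover have v: "pbump c s (p(j := smult (1/s) (bmp_step (p j) (m j)))) (m(j := m j + 2)) x
      = bmp (smult (1/s) (bmp_step (p j) (m j))) (m j + 2) ((x $ j - c $ j) / s) * ?R"
    unfolding pbump_def by (subst prod.remove[of _ j]) (auto intro!: prod.cong)
  moreover have t: "pbump c s p m (x + t *\<^sub>R axis j 1) = ?b j (x + t *\<^sub>R axis j 1) * ?R" for t
    unfolding pbump_def by (subst prod.remove[of _ j]) (auto intro!: prod.cong simp: axis_def)
  ultimately show ?thesis unfolding hpd_def by (simp only: t v)
qed

lemma pd_pbump: "pd j (pbump c s p m) = pbump c s (p(j := smult (1/s) (bmp_step (p j) (m j)))) (m(j := m j + 2))"
  using pbump_hpd hpd_imp_pd by (intro ext) blast

lemma bmp_cont: "continuous_on UNIV (bmp p m)"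
  by (rule DERIV_continuous_on[OF has_field_derivative_at_within[OF bmp_DERIV]])

lemma pbump_cont: "continuous_on UNIV (pbump c s p m)"
  unfolding pbump_def divide_inverse
  by (intro continuous_on_prod continuous_on_compose2[OF bmp_cont] continuous_intros) auto

lemma pbump_Ck: "Ck_on k UNIV (pbump c s p m)"
proof (induction k arbitrary: p m)
  case (Suc k)
  have "(\<lambda>t. pbump c s p m (x + t *\<^sub>R axis j 1)) differentiable (at 0)" for j x
    using pbump_hpd[of j c s p m x] unfolding hpd_def by (rule differentiableI_vector)
  then show ?case using Suc by (simp add: pbump_cont pd_pbump)
qed (simp add: pbump_cont)

lemma bump_exists:
  fixes c :: "real^'n::finite"
  assumes "s > 0"
  obtains \<phi> :: "real^'n \<Rightarrow> real" where "Cinf_on UNIV \<phi>" "\<And>x. \<phi> x \<ge> 0" "\<phi> c > 0"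
    "\<And>x. s \<le> norm (x - c) \<Longrightarrow> \<phi> x = 0" "\<And>i j. pd i (pd j \<phi>) = pd j (pd i \<phi>)"
proof -
  \<comment> \<open>The Euclidean norm is at most the sum of the coordinates, so the cube of half
    side s divided by the dimension lies in the ball of radius s.\<close>
  define e where "e = s / real CARD('n)"
  have e: "e > 0" using assms by (simp add: e_def)
  define \<phi> where "\<phi> = pbump c e (\<lambda>k. 1) (\<lambda>k. 0)"
  show ?thesis
  proof
    show "Cinf_on UNIV \<phi>" by (simp add: Cinf_on_def \<phi>_def pbump_Ck)
    show "\<phi> x \<ge> 0" for x by (auto simp: \<phi>_def pbump_def bmp_def intro!: prod_nonneg)
    show "\<phi> c > 0" by (auto simp: \<phi>_def pbump_def bmp_def intro!: prod_pos)
    show "\<phi> x = 0" if "s \<le> norm (x - c)" for x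
    proof (rule ccontr)
      assume "\<phi> x \<noteq> 0"
      then have *: "\<bar>x $ k - c $ k\<bar> < e" for k
        using e by (auto simp: \<phi>_def pbump_def bmp_def prod_zero_iff split: if_splits)
      have "norm (x - c) \<le> (\<Sum>k\<in>UNIV. \<bar>(x - c) $ k\<bar>)" by (rule norm_le_l1_cart)
      also have "\<dots> < (\<Sum>k\<in>(UNIV::'n set). e)" by (rule sum_strict_mono) (use * in auto)
      also have "\<dots> = s" by (simp add: e_def)
      finally show False using that by simp
    qed
    show "pd i (pd j \<phi>) = pd j (pd i \<phi>)" for i j
      by (cases "i = j") (auto simp: \<phi>_def pd_pbump fun_upd_twist)
  qed
qed

section \<open>Mollification\<close>

text \<open>The clauses on second derivatives are what convolutions must inherit in order to satisfy
  \<open>C2\<close>, the regularity in the Bochner identity. The radius \<open>s\<close> is the only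
  parameter; no rescaled family is fixed.\<close>

definition mollifier :: "real \<Rightarrow> (real^'n::finite \<Rightarrow> real) \<Rightarrow> bool" where
  "mollifier s \<rho> \<longleftrightarrow> C1 UNIV \<rho> \<and> (\<forall>j. C1 UNIV (pd j \<rho>)) \<and> (\<forall>i j. pd i (pd j \<rho>) = pd j (pd i \<rho>))
     \<and> (\<forall>x. 0 \<le> \<rho> x) \<and> (\<forall>x. s \<le> norm x \<longrightarrow> \<rho> x = 0) \<and> integral\<^sup>L lborel \<rho> = 1"

lemma Cinf_C2: "Cinf_on S F \<Longrightarrow> C1 S F \<and> (\<forall>j. C1 S (pd j F))"
  unfolding Cinf_on_def using Ck_on_2_C1 by blast

lemma integral_pos_continuous:
  fixes \<phi> :: "real^'n::finite \<Rightarrow> real"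
  assumes "continuous_on UNIV \<phi>" "\<And>x. \<phi> x \<ge> 0" "\<phi> c > 0" "integrable lborel \<phi>"
  shows "integral\<^sup>L lborel \<phi> > 0"
proof -
  have "integral\<^sup>L lborel \<phi> \<ge> 0" using assms by simp
  moreover have "integral\<^sup>L lborel \<phi> \<noteq> 0"
  proof
    assume "integral\<^sup>L lborel \<phi> = 0"
    then have ae: "AE x in lborel. \<phi> x = 0"
      using integral_nonneg_eq_0_iff_AE[OF assms(4)] assms(2) by simp
    have "open {x. \<phi> x > 0}" by (rule open_Collect_less[OF continuous_on_const assms(1)])
    moreover have "{x. \<phi> x > 0} \<noteq> {}" using assms(3) by auto
    ultimately have "\<not> negligible {x. \<phi> x > 0}" by (rule open_not_negligible)
    moreover have "negligible {x. \<phi> x > 0}"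
    proof -
      have m: "{x. \<phi> x > 0} \<in> sets lborel"
        using borel_measurable_continuous_onI[OF assms(1)] by simp
      have "AE x in lborel. x \<notin> {x. \<phi> x > 0}" using ae by eventually_elim simp
      then have "{x. \<phi> x > 0} \<in> null_sets lborel" using m by (simp add: AE_iff_null_sets)
      then show ?thesis using null_sets_completionI by (auto simp: negligible_iff_null_sets)
    qed
    ultimately show False by blast
  qed
  ultimately show ?thesis by simp
qed

lemma mollifier_exists:
  assumes "s > 0"
  obtains \<rho> :: "real^'n::finite \<Rightarrow> real" where "mollifier s \<rho>"
proof -
  obtain \<phi> :: "real^'n \<Rightarrow> real" where \<phi>: "Cinf_on UNIV \<phi>" "\<And>x. \<phi> x \<ge> 0" "\<phi> 0 > 0"
    "\<And>x. s \<le> norm (x - 0) \<Longrightarrow> \<phi> x = 0" "\<And>i j. pd i (pd j \<phi>) = pd j (pd i \<phi>)"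
    using bump_exists[OF assms, of 0] by blast
  have C: "C1 UNIV \<phi>" "\<And>j. C1 UNIV (pd j \<phi>)" using Cinf_C2[OF \<phi>(1)] by auto
  have int: "integrable lborel \<phi>"
    by (rule continuous_compact_support_integrable[OF C1_cont[OF C(1)] compact_cball[of 0 s]]) (use \<phi>(4) in auto)
  define I where "I = integral\<^sup>L lborel \<phi>"
  have I: "I > 0" unfolding I_def by (rule integral_pos_continuous[OF C1_cont[OF C(1)] \<phi>(2,3) int])
  define \<rho> where "\<rho> = (\<lambda>x. (1/I) * \<phi> x)"
  have pd1: "pd j (\<lambda>x. (1/I) * F x) = (\<lambda>x. (1/I) * pd j F x)" if "C1 UNIV F" for j and F :: "real^'n \<Rightarrow> real"
    by (intro ext hpd_imp_pd hpd_linear[OF bounded_linear_mult_right] C1_hpd[OF that]) simp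
  have "mollifier s \<rho>" unfolding mollifier_def
  proof (intro conjI allI impI)
    show "C1 UNIV \<rho>" unfolding \<rho>_def by (rule C1_linear[OF bounded_linear_mult_right C(1)])
    show "C1 UNIV (pd j \<rho>)" for j unfolding \<rho>_def pd1[OF C(1)]
      by (rule C1_linear[OF bounded_linear_mult_right C(2)])
    show "pd i (pd j \<rho>) = pd j (pd i \<rho>)" for i j unfolding \<rho>_def pd1[OF C(1)] pd1[OF C(2)] \<phi>(5) by (rule refl)
    show "0 \<le> \<rho> x" for x using \<phi>(2)[of x] I by (simp add: \<rho>_def)
    show "\<rho> x = 0" if "s \<le> norm x" for x using \<phi>(4)[of x] that by (simp add: \<rho>_def)
    show "integral\<^sup>L lborel \<rho> = 1" using I by (simp add: \<rho>_def I_def)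
  qed
  then show thesis by (rule that)
qed

definition conv :: "(real^'n::finite \<Rightarrow> real) \<Rightarrow> (real^'n \<Rightarrow> 'b::euclidean_space) \<Rightarrow> real^'n \<Rightarrow> 'b" where
  "conv k w x = (LINT y|lborel. k (x - y) *\<^sub>R w y)"

lemma conv_integrand_integrable:
  fixes w :: "real^'n::finite \<Rightarrow> 'b::euclidean_space"
  assumes "continuous_on UNIV k" "\<And>x. norm (k x) \<le> M" "integrable lborel w"
  shows "integrable lborel (\<lambda>y. k (x - y) *\<^sub>R w y)"
proof (rule Bochner_Integration.integrable_bound[where f="\<lambda>y. M *\<^sub>R w y"])
  have [measurable]: "k \<in> borel_measurable borel" using assms(1) by (rule borel_measurable_continuous_onI)
  have [measurable]: "w \<in> borel_measurable borel" using borel_measurable_integrable[OF assms(3)] by simp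
  show "(\<lambda>y. k (x - y) *\<^sub>R w y) \<in> borel_measurable lborel" by simp
  have "M \<ge> 0" using assms(2)[of 0] norm_ge_zero order_trans by blast
  then have "norm (k (x - y) *\<^sub>R w y) \<le> norm (M *\<^sub>R w y)" for y
    using assms(2)[of "x - y"] by (simp add: mult_right_mono)
  then show "AE y in lborel. norm (k (x - y) *\<^sub>R w y) \<le> norm (M *\<^sub>R w y)" by simp
qed (use assms in simp)

lemma conv_continuous:
  fixes w :: "real^'n::finite \<Rightarrow> 'b::euclidean_space"
  assumes "continuous_on UNIV k" "\<And>x. norm (k x) \<le> M" "integrable lborel w"
  shows "continuous_on UNIV (conv k w)"
proof -
  have [measurable]: "k \<in> borel_measurable borel" using assms(1) by (rule borel_measurable_continuous_onI)
  have [measurable]: "w \<in> borel_measurable borel" using borel_measurable_integrable[OF assms(3)] by simp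
  have M0: "M \<ge> 0" using assms(2)[of 0] norm_ge_zero order_trans by blast
  have "continuous (at x) (conv k w)" for x
    unfolding continuous_at_sequentially comp_def conv_def
  proof (intro allI impI)
    fix u :: "nat \<Rightarrow> real^'n" assume u: "u \<longlonglongrightarrow> x"
    show "(\<lambda>n. LINT y|lborel. k (u n - y) *\<^sub>R w y) \<longlonglongrightarrow> (LINT y|lborel. k (x - y) *\<^sub>R w y)"
    proof (rule integral_dominated_convergence[where w="\<lambda>y. M * norm (w y)"])
      have "(\<lambda>n. k (u n - y)) \<longlonglongrightarrow> k (x - y)" for y
        by (rule continuous_on_tendsto_compose[OF assms(1) tendsto_diff[OF u tendsto_const]]) auto
      then show "AE y in lborel. (\<lambda>n. k (u n - y) *\<^sub>R w y) \<longlonglongrightarrow> k (x - y) *\<^sub>R w y"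
        by (auto intro!: tendsto_scaleR)
      show "AE y in lborel. norm (k (u n - y) *\<^sub>R w y) \<le> M * norm (w y)" for n
        using assms(2) by (auto intro!: mult_right_mono)
    qed (use assms(3) in auto)
  qed
  then show ?thesis by (simp add: continuous_on_eq_continuous_at)
qed

lemma hpdI_seq:
  assumes "\<And>h. h \<longlonglongrightarrow> 0 \<Longrightarrow> (\<And>n. h n \<noteq> 0) \<Longrightarrow> (\<lambda>n. dq j (h n) F x) \<longlonglongrightarrow> F'"
  shows "hpd j F F' x"
proof -
  have "((\<lambda>t. dq j t F x) \<longlongrightarrow> F') (at 0)"
    unfolding tendsto_at_iff_sequentially comp_def using assms by auto
  then have "((\<lambda>t. norm (dq j t F x - F')) \<longlongrightarrow> 0) (at 0)"
    by (simp add: tendsto_norm_zero_iff LIM_zero_iff)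
  then have "((\<lambda>t. norm (F (x + t *\<^sub>R axis j 1) - F x - t *\<^sub>R F') / norm t) \<longlongrightarrow> 0) (at 0)"
  proof (rule Lim_transform_eventually)
    have "norm (dq j t F x - F') = norm (F (x + t *\<^sub>R axis j 1) - F x - t *\<^sub>R F') / norm t" if "t \<noteq> 0" for t
    proof -
      have "dq j t F x - F' = (1 / t) *\<^sub>R (F (x + t *\<^sub>R axis j 1) - F x - t *\<^sub>R F')"
        using that by (simp add: dq_def algebra_simps)
      then show ?thesis by (simp add: divide_inverse_commute)
    qed
    then show "\<forall>\<^sub>F t in at 0. norm (dq j t F x - F') = norm (F (x + t *\<^sub>R axis j 1) - F x - t *\<^sub>R F') / norm t"
      by (auto simp: eventually_at intro: exI[of _ 1])
  qed
  then show ?thesis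
    by (simp add: hpd_def has_vector_derivative_def has_derivative_at bounded_linear_scaleR_left)
qed

lemma conv_hpd:
  fixes w :: "real^'n::finite \<Rightarrow> 'b::euclidean_space"
  assumes k: "C1 UNIV k" "compact K" "\<And>x. x \<notin> K \<Longrightarrow> k x = 0" and w: "integrable lborel w"
  shows "hpd j (conv k w) (conv (pd j k) w x) x"
proof (rule hpdI_seq)
  fix h :: "nat \<Rightarrow> real" assume h: "h \<longlonglongrightarrow> 0" "\<And>n. h n \<noteq> 0"
  have mk [measurable]: "k \<in> borel_measurable borel" "pd j k \<in> borel_measurable borel"
    using C1_cont[OF k(1)] C1_cont_pd[OF k(1)] by (auto intro: borel_measurable_continuous_onI)
  have [measurable]: "w \<in> borel_measurable borel" using borel_measurable_integrable[OF w] by simp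
  obtain M where M: "\<And>x. norm (k x) \<le> M"
    by (rule continuous_compact_support_bounded[OF C1_cont[OF k(1)] k(2,3)]) auto
  have pz: "pd j k x = 0" if "x \<notin> K" for x j
    using pd_eq_0_outside[of K k x j] compact_imp_closed[OF k(2)] k(3) that by blast
  obtain N where N: "\<And>x. norm (pd j k x) \<le> N"
    by (rule continuous_compact_support_bounded[OF C1_cont_pd[OF k(1)] k(2) pz]) auto
  have [measurable]: "dq j t k \<in> borel_measurable borel" for t unfolding dq_def by measurable
  have ci: "integrable lborel (\<lambda>y. k (z - y) *\<^sub>R w y)" for z
    by (rule conv_integrand_integrable[OF C1_cont[OF k(1)] M w])
  have "dq j t (conv k w) x = (LINT y|lborel. dq j t k (x - y) *\<^sub>R w y)" for t
  proof -
    have "(LINT y|lborel. dq j t k (x - y) *\<^sub>R w y)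
        = (LINT y|lborel. (1/t) *\<^sub>R (k (x + t *\<^sub>R axis j 1 - y) *\<^sub>R w y - k (x - y) *\<^sub>R w y))"
      by (rule Bochner_Integration.integral_cong)
         (simp_all add: dq_def scaleR_diff_left[symmetric] add_diff_eq diff_add_eq)
    also have "\<dots> = (1/t) *\<^sub>R ((LINT y|lborel. k (x + t *\<^sub>R axis j 1 - y) *\<^sub>R w y) - (LINT y|lborel. k (x - y) *\<^sub>R w y))"
      by (simp only: integral_scaleR_right Bochner_Integration.integral_diff[OF ci ci])
    finally show ?thesis unfolding dq_def conv_def by (rule sym)
  qed
  moreover have "(\<lambda>n. LINT y|lborel. dq j (h n) k (x - y) *\<^sub>R w y) \<longlonglongrightarrow> (LINT y|lborel. pd j k (x - y) *\<^sub>R w y)"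
  proof (rule integral_dominated_convergence[where w="\<lambda>y. N * norm (w y)"])
    have "(\<lambda>n. dq j (h n) k z) \<longlonglongrightarrow> pd j k z" for z by (rule dq_tendsto[OF C1_hpd[OF k(1)] h]) simp
    then show "AE y in lborel. (\<lambda>n. dq j (h n) k (x - y) *\<^sub>R w y) \<longlonglongrightarrow> pd j k (x - y) *\<^sub>R w y"
      by (auto intro!: tendsto_scaleR)
    have "norm (dq j (h n) k z) \<le> N" for n z by (rule dq_bound[OF C1_hpd[OF k(1)] N]) simp
    then show "AE y in lborel. norm (dq j (h n) k (x - y) *\<^sub>R w y) \<le> N * norm (w y)" for n
      by (auto intro!: mult_right_mono)
  qed (use w in auto)
  ultimately show "(\<lambda>n. dq j (h n) (conv k w) x) \<longlonglongrightarrow> conv (pd j k) w x"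
    by (simp add: conv_def)
qed

lemma
  fixes w :: "real^'n::finite \<Rightarrow> 'b::euclidean_space"
  assumes k: "C1 UNIV k" "compact K" "\<And>x. x \<notin> K \<Longrightarrow> k x = 0" and w: "integrable lborel w"
  shows conv_C1: "C1 UNIV (conv k w)" and conv_pd: "pd j (conv k w) = conv (pd j k) w"
proof -
  obtain M where M: "\<And>x. norm (k x) \<le> M"
    by (rule continuous_compact_support_bounded[OF C1_cont[OF k(1)] k(2,3)]) auto
  have pz: "pd j k x = 0" if "x \<notin> K" for x j
    using pd_eq_0_outside[of K k x j] compact_imp_closed[OF k(2)] k(3) that by blast
  have N: "\<exists>N. \<forall>x. norm (pd j k x) \<le> N" for j
    by (rule continuous_compact_support_bounded[OF C1_cont_pd[OF k(1)] k(2) pz]) auto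
  show "C1 UNIV (conv k w)"
  proof (rule C1I[where F'="\<lambda>j. conv (pd j k) w"])
    show "continuous_on UNIV (conv k w)" by (rule conv_continuous[OF C1_cont[OF k(1)] M w])
    show "continuous_on UNIV (conv (pd j k) w)" for j
      using N[of j] conv_continuous[OF C1_cont_pd[OF k(1)] _ w] by blast
  qed (rule conv_hpd[OF k w])
  show "pd j (conv k w) = conv (pd j k) w" by (intro ext hpd_imp_pd conv_hpd[OF k w])
qed

lemma mollifier_int:
  fixes \<rho> :: "real^'n::finite \<Rightarrow> real"
  assumes "mollifier s \<rho>"
  shows "(LINT y|lborel. \<rho> (x - y)) = 1" "integrable lborel (\<lambda>y. \<rho> (x - y))"
    "(LINT x|lborel. \<rho> (x - y)) = 1" "integrable lborel (\<lambda>x. \<rho> (x - y))"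
    "integrable lborel \<rho>"
proof -
  have c: "continuous_on UNIV \<rho>" using assms C1_cont by (auto simp: mollifier_def)
  show i: "integrable lborel \<rho>"
    by (rule continuous_compact_support_integrable[OF c compact_cball[of 0 s]]) (use assms in \<open>auto simp: mollifier_def\<close>)
  have [measurable]: "\<rho> \<in> borel_measurable borel" by (rule borel_measurable_continuous_onI[OF c])
  have one: "integral\<^sup>L lborel \<rho> = 1" using assms by (simp add: mollifier_def)
  show "(LINT x|lborel. \<rho> (x - y)) = 1" "integrable lborel (\<lambda>x. \<rho> (x - y))"
    using integral_shift[of \<rho> "-y"] integrable_shift[of \<rho> "-y"] i one by simp_all
  have e: "lborel = distr lborel borel (\<lambda>y. x - y)"
    using lborel_affine[of "-1" x] by (simp add: density_1)
  show "(LINT y|lborel. \<rho> (x - y)) = 1"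
    using integral_distr[of "\<lambda>y. x - y" lborel borel \<rho>] one unfolding e[symmetric] by simp
  show "integrable lborel (\<lambda>y. \<rho> (x - y))"
    using integrable_distr_eq[of "\<lambda>y. x - y" lborel borel \<rho>] i unfolding e[symmetric] by simp
qed

lemma conv_support:
  assumes "mollifier s \<rho>" "\<And>y. y \<notin> K \<Longrightarrow> w y = 0" "\<And>y. y \<in> K \<Longrightarrow> s \<le> norm (x - y)"
  shows "conv \<rho> w x = 0"
proof -
  have "(\<lambda>y. \<rho> (x - y) *\<^sub>R w y) = (\<lambda>y. 0)"
  proof
    show "\<rho> (x - y) *\<^sub>R w y = 0" for y using assms by (cases "y \<in> K") (auto simp: mollifier_def)
  qed
  then show ?thesis unfolding conv_def by simp
qed

lemma
  fixes F :: "real^'n::finite \<Rightarrow> real"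
  assumes m: "mollifier s \<rho>" and F: "integrable lborel F"
  shows conv_integrable: "integrable lborel (conv \<rho> F)" and conv_integral: "integral\<^sup>L lborel (conv \<rho> F) = integral\<^sup>L lborel F"
proof -
  have c: "continuous_on UNIV \<rho>" using m C1_cont by (auto simp: mollifier_def)
  have [measurable]: "\<rho> \<in> borel_measurable borel" by (rule borel_measurable_continuous_onI[OF c])
  have [measurable]: "F \<in> borel_measurable borel" using borel_measurable_integrable[OF F] by simp
  have pos: "\<rho> x \<ge> 0" for x using m by (simp add: mollifier_def)
  have I: "integrable (lborel \<Otimes>\<^sub>M lborel) (\<lambda>(y, x). \<rho> (x - y) * F y)"
  proof (rule lborel_pair.Fubini_integrable)
    have *: "(LINT x|lborel. norm (\<rho> (x - y) * F y)) = norm (F y)" for y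
      using mollifier_int(3)[OF m, of y] pos by (simp add: abs_mult)
    show "integrable lborel (\<lambda>y. LINT x|lborel. norm (case (y, x) of (y, x) \<Rightarrow> \<rho> (x - y) * F y))"
      unfolding prod.case * using F by (rule integrable_norm)
    show "AE y in lborel. integrable lborel (\<lambda>x. case (y, x) of (y, x) \<Rightarrow> \<rho> (x - y) * F y)"
      unfolding prod.case by (intro AE_I2 integrable_mult_left mollifier_int(4)[OF m])
    show "(\<lambda>(y, x). \<rho> (x - y) * F y) \<in> borel_measurable (lborel \<Otimes>\<^sub>M lborel)"
      by (simp add: split_beta')
  qed
  show "integrable lborel (conv \<rho> F)"
    using lborel_pair.integrable_snd[OF I] unfolding conv_def[abs_def] by simp
  have "integral\<^sup>L lborel (conv \<rho> F) = (LINT y|lborel. LINT x|lborel. \<rho> (x - y) * F y)"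
    unfolding conv_def real_scaleR_def using lborel_pair.Fubini_integral[OF I] by simp
  also have "\<dots> = integral\<^sup>L lborel F" using mollifier_int(3)[OF m] by simp
  finally show "integral\<^sup>L lborel (conv \<rho> F) = integral\<^sup>L lborel F" .
qed

section \<open>Exterior algebra with values in the fibre\<close>

text \<open>Forms of all degrees share one Euclidean space, indexed by all sets of indices.
  Contraction and exterior product are then linear maps of a single space and adjoint to each other;
  \<open>dgr\<close> picks out one degree.\<close>

definition ctr :: "'n::{finite,linorder} \<Rightarrow> real^'r::finite^'n set \<Rightarrow> real^'r^'n set" where
  "ctr j a = (\<chi> J. if j \<notin> J then sgnpos j J *\<^sub>R a $ insert j J else 0)"

definition wdg :: "'n::{finite,linorder} \<Rightarrow> real^'r::finite^'n set \<Rightarrow> real^'r^'n set" where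
  "wdg i b = (\<chi> K. if i \<in> K then sgnpos i (K - {i}) *\<^sub>R b $ (K - {i}) else 0)"

definition mact :: "real^'r^'r::finite \<Rightarrow> real^'r^'n::finite set \<Rightarrow> real^'r^'n set" where
  "mact M a = (\<chi> I. M *v a $ I)"

definition gB :: "real^'r^'r::finite \<Rightarrow> real^'r^'n::finite set \<Rightarrow> real^'r^'n set \<Rightarrow> real" where
  "gB G a b = a \<bullet> mact G b"

definition dgr :: "nat \<Rightarrow> real^'r::finite^'n::finite set \<Rightarrow> bool" where
  "dgr p a \<longleftrightarrow> (\<forall>I. card I \<noteq> p \<longrightarrow> a $ I = 0)"

definition posdef :: "real^'r^'r::finite \<Rightarrow> bool" where
  "posdef G \<longleftrightarrow> transpose G = G \<and> (\<forall>v. v \<noteq> 0 \<longrightarrow> v \<bullet> (G *v v) > 0)"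

lemma V_eqI: "(\<And>I. a $ I = b $ I) \<Longrightarrow> a = b"
  by (simp add: vec_eq_iff)

lemma sgnpos_sq [simp]: "sgnpos i J * sgnpos i J = 1"
  by (simp add: sgnpos_def power_mult_distrib[symmetric])

lemma sgnpos_insert:
  fixes J :: "'n::{finite,linorder} set"
  assumes "k \<notin> J" shows "sgnpos j (insert k J) = sgnpos j J * (if k < j then -1 else 1)"
proof -
  have "{l \<in> insert k J. l < j} = (if k < j then insert k {l \<in> J. l < j} else {l \<in> J. l < j})" by auto
  then show ?thesis using assms by (simp add: sgnpos_def)
qed

lemma linear_ctr: "linear (ctr j)" and linear_wdg: "linear (wdg j)"
  by (rule linearI; simp add: ctr_def wdg_def vec_eq_iff algebra_simps)+

lemma bl_ctr: "bounded_linear (ctr j)" and bl_wdg: "bounded_linear (wdg j)"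
  using linear_ctr linear_wdg by (auto simp: linear_conv_bounded_linear)

lemmas ctr_add = linear_add[OF linear_ctr]
  and ctr_diff = linear_diff[OF linear_ctr]
  and ctr_scaleR = linear_cmul[OF linear_ctr] and wdg_scaleR = linear_cmul[OF linear_wdg]
  and ctr_0 = linear_0[OF linear_ctr] and wdg_0 = linear_0[OF linear_wdg]

lemma bounded_bilinear_mv: "bounded_bilinear ((*v) :: real^'r^'s \<Rightarrow> real^'r \<Rightarrow> real^'s)"
  unfolding bilinear_conv_bounded_bilinear[symmetric] bilinear_def
  by (auto intro!: linearI simp: matrix_vector_mult_def vec_eq_iff sum.distrib sum_distrib_left algebra_simps)

lemma bounded_bilinear_mm: "bounded_bilinear ((**) :: real^'r^'s \<Rightarrow> real^'t^'r \<Rightarrow> real^'t^'s)"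
  unfolding bilinear_conv_bounded_bilinear[symmetric] bilinear_def
  by (auto intro!: linearI simp: matrix_matrix_mult_def vec_eq_iff sum.distrib sum_distrib_left algebra_simps)

lemma bounded_bilinear_mact: "bounded_bilinear (mact :: real^'r^'r::finite \<Rightarrow> real^'r^'n::finite set \<Rightarrow> _)"
  unfolding bilinear_conv_bounded_bilinear[symmetric] bilinear_def
  by (auto intro!: linearI V_eqI simp: mact_def
      bounded_bilinear.add_left[OF bounded_bilinear_mv] bounded_bilinear.add_right[OF bounded_bilinear_mv]
      bounded_bilinear.scaleR_left[OF bounded_bilinear_mv] bounded_bilinear.scaleR_right[OF bounded_bilinear_mv])

lemmas mact_add_left = bounded_bilinear.add_left[OF bounded_bilinear_mact]
  and mact_add_right = bounded_bilinear.add_right[OF bounded_bilinear_mact]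
  and mact_diff_left = bounded_bilinear.diff_left[OF bounded_bilinear_mact]
  and mact_scaleR_left = bounded_bilinear.scaleR_left[OF bounded_bilinear_mact]
  and mact_scaleR_right = bounded_bilinear.scaleR_right[OF bounded_bilinear_mact]
  and mact_minus_left = bounded_bilinear.minus_left[OF bounded_bilinear_mact]
  and mact_zero_right = bounded_bilinear.zero_right[OF bounded_bilinear_mact]
  and mact_zero_left = bounded_bilinear.zero_left[OF bounded_bilinear_mact]

lemma wdg_ctr_adjoint: "wdg i a \<bullet> b = a \<bullet> ctr i b"
proof -
  have "wdg i a \<bullet> b = (\<Sum>K\<in>UNIV. if i \<in> K then sgnpos i (K - {i}) * (a $ (K - {i}) \<bullet> b $ K) else 0)"
    unfolding inner_vec_def[of "wdg i a" b] by (rule sum.cong) (auto simp: wdg_def)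
  also have "\<dots> = (\<Sum>K\<in>{K. i \<in> K}. sgnpos i (K - {i}) * (a $ (K - {i}) \<bullet> b $ K))"
    by (simp add: sum.If_cases)
  also have "\<dots> = (\<Sum>J\<in>{J. i \<notin> J}. sgnpos i J * (a $ J \<bullet> b $ insert i J))"
    by (rule sum.reindex_bij_witness[of _ "insert i" "\<lambda>K. K - {i}"]) (auto simp: insert_absorb)
  also have "\<dots> = (\<Sum>J\<in>UNIV. if i \<notin> J then sgnpos i J * (a $ J \<bullet> b $ insert i J) else 0)"
    by (simp add: sum.If_cases)
  also have "\<dots> = a \<bullet> ctr i b"
    unfolding inner_vec_def[of a "ctr i b"] by (rule sum.cong) (auto simp: ctr_def)
  finally show ?thesis .
qed

lemma ctr_mact: "ctr j (mact M a) = mact M (ctr j a)" and wdg_mact: "wdg j (mact M a) = mact M (wdg j a)"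
  by (rule V_eqI; simp add: ctr_def wdg_def mact_def bounded_bilinear.scaleR_right[OF bounded_bilinear_mv])+

text \<open>For \<open>i\<close> different from \<open>j\<close>, exactly one of the two indices
  lies below the other, so exactly one of the two orders of insertion picks up an extra sign. This
  relation is the algebra behind the Bochner identity.\<close>

lemma ctr_wdg: "ctr j (wdg i a) = (if i = j then a else 0) - wdg i (ctr j a)"
proof -
  have "ctr j (wdg i a) $ J + wdg i (ctr j a) $ J = (if i = j then a else 0) $ J" for J
  proof (cases "i = j")
    case True
    then show ?thesis by (cases "j \<in> J") (auto simp: ctr_def wdg_def insert_absorb)
  next
    case False
    show ?thesis
    proof (cases "i \<in> J \<and> j \<notin> J")
      case t: True
      define L where "L = J - {i}"
      have J: "J = insert i L" "i \<notin> L" "j \<notin> L" using t by (auto simp: L_def)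
      have e: "insert j (insert i L) - {i} = insert j L" "insert i L - {i} = L" using J False by auto
      show ?thesis using J False unfolding J(1)
        by (auto simp: ctr_def wdg_def e sgnpos_insert)
    qed (use False in \<open>auto simp: ctr_def wdg_def\<close>)
  qed
  then have "ctr j (wdg i a) + wdg i (ctr j a) = (if i = j then a else 0)"
    by (intro V_eqI) simp
  then show ?thesis by (simp add: algebra_simps)
qed

lemma ctr_anticommute: "ctr i (ctr j a) = - ctr j (ctr i a)"
proof -
  have "ctr i (ctr j a) $ J = - ctr j (ctr i a) $ J" for J
  proof (cases "i \<notin> J \<and> j \<notin> J \<and> i \<noteq> j")
    case True
    then show ?thesis by (auto simp: ctr_def sgnpos_insert insert_commute)
  qed (auto simp: ctr_def)
  then show ?thesis by (intro V_eqI) simp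
qed

lemma dgr_ctr: "dgr (Suc p) a \<Longrightarrow> dgr p (ctr j a)"
  by (auto simp: dgr_def ctr_def)

lemma dgr_wdg: "dgr p a \<Longrightarrow> dgr (Suc p) (wdg j a)"
proof -
  assume a: "dgr p a"
  have "wdg j a $ I = 0" if "card I \<noteq> Suc p" for I
  proof (cases "j \<in> I")
    case True
    have "Suc (card (I - {j})) = card I" by (rule card_Suc_Diff1[OF _ True]) simp
    then have "card (I - {j}) \<noteq> p" using that by simp
    then have "a $ (I - {j}) = 0" using a unfolding dgr_def by blast
    then show ?thesis by (simp add: wdg_def)
  qed (simp add: wdg_def)
  then show "dgr (Suc p) (wdg j a)" by (simp add: dgr_def)
qed

lemma dgr_mact: "dgr p a \<Longrightarrow> dgr p (mact M a)"
  by (auto simp: dgr_def mact_def)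

lemma dgr_subspace: "subspace {a. dgr p a}"
  by (auto simp: subspace_def dgr_def)

lemma mact_mact: "mact A (mact B a) = mact (A ** B) a"
  by (simp add: mact_def matrix_vector_mul_assoc)

lemma mact_mat_1 [simp]: "mact (mat 1) a = a"
  by (simp add: mact_def)

lemma gB_alt: "gB G a b = (\<Sum>I\<in>UNIV. a $ I \<bullet> (G *v b $ I))"
  by (simp add: gB_def inner_vec_def[of a] mact_def)

lemma mact_adjoint: "mact M a \<bullet> b = a \<bullet> mact (transpose M) b"
proof -
  have "(M *v x) \<bullet> y = x \<bullet> (transpose M *v y)" for x y
    by (metis dot_lmul_matrix inner_commute transpose_matrix_vector)
  then show ?thesis unfolding inner_vec_def[of "mact M a" b] inner_vec_def[of a "mact (transpose M) b"]
    by (simp add: mact_def)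
qed

lemma bilinear_gB: "bilinear (gB G)"
  unfolding bilinear_def gB_def
  by (auto intro!: linearI simp: mact_add_right mact_scaleR_right inner_add_left inner_add_right)

lemma gB_commute: "posdef G \<Longrightarrow> gB G a b = gB G b a"
  unfolding gB_def posdef_def using mact_adjoint[of G b a] by (simp add: inner_commute)

lemma gB_pos: assumes "posdef G" "a \<noteq> 0" shows "gB G a a > 0"
proof -
  obtain I where I: "a $ I \<noteq> 0" using assms(2) by (auto simp: vec_eq_iff[of a])
  have nn: "v \<bullet> (G *v v) \<ge> 0" for v using assms(1) by (cases "v = 0") (auto simp: posdef_def less_imp_le)
  show ?thesis unfolding gB_alt
    by (rule sum_pos2[of _ I]) (use I nn assms in \<open>auto simp: posdef_def\<close>)
qed

lemma gB_nonneg: "posdef G \<Longrightarrow> gB G a a \<ge> 0"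
  using gB_pos[of G a] by (cases "a = 0") (auto simp: gB_def less_imp_le)

lemma posdef_invertible: "posdef G \<Longrightarrow> invertible G"
proof -
  assume "posdef G"
  then have "\<forall>x. G *v x = 0 \<longrightarrow> x = 0" unfolding posdef_def by (metis inner_zero_right less_irrefl)
  then show ?thesis using matrix_left_invertible_ker invertible_left_inverse by blast
qed

lemma posdef_inv:
  assumes "posdef G"
  shows "matrix_inv G ** G = mat 1" "G ** matrix_inv G = mat 1" "transpose (matrix_inv G) = matrix_inv G"
proof -
  have "\<exists>A'. G ** A' = mat 1 \<and> A' ** G = mat 1" using posdef_invertible[OF assms] by (simp add: invertible_def)
  then have i: "G ** matrix_inv G = mat 1 \<and> matrix_inv G ** G = mat 1"
    unfolding matrix_inv_def by (rule someI_ex)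
  then show 1: "matrix_inv G ** G = mat 1" and 2: "G ** matrix_inv G = mat 1" by auto
  have "transpose (matrix_inv G) ** G = mat 1"
    using arg_cong[OF 2, of transpose] assms by (simp add: matrix_transpose_mul posdef_def transpose_mat)
  then have "(transpose (matrix_inv G) ** G) ** matrix_inv G = matrix_inv G" by simp
  then show "transpose (matrix_inv G) = matrix_inv G" by (simp add: matrix_mul_assoc[symmetric] 2)
qed

lemma posdef_scaleR: "posdef G \<Longrightarrow> c > 0 \<Longrightarrow> posdef (c *\<^sub>R G)"
  by (auto simp: posdef_def transpose_scalar scaleR_matrix_vector_assoc[symmetric])

lemma posdef_mat_1: "posdef (mat 1)"
  by (simp add: posdef_def transpose_mat)

text \<open>Cramer's rule writes the entries of the inverse as quotients of determinants, which are
  polynomials in the entries.\<close>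

lemma continuous_on_matrix_inv:
  fixes g :: "'a::topological_space \<Rightarrow> real^'r^'r::finite"
  assumes "continuous_on S g" "\<And>x. x \<in> S \<Longrightarrow> posdef (g x)"
  shows "continuous_on S (\<lambda>x. matrix_inv (g x))"
proof -
  have e: "matrix_inv (g x) $ k $ l = det (\<chi> i j. if j = k then axis l 1 $ i else g x $ i $ j) / det (g x)"
    if "x \<in> S" for x k l
  proof -
    have "det (g x) \<noteq> 0" using posdef_invertible[OF assms(2)[OF that]] invertible_det_nz by blast
    moreover have "g x *v (matrix_inv (g x) *v axis l 1) = axis l 1"
      by (simp add: matrix_vector_mul_assoc posdef_inv[OF assms(2)[OF that]])
    ultimately have "matrix_inv (g x) *v axis l 1 = (\<chi> k. det (\<chi> i j. if j = k then axis l 1 $ i else g x $ i $ j) / det (g x))"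
      using cramer by blast
    then have "(matrix_inv (g x) *v axis l 1) $ k = det (\<chi> i j. if j = k then axis l 1 $ i else g x $ i $ j) / det (g x)"
      by simp
    moreover have "(matrix_inv (g x) *v axis l 1) $ k = matrix_inv (g x) $ k $ l"
      by (simp add: matrix_vector_mult_basis column_def)
    ultimately show ?thesis by simp
  qed
  have c: "continuous_on S (\<lambda>x. g x $ i $ j)" for i j
    by (intro continuous_on_component assms(1))
  have ch: "continuous_on S (\<lambda>x. if j = k then axis l 1 $ i else g x $ i $ j)" for i j k l
    by (cases "j = k") (auto intro: c)
  have d: "continuous_on S (\<lambda>x. det (\<chi> i j. if j = k then axis l 1 $ i else g x $ i $ j))" for k l
    unfolding det_def
    by (intro continuous_on_sum continuous_on_mult continuous_on_prod continuous_on_const) (simp add: ch)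
  have d0: "continuous_on S (\<lambda>x. det (g x))"
    unfolding det_def by (intro continuous_on_sum continuous_on_mult continuous_on_prod continuous_on_const c)
  have "continuous_on S (\<lambda>x. \<chi> k l. det (\<chi> i j. if j = k then axis l 1 $ i else g x $ i $ j) / det (g x))"
    by (intro continuous_on_vec_lambda continuous_on_divide d d0)
       (use posdef_invertible[OF assms(2)] invertible_det_nz in blast)
  then show ?thesis
    by (rule iffD1[OF continuous_on_cong[OF refl], rotated]) (simp add: vec_eq_iff e)
qed

text \<open>With A and B the inverses at x and at the shifted point y, B (g y - g x) A = A - B. The
  difference quotient of the inverse is therefore a product of factors whose limits are
  known.\<close>

lemma hpd_matrix_inv:
  fixes g :: "real^'n::finite \<Rightarrow> real^'r^'r::finite"
  assumes "open S" "C1 S g" "\<And>x. x \<in> S \<Longrightarrow> posdef (g x)" "x \<in> S"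
  shows "hpd j (\<lambda>x. matrix_inv (g x)) (- (matrix_inv (g x) ** pd j g x ** matrix_inv (g x))) x"
proof (rule hpdI_seq)
  fix h :: "nat \<Rightarrow> real" assume h: "h \<longlonglongrightarrow> 0" "\<And>n. h n \<noteq> 0"
  let ?y = "\<lambda>n. x + h n *\<^sub>R axis j 1"
  have y: "?y \<longlonglongrightarrow> x" using tendsto_add[OF tendsto_const[of x] tendsto_scaleR[OF h(1) tendsto_const[of "axis j 1"]]] by simp
  have ev: "\<forall>\<^sub>F n in sequentially. ?y n \<in> S" by (rule topological_tendstoD[OF y assms(1,4)])
  have ci: "(\<lambda>n. matrix_inv (g (?y n))) \<longlonglongrightarrow> matrix_inv (g x)"
    by (rule continuous_on_tendsto_compose[OF continuous_on_matrix_inv[OF C1_cont[OF assms(2)] assms(3)] y assms(4) ev])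
  have "(\<lambda>n. dq j (h n) g x) \<longlonglongrightarrow> pd j g x" by (rule dq_tendsto[OF C1_hpd[OF assms(2,4)] h])
  then have "(\<lambda>n. - (matrix_inv (g (?y n)) ** dq j (h n) g x ** matrix_inv (g x)))
      \<longlonglongrightarrow> - (matrix_inv (g x) ** pd j g x ** matrix_inv (g x))"
    by (intro tendsto_minus bounded_bilinear.tendsto[OF bounded_bilinear_mm] tendsto_const ci)
  then show "(\<lambda>n. dq j (h n) (\<lambda>x. matrix_inv (g x)) x) \<longlonglongrightarrow> - (matrix_inv (g x) ** pd j g x ** matrix_inv (g x))"
  proof (rule Lim_transform_eventually)
    show "\<forall>\<^sub>F n in sequentially. - (matrix_inv (g (?y n)) ** dq j (h n) g x ** matrix_inv (g x)) = dq j (h n) (\<lambda>x. matrix_inv (g x)) x"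
      using ev
    proof eventually_elim
      case (elim n)
      let ?A = "matrix_inv (g x)" and ?B = "matrix_inv (g (?y n))"
      note mm = bounded_bilinear.diff_left[OF bounded_bilinear_mm] bounded_bilinear.diff_right[OF bounded_bilinear_mm]
        bounded_bilinear.scaleR_left[OF bounded_bilinear_mm] bounded_bilinear.scaleR_right[OF bounded_bilinear_mm]
      have "?B ** (g (?y n) - g x) ** ?A = (?B ** g (?y n)) ** ?A - ?B ** (g x ** ?A)"
        unfolding mm by (simp add: matrix_mul_assoc)
      also have "\<dots> = ?A - ?B" using posdef_inv[OF assms(3)[OF elim]] posdef_inv[OF assms(3)[OF assms(4)]] by simp
      finally have "?B ** (g (?y n) - g x) ** ?A = ?A - ?B" .
      then show ?case unfolding dq_def mm by (simp add: scaleR_diff_right)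
    qed
  qed
qed

lemma C1_matrix_inv:
  fixes g :: "real^'n::finite \<Rightarrow> real^'r^'r::finite"
  assumes "open S" "C1 S g" "\<And>x. x \<in> S \<Longrightarrow> posdef (g x)"
  shows "C1 S (\<lambda>x. matrix_inv (g x))"
proof (rule C1I[where F'="\<lambda>j x. - (matrix_inv (g x) ** pd j g x ** matrix_inv (g x))"])
  have c: "continuous_on S (\<lambda>x. matrix_inv (g x))" by (rule continuous_on_matrix_inv[OF C1_cont[OF assms(2)] assms(3)])
  then show "continuous_on S (\<lambda>x. matrix_inv (g x))" .
  show "continuous_on S (\<lambda>x. - (matrix_inv (g x) ** pd j g x ** matrix_inv (g x)))" for j
    by (intro continuous_on_minus bounded_bilinear.continuous_on[OF bounded_bilinear_mm] c C1_cont_pd[OF assms(2)])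
qed (rule hpd_matrix_inv[OF assms])

section \<open>Riesz representation in weighted square-integrable spaces\<close>

text \<open>A pointwise inner product that varies measurably. Square-integrable maps are kept as
  functions and not as classes, so completeness and Riesz representation are proved for sequences of
  functions. Instances are the weighted metrics on forms and plain multiplication of reals.\<close>

locale l2form =
  fixes B :: "'a::euclidean_space \<Rightarrow> 'v::euclidean_space \<Rightarrow> 'v \<Rightarrow> real"
  assumes bil: "\<And>x. bilinear (B x)"
    and sym: "\<And>x a b. B x a b = B x b a"
    and pos: "\<And>x a. a \<noteq> 0 \<Longrightarrow> B x a a > 0"
    and meas [measurable]: "\<And>u v. u \<in> borel_measurable borel \<Longrightarrow> v \<in> borel_measurable borel \<Longrightarrow>
      (\<lambda>x. B x (u x) (v x)) \<in> borel_measurable borel"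
begin

definition H :: "('a \<Rightarrow> 'v) \<Rightarrow> bool" where
  "H u \<longleftrightarrow> u \<in> borel_measurable borel \<and> integrable lborel (\<lambda>x. B x (u x) (u x))"

definition ip :: "('a \<Rightarrow> 'v) \<Rightarrow> ('a \<Rightarrow> 'v) \<Rightarrow> real" where
  "ip u v = (LINT x|lborel. B x (u x) (v x))"

lemma B_bb: "bounded_bilinear (B x)"
  using bil bilinear_conv_bounded_bilinear by blast

lemmas B_add_left = bounded_bilinear.add_left[OF B_bb]
  and B_add_right = bounded_bilinear.add_right[OF B_bb]
  and B_diff_left = bounded_bilinear.diff_left[OF B_bb]
  and B_diff_right = bounded_bilinear.diff_right[OF B_bb]
  and B_scaleR_left = bounded_bilinear.scaleR_left[OF B_bb]
  and B_scaleR_right = bounded_bilinear.scaleR_right[OF B_bb]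
  and B_zero_left = bounded_bilinear.zero_left[OF B_bb]

lemma B_nonneg: "B x a a \<ge> 0"
  using pos[of a x] B_zero_left[of x 0] by (cases "a = 0") auto

lemma B_young: "\<bar>B x a b\<bar> \<le> B x a a + B x b b"
proof -
  have "B x (a - b) (a - b) \<ge> 0" "B x (a + b) (a + b) \<ge> 0" by (rule B_nonneg)+
  then have "2 * B x a b \<le> B x a a + B x b b" "- 2 * B x a b \<le> B x a a + B x b b"
    using sym[of x b a]
    by (auto simp: B_add_left B_add_right B_diff_left B_diff_right)
  then show ?thesis using B_nonneg[of x a] B_nonneg[of x b] by auto
qed

lemma H_meas: "H u \<Longrightarrow> u \<in> borel_measurable borel" and H_int: "H u \<Longrightarrow> integrable lborel (\<lambda>x. B x (u x) (u x))"
  by (auto simp: H_def)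

lemma B_integrable: "H u \<Longrightarrow> H v \<Longrightarrow> integrable lborel (\<lambda>x. B x (u x) (v x))"
proof (rule Bochner_Integration.integrable_bound[where f="\<lambda>x. B x (u x) (u x) + B x (v x) (v x)"])
  assume u: "H u" and v: "H v"
  show "integrable lborel (\<lambda>x. B x (u x) (u x) + B x (v x) (v x))"
    using H_int[OF u] H_int[OF v] by (rule Bochner_Integration.integrable_add)
  show "(\<lambda>x. B x (u x) (v x)) \<in> borel_measurable lborel" using H_meas[OF u] H_meas[OF v] by measurable
  show "AE x in lborel. norm (B x (u x) (v x)) \<le> norm (B x (u x) (u x) + B x (v x) (v x))"
    using B_young by (auto intro!: AE_I2 order_trans[OF B_young])
qed

lemma B_expand: "B x (a + c *\<^sub>R b) (a + c *\<^sub>R b) = B x a a + (2 * c) * B x a b + c^2 * B x b b"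
  using sym[of x b a]
  by (simp add: B_add_left B_add_right B_scaleR_left B_scaleR_right power2_eq_square algebra_simps)

lemma H_comb:
  assumes "H u" "H v" shows "H (\<lambda>x. u x + c *\<^sub>R v x)"
  unfolding H_def
proof
  show "(\<lambda>x. u x + c *\<^sub>R v x) \<in> borel_measurable borel"
    using H_meas[OF assms(1)] H_meas[OF assms(2)] by measurable
  show "integrable lborel (\<lambda>x. B x (u x + c *\<^sub>R v x) (u x + c *\<^sub>R v x))"
    unfolding B_expand
    by (intro Bochner_Integration.integrable_add integrable_mult_right B_integrable assms)
qed

lemma H_diff: "H u \<Longrightarrow> H v \<Longrightarrow> H (\<lambda>x. u x - v x)"
  using H_comb[of u v "-1"] by simp

lemma ip_comb:
  assumes "H u" "H v"
  shows "ip (\<lambda>x. u x + c *\<^sub>R v x) (\<lambda>x. u x + c *\<^sub>R v x) = ip u u + (2 * c) * ip u v + c^2 * ip v v"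
  unfolding ip_def B_expand using B_integrable[OF assms(1,1)] B_integrable[OF assms(1,2)] B_integrable[OF assms(2,2)]
  by simp

lemma ip_diff_self:
  assumes "H u" "H v"
  shows "ip (\<lambda>x. u x - v x) (\<lambda>x. u x - v x) = ip u u - 2 * ip u v + ip v v"
  using ip_comb[OF assms, of "-1"] by simp

lemma ip_diff_left: "H u \<Longrightarrow> H v \<Longrightarrow> H w \<Longrightarrow> ip (\<lambda>x. u x - v x) w = ip u w - ip v w"
  unfolding ip_def B_diff_left using B_integrable by simp

lemma ip_commute: "ip u v = ip v u"
  unfolding ip_def by (simp add: sym)

lemma ip_nonneg: "ip u u \<ge> 0"
  unfolding ip_def by (intro integral_nonneg_AE AE_I2 B_nonneg)

text \<open>The discriminant of a quadratic that is bounded below by -e. The case e =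
  \<open>ip u u\<close> is Cauchy-Schwarz; a small e measures how far a near-minimiser is from
  satisfying the Euler equation.\<close>

lemma quadratic_discriminant_le:
  fixes e :: real
  assumes "\<And>c. - e \<le> 2 * c * b + c^2 * a" "a \<ge> 0" "e \<ge> 0"
  shows "b^2 \<le> e * a"
proof (cases "a = 0")
  case True
  have "b = 0"
  proof (rule ccontr)
    assume b: "b \<noteq> 0"
    show False using assms(1)[of "- (e + 1) / b"] assms(3) True b by simp
  qed
  then show ?thesis using True by simp
next
  case False
  then have "a > 0" using assms(2) by simp
  then show ?thesis using assms(1)[of "- b / a"] by (simp add: power2_eq_square field_simps)
qed

lemma ip_cauchy_schwarz:
  assumes "H u" "H v" shows "(ip u v)^2 \<le> ip u u * ip v v"
proof (rule quadratic_discriminant_le)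
  show "- ip u u \<le> 2 * c * ip u v + c^2 * ip v v" for c
    using ip_comb[OF assms, of c] ip_nonneg[of "\<lambda>x. u x + c *\<^sub>R v x"] by simp
qed (rule ip_nonneg)+

text \<open>The constant depends on the point; it serves to turn smallness of \<open>B x\<close>
  into pointwise convergence.\<close>

lemma B_coercive: obtains c where "c > 0" "\<And>a. B x a a \<ge> c * (norm a)^2"
proof (cases "\<exists>b::'v. norm b = 1")
  case True
  then have ne: "sphere (0::'v) 1 \<noteq> {}" by auto
  have "continuous_on (sphere 0 1) (\<lambda>a. B x a a)"
    by (intro bounded_bilinear.continuous_on[OF B_bb] continuous_on_id)
  then obtain b where b: "b \<in> sphere 0 1" "\<And>a. a \<in> sphere 0 1 \<Longrightarrow> B x b b \<le> B x a a"
    using continuous_attains_inf[OF compact_sphere ne] by blast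
  have "b \<noteq> 0" using b(1) by auto
  then have p: "B x b b > 0" by (rule pos)
  have "B x a a \<ge> B x b b * (norm a)^2" for a
  proof (cases "a = 0")
    case False
    have "B x b b \<le> B x ((1 / norm a) *\<^sub>R a) ((1 / norm a) *\<^sub>R a)" by (rule b(2)) (use False in simp)
    also have "\<dots> = B x a a / (norm a)^2"
      unfolding B_scaleR_left B_scaleR_right by (simp add: power2_eq_square)
    finally show ?thesis using False by (simp add: pos_le_divide_eq)
  qed (simp add: B_zero_left)
  then show thesis using that p by blast
next
  case False
  then show thesis using vector_choose_size[of 1, where 'a='v] by auto
qed

text \<open>The Riesz-Fischer argument for a sequence that is Cauchy at a geometric rate. The
  subspace \<open>S\<close> keeps the values of the limit at every point, and not just almost
  everywhere, in the forms of one degree.\<close>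

lemma H_complete:
  assumes w: "\<And>n. H (w n)" and e: "\<And>m n. n \<le> m \<Longrightarrow> ip (\<lambda>x. w m x - w n x) (\<lambda>x. w m x - w n x) \<le> C * (1/4)^n"
    and S: "subspace S" "\<And>n x. w n x \<in> S"
  obtains u where "H u" "\<And>x. u x \<in> S" "\<And>n. ip (\<lambda>x. u x - w n x) (\<lambda>x. u x - w n x) \<le> C * (1/4)^n"
proof -
  have C: "C \<ge> 0" using e[of 0 0] ip_nonneg[of "\<lambda>x. w 0 x - w 0 x"] by simp
  have wm [measurable]: "w n \<in> borel_measurable borel" for n by (rule H_meas[OF w])
  define d where "d n x = w (Suc n) x - w n x" for n x
  have dH: "H (d n)" for n unfolding d_def by (rule H_diff[OF w w])
  have dm [measurable]: "d n \<in> borel_measurable borel" for n by (rule H_meas[OF dH])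
  have nn: "(\<integral>\<^sup>+x. ennreal (B x (v x) (v x)) \<partial>lborel) = ennreal (ip v v)" if "H v" for v
    unfolding ip_def by (rule nn_integral_eq_integral[OF H_int[OF that]]) (simp add: B_nonneg)
  \<comment> \<open>The factor 2^n lies strictly between 1 and the rate 4^n: the integrals still sum
    up, and finiteness of \<open>F x\<close> forces the increments at x to decay like
    2^(-n/2).\<close>
  define F where "F x = (\<Sum>n. ennreal (2^n * B x (d n x) (d n x)))" for x
  have "(\<integral>\<^sup>+x. F x \<partial>lborel) = (\<Sum>n. \<integral>\<^sup>+x. ennreal (2^n * B x (d n x) (d n x)) \<partial>lborel)"
    unfolding F_def by (rule nn_integral_suminf) measurable
  also have "\<dots> = (\<Sum>n. ennreal (2^n * ip (d n) (d n)))"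
  proof (rule suminf_cong)
    fix n
    have "(\<integral>\<^sup>+x. ennreal (2^n * B x (d n x) (d n x)) \<partial>lborel) = ennreal (2^n) * (\<integral>\<^sup>+x. ennreal (B x (d n x) (d n x)) \<partial>lborel)"
      by (subst nn_integral_cmult[symmetric]) (auto simp: ennreal_mult B_nonneg)
    then show "(\<integral>\<^sup>+x. ennreal (2^n * B x (d n x) (d n x)) \<partial>lborel) = ennreal (2^n * ip (d n) (d n))"
      unfolding nn[OF dH] by (simp add: ennreal_mult ip_nonneg)
  qed
  also have "\<dots> \<le> (\<Sum>n. ennreal (C * (1/2)^n))"
  proof (intro suminf_le allI summableI ennreal_leI)
    fix n
    have "2^n * ip (d n) (d n) \<le> 2^n * (C * (1/4)^n)"
      using e[of n "Suc n"] by (intro mult_left_mono) (auto simp: d_def[abs_def])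
    also have "\<dots> = C * (1/2)^n" by (simp add: power_mult_distrib[symmetric] mult.left_commute)
    finally show "2^n * ip (d n) (d n) \<le> C * (1/2)^n" .
  qed
  also have "\<dots> < \<infinity>"
  proof -
    have "summable (\<lambda>n. C * (1/2)^n :: real)" by (intro summable_mult summable_geometric) simp
    then have "(\<Sum>n. ennreal (C * (1/2)^n)) = ennreal (\<Sum>n. C * (1/2)^n)"
      by (intro suminf_ennreal2) (use C in auto)
    then show ?thesis by simp
  qed
  finally have "(\<integral>\<^sup>+x. F x \<partial>lborel) \<noteq> \<infinity>" by simp
  moreover have [measurable]: "F \<in> borel_measurable lborel" unfolding F_def by measurable
  ultimately have aeF: "AE x in lborel. F x \<noteq> \<infinity>" by (intro nn_integral_PInf_AE) auto
  have conv: "Cauchy (\<lambda>n. w n x)" if fin: "F x \<noteq> \<infinity>" for x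
  proof -
    obtain K where K: "F x = ennreal K" "K \<ge> 0" using fin by (cases "F x") auto
    obtain c where c: "c > 0" "\<And>a. B x a a \<ge> c * (norm a)^2" using B_coercive by blast
    have "norm (d n x) \<le> sqrt (K / c) * (sqrt (1/2))^n" for n
    proof -
      have "ennreal (2^n * B x (d n x) (d n x)) \<le> F x"
        unfolding F_def using sum_le_suminf[of "\<lambda>n. ennreal (2^n * B x (d n x) (d n x))" "{n}"] by auto
      then have "2^n * B x (d n x) (d n x) \<le> K" unfolding K(1) using K(2) by (simp add: ennreal_le_iff)
      then have "2^n * (c * (norm (d n x))^2) \<le> K" using c(2)[of "d n x"]
        by (meson mult_left_mono order_trans zero_le_numeral zero_le_power)
      then have "(norm (d n x))^2 \<le> (K / c) * (1/2)^n" using c(1) by (simp add: field_simps power_one_over)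
      then have "norm (d n x) \<le> sqrt ((K / c) * (1/2)^n)" by (rule real_le_rsqrt)
      then show ?thesis by (simp only: real_sqrt_mult real_sqrt_power)
    qed
    moreover have "summable (\<lambda>n. sqrt (K / c) * (sqrt (1/2))^n)"
      by (intro summable_mult summable_geometric) (simp add: real_sqrt_lt_1_iff)
    ultimately have "summable (\<lambda>n. d n x)"
      by (intro summable_comparison_test[of "\<lambda>n. d n x" "\<lambda>n. sqrt (K / c) * (sqrt (1/2))^n"]) auto
    then have "convergent (\<lambda>n. \<Sum>i<n. d i x)" by (simp add: summable_iff_convergent)
    moreover have "(\<lambda>n. \<Sum>i<n. d i x) = (\<lambda>n. w n x - w 0 x)"
      unfolding d_def by (rule ext, rule sum_lessThan_telescope)
    ultimately have "convergent (\<lambda>n. w n x - w 0 x)" by simp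
    then have "convergent (\<lambda>n. (w n x - w 0 x) + w 0 x)" by (intro convergent_add convergent_const)
    then show ?thesis by (simp add: convergent_Cauchy)
  qed
  \<comment> \<open>The value 0 off the set of convergence belongs to the subspace \<open>S\<close>,
    and that set is measurable.\<close>
  define u where "u x = (if Cauchy (\<lambda>n. w n x) then lim (\<lambda>n. w n x) else 0)" for x
  have um [measurable]: "u \<in> borel_measurable borel" unfolding u_def by measurable
  have lim: "(\<lambda>n. w n x) \<longlonglongrightarrow> u x" if "Cauchy (\<lambda>n. w n x)" for x
    using that by (simp add: u_def Cauchy_convergent_iff convergent_LIMSEQ_iff)
  have uS: "u x \<in> S" for x
  proof (cases "Cauchy (\<lambda>n. w n x)")
    case True
    then show ?thesis using closed_sequentially[OF closed_subspace[OF S(1)] S(2) lim[OF True]] by simp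
  qed (use S(1) in \<open>simp add: u_def subspace_0\<close>)
  \<comment> \<open>Fatou's lemma in the index m; almost everywhere the limit inferior is an actual
    limit.\<close>
  have le: "(\<integral>\<^sup>+x. ennreal (B x (u x - w n x) (u x - w n x)) \<partial>lborel) \<le> ennreal (C * (1/4)^n)" for n
  proof -
    have "(\<integral>\<^sup>+x. ennreal (B x (u x - w n x) (u x - w n x)) \<partial>lborel)
        = (\<integral>\<^sup>+x. liminf (\<lambda>m. ennreal (B x (w m x - w n x) (w m x - w n x))) \<partial>lborel)"
    proof (rule nn_integral_cong_AE)
      show "AE x in lborel. ennreal (B x (u x - w n x) (u x - w n x)) = liminf (\<lambda>m. ennreal (B x (w m x - w n x) (w m x - w n x)))"
        using aeF
      proof eventually_elim
        case (elim x)
        have "(\<lambda>m. ennreal (B x (w m x - w n x) (w m x - w n x))) \<longlonglongrightarrow> ennreal (B x (u x - w n x) (u x - w n x))"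
          by (intro tendsto_ennrealI bounded_bilinear.tendsto[OF B_bb] tendsto_diff lim[OF conv[OF elim]] tendsto_const)
        then show ?case by (simp add: lim_imp_Liminf)
      qed
    qed
    also have "\<dots> \<le> liminf (\<lambda>m. \<integral>\<^sup>+x. ennreal (B x (w m x - w n x) (w m x - w n x)) \<partial>lborel)"
      by (rule nn_integral_liminf) measurable
    also have "\<dots> = liminf (\<lambda>m. ennreal (ip (\<lambda>x. w m x - w n x) (\<lambda>x. w m x - w n x)))"
      by (simp only: nn[OF H_diff[OF w w]])
    also have "\<dots> \<le> ennreal (C * (1/4)^n)"
    proof -
      have "\<forall>\<^sub>F m in sequentially. ennreal (ip (\<lambda>x. w m x - w n x) (\<lambda>x. w m x - w n x)) \<le> ennreal (C * (1/4)^n)"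
        using eventually_ge_at_top[of n] by eventually_elim (intro ennreal_leI e)
      then have "liminf (\<lambda>m. ennreal (ip (\<lambda>x. w m x - w n x) (\<lambda>x. w m x - w n x))) \<le> liminf (\<lambda>m::nat. ennreal (C * (1/4)^n))"
        by (rule Liminf_mono)
      then show ?thesis by (simp add: Liminf_const)
    qed
    finally show ?thesis .
  qed
  have duH: "H (\<lambda>x. u x - w n x)" for n
    unfolding H_def
  proof
    show "integrable lborel (\<lambda>x. B x (u x - w n x) (u x - w n x))"
    proof (rule integrableI_bounded)
      show "(\<integral>\<^sup>+x. ennreal (norm (B x (u x - w n x) (u x - w n x))) \<partial>lborel) < \<infinity>"
        using le_less_trans[OF le[of n] ennreal_less_top] by (simp add: B_nonneg)
    qed measurable
  qed measurable
  have uH: "H u" using H_comb[OF duH[of 0] w[of 0], of 1] by simp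
  show thesis
  proof (rule that[OF uH uS])
    show "ip (\<lambda>x. u x - w n x) (\<lambda>x. u x - w n x) \<le> C * (1/4)^n" for n
      using le[of n] unfolding nn[OF duH] using C by (simp add: ennreal_le_iff)
  qed
qed

text \<open>The representing vector is the limit of a minimising sequence for |T i|^2 - 2 L i. Test
  forms enter as an index set \<open>X\<close> with a map \<open>T\<close> into the
  square-integrable forms, linear in the sense of \<open>comb\<close>. The sequence \<open>s\<close>
  is returned as well: it shows that \<open>u\<close> lies in the closure of the range of
  \<open>T\<close>, which is what makes \<open>u\<close> an orthogonal projection in
  \<open>closed_projection\<close>.\<close>

lemma riesz:
  assumes X: "X \<noteq> {}" and T: "\<And>i. i \<in> X \<Longrightarrow> H (T i)"
    and comb: "\<And>c i k. i \<in> X \<Longrightarrow> k \<in> X \<Longrightarrow> \<exists>l\<in>X. (\<forall>x. T l x = T i x + c *\<^sub>R T k x) \<and> L l = L i + c * L k"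
    and bound: "\<And>i. i \<in> X \<Longrightarrow> (L i)^2 \<le> A * ip (T i) (T i)" and A: "A \<ge> 0"
    and S: "subspace S" "\<And>i x. i \<in> X \<Longrightarrow> T i x \<in> S"
  obtains u s where "H u" "\<And>x. u x \<in> S" "\<And>i. i \<in> X \<Longrightarrow> ip u (T i) = L i" "ip u u \<le> A"
    "\<And>n::nat. s n \<in> X" "(\<lambda>n. ip (\<lambda>x. u x - T (s n) x) (\<lambda>x. u x - T (s n) x)) \<longlonglongrightarrow> 0"
proof -
  define J where "J i = ip (T i) (T i) - 2 * L i" for i
  \<comment> \<open>2 L \<le> 2 sqrt (A N) \<le> A + N with N = |T i|^2.\<close>
  have Jlow: "J i \<ge> - A" if "i \<in> X" for i
  proof -
    let ?N = "ip (T i) (T i)"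
    have "4 * (L i)^2 \<le> (A + ?N)^2"
      using bound[OF that] sum_squares_bound[of A ?N] by (simp add: power2_eq_square algebra_simps)
    then have "(2 * L i)^2 \<le> (A + ?N)^2" by (simp add: power_mult_distrib)
    then have "2 * L i \<le> A + ?N" using A ip_nonneg[of "T i"] by (meson abs_le_square_iff abs_ge_self abs_of_nonneg add_nonneg_nonneg order_trans order.refl power2_le_imp_le)
    then show ?thesis by (simp add: J_def)
  qed
  have bd: "bdd_below (J ` X)" by (rule bdd_belowI2[of _ "-A"]) (rule Jlow)
  define m where "m = Inf (J ` X)"
  have ml: "m \<le> J i" if "i \<in> X" for i unfolding m_def by (rule cInf_lower[OF imageI[OF that] bd])
  have "\<exists>i\<in>X. J i < m + (1/4)^n" for n :: nat
  proof -
    have "Inf (J ` X) < m + (1/4)^n" by (simp add: m_def)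
    then show ?thesis using cInf_less_iff[OF _ bd] X by auto
  qed
  then obtain s where s: "\<And>n::nat. s n \<in> X" "\<And>n. J (s n) < m + (1/4)^n" by metis
  have Jexp: "m \<le> J i + 2 * c * (ip (T i) (T k) - L k) + c^2 * ip (T k) (T k)" if "i \<in> X" "k \<in> X" for i k c
  proof -
    obtain l where l: "l \<in> X" "\<forall>x. T l x = T i x + c *\<^sub>R T k x" "L l = L i + c * L k" using comb[OF \<open>i \<in> X\<close> \<open>k \<in> X\<close>, of c] by blast
    have "T l = (\<lambda>x. T i x + c *\<^sub>R T k x)" using l(2) by auto
    then have "J l = J i + 2 * c * (ip (T i) (T k) - L k) + c^2 * ip (T k) (T k)"
      using ip_comb[OF T[OF \<open>i \<in> X\<close>] T[OF \<open>k \<in> X\<close>], of c] l(3) by (simp add: J_def algebra_simps)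
    then show ?thesis using ml[OF l(1)] by simp
  qed
  \<comment> \<open>Moving a near-minimiser along k by c lowers J by at most (1/4)^n, for every c;
    the discriminant then bounds the defect of the Euler equation.\<close>
  have near: "(ip (T (s n)) (T k) - L k)^2 \<le> (1/4)^n * ip (T k) (T k)" if "k \<in> X" for n k
  proof (rule quadratic_discriminant_le)
    show "- ((1/4)^n) \<le> 2 * c * (ip (T (s n)) (T k) - L k) + c^2 * ip (T k) (T k)" for c
      using Jexp[OF s(1)[of n] that, of c] s(2)[of n] by linarith
  qed (auto simp: ip_nonneg)
  \<comment> \<open>The parallelogram law: the step of length 1/2 from \<open>s b\<close> along the
    difference is the midpoint, where J is still at least m.\<close>
  have cau: "ip (\<lambda>x. T (s a) x - T (s b) x) (\<lambda>x. T (s a) x - T (s b) x) \<le> 4 * (1/4)^b" if "b \<le> a" for a b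
  proof -
    let ?i = "s a" and ?k = "s b"
    obtain l where l: "l \<in> X" "\<forall>x. T l x = T ?i x + (-1) *\<^sub>R T ?k x" "L l = L ?i + (-1) * L ?k"
      using comb[OF s(1)[of a] s(1)[of b], of "-1"] by blast
    have Tl: "T l = (\<lambda>x. T ?i x - T ?k x)" using l(2) by auto
    have "m \<le> J ?k + (ip (T ?k) (T l) - L l) + (1/4) * ip (T l) (T l)"
      using Jexp[OF s(1) l(1), of b "1/2"] by (simp add: power2_eq_square)
    moreover have "ip (T ?k) (T l) = ip (T ?i) (T ?k) - ip (T ?k) (T ?k)"
      unfolding Tl using ip_diff_left[OF T[OF s(1)] T[OF s(1)] T[OF s(1)], of a b b] by (simp add: ip_commute)
    moreover have "ip (T l) (T l) = ip (T ?i) (T ?i) - 2 * ip (T ?i) (T ?k) + ip (T ?k) (T ?k)"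
      unfolding Tl by (rule ip_diff_self[OF T[OF s(1)] T[OF s(1)]])
    moreover have "(1/4) * N \<le> (1/2) * (a - 2 * li) + (1/2) * (b - 2 * lk) - m"
      if "m \<le> b - 2 * lk + (x - l) + (1/4) * N" "x = c - b" "N = a - 2 * c + b" "l = li - lk"
      for N a b c x l li lk :: real
      using that by (simp add: field_simps)
    ultimately have "(1/4) * ip (T l) (T l) \<le> (1/2) * J ?i + (1/2) * J ?k - m"
      using l(3) unfolding J_def by simp
    also have "\<dots> \<le> (1/2) * (1/4)^a + (1/2) * (1/4)^b" using s(2)[of a] s(2)[of b] by simp
    also have "\<dots> \<le> (1/4)^b"
    proof -
      have "(1/2) * x + (1/2) * y \<le> y" if "x \<le> y" for x y :: real using that by simp
      moreover have "(1/4::real)^a \<le> (1/4)^b" by (rule power_decreasing[OF that]) auto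
      ultimately show ?thesis by blast
    qed
    finally show ?thesis unfolding Tl by simp
  qed
  obtain u where u: "H u" "\<And>x. u x \<in> S"
    "\<And>n. ip (\<lambda>x. u x - T (s n) x) (\<lambda>x. u x - T (s n) x) \<le> 4 * (1/4)^n"
    using H_complete[of "\<lambda>n. T (s n)" 4 S, OF T[OF s(1)] cau S(1) S(2)[OF s(1)]] by blast
  have q0: "(\<lambda>n. K * (1/4)^n) \<longlonglongrightarrow> 0" for K :: real
    using tendsto_mult[OF tendsto_const[of K] LIMSEQ_power_zero[of "1/4::real"]] by simp
  have lim: "(\<lambda>n. ip (\<lambda>x. u x - T (s n) x) (\<lambda>x. u x - T (s n) x)) \<longlonglongrightarrow> 0"
    by (rule tendsto_sandwich[OF _ _ tendsto_const q0[of 4]]) (use u(3) ip_nonneg in auto)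
  have sq0: "z = 0" if "\<And>n::nat. (z::real)^2 \<le> K * (1/4)^n" for z K
  proof -
    have "z^2 \<le> 0" by (rule LIMSEQ_le_const[OF q0[of K]]) (use that in auto)
    then show ?thesis by simp
  qed
  have rep: "ip u (T k) = L k" if k: "k \<in> X" for k
  proof -
    \<comment> \<open>10 = 2 * 4 + 2 * 1: the distance of \<open>u\<close> from the sequence
      contributes 4, the defect in \<open>near\<close> contributes 1, and squaring a sum doubles
      both.\<close>
    have "(ip u (T k) - L k)^2 \<le> (10 * ip (T k) (T k)) * (1/4)^n" for n
    proof -
      let ?p = "ip (\<lambda>x. u x - T (s n) x) (T k)" and ?q = "ip (T (s n)) (T k) - L k"
      have "ip u (T k) - L k = ?p + ?q" using ip_diff_left[OF u(1) T[OF s(1)] T[OF k], of n] by simp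
      moreover have "(?p + ?q)^2 \<le> 2 * ?p^2 + 2 * ?q^2" using sum_squares_bound[of ?p ?q] by (simp add: power2_sum)
      moreover have "?p^2 \<le> (4 * (1/4)^n) * ip (T k) (T k)"
        using ip_cauchy_schwarz[OF H_diff[OF u(1) T[OF s(1)]] T[OF k], of n] mult_right_mono[OF u(3)[of n] ip_nonneg[of "T k"]]
        by linarith
      ultimately show ?thesis using near[OF k, of n] by (simp add: algebra_simps)
    qed
    then have "ip u (T k) - L k = 0" by (rule sq0)
    then show ?thesis by simp
  qed
  \<comment> \<open>Both L (s n) and |T (s n)|^2 tend to |u|^2, so the assumed bound becomes |u|^4
    \<le> A |u|^2 in the limit.\<close>
  have "ip u u \<le> A"
  proof -
    have tl: "(\<lambda>n. L (s n)) \<longlonglongrightarrow> ip u u"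
    proof -
      have "(\<lambda>n. ip u u - L (s n)) \<longlonglongrightarrow> 0"
      proof (rule Lim_null_comparison)
        have "\<bar>ip u u - L (s n)\<bar> \<le> sqrt (ip u u * ip (\<lambda>x. u x - T (s n) x) (\<lambda>x. u x - T (s n) x))" for n
        proof -
          have "ip u u - L (s n) = ip (\<lambda>x. u x - T (s n) x) u"
            using ip_diff_left[OF u(1) T[OF s(1)] u(1), of n] rep[OF s(1)[of n]] by (simp add: ip_commute)
          then have "(ip u u - L (s n))^2 \<le> ip u u * ip (\<lambda>x. u x - T (s n) x) (\<lambda>x. u x - T (s n) x)"
            using ip_cauchy_schwarz[OF H_diff[OF u(1) T[OF s(1)]] u(1), of n] by (simp add: mult.commute)
          then show ?thesis using real_le_rsqrt[of "\<bar>ip u u - L (s n)\<bar>"] by simp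
        qed
        then show "\<forall>\<^sub>F n in sequentially. norm (ip u u - L (s n)) \<le> sqrt (ip u u * ip (\<lambda>x. u x - T (s n) x) (\<lambda>x. u x - T (s n) x))"
          by simp
        have "(\<lambda>n. sqrt (ip u u * ip (\<lambda>x. u x - T (s n) x) (\<lambda>x. u x - T (s n) x))) \<longlonglongrightarrow> sqrt (ip u u * 0)"
          by (intro tendsto_real_sqrt tendsto_mult tendsto_const lim)
        then show "(\<lambda>n. sqrt (ip u u * ip (\<lambda>x. u x - T (s n) x) (\<lambda>x. u x - T (s n) x))) \<longlonglongrightarrow> 0" by simp
      qed
      from tendsto_diff[OF tendsto_const[of "ip u u"] this] show ?thesis by simp
    qed
    have tn: "(\<lambda>n. ip (T (s n)) (T (s n))) \<longlonglongrightarrow> ip u u"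
    proof -
      have e: "ip (T (s n)) (T (s n)) = ip (\<lambda>x. u x - T (s n) x) (\<lambda>x. u x - T (s n) x) - ip u u + 2 * L (s n)" for n
        using ip_diff_self[OF u(1) T[OF s(1)], of n] rep[OF s(1)[of n]] by simp
      have "(\<lambda>n. ip (\<lambda>x. u x - T (s n) x) (\<lambda>x. u x - T (s n) x) - ip u u + 2 * L (s n)) \<longlonglongrightarrow> 0 - ip u u + 2 * ip u u"
        by (intro tendsto_intros lim tl)
      then show ?thesis unfolding e by simp
    qed
    have "(ip u u)^2 \<le> A * ip u u"
      by (rule LIMSEQ_le[OF tendsto_power[OF tl] tendsto_mult[OF tendsto_const tn]]) (use bound[OF s(1)] in auto)
    then show ?thesis using ip_nonneg[of u] A by (cases "ip u u = 0") (auto simp: power2_eq_square)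
  qed
  then show thesis using that[OF u(1,2) rep _ s(1) lim] by blast
qed

end

section \<open>The Bochner identity\<close>

lemma bb_gB: "bounded_bilinear (gB G)"
  using bilinear_gB bilinear_conv_bounded_bilinear by blast

lemmas gB_add_left = bounded_bilinear.add_left[OF bb_gB]
  and gB_add_right = bounded_bilinear.add_right[OF bb_gB]
  and gB_diff_left = bounded_bilinear.diff_left[OF bb_gB]
  and gB_diff_right = bounded_bilinear.diff_right[OF bb_gB]
  and gB_minus_left = bounded_bilinear.minus_left[OF bb_gB]
  and gB_minus_right = bounded_bilinear.minus_right[OF bb_gB]
  and gB_scaleR_left = bounded_bilinear.scaleR_left[OF bb_gB]
  and gB_scaleR_right = bounded_bilinear.scaleR_right[OF bb_gB]
  and gB_zero_left = bounded_bilinear.zero_left[OF bb_gB]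
  and gB_zero_right = bounded_bilinear.zero_right[OF bb_gB]
  and gB_sum_left = bounded_bilinear.sum_left[OF bb_gB]
  and gB_sum_right = bounded_bilinear.sum_right[OF bb_gB]

lemma gB_scaleR: "gB (c *\<^sub>R G) a b = c * gB G a b"
  by (simp add: gB_def mact_scaleR_left)

lemma gB_mult: "gB (G ** M) a b = gB G a (mact M b)"
  by (simp add: gB_def mact_mact)

lemma continuous_on_mact [continuous_intros]:
  "continuous_on S M \<Longrightarrow> continuous_on S a \<Longrightarrow> continuous_on S (\<lambda>x. mact (M x) (a x))"
  by (rule bounded_bilinear.continuous_on[OF bounded_bilinear_mact])

lemma continuous_on_gB [continuous_intros]:
  "continuous_on S G \<Longrightarrow> continuous_on S a \<Longrightarrow> continuous_on S b \<Longrightarrow> continuous_on S (\<lambda>x. gB (G x) (a x) (b x))"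
  unfolding gB_def by (intro continuous_on_inner continuous_on_mact)

lemma continuous_on_ctr [continuous_intros]: "continuous_on S a \<Longrightarrow> continuous_on S (\<lambda>x. ctr j (a x))"
  by (rule bounded_linear.continuous_on[OF bl_ctr])

lemma continuous_on_wdg [continuous_intros]: "continuous_on S a \<Longrightarrow> continuous_on S (\<lambda>x. wdg j (a x))"
  by (rule bounded_linear.continuous_on[OF bl_wdg])

lemma C1_mact: "C1 S M \<Longrightarrow> C1 S a \<Longrightarrow> C1 S (\<lambda>x. mact (M x) (a x))"
  by (rule C1_bilinear[OF bounded_bilinear_mact])

lemma C1_gB: "C1 S G \<Longrightarrow> C1 S a \<Longrightarrow> C1 S b \<Longrightarrow> C1 S (\<lambda>x. gB (G x) (a x) (b x))"
  unfolding gB_def by (intro C1_bilinear[OF bounded_bilinear_inner] C1_mact)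

lemma C1_ctr: "C1 S a \<Longrightarrow> C1 S (\<lambda>x. ctr j (a x))"
  by (rule C1_linear[OF bl_ctr])

lemma pd_ctr: "C1 S a \<Longrightarrow> x \<in> S \<Longrightarrow> pd i (\<lambda>x. ctr j (a x)) x = ctr j (pd i a x)"
  by (intro hpd_imp_pd hpd_linear[OF bl_ctr] C1_hpd)

lemma hpd_gB:
  assumes "hpd j G G' x" "hpd j a a' x" "hpd j b b' x"
  shows "hpd j (\<lambda>x. gB (G x) (a x) (b x)) (gB G' (a x) (b x) + gB (G x) a' (b x) + gB (G x) (a x) b') x"
  using hpd_bilinear[OF bounded_bilinear_inner assms(2) hpd_bilinear[OF bounded_bilinear_mact assms(1,3)]]
  by (simp add: gB_def inner_add_right add_ac)

lemma gB_wdg_wdg: "gB G (wdg i a) (wdg j b) = (if i = j then gB G a b else 0) - gB G (ctr j a) (ctr i b)"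
proof -
  have "gB G (wdg i a) (wdg j b) = a \<bullet> ctr i (wdg j (mact G b))"
    by (simp add: gB_def wdg_mact[symmetric] wdg_ctr_adjoint)
  also have "\<dots> = (if i = j then a \<bullet> mact G b else 0) - a \<bullet> wdg j (ctr i (mact G b))"
    by (simp add: ctr_wdg inner_diff_right)
  also have "a \<bullet> wdg j (ctr i (mact G b)) = ctr j a \<bullet> mact G (ctr i b)"
    by (metis inner_commute wdg_ctr_adjoint ctr_mact)
  finally show ?thesis by (simp add: gB_def)
qed

lemma set_integrable_compact:
  fixes f :: "'a::euclidean_space \<Rightarrow> 'b::{banach, second_countable_topology}"
  shows "compact K \<Longrightarrow> continuous_on K f \<Longrightarrow> set_integrable lborel K f"
  unfolding set_integrable_def by (rule borel_integrable_compact)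

definition dext :: "((real,'n::{finite,linorder}) vec \<Rightarrow> real^'r::finite^'n set) \<Rightarrow> (real,'n) vec \<Rightarrow> real^'r^'n set" where
  "dext u x = (\<Sum>i\<in>UNIV. wdg i (pd i u x))"

text \<open>When \<open>A i\<close> is the inverse of G times the i-th derivative of G, this is the
  formal adjoint of d in the metric G. The matrices are an argument of their own because a scalar
  weight changes them by a multiple of the identity only.\<close>

definition codiff :: "('n::{finite,linorder} \<Rightarrow> (real,'n) vec \<Rightarrow> real^'r::finite^'r) \<Rightarrow> ((real,'n) vec \<Rightarrow> real^'r^'n set) \<Rightarrow> (real,'n) vec \<Rightarrow> real^'r^'n set" where
  "codiff A u x = - (\<Sum>i\<in>UNIV. ctr i (pd i u x + mact (A i x) (u x)))"

text \<open>The quadratic form of the curvature operator, with its exterior product moved to the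
  other argument, where it becomes a second contraction; see \<open>gip_Theta\<close>.\<close>

definition curvform :: "('n::{finite,linorder} \<Rightarrow> (real,'n) vec \<Rightarrow> real^'r::finite^'r) \<Rightarrow> ((real,'n) vec \<Rightarrow> real^'r^'r) \<Rightarrow> (real,'n) vec \<Rightarrow> real^'r^'n set \<Rightarrow> real" where
  "curvform A G x a = - (\<Sum>i\<in>UNIV. \<Sum>j\<in>UNIV. gB (G x) (mact (pd j (A i) x) (ctr i a)) (ctr j a))"

definition C2 :: "(real^'n::finite \<Rightarrow> 'b::real_normed_vector) \<Rightarrow> bool" where
  "C2 u \<longleftrightarrow> C1 UNIV u \<and> (\<forall>j. C1 UNIV (pd j u)) \<and> (\<forall>i j. pd i (pd j u) = pd j (pd i u))"

text \<open>\<open>GA\<close> determines \<open>A\<close> as the logarithmic derivative of the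
  metric, and requiring \<open>A\<close> to be C1 is how second derivatives of the metric enter.
  Instances are g, its restrictions to smaller open sets and its multiples by the exponential of a
  weight.\<close>

locale metric_connection =
  fixes W :: "((real,'n::{finite,linorder}) vec) set" and G :: "(real,'n) vec \<Rightarrow> real^'r::finite^'r"
    and A :: "'n \<Rightarrow> (real,'n) vec \<Rightarrow> real^'r^'r"
  assumes W: "open W" and G: "C1 W G" and pG: "\<And>x. x \<in> W \<Longrightarrow> posdef (G x)"
    and A: "\<And>j. C1 W (A j)" and GA: "\<And>j x. x \<in> W \<Longrightarrow> pd j G x = G x ** A j x"
begin

lemma pd_G_sym: "x \<in> W \<Longrightarrow> transpose (pd j G x) = pd j G x"
proof -
  assume x: "x \<in> W"
  have bt: "bounded_linear (transpose :: real^'r^'r \<Rightarrow> _)"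
    unfolding linear_conv_bounded_linear[symmetric]
    by (rule linearI) (auto simp: transpose_def vec_eq_iff)
  have "hpd j (\<lambda>x. transpose (G x)) (transpose (pd j G x)) x" by (rule hpd_linear[OF bt C1_hpd[OF G x]])
  moreover have "hpd j (\<lambda>x. transpose (G x)) (pd j G x) x"
    using hpd_cong[OF W x, of "\<lambda>x. transpose (G x)" G j] C1_hpd[OF G x] pG by (simp add: posdef_def)
  ultimately show ?thesis using hpd_imp_pd by metis
qed

text \<open>G times \<open>A j\<close> is a derivative of the symmetric matrix G, hence symmetric
  itself.\<close>

lemma A_sym: "x \<in> W \<Longrightarrow> gB (G x) (mact (A j x) a) b = gB (G x) a (mact (A j x) b)"
proof -
  assume x: "x \<in> W"
  have "gB (G x) a (mact (A j x) b) = a \<bullet> mact (pd j G x) b" by (simp add: GA[OF x] gB_def mact_mact)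
  also have "\<dots> = mact (pd j G x) a \<bullet> b" by (simp add: mact_adjoint pd_G_sym[OF x])
  also have "\<dots> = gB (G x) b (mact (A j x) a)" by (simp add: GA[OF x] gB_def mact_mact inner_commute)
  finally show ?thesis using gB_commute[OF pG[OF x]] by simp
qed

lemma pd_gB:
  assumes "C1 W a" "C1 W b" "x \<in> W"
  shows "pd j (\<lambda>x. gB (G x) (a x) (b x)) x
      = gB (G x) (pd j a x + mact (A j x) (a x)) (b x) + gB (G x) (a x) (pd j b x)"
    and "pd j (\<lambda>x. gB (G x) (a x) (b x)) x
      = gB (G x) (pd j a x) (b x) + gB (G x) (a x) (pd j b x + mact (A j x) (b x))"
  using hpd_imp_pd[OF hpd_gB[OF C1_hpd[OF G assms(3)] C1_hpd[OF assms(1,3)] C1_hpd[OF assms(2,3)], of j]]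
  by (simp_all add: GA[OF assms(3)] gB_mult gB_add_left gB_add_right A_sym[OF assms(3)])

text \<open>Write D_i for \<open>pd i\<close> plus \<open>A i\<close>. The integrals of the j-th
  derivative of <D_i a, b> and of the i-th derivative of <\<open>pd j\<close> a, b> vanish by
  compact support. In their difference the second derivatives of a cancel, and what remains of the
  commutator is the derivative of the matrix \<open>A i\<close>.\<close>

lemma commutator_integral:
  assumes K: "compact K" "K \<subseteq> W"
    and a: "C2 a" "\<And>x. x \<notin> K \<Longrightarrow> a x = 0" and b: "C1 UNIV b" "\<And>x. x \<notin> K \<Longrightarrow> b x = 0"
  shows "(LINT x:K|lborel. gB (G x) (pd i a x + mact (A i x) (a x)) (pd j b x + mact (A j x) (b x)))
     = (LINT x:K|lborel. gB (G x) (pd j a x) (pd i b x) - gB (G x) (mact (pd j (A i) x) (a x)) (b x))"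
proof -
  have C: "C1 W a" "\<And>j. C1 W (pd j a)" "C1 W b" and comm: "pd i (pd j a) = pd j (pd i a)"
    using a(1) C1_subset[OF _ subset_UNIV] b(1) unfolding C2_def by blast+
  define u where "u x = pd i a x + mact (A i x) (a x)" for x
  have Cu: "C1 W u" unfolding u_def[abs_def] by (intro C1_add C1_mact C A)
  have pdu: "pd j u x = pd j (pd i a) x + (mact (A i x) (pd j a x) + mact (pd j (A i) x) (a x))" if "x \<in> W" for x
    unfolding u_def[abs_def]
    by (intro hpd_imp_pd hpd_add hpd_bilinear[OF bounded_bilinear_mact] C1_hpd[OF _ that] C A)
  have 1: "pd j (\<lambda>x. gB (G x) (u x) (b x)) x - pd i (\<lambda>x. gB (G x) (pd j a x) (b x)) x
     = gB (G x) (u x) (pd j b x + mact (A j x) (b x))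
       - (gB (G x) (pd j a x) (pd i b x) - gB (G x) (mact (pd j (A i) x) (a x)) (b x))" if "x \<in> W" for x
    unfolding pd_gB(2)[OF Cu C(3) that] pd_gB(1)[OF C(2) C(3) that] pdu[OF that]
    by (simp add: comm gB_add_left)
  have z: "gB M c (b x) = 0" if "x \<notin> K" for M c x using b(2)[OF that] by (simp add: gB_zero_right)
  have i1: "(LINT x:K|lborel. pd j (\<lambda>x. gB (G x) (u x) (b x)) x) = 0"
    by (rule integral_pd_eq_0[OF W C1_gB[OF G Cu C(3)] K]) (simp add: z)
  have i2: "(LINT x:K|lborel. pd i (\<lambda>x. gB (G x) (pd j a x) (b x)) x) = 0"
    by (rule integral_pd_eq_0[OF W C1_gB[OF G C(2) C(3)] K]) (simp add: z)
  note cK = continuous_on_subset[OF _ K(2)]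
  have s1: "set_integrable lborel K (pd j (\<lambda>x. gB (G x) (u x) (b x)))"
    by (rule set_integrable_compact[OF K(1) cK[OF C1_cont_pd[OF C1_gB[OF G Cu C(3)]]]])
  have s2: "set_integrable lborel K (pd i (\<lambda>x. gB (G x) (pd j a x) (b x)))"
    by (rule set_integrable_compact[OF K(1) cK[OF C1_cont_pd[OF C1_gB[OF G C(2) C(3)]]]])
  note cs = C1_cont[OF G] C1_cont[OF A] C1_cont_pd[OF A] C1_cont[OF C(1)] C1_cont_pd[OF C(1)] C1_cont[OF C(3)] C1_cont_pd[OF C(3)] C1_cont[OF Cu]
  have s3: "set_integrable lborel K (\<lambda>x. gB (G x) (u x) (pd j b x + mact (A j x) (b x)))"
    by (intro set_integrable_compact[OF K(1) cK] continuous_intros cs)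
  have s4: "set_integrable lborel K (\<lambda>x. gB (G x) (pd j a x) (pd i b x) - gB (G x) (mact (pd j (A i) x) (a x)) (b x))"
    by (intro set_integrable_compact[OF K(1) cK] continuous_intros cs)
  have "0 = (LINT x:K|lborel. pd j (\<lambda>x. gB (G x) (u x) (b x)) x - pd i (\<lambda>x. gB (G x) (pd j a x) (b x)) x)"
    using i1 i2 set_integral_diff(2)[OF s1 s2] by simp
  also have "\<dots> = (LINT x:K|lborel. gB (G x) (u x) (pd j b x + mact (A j x) (b x))
       - (gB (G x) (pd j a x) (pd i b x) - gB (G x) (mact (pd j (A i) x) (a x)) (b x)))"
    by (rule set_lebesgue_integral_cong) (use 1 K in \<open>auto simp: borel_compact\<close>)
  also have "\<dots> = (LINT x:K|lborel. gB (G x) (u x) (pd j b x + mact (A j x) (b x)))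
     - (LINT x:K|lborel. gB (G x) (pd j a x) (pd i b x) - gB (G x) (mact (pd j (A i) x) (a x)) (b x))"
    by (rule set_integral_diff(2)[OF s3 s4])
  finally show ?thesis by (simp add: u_def)
qed

text \<open>Both squares expand over pairs of indices. By anticommutation |dc|^2 is the full
  gradient minus the crossed terms \<open>?P\<close>; by the commutator formula the square of the
  codifferential integrates to the same crossed terms minus the curvature terms \<open>?R\<close>.
  The crossed terms cancel in the sum.\<close>

lemma bochner_identity:
  assumes K: "compact K" "K \<subseteq> W" and c: "C2 c" "\<And>x. x \<notin> K \<Longrightarrow> c x = 0"
  shows "(LINT x:K|lborel. gB (G x) (dext c x) (dext c x)) + (LINT x:K|lborel. gB (G x) (codiff A c x) (codiff A c x))
    = (LINT x:K|lborel. (\<Sum>j\<in>UNIV. gB (G x) (pd j c x) (pd j c x))) + (LINT x:K|lborel. curvform A G x (c x))"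
proof -
  have C: "C1 UNIV c" "\<And>j. C1 UNIV (pd j c)" using c(1) by (auto simp: C2_def)
  have pc: "pd i (\<lambda>x. ctr j (c x)) x = ctr j (pd i c x)" for i j x by (rule pd_ctr[OF C(1)]) simp
  have C2c: "C2 (\<lambda>x. ctr j (c x))" for j
  proof -
    have p1: "pd i (\<lambda>x. ctr j (c x)) = (\<lambda>x. ctr j (pd i c x))" for i by (rule ext) (rule pc)
    have p2: "pd k (\<lambda>x. ctr j (pd i c x)) = (\<lambda>x. ctr j (pd k (pd i c) x))" for i k
      by (rule ext, rule pd_ctr[OF C(2)]) simp
    show ?thesis unfolding C2_def p1 p2
      using c(1) by (auto simp: C2_def intro!: C1_ctr)
  qed
  have CW: "continuous_on W c" "\<And>j. continuous_on W (pd j c)"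
    using C1_cont[OF C(1)] C1_cont_pd[OF C(1)] continuous_on_subset by blast+
  note cs = C1_cont[OF G] C1_cont[OF A] C1_cont_pd[OF A] CW
  note cK = continuous_on_subset[OF _ K(2)]
  let ?P = "\<lambda>i j x. gB (G x) (ctr j (pd i c x)) (ctr i (pd j c x))"
  let ?D = "\<lambda>i j x. gB (G x) (ctr i (pd i c x + mact (A i x) (c x))) (ctr j (pd j c x + mact (A j x) (c x)))"
  let ?R = "\<lambda>i j x. gB (G x) (mact (pd j (A i) x) (ctr i (c x))) (ctr j (c x))"
  have sP: "set_integrable lborel K (?P i j)" for i j
    by (intro set_integrable_compact[OF K(1) cK] continuous_intros cs)
  have sD: "set_integrable lborel K (?D i j)" for i j
    by (intro set_integrable_compact[OF K(1) cK] continuous_intros cs)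
  have sR: "set_integrable lborel K (?R i j)" for i j
    by (intro set_integrable_compact[OF K(1) cK] continuous_intros cs)
  have sN: "set_integrable lborel K (\<lambda>x. \<Sum>j\<in>UNIV. gB (G x) (pd j c x) (pd j c x))"
    by (intro set_integrable_compact[OF K(1) cK] continuous_intros cs)
  have DP: "(LINT x:K|lborel. ?D i j x) = (LINT x:K|lborel. ?P i j x) - (LINT x:K|lborel. ?R i j x)" for i j
  proof -
    have "(LINT x:K|lborel. ?D i j x) = (LINT x:K|lborel. gB (G x) (ctr i (pd j c x)) (ctr j (pd i c x)) - ?R i j x)"
      using commutator_integral[OF K C2c[of i] _ C1_ctr[OF C(1), of j], of i j] c(2)
      by (simp add: pc ctr_0 ctr_add ctr_mact)
    also have "\<dots> = (LINT x:K|lborel. ?P i j x - ?R i j x)"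
    proof (rule set_lebesgue_integral_cong, simp add: borel_compact K, intro allI impI)
      fix x assume "x \<in> K"
      then have "posdef (G x)" using pG K by auto
      then show "gB (G x) (ctr i (pd j c x)) (ctr j (pd i c x)) - ?R i j x = ?P i j x - ?R i j x"
        using gB_commute by metis
    qed
    also have "\<dots> = (LINT x:K|lborel. ?P i j x) - (LINT x:K|lborel. ?R i j x)"
      by (rule set_integral_diff(2)[OF sP sR])
    finally show ?thesis .
  qed
  have isum: "(LINT x:K|lborel. (\<Sum>i\<in>UNIV. \<Sum>j\<in>UNIV. F i j x)) = (\<Sum>i\<in>UNIV. \<Sum>j\<in>UNIV. LINT x:K|lborel. F i j x)"
    if "\<And>i j. set_integrable lborel K (F i j)" for F :: "'n \<Rightarrow> 'n \<Rightarrow> (real,'n) vec \<Rightarrow> real"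
  proof -
    have i: "integrable lborel (\<lambda>x. indicator K x *\<^sub>R F i j x)" for i j
      using that unfolding set_integrable_def .
    have "(LINT x|lborel. (\<Sum>i\<in>UNIV. \<Sum>j\<in>UNIV. indicator K x *\<^sub>R F i j x))
        = (\<Sum>i\<in>UNIV. LINT x|lborel. (\<Sum>j\<in>UNIV. indicator K x *\<^sub>R F i j x))"
      by (rule Bochner_Integration.integral_sum) (intro Bochner_Integration.integrable_sum i)
    also have "\<dots> = (\<Sum>i\<in>UNIV. \<Sum>j\<in>UNIV. LINT x|lborel. indicator K x *\<^sub>R F i j x)"
      by (intro sum.cong refl Bochner_Integration.integral_sum i)
    finally show ?thesis unfolding set_lebesgue_integral_def scaleR_sum_right .
  qed
  have "gB (G x) (dext c x) (dext c x) = (\<Sum>j\<in>UNIV. gB (G x) (pd j c x) (pd j c x)) - (\<Sum>i\<in>UNIV. \<Sum>j\<in>UNIV. ?P i j x)" for x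
    unfolding dext_def gB_sum_left gB_sum_right gB_wdg_wdg sum_subtractf by simp (rule sum.swap)
  then have d: "(LINT x:K|lborel. gB (G x) (dext c x) (dext c x))
      = (LINT x:K|lborel. (\<Sum>j\<in>UNIV. gB (G x) (pd j c x) (pd j c x))) - (\<Sum>i\<in>UNIV. \<Sum>j\<in>UNIV. LINT x:K|lborel. ?P i j x)"
  proof -
    have "set_integrable lborel K (\<lambda>x. \<Sum>i\<in>UNIV. \<Sum>j\<in>UNIV. ?P i j x)"
      by (intro set_integrable_compact[OF K(1) cK] continuous_intros cs)
    then show ?thesis
      using set_integral_diff(2)[OF sN, of "\<lambda>x. \<Sum>i\<in>UNIV. \<Sum>j\<in>UNIV. ?P i j x"] isum[of ?P, OF sP]
        \<open>\<And>x. gB (G x) (dext c x) (dext c x) = _\<close> by simp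
  qed
  have "gB (G x) (codiff A c x) (codiff A c x) = (\<Sum>i\<in>UNIV. \<Sum>j\<in>UNIV. ?D i j x)" for x
    unfolding codiff_def gB_minus_left gB_minus_right gB_sum_left gB_sum_right sum_negf minus_minus by (rule sum.swap)
  then have e: "(LINT x:K|lborel. gB (G x) (codiff A c x) (codiff A c x)) = (\<Sum>i\<in>UNIV. \<Sum>j\<in>UNIV. LINT x:K|lborel. ?D i j x)"
    using isum[of ?D, OF sD] by simp
  have r: "(LINT x:K|lborel. curvform A G x (c x)) = - (\<Sum>i\<in>UNIV. \<Sum>j\<in>UNIV. LINT x:K|lborel. ?R i j x)"
    using isum[of ?R, OF sR] unfolding curvform_def by (simp add: set_lebesgue_integral_def)
  show ?thesis unfolding d e r DP by (simp add: sum_subtractf)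
qed

end

lemma conn_weight:
  assumes "metric_connection W g A" "C1 W \<phi>" "\<And>j. C1 W (pd j \<phi>)"
  shows "metric_connection W (\<lambda>x. exp (- \<phi> x) *\<^sub>R g x) (\<lambda>j x. A j x - pd j \<phi> x *\<^sub>R mat 1)"
proof -
  interpret metric_connection W g A by fact
  have Ce: "C1 W (\<lambda>x. exp (- \<phi> x))"
    by (rule C1_compose_real[OF assms(2), of "\<lambda>t. exp (- t)" "\<lambda>t. - exp (- t)"])
       (auto intro!: derivative_eq_intros continuous_intros)
  show ?thesis
  proof
    show "open W" by (rule W)
    show "C1 W (\<lambda>x. exp (- \<phi> x) *\<^sub>R g x)" by (rule C1_bilinear[OF bounded_bilinear_scaleR Ce G])
    show "posdef (exp (- \<phi> x) *\<^sub>R g x)" if "x \<in> W" for x by (rule posdef_scaleR[OF pG[OF that]]) simp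
    show "C1 W (\<lambda>x. A j x - pd j \<phi> x *\<^sub>R mat 1)" for j
      by (intro C1_diff A C1_bilinear[OF bounded_bilinear_scaleR] assms(3) C1_const)
    fix j x assume x: "x \<in> W"
    have "hpd j (\<lambda>x. exp (- \<phi> x)) (- exp (- \<phi> x) * pd j \<phi> x) x"
      by (rule hpd_compose_real[OF C1_hpd[OF assms(2) x], of "\<lambda>t. exp (- t)"]) (auto intro!: derivative_eq_intros)
    from hpd_imp_pd[OF hpd_bilinear[OF bounded_bilinear_scaleR this C1_hpd[OF G x]]]
    show "pd j (\<lambda>x. exp (- \<phi> x) *\<^sub>R g x) x = (exp (- \<phi> x) *\<^sub>R g x) ** (A j x - pd j \<phi> x *\<^sub>R mat 1)"
      by (simp add: GA[OF x] bounded_bilinear.scaleR_left[OF bounded_bilinear_mm]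
          bounded_bilinear.scaleR_right[OF bounded_bilinear_mm] bounded_bilinear.diff_right[OF bounded_bilinear_mm] algebra_simps)
  qed
qed

text \<open>The gradient term that separates the two codifferentials is absorbed by the Hessian of the weight.\<close>
lemma weighted_basic_estimate:
  fixes g :: "(real,'n::{finite,linorder}) vec \<Rightarrow> real^'r::finite^'r"
  assumes mc: "metric_connection W g A" and ph: "C1 W \<phi>" "\<And>j. C1 W (pd j \<phi>)" and ps: "C1 W \<psi>" and e: "e > 0"
    and hess: "\<And>x a. x \<in> W \<Longrightarrow> (1 + 1/e) * gB (g x) (\<Sum>j\<in>UNIV. pd j \<psi> x *\<^sub>R ctr j a) (\<Sum>j\<in>UNIV. pd j \<psi> x *\<^sub>R ctr j a)
        \<le> (\<Sum>i\<in>UNIV. \<Sum>j\<in>UNIV. pd j (pd i \<phi>) x * gB (g x) (ctr i a) (ctr j a))"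
    and K: "compact K" "K \<subseteq> W" and c: "C2 c" "\<And>x. x \<notin> K \<Longrightarrow> c x = 0"
  defines "A2 \<equiv> \<lambda>j x. A j x - (pd j \<phi> x - pd j \<psi> x) *\<^sub>R mat 1"
  shows "(LINT x:K|lborel. exp (- \<phi> x) * curvform A g x (c x))
     \<le> (1 + e) * (LINT x:K|lborel. exp (- \<phi> x) * gB (g x) (codiff A2 c x) (codiff A2 c x))
       + (LINT x:K|lborel. exp (- \<phi> x) * gB (g x) (dext c x) (dext c x))"
proof -
  interpret m: metric_connection W g A by fact
  define G where "G x = exp (- \<phi> x) *\<^sub>R g x" for x
  define AG where "AG j x = A j x - pd j \<phi> x *\<^sub>R mat 1" for j x
  interpret metric_connection W G AG
    unfolding G_def[abs_def] AG_def[abs_def] by (rule conn_weight[OF mc ph])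
  let ?s = "\<lambda>x a. \<Sum>j\<in>UNIV. pd j \<psi> x *\<^sub>R ctr j a"
  let ?H = "\<lambda>x a. \<Sum>i\<in>UNIV. \<Sum>j\<in>UNIV. pd j (pd i \<phi>) x * gB (g x) (ctr i a) (ctr j a)"
  have C: "C1 UNIV c" "\<And>j. C1 UNIV (pd j c)" using c(1) by (auto simp: C2_def)
  have CW: "continuous_on W c" "\<And>j. continuous_on W (pd j c)"
    using C1_cont[OF C(1)] C1_cont_pd[OF C(1)] continuous_on_subset by blast+
  have cA2: "continuous_on W (A2 j)" for j
    unfolding A2_def by (intro continuous_intros C1_cont[OF m.A] C1_cont_pd[OF ph(1)] C1_cont_pd[OF ps])
  note cs = C1_cont[OF G] C1_cont[OF m.G] C1_cont[OF A] C1_cont_pd[OF A] C1_cont[OF m.A] C1_cont_pd[OF m.A] CW cA2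
     C1_cont[OF ph(1)] C1_cont_pd[OF ph(1)] C1_cont_pd[OF ph(2)] C1_cont_pd[OF ps]
  note cK = continuous_on_subset[OF _ K(2)]
  have pdAG: "pd j (AG i) x = pd j (A i) x - pd j (pd i \<phi>) x *\<^sub>R mat 1" if "x \<in> W" for i j x
  proof -
    have "hpd j (\<lambda>x. pd i \<phi> x *\<^sub>R mat 1 :: real^'r^'r) (pd j (pd i \<phi>) x *\<^sub>R mat 1) x"
      by (rule hpd_linear[OF bounded_linear_scaleR_left C1_hpd[OF ph(2) that]])
    from hpd_imp_pd[OF hpd_diff[OF C1_hpd[OF m.A that] this]] show ?thesis unfolding AG_def[abs_def] .
  qed
  \<comment> \<open>The weight changes the connection matrices by scalar multiples of the identity,
    so it adds exactly its Hessian to the curvature.\<close>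
  have cf: "curvform AG G x a = exp (- \<phi> x) * (curvform A g x a + ?H x a)" if "x \<in> W" for x a
    unfolding curvform_def G_def gB_scaleR pdAG[OF that]
    by (simp add: mact_diff_left mact_scaleR_left gB_diff_left gB_scaleR_left sum_subtractf sum_distrib_left algebra_simps)
  \<comment> \<open>\<open>A2\<close> belongs to the weight \<phi> - \<psi> and \<open>AG\<close> to
    \<phi>; the difference of the two codifferentials is the contraction with d\<psi>.\<close>
  have cd: "codiff AG c x = codiff A2 c x + ?s x (c x)" for x
    unfolding codiff_def AG_def A2_def
    by (simp add: mact_add_left mact_diff_left mact_scaleR_left ctr_add ctr_diff ctr_scaleR sum.distrib sum_subtractf algebra_simps)
  have young: "gB M (a + b) (a + b) \<le> (1 + e) * gB M a a + (1 + 1/e) * gB M b b" if "posdef M" for M :: "real^'r^'r" and a b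
  proof -
    have "0 \<le> gB M (e *\<^sub>R a - b) (e *\<^sub>R a - b)" by (rule gB_nonneg[OF that])
    also have "\<dots> = e^2 * gB M a a - 2 * e * gB M a b + gB M b b"
      using gB_commute[OF that, of b a] by (simp add: gB_diff_left gB_diff_right gB_scaleR_left gB_scaleR_right power2_eq_square algebra_simps)
    finally have "2 * gB M a b \<le> e * gB M a a + (1/e) * gB M b b"
      using e by (simp add: field_simps power2_eq_square)
    then show ?thesis using gB_commute[OF that, of b a] by (simp add: gB_add_left gB_add_right algebra_simps)
  qed
  have pt: "gB (G x) (codiff AG c x) (codiff AG c x) - curvform AG G x (c x)
     \<le> (1 + e) * (exp (- \<phi> x) * gB (g x) (codiff A2 c x) (codiff A2 c x)) - exp (- \<phi> x) * curvform A g x (c x)"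
    if "x \<in> W" for x
  proof -
    have "gB (g x) (codiff AG c x) (codiff AG c x) - ?H x (c x) \<le> (1 + e) * gB (g x) (codiff A2 c x) (codiff A2 c x)"
      unfolding cd using young[OF m.pG[OF that], of "codiff A2 c x" "?s x (c x)"] hess[OF that, of "c x"] by linarith
    from mult_left_mono[OF this, of "exp (- \<phi> x)"] show ?thesis
      unfolding cf[OF that] G_def gB_scaleR by (simp add: algebra_simps)
  qed
  have s1: "set_integrable lborel K (\<lambda>x. gB (G x) (codiff AG c x) (codiff AG c x))"
    unfolding codiff_def by (intro set_integrable_compact[OF K(1) cK] continuous_intros cs)
  have s2: "set_integrable lborel K (\<lambda>x. curvform AG G x (c x))"
    unfolding curvform_def by (intro set_integrable_compact[OF K(1) cK] continuous_intros cs)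
  have s3: "set_integrable lborel K (\<lambda>x. exp (- \<phi> x) * gB (g x) (codiff A2 c x) (codiff A2 c x))"
    unfolding codiff_def by (intro set_integrable_compact[OF K(1) cK] continuous_intros cs)
  have s4: "set_integrable lborel K (\<lambda>x. exp (- \<phi> x) * curvform A g x (c x))"
    unfolding curvform_def by (intro set_integrable_compact[OF K(1) cK] continuous_intros cs)
  have s3': "set_integrable lborel K (\<lambda>x. (1 + e) * (exp (- \<phi> x) * gB (g x) (codiff A2 c x) (codiff A2 c x)))"
    using s3 by simp
  have "(LINT x:K|lborel. gB (G x) (codiff AG c x) (codiff AG c x) - curvform AG G x (c x))
     \<le> (LINT x:K|lborel. (1 + e) * (exp (- \<phi> x) * gB (g x) (codiff A2 c x) (codiff A2 c x)) - exp (- \<phi> x) * curvform A g x (c x))"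
    by (rule set_integral_mono[OF set_integral_diff(1)[OF s1 s2] set_integral_diff(1)[OF s3' s4]]) (use pt K in auto)
  then have 1: "(LINT x:K|lborel. gB (G x) (codiff AG c x) (codiff AG c x)) - (LINT x:K|lborel. curvform AG G x (c x))
     \<le> (1 + e) * (LINT x:K|lborel. exp (- \<phi> x) * gB (g x) (codiff A2 c x) (codiff A2 c x))
       - (LINT x:K|lborel. exp (- \<phi> x) * curvform A g x (c x))"
    unfolding set_integral_diff(2)[OF s1 s2] set_integral_diff(2)[OF s3' s4] by simp
  \<comment> \<open>Of the gradient term in the Bochner identity only the sign is kept.\<close>
  have "0 \<le> (LINT x:K|lborel. (\<Sum>j\<in>UNIV. gB (G x) (pd j c x) (pd j c x)))"
    unfolding set_lebesgue_integral_def
    by (intro integral_nonneg_AE AE_I2) (use K pG gB_nonneg in \<open>auto simp: indicator_def intro!: sum_nonneg\<close>)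
  with 1 bochner_identity[OF K c]
  have "(LINT x:K|lborel. exp (- \<phi> x) * curvform A g x (c x))
     \<le> (1 + e) * (LINT x:K|lborel. exp (- \<phi> x) * gB (g x) (codiff A2 c x) (codiff A2 c x))
       + (LINT x:K|lborel. gB (G x) (dext c x) (dext c x))" by linarith
  then show ?thesis by (simp add: G_def gB_scaleR)
qed

section \<open>Weights and cut-off functions\<close>

text \<open>Finitely many boxes inside \<open>D\<close> cover \<open>K\<close>, and the convex hull
  of all their vertices is a polytope inside \<open>D\<close> because \<open>D\<close> is convex.
  Its defining half-spaces, taken with strict inequality, give the open set; \<open>K\<close>
  satisfies them strictly since it lies in the interior and the normals are nonzero.\<close>

lemma polytope_between:
  fixes D :: "'a::euclidean_space set"
  assumes "compact K" "open D" "convex D" "K \<subseteq> D"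
  obtains F :: "('a \<times> real) set" where "finite F" "K \<subseteq> {x. \<forall>p\<in>F. fst p \<bullet> x < snd p}"
    "{x. \<forall>p\<in>F. fst p \<bullet> x < snd p} \<subseteq> D" "bounded {x. \<forall>p\<in>F. fst p \<bullet> x < snd p}"
proof -
  have "\<exists>a b S. x \<in> box a b \<and> finite S \<and> cbox a b = convex hull S \<and> cbox a b \<subseteq> D" if "x \<in> K" for x
  proof -
    obtain a b where "x \<in> box a b" "cbox a b \<subseteq> D" 
      using open_contains_cbox[OF assms(2), of x] \<open>x \<in> K\<close> assms(4) by (metis subsetD)
    moreover obtain S where "finite S" "cbox a b = convex hull S" using closed_interval_as_convex_hull by blast
    ultimately show ?thesis by blast
  qed
  then obtain a b S where abS: "\<And>x. x \<in> K \<Longrightarrow> x \<in> box (a x) (b x) \<and> finite (S x) \<and> cbox (a x) (b x) = convex hull (S x) \<and> cbox (a x) (b x) \<subseteq> D"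
    by metis
  obtain C where C: "C \<subseteq> K" "finite C" "K \<subseteq> (\<Union>x\<in>C. box (a x) (b x))"
    by (rule compactE_image[OF assms(1), of K "\<lambda>x. box (a x) (b x)"]) (use abS in auto)
  define V where "V = (\<Union>x\<in>C. S x)"
  define P where "P = convex hull V"
  have finV: "finite V" using C(1,2) abS by (auto simp: V_def)
  have "S x \<subseteq> D" if "x \<in> C" for x
    using abS[of x] that C(1) hull_subset[of "S x" convex] by auto
  then have "V \<subseteq> D" by (auto simp: V_def)
  then have PD: "P \<subseteq> D" unfolding P_def by (rule hull_minimal) (rule assms(3))
  have boxP: "box (a x) (b x) \<subseteq> interior P" if "x \<in> C" for x
  proof (rule interior_maximal)
    have "convex hull (S x) \<subseteq> P" unfolding P_def by (rule hull_mono) (use that in \<open>auto simp: V_def\<close>)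
    then show "box (a x) (b x) \<subseteq> P" using abS[of x] that C(1) box_subset_cbox by fastforce
  qed (rule open_box)
  have KP: "K \<subseteq> interior P" using C(3) boxP by blast
  have "polytope P" using finV by (auto simp: polytope_def P_def)
  then have "polyhedron P" "bounded P" by (simp_all add: polytope_imp_polyhedron polytope_imp_bounded)
  then obtain H where H: "finite H" "P = \<Inter>H" "\<forall>h\<in>H. \<exists>a b. a \<noteq> 0 \<and> h = {x. a \<bullet> x \<le> b}"
    unfolding polyhedron_def by blast
  then obtain \<alpha> \<beta> where ab: "\<And>h. h \<in> H \<Longrightarrow> \<alpha> h \<noteq> 0 \<and> h = {x. \<alpha> h \<bullet> x \<le> \<beta> h}" by metis
  define F where "F = (\<lambda>h. (\<alpha> h, \<beta> h)) ` H"
  let ?W = "{x. \<forall>p\<in>F. fst p \<bullet> x < snd p}"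
  have WP: "?W \<subseteq> P"
  proof
    fix x assume x: "x \<in> ?W"
    have "x \<in> h" if "h \<in> H" for h
    proof -
      have "\<alpha> h \<bullet> x < \<beta> h" using x that by (auto simp: F_def)
      then have "x \<in> {x. \<alpha> h \<bullet> x \<le> \<beta> h}" by simp
      then show ?thesis using ab[OF that] by blast
    qed
    then show "x \<in> P" using H(2) by auto
  qed
  have KW: "K \<subseteq> ?W"
  proof
    fix x assume "x \<in> K"
    then have x: "x \<in> interior P" using KP by auto
    have "\<alpha> h \<bullet> x < \<beta> h" if "h \<in> H" for h
    proof -
      have "P \<subseteq> {x. \<alpha> h \<bullet> x \<le> \<beta> h}" using H(2) ab[OF that] that by blast
      then have "x \<in> interior {x. \<alpha> h \<bullet> x \<le> \<beta> h}" using x interior_mono by blast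
      moreover have "\<alpha> h \<noteq> 0" using ab[OF that] by blast
      ultimately show ?thesis using interior_halfspace_le[of "\<alpha> h" "\<beta> h"] by simp
    qed
    then show "x \<in> ?W" by (auto simp: F_def)
  qed
  show thesis
    by (rule that[OF _ KW]) (use H(1) WP PD \<open>bounded P\<close> bounded_subset in \<open>auto simp: F_def\<close>)
qed

text \<open>A truncated power: zero up to the knot \<open>Y\<close>, and differentiable k - 1 times
  across it. Composed with an exhaustion function, it gives a weight that vanishes on a compact set
  and still has the derivatives that the estimates take.\<close>

definition pospow :: "real \<Rightarrow> nat \<Rightarrow> real \<Rightarrow> real" where
  "pospow Y k t = (max 0 (t - Y)) ^ k"

lemma pospow_DERIV:
  assumes "k \<ge> 2"
  shows "(pospow Y k has_real_derivative real k * pospow Y (k - 1) t) (at t)"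
proof -
  obtain m where m: "k = Suc (Suc m)" using le_Suc_ex[OF assms] by auto
  consider "t < Y" | "t = Y" | "t > Y" by linarith
  then show ?thesis
  proof cases
    case 1
    have "((\<lambda>s. 0::real) has_real_derivative 0) (at t)" by simp
    then have "(pospow Y k has_real_derivative 0) (at t)"
      by (rule has_field_derivative_transform_within_open[of _ _ _ "{..<Y}"]) (use 1 assms in \<open>auto simp: pospow_def\<close>)
    then show ?thesis using 1 by (simp add: pospow_def m)
  next
    case 2
    have "\<bar>if \<bar>s - Y\<bar> < 1 then pospow Y k s else 0\<bar> \<le> 1 * (s - Y)^2" for s
    proof (cases "Y < s \<and> s < Y + 1")
      case True
      then have "(s - Y)^k \<le> (s - Y)^2" by (intro power_decreasing assms) auto
      then show ?thesis using True by (simp add: pospow_def)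
    next
      case False
      then show ?thesis by (auto simp: pospow_def max_def m)
    qed
    then have "((\<lambda>s. if \<bar>s - Y\<bar> < 1 then pospow Y k s else 0) has_real_derivative 0) (at Y)"
      by (rule DERIV_quadratic_bound)
    then have "(pospow Y k has_real_derivative 0) (at Y)"
      by (rule has_field_derivative_transform_within_open[of _ _ _ "{Y-1<..<Y+1}"]) auto
    then show ?thesis using 2 by (simp add: pospow_def m)
  next
    case 3
    have "((\<lambda>s. (s - Y)^k) has_real_derivative real k * (t - Y)^(k - 1)) (at t)"
      by (auto intro!: derivative_eq_intros)
    then have "(pospow Y k has_real_derivative real k * (t - Y)^(k-1)) (at t)"
      by (rule has_field_derivative_transform_within_open[of _ _ _ "{Y<..}"]) (use 3 in \<open>auto simp: pospow_def\<close>)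
    then show ?thesis using 3 by (simp add: pospow_def)
  qed
qed

lemma pospow_cont [continuous_intros]: "continuous_on S (pospow Y k)"
  unfolding pospow_def by (intro continuous_intros)

lemma pospow_nonneg [simp]: "pospow Y k t \<ge> 0"
  by (simp add: pospow_def)

lemma C1_pospow:
  assumes "k \<ge> 2" "C1 W y"
  shows "C1 W (\<lambda>x. pospow Y k (y x))"
    and "x \<in> W \<Longrightarrow> hpd j (\<lambda>x. pospow Y k (y x)) (real k * pospow Y (k - 1) (y x) * pd j y x) x"
  by (rule C1_compose_real[OF assms(2) pospow_DERIV[OF assms(1)]], intro continuous_intros)
     (rule hpd_compose_real[OF C1_hpd[OF assms(2)] pospow_DERIV[OF assms(1)]])

lemma cutoff_from_exhaustion:
  fixes y :: "real^'n::finite \<Rightarrow> real"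
  assumes W: "open W" and y: "C1 W y" and nu: "\<nu> > 0" and K: "compact {x\<in>W. y x \<le> \<nu>}" and yp: "\<And>x. x \<in> W \<Longrightarrow> y x \<ge> 0"
  obtains \<eta> where "C1 UNIV \<eta>" "\<And>x. x \<notin> {x\<in>W. y x \<le> \<nu>} \<Longrightarrow> \<eta> x = 0" "\<And>x. 0 \<le> \<eta> x \<and> \<eta> x \<le> 1"
    "\<And>x. x \<in> W \<Longrightarrow> \<eta> x = (max 0 (1 - y x / \<nu>))^2"
    "\<And>x j. x \<in> W \<Longrightarrow> \<bar>pd j \<eta> x\<bar> \<le> 2 * \<bar>pd j y x\<bar> / \<nu>"
proof -
  let ?K = "{x\<in>W. y x \<le> \<nu>}"
  \<comment> \<open>\<open>pospow\<close> truncates on the left while the cut-off has to vanish for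
    large y, so it is applied to -y with knot -\<nu>. The result is max 0 (1 - y/\<nu>) squared,
    which is C1 because of the square.\<close>
  define E where "E x = (1/\<nu>^2) * pospow (-\<nu>) 2 ((-1) * y x)" for x
  have CE: "C1 W E" unfolding E_def
    by (intro C1_linear[OF bounded_linear_mult_right] C1_pospow(1) y) simp
  have pE: "pd j E x = (1/\<nu>^2) * (2 * pospow (-\<nu>) 1 (- y x) * ((-1) * pd j y x))" if "x \<in> W" for j x
  proof -
    have 1: "pd j (\<lambda>x. (-1) * y x) x = (-1) * pd j y x"
      by (rule hpd_imp_pd, rule hpd_linear[OF bounded_linear_mult_right C1_hpd[OF y that]])
    have "pd j E x = (1/\<nu>^2) * (real 2 * pospow (-\<nu>) (2 - 1) ((-1) * y x) * pd j (\<lambda>x. (-1) * y x) x)"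
      unfolding E_def[abs_def]
      by (rule hpd_imp_pd, rule hpd_linear[OF bounded_linear_mult_right],
          rule C1_pospow(2)[OF _ C1_linear[OF bounded_linear_mult_right y] that]) simp
    then show ?thesis unfolding 1 by simp
  qed
  have Ef: "E x = (max 0 (1 - y x / \<nu>))^2" for x
  proof -
    have "max 0 (1 - y x / \<nu>) = max 0 (- y x + \<nu>) / \<nu>" using nu by (auto simp: max_def field_simps)
    then show ?thesis by (simp add: E_def pospow_def power_divide)
  qed
  have E0: "E x = 0" if "x \<in> W - ?K" for x using that nu by (simp add: Ef max_def field_simps)
  define \<eta> where "\<eta> x = (if x \<in> ?K then E x else 0)" for x
  note ext = C1_extend[OF W CE compact_imp_closed[OF K] _ E0, folded \<eta>_def[abs_def]]
  have eW: "\<eta> x = E x" if "x \<in> W" for x using E0[of x] that by (auto simp: \<eta>_def)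
  have E1: "0 \<le> E x \<and> E x \<le> 1" if "x \<in> W" for x
    using yp[OF that] nu by (auto simp: Ef intro!: power_le_one)
  have b: "\<bar>pd j \<eta> x\<bar> \<le> 2 * \<bar>pd j y x\<bar> / \<nu>" if x: "x \<in> W" for x j
  proof -
    have "pospow (-\<nu>) 1 (- y x) \<le> \<nu>" using yp[OF x] nu by (auto simp: pospow_def max_def)
    then have "(1/\<nu>^2) * (2 * pospow (-\<nu>) 1 (- y x) * \<bar>pd j y x\<bar>) \<le> (1/\<nu>^2) * (2 * \<nu> * \<bar>pd j y x\<bar>)"
      by (intro mult_left_mono mult_right_mono) auto
    also have "\<dots> = 2 * \<bar>pd j y x\<bar> / \<nu>" using nu by (simp add: power2_eq_square)
    finally have "\<bar>pd j E x\<bar> \<le> 2 * \<bar>pd j y x\<bar> / \<nu>" by (simp add: pE[OF x] abs_mult)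
    moreover have "pd j \<eta> x = pd j E x" by (rule pd_cong[OF W x eW CE])
    ultimately show ?thesis by simp
  qed
  show thesis
    by (rule that[of \<eta>]) (use ext(1) b eW Ef E1 in \<open>auto simp: \<eta>_def\<close>)
qed

text \<open>The argument \<open>fibre\<close> fixes the type of the fibre indices, since
  \<open>hess\<close> ranges over all forms and all metrics on the fibre. Roles of the conditions:
  \<open>zero\<close> keeps the original metric on \<open>K\<close>; \<open>eta_grad\<close>
  dominates derivatives of the cut-offs across the step from weight \<phi> - \<psi> to \<phi>;
  \<open>phi_psi\<close> says that exp (-2 (\<phi> - \<psi>)) \<le> exp (-\<phi>);
  \<open>hess\<close> pays for the contraction with d\<psi> in
  \<open>weighted_basic_estimate\<close>.\<close>

locale weight_data =
  fixes fibre :: "'r::finite itself" and W :: "((real,'n::{finite,linorder}) vec) set" and K :: "((real,'n) vec) set" and e :: real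
    and \<phi> \<psi> :: "(real,'n) vec \<Rightarrow> real" and \<eta> :: "nat \<Rightarrow> (real,'n) vec \<Rightarrow> real" and C :: real
    and L :: "nat \<Rightarrow> ((real,'n) vec) set"
  assumes oW: "open W" and e: "e > 0" and K: "compact K" "K \<subseteq> W"
    and ph: "C1 W \<phi>" "\<And>j. C1 W (pd j \<phi>)" and ps: "C1 W \<psi>" "\<And>j. C1 W (pd j \<psi>)"
    and zero: "\<And>x. x \<in> K \<Longrightarrow> \<phi> x = 0" "\<And>x. x \<in> K \<Longrightarrow> \<psi> x = 0"
    and psi_nonneg: "\<And>x. x \<in> W \<Longrightarrow> \<psi> x \<ge> 0" and phi_psi: "\<And>x. x \<in> W \<Longrightarrow> 2 * \<psi> x \<le> \<phi> x"
    and hess: "\<And>x (a::real^'r^'n set) M. x \<in> W \<Longrightarrow> posdef M \<Longrightarrow>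
        (1 + 1/e) * gB M (\<Sum>j\<in>UNIV. pd j \<psi> x *\<^sub>R ctr j a) (\<Sum>j\<in>UNIV. pd j \<psi> x *\<^sub>R ctr j a)
        \<le> (\<Sum>i\<in>UNIV. \<Sum>j\<in>UNIV. pd j (pd i \<phi>) x * gB M (ctr i a) (ctr j a))"
    and eta: "\<And>n. C1 UNIV (\<eta> n)" "\<And>n. compact (L n)" "\<And>n. L n \<subseteq> W" "\<And>n x. x \<notin> L n \<Longrightarrow> \<eta> n x = 0"
      "\<And>n x. 0 \<le> \<eta> n x \<and> \<eta> n x \<le> 1"
    and eta_grad: "\<And>n j x. x \<in> W \<Longrightarrow> (pd j (\<eta> n) x)^2 \<le> C * exp (\<psi> x)"
    and eta_lim: "\<And>x. x \<in> W \<Longrightarrow> (\<lambda>n. \<eta> n x) \<longlonglongrightarrow> 1" "\<And>j x. x \<in> W \<Longrightarrow> (\<lambda>n. pd j (\<eta> n) x) \<longlonglongrightarrow> 0"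

lemma sum_rotate3: "(\<Sum>i\<in>A. \<Sum>j\<in>B. \<Sum>p\<in>C. f i j p) = (\<Sum>p\<in>C. \<Sum>i\<in>A. \<Sum>j\<in>B. f i j p)"
proof -
  have "(\<Sum>i\<in>A. \<Sum>j\<in>B. \<Sum>p\<in>C. f i j p) = (\<Sum>i\<in>A. \<Sum>p\<in>C. \<Sum>j\<in>B. f i j p)"
    by (intro sum.cong refl sum.swap)
  also have "\<dots> = (\<Sum>p\<in>C. \<Sum>i\<in>A. \<Sum>j\<in>B. f i j p)" by (rule sum.swap)
  finally show ?thesis .
qed

lemma inverse_square_DERIV: "t \<noteq> 0 \<Longrightarrow> ((\<lambda>t. c / t^2) has_real_derivative (- 2 * c / t^3)) (at t)"
  by (auto intro!: derivative_eq_intros simp: field_simps power2_eq_square power3_eq_cube)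

lemma weights_exist:
  fixes D K :: "((real,'n::{finite,linorder}) vec) set"
  assumes K: "compact K" and D: "open D" "convex D" "K \<subseteq> D" and e: "e > 0"
  obtains W \<phi> \<psi> \<eta> C L where "W \<subseteq> D" "weight_data (TYPE('r::finite)) W K e \<phi> \<psi> \<eta> C L"
proof -
  obtain F where F: "finite F" "K \<subseteq> {x. \<forall>p\<in>F. fst p \<bullet> x < snd p}" "{x. \<forall>p\<in>F. fst p \<bullet> x < snd p} \<subseteq> D"
    "bounded {x. \<forall>p\<in>F. fst p \<bullet> x < snd p}"
    using polytope_between[OF K D] by blast
  define W where "W = {x. \<forall>p\<in>F. fst p \<bullet> x < snd p}"
  have oW: "open W"
  proof -
    have "W = (\<Inter>p\<in>F. {x. fst p \<bullet> x < snd p})" by (auto simp: W_def)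
    then show ?thesis using F(1) by (auto intro!: open_INT open_halfspace_lt)
  qed
  \<comment> \<open>Each summand is, up to a factor, the reciprocal distance to a face: convex,
    infinite at that face, and with gradient bounded by a multiple of its own square. So y is a
    convex exhaustion of the polytope whose gradient is controlled by y^2.\<close>
  define y where "y x = 1 + (\<Sum>p\<in>F. 1 / (snd p - fst p \<bullet> x))" for x
  define y1 where "y1 j x = (\<Sum>p\<in>F. fst p $ j / (snd p - fst p \<bullet> x)^2)" for j x
  define y2 where "y2 i j x = (\<Sum>p\<in>F. (2 / (snd p - fst p \<bullet> x)^3) * (fst p $ i * fst p $ j))" for i j x
  have lpos: "snd p - fst p \<bullet> x > 0" if "x \<in> W" "p \<in> F" for x p using that by (auto simp: W_def)
  have hl: "hpd j (\<lambda>x. snd p - fst p \<bullet> x) (- (fst p $ j)) x" for j p x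
  proof -
    have "hpd j (\<lambda>x. snd p - fst p \<bullet> x) (0 - fst p $ j) x" by (rule hpd_diff[OF hpd_const hpd_inner_id])
    then show ?thesis by simp
  qed
  have hy: "hpd j y (y1 j x) x" if x: "x \<in> W" for j x
  proof -
    have "hpd j (\<lambda>x. 1 / (snd p - fst p \<bullet> x)) (fst p $ j / (snd p - fst p \<bullet> x)^2) x" if p: "p \<in> F" for p
    proof -
      let ?t = "snd p - fst p \<bullet> x"
      have "((\<lambda>t. 1 / t) has_real_derivative (- 1 / ?t^2)) (at ?t)"
        using lpos[OF x p] by (auto intro!: derivative_eq_intros simp: power2_eq_square)
      from hpd_compose_real[OF hl this] show ?thesis by simp
    qed
    then show ?thesis unfolding y_def[abs_def] y1_def
      using hpd_add[OF hpd_const[of j 1 x] hpd_sum[of F j "\<lambda>p x. 1 / (snd p - fst p \<bullet> x)" "\<lambda>p. fst p $ j / (snd p - fst p \<bullet> x)^2" x]]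
      by simp
  qed
  have hy1: "hpd i (y1 j) (y2 i j x) x" if x: "x \<in> W" for i j x
    unfolding y1_def[abs_def] y2_def
  proof (rule hpd_sum)
    fix p assume p: "p \<in> F"
    let ?t = "snd p - fst p \<bullet> x"
    have "((\<lambda>t. fst p $ j / t^2) has_real_derivative (- 2 * fst p $ j / ?t^3)) (at ?t)"
      by (rule inverse_square_DERIV) (use lpos[OF x p] in simp)
    from hpd_compose_real[OF hl this]
    show "hpd i (\<lambda>x. fst p $ j / (snd p - fst p \<bullet> x)^2) (2 / ?t^3 * (fst p $ i * fst p $ j)) x"
      by (simp add: mult_ac)
  qed
  have cy: "continuous_on W y" "continuous_on W (y1 j)" "continuous_on W (y2 i j)" for i j
    unfolding y_def[abs_def] y1_def[abs_def] y2_def[abs_def]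
    by (intro continuous_intros; use lpos in fastforce)+
  have Cy: "C1 W y" by (rule C1I[OF cy(1) cy(2) hy])
  have Cy1: "C1 W (y1 j)" for j by (rule C1I[OF cy(2) cy(3) hy1])
  have pdy: "pd j y x = y1 j x" if "x \<in> W" for j x by (rule hpd_imp_pd[OF hy[OF that]])
  have yl: "1 / (snd p - fst p \<bullet> x) \<le> y x" if "x \<in> W" "p \<in> F" for x p
  proof -
    have "1 / (snd p - fst p \<bullet> x) \<le> (\<Sum>p\<in>F. 1 / (snd p - fst p \<bullet> x))"
      by (rule member_le_sum) (use that F(1) lpos[OF that(1)] less_imp_le in auto)
    then show ?thesis by (simp add: y_def)
  qed
  have y1pos: "y x \<ge> 1" if "x \<in> W" for x
  proof -
    have "0 \<le> (\<Sum>p\<in>F. 1 / (snd p - fst p \<bullet> x))"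
      by (rule sum_nonneg) (use less_imp_le[OF lpos[OF that]] in simp)
    then show ?thesis by (simp add: y_def)
  qed
  define S where "S = (\<Sum>p\<in>F. norm (fst p))"
  have S0: "S \<ge> 0" by (simp add: S_def sum_nonneg)
  have grad: "\<bar>y1 j x\<bar> \<le> S * (y x)^2" if x: "x \<in> W" for j x
  proof -
    have "\<bar>y1 j x\<bar> \<le> (\<Sum>p\<in>F. \<bar>fst p $ j / (snd p - fst p \<bullet> x)^2\<bar>)" unfolding y1_def by (rule sum_abs)
    also have "\<dots> \<le> (\<Sum>p\<in>F. norm (fst p) * (y x)^2)"
    proof (rule sum_mono)
      fix p assume p: "p \<in> F"
      have "(1 / (snd p - fst p \<bullet> x))^2 \<le> (y x)^2" using yl[OF x p] lpos[OF x p] by (intro power_mono) auto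
      then have "\<bar>fst p $ j\<bar> * (1 / (snd p - fst p \<bullet> x))^2 \<le> norm (fst p) * (y x)^2"
        by (intro mult_mono component_le_norm_cart) auto
      then show "\<bar>fst p $ j / (snd p - fst p \<bullet> x)^2\<bar> \<le> norm (fst p) * (y x)^2"
        by (simp add: power_divide)
    qed
    finally show ?thesis by (simp add: S_def sum_distrib_right)
  qed
  \<comment> \<open>The level up to which both weights will vanish. \<open>Y \<ge> 1\<close> is used
    for the constant \<open>C\<close> below.\<close>
  obtain Y where Y: "Y \<ge> 1" "\<And>x. x \<in> K \<Longrightarrow> y x \<le> Y"
  proof -
    have "compact (y ` K)" using K cy(1) F(2) by (auto simp: W_def intro!: compact_continuous_image intro: continuous_on_subset)
    then have "bdd_above (y ` K)" by (intro bounded_imp_bdd_above compact_imp_bounded)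
    then obtain B where "\<And>x. x \<in> K \<Longrightarrow> y x \<le> B" by (auto simp: bdd_above_def)
    then show thesis by (intro that[of "max 1 B"]) fastforce+
  qed
  \<comment> \<open>At least 2 for 2\<psi> \<le> \<phi>, and at least 1 + 1/e for the Hessian
    condition.\<close>
  define N where "N = 2 + 1/e"
  have N: "N \<ge> 2" "1 + 1/e \<le> N" using e by (simp_all add: N_def)
  \<comment> \<open>Put z = max 0 (y - Y). The power z^4 in \<psi> makes exp \<psi> dominate y^4,
    which is the growth of the squared gradients of the cut-offs. The square of its derivative is 16
    z^6, below the second derivative 56 z^6 of z^8; this is why \<phi> contains z^8. For z < 1 the
    inequality 2\<psi> \<le> \<phi> comes from z^3. All exponents are at least 3, so two derivatives
    exist across the knot.\<close>
  define \<psi> where "\<psi> x = pospow Y 4 (y x)" for x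
  define \<phi> where "\<phi> x = N * (pospow Y 3 (y x) + pospow Y 8 (y x))" for x
  have Cps: "C1 W \<psi>" unfolding \<psi>_def[abs_def] by (rule C1_pospow(1)[OF _ Cy]) simp
  have Cph: "C1 W \<phi>" unfolding \<phi>_def[abs_def]
    by (intro C1_linear[OF bounded_linear_mult_right] C1_add C1_pospow(1)[OF _ Cy]) auto
  have pps: "pd j \<psi> x = 4 * pospow Y 3 (y x) * y1 j x" if "x \<in> W" for j x
    using hpd_imp_pd[OF C1_pospow(2)[OF _ Cy that, of 4 j Y]] by (simp add: \<psi>_def[abs_def] pdy[OF that])
  have pph: "pd j \<phi> x = N * (3 * pospow Y 2 (y x) * y1 j x + 8 * pospow Y 7 (y x) * y1 j x)" if "x \<in> W" for j x
  proof -
    have "hpd j \<phi> (N * (real 3 * pospow Y (3-1) (y x) * pd j y x + real 8 * pospow Y (8-1) (y x) * pd j y x)) x"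
      unfolding \<phi>_def[abs_def]
      by (intro hpd_linear[OF bounded_linear_mult_right] hpd_add C1_pospow(2)[OF _ Cy that]) auto
    from hpd_imp_pd[OF this] show ?thesis by (simp add: pdy[OF that])
  qed
  have cpp: "C1 W (\<lambda>x. c * pospow Y k (y x) * y1 j x)" if "k \<ge> 2" for c k j
    by (intro C1_bilinear[OF bounded_bilinear_mult] C1_const C1_pospow(1)[OF that Cy] Cy1)
  have Cpps: "C1 W (pd j \<psi>)" for j by (rule C1_cong[OF oW _ cpp[of 3 4 j]]) (simp_all add: pps)
  define q where "q j x = N * (3 * pospow Y 2 (y x) * y1 j x + 8 * pospow Y 7 (y x) * y1 j x)" for j x
  have hpp: "hpd i (\<lambda>x. c * pospow Y k (y x) * y1 j x)
      (c * pospow Y k (y x) * y2 i j x + c * (real k * pospow Y (k-1) (y x) * y1 i x) * y1 j x) x" if "k \<ge> 2" "x \<in> W" for c k i j x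
    using hpd_bilinear[OF bounded_bilinear_mult
        hpd_linear[OF bounded_linear_mult_right[of c] C1_pospow(2)[OF that(1) Cy that(2), of i Y]] hy1[OF that(2), of i j]]
    by (simp add: pdy[OF that(2)])
  have Cq: "C1 W (q j)" for j unfolding q_def[abs_def]
    by (intro C1_linear[OF bounded_linear_mult_right] C1_add cpp) auto
  have Cpph: "C1 W (pd j \<phi>)" for j by (rule C1_cong[OF oW _ Cq[of j]]) (simp add: pph q_def)
  have ppph: "pd i (pd j \<phi>) x = N * (3 * pospow Y 2 (y x) + 8 * pospow Y 7 (y x)) * y2 i j x
      + N * (6 * pospow Y 1 (y x) + 56 * pospow Y 6 (y x)) * (y1 i x * y1 j x)" if x: "x \<in> W" for i j x
  proof -
    have "pd i (pd j \<phi>) x = pd i (q j) x" by (rule pd_cong[OF oW x _ Cq]) (simp add: pph q_def)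
    also have "\<dots> = N * ((3 * pospow Y 2 (y x) * y2 i j x + 3 * (real 2 * pospow Y (2-1) (y x) * y1 i x) * y1 j x)
        + (8 * pospow Y 7 (y x) * y2 i j x + 8 * (real 7 * pospow Y (7-1) (y x) * y1 i x) * y1 j x))"
      unfolding q_def[abs_def]
      by (rule hpd_imp_pd, intro hpd_linear[OF bounded_linear_mult_right] hpd_add hpp x) auto
    finally show ?thesis by (simp add: algebra_simps)
  qed
  have hess: "(1 + 1/e) * gB M (\<Sum>j\<in>UNIV. pd j \<psi> x *\<^sub>R ctr j a) (\<Sum>j\<in>UNIV. pd j \<psi> x *\<^sub>R ctr j a)
        \<le> (\<Sum>i\<in>UNIV. \<Sum>j\<in>UNIV. pd j (pd i \<phi>) x * gB M (ctr i a) (ctr j a))"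
    if x: "x \<in> W" and M: "posdef M" for x and a :: "real^'r^'n set" and M
  proof -
    let ?s = "\<Sum>j\<in>UNIV. y1 j x *\<^sub>R ctr j a"
    let ?z = "\<lambda>k. pospow Y k (y x)"
    \<comment> \<open>A matrix of rank one with entries c_i c_j contributes the squared norm of the
      contraction with c. Thus the Hessian of y, a positive combination of such matrices over the
      faces, gives a nonnegative term.\<close>
    have sq: "(\<Sum>i\<in>UNIV. \<Sum>j\<in>UNIV. (c j * c i) * gB M (ctr i a) (ctr j a))
        = gB M (\<Sum>j\<in>UNIV. c j *\<^sub>R ctr j a) (\<Sum>j\<in>UNIV. c j *\<^sub>R ctr j a)" for c :: "'n \<Rightarrow> real"
      unfolding gB_sum_left gB_sum_right gB_scaleR_left gB_scaleR_right
      by (subst sum.swap) (simp add: sum_distrib_left mult_ac gB_commute[OF M])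
    have Y2: "(\<Sum>i\<in>UNIV. \<Sum>j\<in>UNIV. y2 j i x * gB M (ctr i a) (ctr j a)) \<ge> 0"
    proof -
      have "(\<Sum>i\<in>UNIV. \<Sum>j\<in>UNIV. y2 j i x * gB M (ctr i a) (ctr j a))
        = (\<Sum>i\<in>UNIV. \<Sum>j\<in>UNIV. \<Sum>p\<in>F. (2 / (snd p - fst p \<bullet> x)^3) * ((fst p $ j * fst p $ i) * gB M (ctr i a) (ctr j a)))"
        by (simp add: y2_def sum_distrib_right mult.assoc)
      also have "\<dots> = (\<Sum>p\<in>F. (2 / (snd p - fst p \<bullet> x)^3) * (\<Sum>i\<in>UNIV. \<Sum>j\<in>UNIV. (fst p $ j * fst p $ i) * gB M (ctr i a) (ctr j a)))"
        unfolding sum_distrib_left by (rule sum_rotate3)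
      also have "\<dots> \<ge> 0"
        unfolding sq using lpos[OF x] by (intro sum_nonneg mult_nonneg_nonneg gB_nonneg[OF M]) (auto intro: less_imp_le)
      finally show ?thesis .
    qed
    have "(\<Sum>i\<in>UNIV. \<Sum>j\<in>UNIV. pd j (pd i \<phi>) x * gB M (ctr i a) (ctr j a))
      = N * (3 * ?z 2 + 8 * ?z 7) * (\<Sum>i\<in>UNIV. \<Sum>j\<in>UNIV. y2 j i x * gB M (ctr i a) (ctr j a))
        + N * (6 * ?z 1 + 56 * ?z 6) * (\<Sum>i\<in>UNIV. \<Sum>j\<in>UNIV. (y1 j x * y1 i x) * gB M (ctr i a) (ctr j a))"
      unfolding ppph[OF x] by (simp add: distrib_right sum.distrib sum_distrib_left mult.assoc)
    also have "\<dots> \<ge> 0 + N * (6 * ?z 1 + 56 * ?z 6) * gB M ?s ?s"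
      unfolding sq by (intro add_mono mult_nonneg_nonneg Y2) (use N in auto)
    finally have 1: "(\<Sum>i\<in>UNIV. \<Sum>j\<in>UNIV. pd j (pd i \<phi>) x * gB M (ctr i a) (ctr j a)) \<ge> N * (6 * ?z 1 + 56 * ?z 6) * gB M ?s ?s"
      by simp
    have "(\<Sum>j\<in>UNIV. pd j \<psi> x *\<^sub>R ctr j a) = (4 * ?z 3) *\<^sub>R ?s"
      unfolding pps[OF x] by (simp add: scaleR_sum_right)
    then have "(1 + 1/e) * gB M (\<Sum>j\<in>UNIV. pd j \<psi> x *\<^sub>R ctr j a) (\<Sum>j\<in>UNIV. pd j \<psi> x *\<^sub>R ctr j a)
       = (1 + 1/e) * (16 * ?z 6) * gB M ?s ?s"
      by (simp add: gB_scaleR_left gB_scaleR_right pospow_def power_mult_distrib flip: power_add)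
    also have "\<dots> \<le> N * (6 * ?z 1 + 56 * ?z 6) * gB M ?s ?s"
      by (intro mult_right_mono mult_mono gB_nonneg[OF M]) (use N in auto)
    finally show ?thesis using 1 by simp
  qed
  have z0: "pospow Y k (y x) = 0" if "x \<in> K" "k > 0" for x k using Y(2)[OF that(1)] that(2) by (simp add: pospow_def max_def)
  have php: "2 * \<psi> x \<le> \<phi> x" for x
  proof -
    let ?z = "max 0 (y x - Y)"
    have "?z^4 \<le> ?z^3 + ?z^8"
    proof (cases "?z \<le> 1")
      case True
      then have "?z^4 \<le> ?z^3" by (intro power_decreasing) auto
      then show ?thesis by (simp add: add_increasing2)
    next
      case False
      then have "?z^4 \<le> ?z^8" by (intro power_increasing) auto
      then show ?thesis by (simp add: add_increasing)
    qed
    then have "2 * ?z^4 \<le> N * (?z^3 + ?z^8)" using N by (intro mult_mono) auto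
    then show ?thesis by (simp add: \<psi>_def \<phi>_def pospow_def)
  qed
  define L where "L n = {x\<in>W. y x \<le> real (Suc n)}" for n
  \<comment> \<open>On this level set every slack is at least 1/(n+1), so it stays away from all
    faces and is closed in the whole space; it is bounded because the polytope is.\<close>
  have cL: "compact (L n)" for n
  proof -
    let ?C = "{x. \<forall>p\<in>F. 1 / real (Suc n) \<le> snd p - fst p \<bullet> x}"
    have "?C = (\<Inter>p\<in>F. {x. fst p \<bullet> x \<le> snd p - 1 / real (Suc n)})" by (auto simp: algebra_simps)
    then have clC: "closed ?C" by (auto intro!: closed_INT closed_halfspace_le)
    have pos1: "0 < 1 / real (Suc n)" by simp
    have CW: "?C \<subseteq> W"
    proof
      fix x assume x: "x \<in> ?C"
      have "0 < snd p - fst p \<bullet> x" if "p \<in> F" for p using x that less_le_trans[OF pos1] by blast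
      then show "x \<in> W" unfolding W_def by fastforce
    qed
    have "L n = {x \<in> ?C. y x \<in> {..real (Suc n)}}"
    proof -
      have "1 / real (Suc n) \<le> snd p - fst p \<bullet> x" if "x \<in> W" "y x \<le> real (Suc n)" "p \<in> F" for x p
      proof -
        have "1 / (snd p - fst p \<bullet> x) \<le> real (Suc n)" using yl[OF that(1,3)] that(2) by simp
        then show ?thesis using lpos[OF that(1,3)] by (simp add: field_simps)
      qed
      then show ?thesis using CW unfolding L_def by blast
    qed
    moreover have "closed (?C \<inter> y -` {..real (Suc n)})"
      by (rule continuous_closed_preimage[OF continuous_on_subset[OF cy(1) CW] clC]) simp
    moreover have "?C \<inter> y -` {..real (Suc n)} = {x \<in> ?C. y x \<in> {..real (Suc n)}}" by auto
    ultimately have "closed (L n)" by simp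
    moreover have "bounded (L n)" using F(4) bounded_subset[of W "L n"] by (auto simp: L_def W_def)
    ultimately show ?thesis by (simp add: compact_eq_bounded_closed)
  qed
  have "\<exists>\<eta>. C1 UNIV \<eta> \<and> (\<forall>x. x \<notin> L n \<longrightarrow> \<eta> x = 0) \<and> (\<forall>x. 0 \<le> \<eta> x \<and> \<eta> x \<le> 1) \<and>
    (\<forall>x\<in>W. \<eta> x = (max 0 (1 - y x / real (Suc n)))^2) \<and> (\<forall>x\<in>W. \<forall>j. \<bar>pd j \<eta> x\<bar> \<le> 2 * \<bar>pd j y x\<bar> / real (Suc n))" for n
  proof -
    have yp: "y x \<ge> 0" if "x \<in> W" for x using y1pos[OF that] by simp
    obtain \<eta> where "C1 UNIV \<eta>" "\<And>x. x \<notin> {x\<in>W. y x \<le> real (Suc n)} \<Longrightarrow> \<eta> x = 0" "\<And>x. 0 \<le> \<eta> x \<and> \<eta> x \<le> 1"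
      "\<And>x. x \<in> W \<Longrightarrow> \<eta> x = (max 0 (1 - y x / real (Suc n)))^2"
      "\<And>x j. x \<in> W \<Longrightarrow> \<bar>pd j \<eta> x\<bar> \<le> 2 * \<bar>pd j y x\<bar> / real (Suc n)"
      by (rule cutoff_from_exhaustion[OF oW Cy _ cL[of n, unfolded L_def] yp]) auto
    then show ?thesis unfolding L_def by blast
  qed
  then obtain \<eta> where \<eta>: "\<And>n. C1 UNIV (\<eta> n)" "\<And>n x. x \<notin> L n \<Longrightarrow> \<eta> n x = 0" "\<And>n x. 0 \<le> \<eta> n x \<and> \<eta> n x \<le> 1"
    "\<And>n x. x \<in> W \<Longrightarrow> \<eta> n x = (max 0 (1 - y x / real (Suc n)))^2"
    "\<And>n x j. x \<in> W \<Longrightarrow> \<bar>pd j (\<eta> n) x\<bar> \<le> 2 * \<bar>pd j y x\<bar> / real (Suc n)"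
    by metis
  \<comment> \<open>4 S^2 y^4 is the square of the gradient bound 2 S y^2, with the factor 1/(n+1)
    discarded. Then y^4 \<le> (z + Y)^4 \<le> 8 (z^4 + Y^4) \<le> 8 Y^4 (1 + z^4) since Y \<ge> 1,
    and 1 + z^4 \<le> exp \<psi>.\<close>
  define C where "C = 4 * S^2 * (8 * Y^4)"
  have y4: "(y x)^4 \<le> (8 * Y^4) * exp (\<psi> x)" if xW: "x \<in> W" for x
  proof -
    have True: "y x \<ge> 0" using y1pos[OF xW] by simp
    let ?z = "max 0 (y x - Y)"
    have "(y x)^4 \<le> (?z + Y)^4" by (intro power_mono True) auto
    also have "\<dots> \<le> 8 * (?z^4 + Y^4)"
    proof -
      have s2: "(a + b)^2 \<le> 2 * (a^2 + b^2)" for a b :: real using sum_squares_bound[of a b] by (simp add: power2_sum)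
      have "((?z + Y)^2)^2 \<le> (2 * (?z^2 + Y^2))^2" by (intro power_mono s2) simp
      also have "\<dots> = 4 * (?z^2 + Y^2)^2" by (simp only: power_mult_distrib) simp
      also have "\<dots> \<le> 4 * (2 * ((?z^2)^2 + (Y^2)^2))" by (intro mult_left_mono s2) simp
      finally show ?thesis by (simp flip: power_mult)
    qed
    also have "\<dots> \<le> 8 * (Y^4 * (1 + ?z^4))"
    proof -
      have "?z^4 * 1 \<le> ?z^4 * Y^4" by (intro mult_left_mono one_le_power Y) simp
      then show ?thesis by (simp add: algebra_simps)
    qed
    also have "\<dots> \<le> 8 * (Y^4 * exp (?z^4))" by (intro mult_left_mono exp_ge_add_one_self) (use Y in auto)
    finally show ?thesis by (simp add: \<psi>_def pospow_def)
  qed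
  have eg: "(pd j (\<eta> n) x)^2 \<le> C * exp (\<psi> x)" if x: "x \<in> W" for n j x
  proof -
    have "\<bar>pd j (\<eta> n) x\<bar> \<le> 2 * \<bar>pd j y x\<bar> / real (Suc n)" by (rule \<eta>(5)[OF x])
    also have "\<dots> \<le> 2 * \<bar>y1 j x\<bar>" unfolding pdy[OF x] by (simp add: pos_divide_le_eq mult_le_cancel_left1)
    also have "\<dots> \<le> 2 * (S * (y x)^2)" using grad[OF x, of j] by simp
    finally have "\<bar>pd j (\<eta> n) x\<bar>^2 \<le> (2 * (S * (y x)^2))^2" by (intro power_mono) auto
    then have "(pd j (\<eta> n) x)^2 \<le> 4 * S^2 * (y x)^4" by (simp add: power_mult_distrib flip: power_mult)
    also have "\<dots> \<le> 4 * S^2 * ((8 * Y^4) * exp (\<psi> x))" by (intro mult_left_mono y4 x) simp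
    finally show ?thesis by (simp add: C_def mult.assoc)
  qed
  have inv0: "(\<lambda>n. c / real (Suc n)) \<longlonglongrightarrow> 0" for c :: real
    using tendsto_mult[OF tendsto_const[of c] LIMSEQ_inverse_real_of_nat] by (simp add: divide_inverse)
  have l1: "(\<lambda>n. \<eta> n x) \<longlonglongrightarrow> 1" if x: "x \<in> W" for x
  proof -
    have "(\<lambda>n. (max 0 (1 - y x / real (Suc n)))^2) \<longlonglongrightarrow> (max 0 (1 - 0))^2"
      by (intro tendsto_power tendsto_max tendsto_diff tendsto_const inv0)
    then show ?thesis by (simp add: \<eta>(4)[OF x])
  qed
  have l2: "(\<lambda>n. pd j (\<eta> n) x) \<longlonglongrightarrow> 0" if x: "x \<in> W" for j x
    by (rule Lim_null_comparison[OF _ inv0[of "2 * \<bar>pd j y x\<bar>"]]) (use \<eta>(5)[OF x] in simp)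
  show thesis
  proof (rule that)
    show "W \<subseteq> D" using F(3) by (simp add: W_def)
    show "weight_data (TYPE('r)) W K e \<phi> \<psi> \<eta> C L"
      by unfold_locales
         (use oW e K F(2) Cph Cpph Cps Cpps z0 php hess \<eta>(1,2,3) cL eg l1 l2 in \<open>auto simp: W_def \<phi>_def \<psi>_def L_def\<close>)
  qed
qed

section \<open>Estimates for mollified forms\<close>

text \<open>By the anticommutation relation the squared norms of the contraction and of the exterior
  product with one direction add up to that of a.\<close>

lemma gB_ctr_wdg_le:
  assumes "posdef M"
  shows "gB M (ctr i a) (ctr i a) \<le> gB M a a" "gB M (wdg i a) (wdg i a) \<le> gB M a a"
  using gB_wdg_wdg[of M i a i a] gB_nonneg[OF assms, of "wdg i a"] gB_nonneg[OF assms, of "ctr i a"] by simp_all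

lemma gB_young:
  assumes "posdef M" "e > 0"
  shows "gB M (a + b) (a + b) \<le> (1 + e) * gB M a a + (1 + 1/e) * gB M b b"
proof -
  have "0 \<le> gB M (e *\<^sub>R a - b) (e *\<^sub>R a - b)" by (rule gB_nonneg[OF assms(1)])
  also have "\<dots> = e^2 * gB M a a - 2 * e * gB M a b + gB M b b"
    using gB_commute[OF assms(1), of b a]
    by (simp add: gB_diff_left gB_diff_right gB_scaleR_left gB_scaleR_right power2_eq_square algebra_simps)
  finally have "2 * gB M a b \<le> e * gB M a a + (1/e) * gB M b b"
    using assms(2) by (simp add: field_simps power2_eq_square)
  then show ?thesis using gB_commute[OF assms(1), of b a] by (simp add: gB_add_left gB_add_right algebra_simps)
qed

lemma gB_sum_le:
  fixes x :: "'i::finite \<Rightarrow> real^'r::finite^'n::finite set"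
  assumes "posdef M"
  shows "gB M (\<Sum>i\<in>UNIV. x i) (\<Sum>i\<in>UNIV. x i) \<le> real CARD('i) * (\<Sum>i\<in>UNIV. gB M (x i) (x i))"
proof -
  have p: "gB M (x i) (x j) \<le> (gB M (x i) (x i) + gB M (x j) (x j)) / 2" for i j
    using gB_nonneg[OF assms, of "x i - x j"] gB_commute[OF assms, of "x j" "x i"]
    by (simp add: gB_diff_left gB_diff_right)
  have "gB M (\<Sum>i\<in>UNIV. x i) (\<Sum>i\<in>UNIV. x i) = (\<Sum>j\<in>UNIV. \<Sum>i\<in>UNIV. gB M (x i) (x j))"
    unfolding gB_sum_left gB_sum_right by (rule refl)
  also have "\<dots> \<le> (\<Sum>j\<in>UNIV. \<Sum>i\<in>UNIV. (gB M (x i) (x i) + gB M (x j) (x j)) / 2)" by (intro sum_mono p)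
  also have "\<dots> = real CARD('i) * (\<Sum>i\<in>UNIV. gB M (x i) (x i))"
    by (simp add: add_divide_distrib sum.distrib sum_divide_distrib[symmetric] sum_distrib_left[symmetric])
  finally show ?thesis .
qed

text \<open>Moving the coefficients from x to a nearby y costs arbitrarily little. For x = y the
  error \<open>E\<close> vanishes and the inequality is strict unless w = z = 0, because \<kappa> >
  0. On the unit sphere the pairs where it fails form a compact set \<open>N\<close> off the
  diagonal, hence at a positive distance from it; homogeneity gives all other (w, z).\<close>

lemma near_diagonal:
  fixes G :: "'a::metric_space \<Rightarrow> real^'r^'r::finite" and E :: "'a \<Rightarrow> 'a \<Rightarrow> real^'r^'n::finite set \<Rightarrow> real^'r^'n set"
  assumes K: "compact K" and G: "continuous_on K G" "\<And>x. x \<in> K \<Longrightarrow> posdef (G x)" and k: "\<kappa> > 0"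
    and E: "continuous_on (K \<times> K \<times> UNIV) (\<lambda>(x, y, z). E x y z)" "\<And>x z. E x x z = 0" "\<And>x y c z. E x y (c *\<^sub>R z) = c *\<^sub>R E x y z"
  obtains \<delta> where "\<delta> > 0" "\<And>x y w z. x \<in> K \<Longrightarrow> y \<in> K \<Longrightarrow> dist x y < \<delta> \<Longrightarrow>
    gB (G x) (w + E x y z) (w + E x y z) \<le> (1 + \<kappa>) * gB (G y) w w + \<kappa> * gB (G y) z z"
proof -
  define Q where "Q = (\<lambda>(x, y, w, z). (1 + \<kappa>) * gB (G y) w w + \<kappa> * gB (G y) z z - gB (G x) (w + E x y z) (w + E x y z))"
  define S where "S = sphere (0 :: (real^'r^'n set) \<times> (real^'r^'n set)) 1"
  have cS: "compact (K \<times> K \<times> S)" unfolding S_def by (intro compact_Times K compact_sphere)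
  have cG1: "continuous_on (K \<times> K \<times> S) (\<lambda>p. G (fst p))"
    by (rule continuous_on_compose2[OF G(1)]) (auto intro: continuous_intros)
  have cG2: "continuous_on (K \<times> K \<times> S) (\<lambda>p. G (fst (snd p)))"
    by (rule continuous_on_compose2[OF G(1)]) (auto intro!: continuous_intros)
  have cE: "continuous_on (K \<times> K \<times> S) (\<lambda>p. E (fst p) (fst (snd p)) (snd (snd (snd p))))"
    by (rule continuous_on_compose2[OF E(1), where f="\<lambda>p. (fst p, fst (snd p), snd (snd (snd p)))", simplified])
       (auto intro!: continuous_intros)
  have "continuous_on (K \<times> K \<times> S) Q"
    unfolding Q_def split_beta' by (intro continuous_intros cG1 cG2 cE)
  then have "closed ((K \<times> K \<times> S) \<inter> Q -` {..0})"
    by (rule continuous_closed_preimage[OF _ compact_imp_closed[OF cS]]) simp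
  then have cN: "compact ((K \<times> K \<times> S) \<inter> ((K \<times> K \<times> S) \<inter> Q -` {..0}))" by (rule compact_Int_closed[OF cS])
  define N where "N = (K \<times> K \<times> S) \<inter> Q -` {..0}"
  have cN: "compact N" using cN by (simp add: N_def Int_absorb1)
  have diag: "Q (x, x, w, z) > 0" if "x \<in> K" "(w, z) \<in> S" for x w z
  proof -
    have p: "posdef (G x)" by (rule G(2)[OF that(1)])
    have "w \<noteq> 0 \<or> z \<noteq> 0" using that(2) by (auto simp: S_def norm_Pair)
    then have "gB (G x) w w + gB (G x) z z > 0"
      using gB_pos[OF p, of w] gB_pos[OF p, of z] gB_nonneg[OF p, of w] gB_nonneg[OF p, of z] by fastforce
    then have "\<kappa> * (gB (G x) w w + gB (G x) z z) > 0" using k by simp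
    then show ?thesis by (simp add: Q_def E(2) algebra_simps)
  qed
  obtain \<delta> where d: "\<delta> > 0" "\<And>x y p. (x, y, p) \<in> N \<Longrightarrow> \<delta> \<le> dist x y"
  proof (cases "N = {}")
    case True
    then show thesis using that[of 1] by auto
  next
    case False
    have "continuous_on N (\<lambda>p. dist (fst p) (fst (snd p)))" by (intro continuous_intros)
    then obtain p0 where p0: "p0 \<in> N" "\<And>p. p \<in> N \<Longrightarrow> dist (fst p0) (fst (snd p0)) \<le> dist (fst p) (fst (snd p))"
      using continuous_attains_inf[OF cN False] by blast
    have "fst p0 \<noteq> fst (snd p0)"
    proof
      assume e: "fst p0 = fst (snd p0)"
      obtain x y w z where p: "p0 = (x, y, w, z)" by (cases p0)
      show False using p0(1) e diag[of x w z] by (auto simp: p N_def)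
    qed
    then show thesis using that[of "dist (fst p0) (fst (snd p0))"] p0(2) by force
  qed
  show thesis
  proof (rule that[OF d(1)])
    fix x y w z assume xy: "x \<in> K" "y \<in> K" "dist x y < \<delta>"
    show "gB (G x) (w + E x y z) (w + E x y z) \<le> (1 + \<kappa>) * gB (G y) w w + \<kappa> * gB (G y) z z"
    proof (cases "(w, z) = 0")
      case True
      then have "w = 0" "z = 0" by (auto simp: prod_eq_iff)
      then show ?thesis using E(3)[of x y 0 0] by (simp add: gB_zero_left)
    next
      case False
      define c where "c = 1 / norm (w, z)"
      have c: "c > 0" using False by (simp add: c_def)
      have "(c *\<^sub>R w, c *\<^sub>R z) = c *\<^sub>R (w, z)" by simp
      then have "norm (c *\<^sub>R w, c *\<^sub>R z) = 1" using False by (simp only: norm_scaleR) (simp add: c_def)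
      then have "(c *\<^sub>R w, c *\<^sub>R z) \<in> S" by (simp add: S_def)
      then have "Q (x, y, c *\<^sub>R w, c *\<^sub>R z) > 0" using xy d(2)[of x y] by (force simp: N_def)
      moreover have "Q (x, y, c *\<^sub>R w, c *\<^sub>R z) = c^2 * ((1 + \<kappa>) * gB (G y) w w + \<kappa> * gB (G y) z z - gB (G x) (w + E x y z) (w + E x y z))"
        unfolding Q_def prod.case E(3) scaleR_add_right[symmetric] gB_scaleR_left gB_scaleR_right
        by (simp add: power2_eq_square algebra_simps)
      ultimately have "0 < (1 + \<kappa>) * gB (G y) w w + \<kappa> * gB (G y) z z - gB (G x) (w + E x y z) (w + E x y z)"
        using c by (simp add: zero_less_mult_iff)
      then show ?thesis by simp
    qed
  qed
qed

lemma measurable_gB [measurable (raw)]: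
  assumes "G \<in> borel_measurable M" "a \<in> borel_measurable M" "b \<in> borel_measurable M"
  shows "(\<lambda>x. gB (G x) (a x) (b x)) \<in> borel_measurable M"
proof -
  have "(\<lambda>x. mact (G x) (b x)) \<in> borel_measurable M"
    by (rule borel_measurable_continuous_Pair[OF assms(1,3)])
       (intro bounded_bilinear.continuous_on[OF bounded_bilinear_mact] continuous_intros)
  then show ?thesis unfolding gB_def using assms by measurable
qed

lemma measurable_mact [measurable (raw)]:
  assumes "G \<in> borel_measurable M" "b \<in> borel_measurable M"
  shows "(\<lambda>x. mact (G x) (b x)) \<in> borel_measurable M"
  by (rule borel_measurable_continuous_Pair[OF assms])
     (intro bounded_bilinear.continuous_on[OF bounded_bilinear_mact] continuous_intros)

lemma measurable_ctr [measurable (raw)]: "a \<in> borel_measurable M \<Longrightarrow> (\<lambda>x. ctr j (a x)) \<in> borel_measurable M"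
  by (rule measurable_compose[OF _ borel_measurable_continuous_onI[OF continuous_on_ctr[OF continuous_on_id]]])

lemma measurable_wdg [measurable (raw)]: "a \<in> borel_measurable M \<Longrightarrow> (\<lambda>x. wdg j (a x)) \<in> borel_measurable M"
  by (rule measurable_compose[OF _ borel_measurable_continuous_onI[OF continuous_on_wdg[OF continuous_on_id]]])

section \<open>Convolution: convexity bounds and weak convergence\<close>

lemma mollifier_bounded:
  assumes "mollifier s \<rho>" obtains M where "M > 0" "\<And>x. norm (\<rho> x) \<le> M"
  by (rule continuous_compact_support_bounded[of \<rho> "cball 0 s"])
     (use assms in \<open>auto simp: mollifier_def dest: C1_cont\<close>)

text \<open>Jensen's inequality for the probability density \<rho> (x - y): with c the mean of U,
  expand the nonnegative integral of |U - c|^2.\<close>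

lemma gB_conv_le:
  fixes U :: "real^'n::finite \<Rightarrow> real^'r::finite^'m::finite set"
  assumes m: "mollifier s \<rho>" and M: "posdef M" and U: "integrable lborel U" and F: "integrable lborel F"
    and le: "\<And>y. norm (x - y) < s \<Longrightarrow> gB M (U y) (U y) \<le> F y"
  shows "gB M (conv \<rho> U x) (conv \<rho> U x) \<le> conv \<rho> F x"
proof -
  have c: "continuous_on UNIV \<rho>" using m C1_cont by (auto simp: mollifier_def)
  have [measurable]: "\<rho> \<in> borel_measurable borel" by (rule borel_measurable_continuous_onI[OF c])
  have mU [measurable]: "U \<in> borel_measurable borel" using borel_measurable_integrable[OF U] by simp
  obtain N where N: "N > 0" "\<And>x. norm (\<rho> x) \<le> N" by (rule mollifier_bounded[OF m]) blast
  have r0: "\<rho> z \<ge> 0" for z using m by (simp add: mollifier_def)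
  have iU: "integrable lborel (\<lambda>y. \<rho> (x - y) *\<^sub>R U y)" by (rule conv_integrand_integrable[OF c N(2) U])
  have iF: "integrable lborel (\<lambda>y. \<rho> (x - y) * F y)" using conv_integrand_integrable[OF c N(2) F] by simp
  have pt: "\<rho> (x - y) * gB M (U y) (U y) \<le> \<rho> (x - y) * F y" for y
  proof (cases "norm (x - y) < s")
    case False
    then have "\<rho> (x - y) = 0" using m by (simp add: mollifier_def)
    then show ?thesis by simp
  qed (auto intro: mult_left_mono le r0)
  have iQ: "integrable lborel (\<lambda>y. \<rho> (x - y) * gB M (U y) (U y))"
  proof (rule Bochner_Integration.integrable_bound[OF iF])
    have "norm (\<rho> (x - y) * gB M (U y) (U y)) \<le> norm (\<rho> (x - y) * F y)" for y
    proof -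
      have "norm (\<rho> (x - y) * gB M (U y) (U y)) = \<rho> (x - y) * gB M (U y) (U y)"
        unfolding real_norm_def by (rule abs_of_nonneg[OF mult_nonneg_nonneg[OF r0 gB_nonneg[OF M]]])
      also have "\<dots> \<le> norm (\<rho> (x - y) * F y)" using pt[of y] by simp
      finally show ?thesis .
    qed
    then show "AE y in lborel. norm (\<rho> (x - y) * gB M (U y) (U y)) \<le> norm (\<rho> (x - y) * F y)" by simp
  qed measurable
  let ?c = "conv \<rho> U x"
  have bl: "bounded_linear (gB M ?c)" by (rule bounded_bilinear.bounded_linear_right[OF bb_gB])
  have iL: "integrable lborel (\<lambda>y. \<rho> (x - y) * gB M ?c (U y))"
    using integrable_bounded_linear[OF bl iU] by (simp add: gB_scaleR_right)
  have L: "(LINT y|lborel. \<rho> (x - y) * gB M ?c (U y)) = gB M ?c ?c"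
    using integral_bounded_linear[OF bl iU] by (simp add: gB_scaleR_right conv_def)
  have "0 \<le> (LINT y|lborel. \<rho> (x - y) * gB M (U y - ?c) (U y - ?c))"
    by (intro integral_nonneg_AE AE_I2 mult_nonneg_nonneg r0 gB_nonneg[OF M])
  also have "\<dots> = (LINT y|lborel. \<rho> (x - y) * gB M (U y) (U y) - 2 * (\<rho> (x - y) * gB M ?c (U y)) + gB M ?c ?c * \<rho> (x - y))"
    by (rule Bochner_Integration.integral_cong)
       (auto simp: gB_diff_left gB_diff_right gB_commute[OF M, of "U _" ?c] algebra_simps)
  also have "\<dots> = (LINT y|lborel. \<rho> (x - y) * gB M (U y) (U y)) - 2 * gB M ?c ?c + gB M ?c ?c"
    using iQ iL mollifier_int(1,2)[OF m, of x] by (simp add: L)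
  finally have "gB M ?c ?c \<le> (LINT y|lborel. \<rho> (x - y) * gB M (U y) (U y))" by simp
  also have "\<dots> \<le> (LINT y|lborel. \<rho> (x - y) * F y)" by (rule integral_mono[OF iQ iF pt])
  finally show ?thesis by (simp add: conv_def)
qed

text \<open>The convolved form \<open>U x\<close> may depend on the point x, as it does when
  coefficients are frozen there. The bound \<open>F\<close> does not, so that integrating over x
  comes down to the fact that convolution preserves integrals.\<close>

lemma set_integral_gB_conv_le:
  fixes H :: "real^'n::finite \<Rightarrow> real^'r::finite^'m::finite set"
  assumes m: "mollifier s \<rho>" and K: "compact K" and G: "continuous_on K G" "\<And>x. x \<in> K \<Longrightarrow> posdef (G x)"
    and H: "continuous_on K H" and U: "\<And>x. x \<in> K \<Longrightarrow> integrable lborel (U x)" "\<And>x. x \<in> K \<Longrightarrow> H x = conv \<rho> (U x) x"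
    and F: "integrable lborel F" "\<And>y. F y \<ge> 0"
    and le: "\<And>x y. x \<in> K \<Longrightarrow> norm (x - y) < s \<Longrightarrow> gB (G x) (U x y) (U x y) \<le> F y"
  shows "(LINT x:K|lborel. gB (G x) (H x) (H x)) \<le> integral\<^sup>L lborel F"
proof -
  have r0: "\<rho> z \<ge> 0" for z using m by (simp add: mollifier_def)
  have cF0: "conv \<rho> F x \<ge> 0" for x unfolding conv_def using r0 F(2) by (intro integral_nonneg_AE AE_I2) simp
  have "(LINT x:K|lborel. gB (G x) (H x) (H x)) \<le> integral\<^sup>L lborel (conv \<rho> F)"
    unfolding set_lebesgue_integral_def
  proof (rule integral_mono)
    show "integrable lborel (\<lambda>x. indicator K x *\<^sub>R gB (G x) (H x) (H x))"
      using set_integrable_compact[OF K continuous_on_gB[OF G(1) H H]] by (simp add: set_integrable_def)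
    show "integrable lborel (conv \<rho> F)" by (rule conv_integrable[OF m F(1)])
    show "indicator K x *\<^sub>R gB (G x) (H x) (H x) \<le> conv \<rho> F x" for x
    proof (cases "x \<in> K")
      case True
      then show ?thesis using gB_conv_le[OF m G(2)[OF True] U(1)[OF True] F(1) le[OF True]] by (simp add: U(2)[OF True])
    qed (simp add: cF0)
  qed
  then show ?thesis by (simp add: conv_integral[OF m F(1)])
qed

text \<open>Uniform continuity allows v x to be replaced by v y under the convolution, at a cost
  proportional to the L^1 norm of w; preservation of integrals does the rest. The margin
  \<open>r\<close> keeps the support of the mollified form inside \<open>K\<close>.\<close>

lemma conv_weak_limit:
  fixes v w :: "real^'n::finite \<Rightarrow> 'b::euclidean_space"
  assumes K: "compact K" and v: "continuous_on K v" and w: "integrable lborel w" "\<And>y. y \<notin> L \<Longrightarrow> w y = 0"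
    and L: "compact L" "\<And>x y. y \<in> L \<Longrightarrow> norm (x - y) < r \<Longrightarrow> x \<in> K" "r > 0" and k: "\<kappa> > 0"
  obtains \<delta> where "\<delta> > 0" "\<And>s \<rho>. s < \<delta> \<Longrightarrow> mollifier s \<rho> \<Longrightarrow>
    \<bar>(LINT x:K|lborel. v x \<bullet> conv \<rho> w x) - (LINT x:L|lborel. v x \<bullet> w x)\<bar> \<le> \<kappa>"
proof -
  define N where "N = (LINT y|lborel. norm (w y))"
  have N: "N \<ge> 0" by (simp add: N_def)
  have LK: "L \<subseteq> K" using L(2)[of x x for x] L(3) by auto
  have "uniformly_continuous_on K v" by (rule compact_uniformly_continuous[OF v K])
  \<comment> \<open>The error is multiplied by \<open>N\<close> at the end; N + 1 keeps the quotient
    meaningful when w vanishes.\<close>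
  then obtain d where d: "d > 0" "\<And>x y. x \<in> K \<Longrightarrow> y \<in> K \<Longrightarrow> dist x y < d \<Longrightarrow> dist (v x) (v y) < \<kappa> / (N + 1)"
    unfolding uniformly_continuous_on_def using k N by (metis add_nonneg_pos dist_commute divide_pos_pos zero_less_one)
  show thesis
  proof (rule that[of "min d r"])
    show "min d r > 0" using d(1) L(3) by simp
    fix s and \<rho> :: "real^'n \<Rightarrow> real" assume s: "s < min d r" and m: "mollifier s \<rho>"
    have c: "continuous_on UNIV \<rho>" using m C1_cont by (auto simp: mollifier_def)
    have [measurable]: "\<rho> \<in> borel_measurable borel" by (rule borel_measurable_continuous_onI[OF c])
    have mw [measurable]: "w \<in> borel_measurable borel" using borel_measurable_integrable[OF w(1)] by simp
    obtain M where M: "M > 0" "\<And>x. norm (\<rho> x) \<le> M" by (rule mollifier_bounded[OF m]) blast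
    have r0: "\<rho> z \<ge> 0" for z using m by (simp add: mollifier_def)
    \<comment> \<open>Cutting v to \<open>L\<close> makes it bounded and Borel on the whole space
      and leaves its product with w unchanged.\<close>
    define vL where "vL x = (if x \<in> L then v x else 0)" for x
    have mvL [measurable]: "vL \<in> borel_measurable borel"
      unfolding vL_def using LK by (intro borel_measurable_continuous_on_if borel_compact L(1) continuous_on_const)
        (auto intro: continuous_on_subset[OF v])
    have "bounded (v ` L)" by (intro compact_imp_bounded compact_continuous_image L(1) continuous_on_subset[OF v LK])
    then obtain B where B: "B > 0" "\<And>x. x \<in> L \<Longrightarrow> norm (v x) \<le> B" unfolding bounded_pos by auto
    have vB: "norm (vL x) \<le> B" for x using B by (simp add: vL_def)
    have ivw: "integrable lborel (\<lambda>y. vL y \<bullet> w y)"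
    proof (rule Bochner_Integration.integrable_bound[where f="\<lambda>y. B * norm (w y)"])
      have "norm (vL y \<bullet> w y) \<le> norm (B * norm (w y))" for y
        using Cauchy_Schwarz_ineq2[of "vL y" "w y"] mult_right_mono[OF vB norm_ge_zero, of y "w y"] B(1)
        by simp
      then show "AE y in lborel. norm (vL y \<bullet> w y) \<le> norm (B * norm (w y))" by simp
    qed (use w(1) in auto)
    have Lint: "(LINT x:L|lborel. v x \<bullet> w x) = (LINT x|lborel. vL x \<bullet> w x)"
      unfolding set_lebesgue_integral_def
      by (rule Bochner_Integration.integral_cong) (auto simp: vL_def indicator_def)
    have iw: "integrable lborel (\<lambda>y. \<rho> (x - y) *\<^sub>R w y)" for x by (rule conv_integrand_integrable[OF c M(2) w(1)])
    have iv: "integrable lborel (\<lambda>y. \<rho> (x - y) *\<^sub>R (vL y \<bullet> w y))" for x by (rule conv_integrand_integrable[OF c M(2) ivw])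
    have inw: "integrable lborel (\<lambda>y. norm (w y))" using w(1) by simp
    have iN: "integrable lborel (\<lambda>y. \<rho> (x - y) *\<^sub>R norm (w y))" for x by (rule conv_integrand_integrable[OF c M(2) inw])
    have cw: "continuous_on UNIV (conv \<rho> w)" by (rule conv_continuous[OF c M(2) w(1)])
    have pt: "\<bar>indicator K x *\<^sub>R (v x \<bullet> conv \<rho> w x) - conv \<rho> (\<lambda>y. vL y \<bullet> w y) x\<bar> \<le> (\<kappa> / (N + 1)) * conv \<rho> (\<lambda>y. norm (w y)) x" for x
    proof (cases "x \<in> K")
      case True
      have e: "v x \<bullet> conv \<rho> w x - conv \<rho> (\<lambda>y. vL y \<bullet> w y) x = (LINT y|lborel. \<rho> (x - y) * ((v x - vL y) \<bullet> w y))"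
      proof -
        have "v x \<bullet> conv \<rho> w x = (LINT y|lborel. v x \<bullet> (\<rho> (x - y) *\<^sub>R w y))"
          unfolding conv_def using integral_bounded_linear[OF bounded_linear_inner_right iw] by metis
        then have "v x \<bullet> conv \<rho> w x - conv \<rho> (\<lambda>y. vL y \<bullet> w y) x
           = (LINT y|lborel. v x \<bullet> (\<rho> (x - y) *\<^sub>R w y) - \<rho> (x - y) *\<^sub>R (vL y \<bullet> w y))"
          unfolding conv_def using Bochner_Integration.integral_diff[OF integrable_bounded_linear[OF bounded_linear_inner_right iw] iv] by simp
        also have "\<dots> = (LINT y|lborel. \<rho> (x - y) * ((v x - vL y) \<bullet> w y))"
          by (rule Bochner_Integration.integral_cong) (auto simp: inner_diff_left algebra_simps)
        finally show ?thesis .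
      qed
      have "\<bar>\<rho> (x - y) * ((v x - vL y) \<bullet> w y)\<bar> \<le> (\<kappa> / (N + 1)) * (\<rho> (x - y) *\<^sub>R norm (w y))" for y
      proof (cases "y \<in> L \<and> norm (x - y) < s")
        case t: True
        then have "dist (v x) (v y) < \<kappa> / (N + 1)" using d(2)[OF True, of y] LK s by (auto simp: dist_norm)
        then have "\<bar>(v x - vL y) \<bullet> w y\<bar> \<le> (\<kappa> / (N + 1)) * norm (w y)"
          using Cauchy_Schwarz_ineq2[of "v x - vL y" "w y"] t
          by (intro order_trans[OF Cauchy_Schwarz_ineq2] mult_right_mono) (auto simp: vL_def dist_norm)
        from mult_left_mono[OF this r0[of "x - y"]] show ?thesis using r0[of "x - y"] by (simp add: abs_mult mult_ac)
      next
        case False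
        then have "w y = 0 \<or> \<rho> (x - y) = 0" using w(2) m by (auto simp: mollifier_def)
        then show ?thesis by auto
      qed
      then have "norm (LINT y|lborel. \<rho> (x - y) * ((v x - vL y) \<bullet> w y)) \<le> (LINT y|lborel. (\<kappa> / (N + 1)) * (\<rho> (x - y) *\<^sub>R norm (w y)))"
      proof -
        assume b: "\<And>y. \<bar>\<rho> (x - y) * ((v x - vL y) \<bullet> w y)\<bar> \<le> (\<kappa> / (N + 1)) * (\<rho> (x - y) *\<^sub>R norm (w y))"
        have i: "integrable lborel (\<lambda>y. (\<kappa> / (N + 1)) * (\<rho> (x - y) *\<^sub>R norm (w y)))"
          by (rule integrable_mult_right[OF iN])
        have "norm (\<rho> (x - y) * ((v x - vL y) \<bullet> w y)) \<le> norm ((\<kappa> / (N + 1)) * (\<rho> (x - y) *\<^sub>R norm (w y)))" for y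
          using order_trans[OF b[of y] abs_ge_self] by simp
        then have "integrable lborel (\<lambda>y. \<rho> (x - y) * ((v x - vL y) \<bullet> w y))"
          by (intro Bochner_Integration.integrable_bound[OF i]) auto
        then show ?thesis by (rule Bochner_Integration.integral_norm_bound_integral[OF _ i]) (use b in simp)
      qed
      then show ?thesis using True e by (simp add: conv_def)
    next
      case False
      have "s \<le> norm (x - y)" if "y \<in> L" for y using L(2)[OF that, of x] False s by force
      then have "conv \<rho> (\<lambda>y. vL y \<bullet> w y) x = 0" "conv \<rho> (\<lambda>y. norm (w y)) x = 0"
        by (auto intro!: conv_support[OF m, of L] simp: w(2))
      then show ?thesis using False by simp
    qed
    have i1: "integrable lborel (\<lambda>x. indicator K x *\<^sub>R (v x \<bullet> conv \<rho> w x))"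
      using set_integrable_compact[OF K continuous_on_inner[OF v continuous_on_subset[OF cw]]] by (simp add: set_integrable_def)
    have "\<bar>(LINT x:K|lborel. v x \<bullet> conv \<rho> w x) - (LINT x:L|lborel. v x \<bullet> w x)\<bar>
      = \<bar>LINT x|lborel. indicator K x *\<^sub>R (v x \<bullet> conv \<rho> w x) - conv \<rho> (\<lambda>y. vL y \<bullet> w y) x\<bar>"
      unfolding Lint unfolding set_lebesgue_integral_def
      using Bochner_Integration.integral_diff[OF i1 conv_integrable[OF m ivw]] conv_integral[OF m ivw] by simp
    also have "\<dots> \<le> (LINT x|lborel. (\<kappa> / (N + 1)) * conv \<rho> (\<lambda>y. norm (w y)) x)"
      using Bochner_Integration.integral_norm_bound_integral[OF Bochner_Integration.integrable_diff[OF i1 conv_integrable[OF m ivw]]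
          integrable_mult_right[OF conv_integrable[OF m inw], of "\<kappa> / (N + 1)"]] pt by simp
    also have "\<dots> = (\<kappa> / (N + 1)) * N" using conv_integral[OF m inw] by (simp add: N_def)
    also have "\<dots> \<le> \<kappa>" using N k by (simp add: field_simps)
    finally show "\<bar>(LINT x:K|lborel. v x \<bullet> conv \<rho> w x) - (LINT x:L|lborel. v x \<bullet> w x)\<bar> \<le> \<kappa>" .
  qed
qed

text \<open>The quotient \<open>h\<^sup>2 / Q\<close> is a measurable lower bound of the dual quadratic form, so no measurability
  of \<open>\<theta>\<close> is needed. Adding \<open>\<delta>\<close> keeps the denominator positive and lets \<open>\<theta> = \<infinity>\<close> mean
  what it should where \<open>Q = 0\<close>, since \<open>\<infinity> * 0 = 0\<close>.\<close>
lemma dual_form_cauchy_schwarz: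
  fixes h Q b :: "'a::euclidean_space \<Rightarrow> real" and \<theta> :: "'a \<Rightarrow> ennreal"
  assumes K: "compact K" and h: "continuous_on K h" and Q: "continuous_on K Q" "\<And>x. x \<in> K \<Longrightarrow> Q x \<ge> 0"
    and b: "continuous_on K b" "\<And>x. x \<in> K \<Longrightarrow> b x \<ge> 0"
    and th: "\<And>x \<delta>. x \<in> K \<Longrightarrow> \<delta> > 0 \<Longrightarrow> ennreal ((h x)^2) \<le> \<theta> x * ennreal (Q x + \<delta>)"
    and A: "(\<integral>\<^sup>+x\<in>K. \<theta> x \<partial>lebesgue) \<le> ennreal A" "A \<ge> 0"
  shows "(LINT x:K|lborel. b x * h x)^2 \<le> A * (LINT x:K|lborel. (b x)^2 * Q x)"
proof -
  interpret l2form "\<lambda>(x::'a) a c. (a::real) * c"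
    by unfold_locales (auto simp: bilinear_def zero_less_mult_iff linorder_neq_iff intro!: linearI simp: algebra_simps)
  have main: "(LINT x:K|lborel. b x * h x)^2 \<le> A * ((LINT x:K|lborel. (b x)^2 * Q x) + \<delta> * (LINT x:K|lborel. (b x)^2))"
    if d: "\<delta> > 0" for \<delta>
  proof -
    have Qd: "Q x + \<delta> > 0" if "x \<in> K" for x using Q(2)[OF that] d by simp
    \<comment> \<open>The splitting b h = (h / sqrt (Q + \<delta>)) (b sqrt (Q + \<delta>)): the
      square of the first factor lies below \<theta>, that of the second is b^2 (Q +
      \<delta>).\<close>
    define u where "u x = (if x \<in> K then h x / sqrt (Q x + \<delta>) else 0)" for x
    define v where "v x = (if x \<in> K then b x * sqrt (Q x + \<delta>) else 0)" for x
    have cu: "continuous_on K (\<lambda>x. h x / sqrt (Q x + \<delta>))"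
      using Qd by (intro continuous_intros h Q) (auto simp: less_imp_neq[symmetric])
    have cv: "continuous_on K (\<lambda>x. b x * sqrt (Q x + \<delta>))" by (intro continuous_intros b Q)
    have mu [measurable]: "u \<in> borel_measurable borel"
      unfolding u_def by (intro borel_measurable_continuous_on_if borel_compact K cu continuous_on_const)
    have mv [measurable]: "v \<in> borel_measurable borel"
      unfolding v_def by (intro borel_measurable_continuous_on_if borel_compact K cv continuous_on_const)
    have su: "set_integrable lborel K (\<lambda>x. (h x / sqrt (Q x + \<delta>)) * (h x / sqrt (Q x + \<delta>)))"
      by (intro set_integrable_compact[OF K] continuous_on_mult cu)
    have sv: "set_integrable lborel K (\<lambda>x. (b x * sqrt (Q x + \<delta>)) * (b x * sqrt (Q x + \<delta>)))"
      by (intro set_integrable_compact[OF K] continuous_on_mult cv)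
    have uu: "(\<lambda>x. u x * u x) = (\<lambda>x. indicator K x *\<^sub>R ((h x / sqrt (Q x + \<delta>)) * (h x / sqrt (Q x + \<delta>))))"
      by (auto simp: u_def fun_eq_iff)
    have vv: "(\<lambda>x. v x * v x) = (\<lambda>x. indicator K x *\<^sub>R ((b x * sqrt (Q x + \<delta>)) * (b x * sqrt (Q x + \<delta>))))"
      by (auto simp: v_def fun_eq_iff)
    have Hu: "H u" unfolding H_def uu using su mu by (simp add: set_integrable_def)
    have Hv: "H v" unfolding H_def vv using sv mv by (simp add: set_integrable_def)
    have uv: "ip u v = (LINT x:K|lborel. b x * h x)"
      unfolding ip_def set_lebesgue_integral_def
    proof (rule Bochner_Integration.integral_cong[OF refl])
      show "u x * v x = indicator K x *\<^sub>R (b x * h x)" for x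
      proof (cases "x \<in> K")
        case True
        then have "sqrt (Q x + \<delta>) \<noteq> 0" using Qd[OF True] by simp
        then show ?thesis using True by (simp add: u_def v_def)
      qed (simp add: u_def)
    qed
    have "ennreal (ip u u) = (\<integral>\<^sup>+x. ennreal (u x * u x) \<partial>lborel)"
      unfolding ip_def by (rule nn_integral_eq_integral[symmetric, OF H_int[OF Hu]]) simp
    also have "\<dots> = (\<integral>\<^sup>+x. ennreal (u x * u x) \<partial>lebesgue)"
      by (rule nn_integral_completion[symmetric])
    also have "\<dots> \<le> (\<integral>\<^sup>+x\<in>K. \<theta> x \<partial>lebesgue)"
    proof (rule nn_integral_mono)
      show "ennreal (u x * u x) \<le> \<theta> x * indicator K x" for x
      proof (cases "x \<in> K")
        case True
        let ?r = "Q x + \<delta>"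
        have r: "?r > 0" by (rule Qd[OF True])
        have "ennreal ((h x)^2) \<le> \<theta> x * ennreal ?r"
          by (rule th[OF True d])
        then have "ennreal ((h x)^2) * ennreal (1 / ?r) \<le> \<theta> x * ennreal ?r * ennreal (1 / ?r)"
          by (rule mult_right_mono) simp
        also have "\<dots> = \<theta> x * ennreal (?r * (1 / ?r))" using r by (simp only: mult.assoc ennreal_mult[symmetric] less_imp_le divide_nonneg_pos zero_le_one)
        also have "\<dots> = \<theta> x" using r by simp
        finally have "ennreal ((h x)^2 * (1 / ?r)) \<le> \<theta> x" using r
          by (subst ennreal_mult) auto
        moreover have "u x * u x = (h x)^2 * (1 / ?r)" using True r by (simp add: u_def power2_eq_square)
        ultimately show ?thesis using True by simp
      qed (simp add: u_def)
    qed
    also have "\<dots> \<le> ennreal A" by (rule A(1))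
    finally have uA: "ip u u \<le> A" using A(2) by (simp add: ennreal_le_iff)
    have "ip v v = (LINT x:K|lborel. (b x)^2 * Q x + \<delta> * (b x)^2)"
      unfolding ip_def vv set_lebesgue_integral_def
    proof (rule Bochner_Integration.integral_cong[OF refl])
      show "indicator K x *\<^sub>R (b x * sqrt (Q x + \<delta>) * (b x * sqrt (Q x + \<delta>))) = indicator K x *\<^sub>R ((b x)^2 * Q x + \<delta> * (b x)^2)" for x
      proof (cases "x \<in> K")
        case True
        have "sqrt (Q x + \<delta>) * sqrt (Q x + \<delta>) = Q x + \<delta>" using Qd[OF True] by simp
        then have "b x * sqrt (Q x + \<delta>) * (b x * sqrt (Q x + \<delta>)) = (b x)^2 * (Q x + \<delta>)"
          by (metis mult.assoc mult.left_commute power2_eq_square)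
        then show ?thesis by (simp add: algebra_simps)
      qed simp
    qed
    also have "\<dots> = (LINT x:K|lborel. (b x)^2 * Q x) + (LINT x:K|lborel. \<delta> * (b x)^2)"
      by (intro set_integral_add(2) set_integrable_compact[OF K] continuous_intros b Q)
    finally have vv': "ip v v = (LINT x:K|lborel. (b x)^2 * Q x) + \<delta> * (LINT x:K|lborel. (b x)^2)" by simp
    have "(ip u v)^2 \<le> ip u u * ip v v" by (rule ip_cauchy_schwarz[OF Hu Hv])
    also have "\<dots> \<le> A * ip v v" by (rule mult_right_mono[OF uA ip_nonneg])
    finally show ?thesis unfolding uv vv' .
  qed
  let ?R = "LINT x:K|lborel. (b x)^2 * Q x" and ?B = "LINT x:K|lborel. (b x)^2"
  have "((\<lambda>\<delta>. A * (?R + \<delta> * ?B)) \<longlongrightarrow> A * (?R + 0 * ?B)) (at_right 0)" by (intro tendsto_intros)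
  moreover have "\<forall>\<^sub>F \<delta> in at_right 0. (LINT x:K|lborel. b x * h x)^2 \<le> A * (?R + \<delta> * ?B)"
    using main by (auto simp: eventually_at_filter)
  ultimately have "(LINT x:K|lborel. b x * h x)^2 \<le> A * (?R + 0 * ?B)"
    by (rule tendsto_lowerbound) simp
  then show ?thesis by simp
qed

section \<open>Test forms and the projection onto closed forms\<close>

text \<open>The codifferential of the flat Euclidean metric. It acts on v = G \<alpha>, so that the
  metric comes in only afterwards, through a multiplication by its inverse.\<close>

definition cod :: "((real,'n::{finite,linorder}) vec \<Rightarrow> real^'r::finite^'n set) \<Rightarrow> (real,'n) vec \<Rightarrow> real^'r^'n set" where
  "cod u x = - (\<Sum>i\<in>UNIV. ctr i (pd i u x))"

definition cform :: "((real,'n::{finite,linorder}) vec) set \<Rightarrow> ((real,'n) vec \<Rightarrow> real^'r::finite^'n set) \<Rightarrow> bool" where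
  "cform W u \<longleftrightarrow> C1 UNIV u \<and> (\<exists>K. compact K \<and> K \<subseteq> W \<and> (\<forall>x. x \<notin> K \<longrightarrow> u x = 0))"

definition tform :: "((real,'n::{finite,linorder}) vec) set \<Rightarrow> nat \<Rightarrow> ((real,'n) vec \<Rightarrow> real^'r::finite^'n set) \<Rightarrow> bool" where
  "tform W p u \<longleftrightarrow> cform W u \<and> (\<forall>x. dgr p (u x))"

lemma cform_C1: "cform W u \<Longrightarrow> C1 UNIV u"
  by (simp add: cform_def)

lemma pd_comb:
  assumes "C1 UNIV u" "C1 UNIV v"
  shows "pd j (\<lambda>x. u x + c *\<^sub>R v x) x = pd j u x + c *\<^sub>R pd j v x"
  by (intro hpd_imp_pd hpd_add hpd_linear[OF bounded_linear_scaleR_right]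
      C1_hpd[OF assms(1) UNIV_I] C1_hpd[OF assms(2) UNIV_I])

lemma C1_comb: "C1 S u \<Longrightarrow> C1 S v \<Longrightarrow> C1 S (\<lambda>x. u x + c *\<^sub>R v x)"
  by (intro C1_add C1_linear[OF bounded_linear_scaleR_right])

lemma cod_comb: "C1 UNIV u \<Longrightarrow> C1 UNIV v \<Longrightarrow> cod (\<lambda>x. u x + c *\<^sub>R v x) x = cod u x + c *\<^sub>R cod v x"
  by (simp add: cod_def pd_comb ctr_add ctr_scaleR sum.distrib scaleR_sum_right)

lemma tform_comb:
  assumes "tform W p u" "tform W p v" shows "tform W p (\<lambda>x. u x + c *\<^sub>R v x)"
proof -
  obtain K L where K: "compact K" "K \<subseteq> W" "\<And>x. x \<notin> K \<Longrightarrow> u x = 0" and L: "compact L" "L \<subseteq> W" "\<And>x. x \<notin> L \<Longrightarrow> v x = 0"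
    using assms unfolding tform_def cform_def by blast
  have "compact (K \<union> L) \<and> K \<union> L \<subseteq> W \<and> (\<forall>x. x \<notin> K \<union> L \<longrightarrow> u x + c *\<^sub>R v x = 0)"
    using K L by (auto intro: compact_Un)
  moreover have "C1 UNIV (\<lambda>x. u x + c *\<^sub>R v x)"
    using assms by (intro C1_comb) (auto simp: tform_def cform_def)
  ultimately show ?thesis
    using assms unfolding tform_def cform_def by (auto simp: dgr_def)
qed

lemma tform_zero: "tform W p (\<lambda>x. 0)"
  unfolding tform_def cform_def by (auto simp: dgr_def intro!: exI[of _ "{}"])

lemma continuous_dext: "C1 S u \<Longrightarrow> continuous_on S (dext u)"
  unfolding dext_def[abs_def] by (intro continuous_intros C1_cont_pd)

lemma continuous_cod: "C1 S u \<Longrightarrow> continuous_on S (cod u)"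
  unfolding cod_def[abs_def] by (intro continuous_intros C1_cont_pd)

lemma support_dext_cod:
  assumes "compact K" "\<And>x. x \<notin> K \<Longrightarrow> u x = 0" "x \<notin> K"
  shows "dext u x = 0" "cod u x = 0"
  using pd_eq_0_outside[OF compact_imp_closed[OF assms(1)], of u x] assms(2,3)
  by (simp_all add: dext_def cod_def wdg_0 ctr_0)

lemma set_integral_outside:
  assumes "\<And>x. x \<notin> K \<Longrightarrow> h x = 0"
  shows "(LINT x:K|M. h x) = (LINT x|M. h x)"
  unfolding set_lebesgue_integral_def
  by (rule Bochner_Integration.integral_cong[OF refl]) (use assms in \<open>auto simp: indicator_def\<close>)

lemma dext_cod_adjoint_on:
  assumes S: "open S" and u: "C1 S u" and v: "C1 UNIV v" "compact K" "K \<subseteq> S" "\<And>x. x \<notin> K \<Longrightarrow> v x = 0"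
  shows "(LINT x:K|lborel. v x \<bullet> dext u x) = (LINT x:K|lborel. cod v x \<bullet> u x)"
proof -
  have vS: "C1 S v" by (rule C1_subset[OF v(1)]) simp
  have p: "C1 S (\<lambda>x. v x \<bullet> wdg i (u x))" for i
    by (intro C1_bilinear[OF bounded_bilinear_inner vS] C1_linear[OF bl_wdg u])
  have e: "pd i (\<lambda>x. v x \<bullet> wdg i (u x)) x = ctr i (pd i v x) \<bullet> u x + v x \<bullet> wdg i (pd i u x)" if "x \<in> S" for i x
  proof -
    have "hpd i (\<lambda>x. v x \<bullet> wdg i (u x)) (v x \<bullet> wdg i (pd i u x) + pd i v x \<bullet> wdg i (u x)) x"
      by (intro hpd_bilinear[OF bounded_bilinear_inner] hpd_linear[OF bl_wdg] C1_hpd[OF vS that] C1_hpd[OF u that])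
    then show ?thesis using wdg_ctr_adjoint[of i "u x" "pd i v x"] by (simp add: hpd_imp_pd inner_commute)
  qed
  have cu: "continuous_on K u" "\<And>i. continuous_on K (pd i u)" "continuous_on K v" "\<And>i. continuous_on K (pd i v)"
    using continuous_on_subset[OF C1_cont[OF u] v(3)] continuous_on_subset[OF C1_cont_pd[OF u] v(3)]
      continuous_on_subset[OF C1_cont[OF vS] v(3)] continuous_on_subset[OF C1_cont_pd[OF vS] v(3)] by auto
  have z: "(LINT x:K|lborel. pd i (\<lambda>x. v x \<bullet> wdg i (u x)) x) = 0" for i
    by (rule integral_pd_eq_0[OF S p v(2,3)]) (simp add: v(4))
  have "0 = (\<Sum>i\<in>UNIV. LINT x:K|lborel. pd i (\<lambda>x. v x \<bullet> wdg i (u x)) x)" by (simp add: z)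
  also have "\<dots> = (\<Sum>i\<in>UNIV. LINT x:K|lborel. ctr i (pd i v x) \<bullet> u x + v x \<bullet> wdg i (pd i u x))"
    by (intro sum.cong refl set_lebesgue_integral_cong) (use e v(2,3) in \<open>auto simp: borel_compact\<close>)
  also have "\<dots> = (LINT x:K|lborel. \<Sum>i\<in>UNIV. ctr i (pd i v x) \<bullet> u x + v x \<bullet> wdg i (pd i u x))"
    unfolding set_lebesgue_integral_def scaleR_sum_right
    by (intro Bochner_Integration.integral_sum[symmetric] set_integrable_compact[OF v(2), unfolded set_integrable_def] continuous_intros cu)
  also have "\<dots> = (LINT x:K|lborel. v x \<bullet> dext u x - cod v x \<bullet> u x)"
    by (intro arg_cong[of _ _ "\<lambda>h. set_lebesgue_integral lborel K h"] ext)
       (simp add: dext_def cod_def inner_sum_left inner_sum_right sum.distrib)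
  also have "\<dots> = (LINT x:K|lborel. v x \<bullet> dext u x) - (LINT x:K|lborel. cod v x \<bullet> u x)"
    unfolding dext_def cod_def
    by (intro set_integral_diff(2) set_integrable_compact[OF v(2)] continuous_intros cu)
  finally show ?thesis by simp
qed

lemma dext_cod_adjoint:
  assumes v: "C1 UNIV v" "compact K" "\<And>x. x \<notin> K \<Longrightarrow> v x = 0" and u: "C1 UNIV u"
  shows "(LINT x|lborel. v x \<bullet> dext u x) = (LINT x|lborel. cod v x \<bullet> u x)"
proof -
  have "(LINT x:K|lborel. v x \<bullet> dext u x) = (LINT x:K|lborel. cod v x \<bullet> u x)"
    by (rule dext_cod_adjoint_on[OF open_UNIV u v(1,2) subset_UNIV v(3)])
  moreover have "(LINT x:K|lborel. v x \<bullet> dext u x) = (LINT x|lborel. v x \<bullet> dext u x)"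
    by (rule set_integral_outside) (simp add: v(3))
  moreover have "(LINT x:K|lborel. cod v x \<bullet> u x) = (LINT x|lborel. cod v x \<bullet> u x)"
    by (rule set_integral_outside) (simp add: support_dext_cod[OF v(2,3)])
  ultimately show ?thesis by simp
qed

text \<open>d d = 0 in weak form, for forms with one derivative: the double contraction is
  antisymmetric in i and j, while the integral of the product of the partial derivatives is
  symmetric by \<open>integral_pd_pd_commute\<close>.\<close>

lemma cod_dext_orthogonal:
  assumes b: "C1 UNIV b" "compact K" "\<And>x. x \<notin> K \<Longrightarrow> b x = 0"
    and u: "C1 UNIV u" "compact L" "\<And>x. x \<notin> L \<Longrightarrow> u x = 0"
  shows "(LINT x|lborel. cod b x \<bullet> dext u x) = 0"
proof -
  define c where "c i j x = ctr i (ctr j (b x))" for i j x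
  have C: "C1 UNIV (c i j)" for i j unfolding c_def[abs_def] by (intro C1_ctr b)
  have pc: "pd k (c i j) x = ctr i (ctr j (pd k b x))" for i j k x
    unfolding c_def[abs_def] by (simp add: pd_ctr[OF C1_ctr[OF b(1)] UNIV_I] pd_ctr[OF b(1) UNIV_I])
  have z: "c i j x = 0" if "x \<notin> K" for i j x by (simp add: c_def b(3)[OF that] ctr_0)
  have int: "integrable lborel (\<lambda>x. pd k (c i j) x \<bullet> pd l u x)" for i j k l
    by (rule continuous_compact_support_integrable[OF continuous_on_inner[OF C1_cont_pd[OF C] C1_cont_pd[OF u(1)]] b(2)])
       (simp add: pd_eq_0_outside[OF compact_imp_closed[OF b(2)] z])
  have e: "cod b x \<bullet> dext u x = - (\<Sum>i\<in>UNIV. \<Sum>j\<in>UNIV. pd i (c j i) x \<bullet> pd j u x)" for x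
  proof -
    have "cod b x \<bullet> dext u x = - (\<Sum>j\<in>UNIV. \<Sum>i\<in>UNIV. ctr i (pd i b x) \<bullet> wdg j (pd j u x))"
      by (simp add: cod_def dext_def inner_sum_left inner_sum_right sum_negf)
    also have "\<dots> = - (\<Sum>j\<in>UNIV. \<Sum>i\<in>UNIV. pd i (c j i) x \<bullet> pd j u x)"
    proof -
      have "ctr i (pd i b x) \<bullet> wdg j (pd j u x) = pd i (c j i) x \<bullet> pd j u x" for i j
        unfolding pc using wdg_ctr_adjoint[of j "pd j u x" "ctr i (pd i b x)"] by (simp only: inner_commute)
      then show ?thesis by simp
    qed
    also have "(\<Sum>j\<in>UNIV. \<Sum>i\<in>UNIV. pd i (c j i) x \<bullet> pd j u x) = (\<Sum>i\<in>UNIV. \<Sum>j\<in>UNIV. pd i (c j i) x \<bullet> pd j u x)"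
      by (rule sum.swap)
    finally show ?thesis .
  qed
  define I where "I i j = (LINT x|lborel. pd i (c j i) x \<bullet> pd j u x)" for i j
  have anti: "I i j = - I j i" for i j
  proof -
    have "I i j = (LINT x|lborel. pd j (c j i) x \<bullet> pd i u x)"
      unfolding I_def by (rule integral_pd_pd_commute[OF C b(2) z u])
    also have "\<dots> = (LINT x|lborel. - (pd j (c i j) x \<bullet> pd i u x))"
      by (rule Bochner_Integration.integral_cong) (simp_all add: pc ctr_anticommute[of j i])
    finally show ?thesis by (simp add: I_def)
  qed
  have "(LINT x|lborel. cod b x \<bullet> dext u x) = - (\<Sum>i\<in>UNIV. \<Sum>j\<in>UNIV. I i j)"
    unfolding e I_def using int by simp
  moreover have "(\<Sum>i\<in>UNIV. \<Sum>j\<in>UNIV. I i j) = - (\<Sum>i\<in>UNIV. \<Sum>j\<in>UNIV. I i j)"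
  proof -
    have "(\<Sum>i\<in>UNIV. \<Sum>j\<in>UNIV. I i j) = (\<Sum>i\<in>UNIV. \<Sum>j\<in>UNIV. - I j i)" by (intro sum.cong refl anti)
    also have "\<dots> = - (\<Sum>i\<in>UNIV. \<Sum>j\<in>UNIV. I j i)" by (simp add: sum_negf)
    also have "(\<Sum>i\<in>UNIV. \<Sum>j\<in>UNIV. I j i) = (\<Sum>i\<in>UNIV. \<Sum>j\<in>UNIV. I i j)" by (rule sum.swap)
    finally show ?thesis .
  qed
  ultimately show ?thesis by simp
qed

section \<open>Weighted square-integrable forms and the projection\<close>

locale weighted_forms =
  fixes W :: "((real,'n::{finite,linorder}) vec) set" and G :: "(real,'n) vec \<Rightarrow> real^'r::finite^'r"
  assumes oW: "open W" and cG: "continuous_on W G" and pG: "\<And>x. x \<in> W \<Longrightarrow> posdef (G x)"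
begin

text \<open>The identity matrix outside \<open>W\<close> makes the inner product positive definite
  at every point, as \<open>l2form\<close> demands.\<close>

definition Gx :: "(real,'n) vec \<Rightarrow> real^'r^'r" where
  "Gx x = (if x \<in> W then G x else mat 1)"

lemma Gx_pos: "posdef (Gx x)"
  by (simp add: Gx_def pG posdef_mat_1)

lemma Gx_meas [measurable]: "Gx \<in> borel_measurable borel"
  unfolding Gx_def[abs_def] by (rule borel_measurable_continuous_on_if) (auto simp: cG oW)

sublocale l2form "\<lambda>x (a::real^'r^'n set) b. gB (Gx x) a b"
proof
  show "(\<lambda>x. gB (Gx x) (u x) (v x)) \<in> borel_measurable borel"
    if [measurable]: "u \<in> borel_measurable borel" "v \<in> borel_measurable borel" for u v :: "(real,'n) vec \<Rightarrow> real^'r^'n set"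
    by measurable
qed (auto simp: bilinear_gB gB_commute[OF Gx_pos] gB_pos[OF Gx_pos])

lemma H_cont:
  assumes "continuous_on W u" "compact K" "K \<subseteq> W" "\<And>x. x \<notin> K \<Longrightarrow> u x = 0"
  shows "H u"
  unfolding H_def
proof
  have "u = (\<lambda>x. if x \<in> K then u x else 0)" using assms(4) by auto
  also have "\<dots> \<in> borel_measurable borel"
    by (intro borel_measurable_continuous_on_if borel_compact assms(2) continuous_on_const continuous_on_subset[OF assms(1,3)])
  finally show "u \<in> borel_measurable borel" .
  have "(\<lambda>x. gB (Gx x) (u x) (u x)) = (\<lambda>x. indicator K x *\<^sub>R gB (G x) (u x) (u x))"
    using assms(3,4) by (auto simp: fun_eq_iff Gx_def gB_zero_left indicator_def)
  then show "integrable lborel (\<lambda>x. gB (Gx x) (u x) (u x))"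
    using set_integrable_compact[OF assms(2), of "\<lambda>x. gB (G x) (u x) (u x)"]
      continuous_on_subset[OF continuous_on_gB[OF cG assms(1,1)] assms(3)] by (simp add: set_integrable_def)
qed

lemma H_dext:
  assumes "cform W u" shows "H (dext u)"
proof -
  obtain K where K: "compact K" "K \<subseteq> W" "\<And>x. x \<notin> K \<Longrightarrow> u x = 0" and C: "C1 UNIV u"
    using assms unfolding cform_def by blast
  show ?thesis
    by (rule H_cont[OF continuous_on_subset[OF continuous_dext[OF C] subset_UNIV] K(1,2)])
       (rule support_dext_cod(1)[OF K(1,3)])
qed

text \<open>The adjoint of d in the metric G, applied to the form G^(-1) b. The inner product of u
  with \<open>T b\<close> is the distributional pairing of du with b, whatever the metric; see
  \<open>ip_T\<close>.\<close>

definition T :: "((real,'n) vec \<Rightarrow> real^'r^'n set) \<Rightarrow> (real,'n) vec \<Rightarrow> real^'r^'n set" where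
  "T b x = mact (matrix_inv (Gx x)) (cod b x)"

lemma gB_T: "gB (Gx x) a (T b x) = a \<bullet> cod b x"
  by (simp add: T_def gB_def mact_mact posdef_inv[OF Gx_pos])

lemma H_T:
  assumes "cform W b" shows "H (T b)"
proof -
  obtain K where K: "compact K" "K \<subseteq> W" "\<And>x. x \<notin> K \<Longrightarrow> b x = 0" and C: "C1 UNIV b"
    using assms unfolding cform_def by blast
  have "continuous_on W (\<lambda>x. matrix_inv (G x))" by (rule continuous_on_matrix_inv[OF cG pG])
  moreover have "continuous_on W (cod b)" using continuous_on_subset[OF continuous_cod[OF C]] by blast
  ultimately have "continuous_on W (\<lambda>x. mact (matrix_inv (G x)) (cod b x))" by (rule continuous_on_mact)
  then have "continuous_on W (T b)"
    by (rule iffD1[OF continuous_on_cong[OF refl], rotated]) (simp add: T_def Gx_def)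
  then show ?thesis
    by (rule H_cont[OF _ K(1,2)]) (simp add: T_def support_dext_cod(2)[OF K(1,3)] mact_zero_right)
qed

lemma ip_T: "ip u (T b) = (LINT x|lborel. u x \<bullet> cod b x)"
  unfolding ip_def gB_T ..

lemma dgr_T: assumes "tform W (Suc p) b" shows "dgr p (T b x)"
proof -
  obtain K where K: "compact K" "\<And>x. x \<notin> K \<Longrightarrow> b x = 0" and C: "C1 UNIV b"
    using assms unfolding tform_def cform_def by blast
  have "dgr (Suc p) (pd i b x)" for i
  proof -
    have "pd i b x $ I = 0" if "card I \<noteq> Suc p" for I
    proof -
      have "hpd i (\<lambda>x. b x $ I) (pd i b x $ I) x"
        by (rule hpd_linear[OF bounded_linear_vec_nth C1_hpd[OF C UNIV_I]])
      moreover have "(\<lambda>x. b x $ I) = (\<lambda>x. 0)" using assms that by (auto simp: tform_def dgr_def)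
      ultimately have "hpd i (\<lambda>x. 0) (pd i b x $ I) x" by (simp only:)
      from hpd_imp_pd[OF this] hpd_imp_pd[OF hpd_const[of i "0::real^'r" x]] show ?thesis by simp
    qed
    then show ?thesis by (simp add: dgr_def)
  qed
  then have "dgr p (ctr i (pd i b x))" for i by (rule dgr_ctr)
  then have "dgr p (cod b x)" unfolding cod_def dgr_def by simp
  then show ?thesis unfolding T_def by (rule dgr_mact)
qed

lemma ip_limit_right:
  assumes u: "H u" and w: "H w" and s: "\<And>n. H (s n)" and l: "(\<lambda>n. ip (\<lambda>x. u x - s n x) (\<lambda>x. u x - s n x)) \<longlonglongrightarrow> 0"
    and z: "\<And>n::nat. ip (s n) w = 0"
  shows "ip u w = 0"
proof -
  have "(ip u w)^2 \<le> ip (\<lambda>x. u x - s n x) (\<lambda>x. u x - s n x) * ip w w" for n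
    using ip_cauchy_schwarz[OF H_diff[OF u s] w, of n] ip_diff_left[OF u s w, of n] z[of n] by simp
  moreover have "(\<lambda>n. ip (\<lambda>x. u x - s n x) (\<lambda>x. u x - s n x) * ip w w) \<longlonglongrightarrow> 0 * ip w w"
    by (intro tendsto_mult l tendsto_const)
  ultimately have "(ip u w)^2 \<le> 0" using LIMSEQ_le_const by fastforce
  then show ?thesis by simp
qed

text \<open>Representing b \<mapsto> <\<alpha>, T b> yields the projection p of \<alpha> onto the
  closure of the range of \<open>T\<close>, and \<alpha>1 = \<alpha> - p is weakly closed. As a
  limit of elements \<open>T b\<close>, p is orthogonal to every du by
  \<open>cod_dext_orthogonal\<close> and to every weakly closed F. So \<alpha>1 keeps the weak
  codifferential of \<alpha> and its pairing with F.\<close>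

lemma closed_projection:
  assumes a: "H \<alpha>" "\<And>x. dgr q (\<alpha> x)"
  obtains \<alpha>1 where "H \<alpha>1" "\<And>x. dgr q (\<alpha>1 x)"
    "\<And>b. tform W (Suc q) b \<Longrightarrow> (LINT x|lborel. \<alpha>1 x \<bullet> cod b x) = 0"
    "\<And>u. cform W u \<Longrightarrow> ip \<alpha>1 (dext u) = ip \<alpha> (dext u)"
    "\<And>F. H F \<Longrightarrow> (\<And>b. tform W (Suc q) b \<Longrightarrow> (LINT x|lborel. F x \<bullet> cod b x) = 0) \<Longrightarrow> ip \<alpha>1 F = ip \<alpha> F"
proof -
  let ?X = "{b. tform W (Suc q) b}"
  have HT: "H (T b)" if "b \<in> ?X" for b using that H_T by (simp add: tform_def)
  have comb: "\<exists>l\<in>?X. (\<forall>x. T l x = T i x + c *\<^sub>R T k x) \<and> ip \<alpha> (T l) = ip \<alpha> (T i) + c * ip \<alpha> (T k)"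
    if "i \<in> ?X" "k \<in> ?X" for c i k
  proof (intro bexI conjI allI)
    let ?l = "\<lambda>x. i x + c *\<^sub>R k x"
    show l: "?l \<in> ?X" using tform_comb that by blast
    show e: "T ?l x = T i x + c *\<^sub>R T k x" for x
      using that by (simp add: T_def cod_comb tform_def cform_def mact_add_right mact_scaleR_right)
    show "ip \<alpha> (T ?l) = ip \<alpha> (T i) + c * ip \<alpha> (T k)"
      unfolding ip_def e gB_add_right gB_scaleR_right
      using B_integrable[OF a(1) HT[OF that(1)]] B_integrable[OF a(1) HT[OF that(2)]] by simp
  qed
  obtain p s where p: "H p" "\<And>x. p x \<in> {a. dgr q a}" "\<And>b. b \<in> ?X \<Longrightarrow> ip p (T b) = ip \<alpha> (T b)"
    and s: "\<And>n::nat. s n \<in> ?X" "(\<lambda>n. ip (\<lambda>x. p x - T (s n) x) (\<lambda>x. p x - T (s n) x)) \<longlonglongrightarrow> 0"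
  proof (rule riesz[of ?X T "\<lambda>b. ip \<alpha> (T b)" "ip \<alpha> \<alpha>" "{a. dgr q a}"])
    show "?X \<noteq> {}" using tform_zero by blast
    show "(ip \<alpha> (T i))^2 \<le> ip \<alpha> \<alpha> * ip (T i) (T i)" if "i \<in> ?X" for i
      by (rule ip_cauchy_schwarz[OF a(1) HT[OF that]])
    show "T i x \<in> {a. dgr q a}" if "i \<in> ?X" for i x using dgr_T that by blast
  qed (use HT comb ip_nonneg dgr_subspace in auto)
  define \<alpha>1 where "\<alpha>1 x = \<alpha> x - p x" for x
  have H1: "H \<alpha>1" unfolding \<alpha>1_def[abs_def] by (rule H_diff[OF a(1) p(1)])
  have orth: "ip \<alpha>1 F = ip \<alpha> F" if F: "H F" "\<And>n. ip (T (s n)) F = 0" for F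
  proof -
    have "ip p F = 0" by (rule ip_limit_right[OF p(1) F(1) HT[OF s(1)] s(2) F(2)])
    then show ?thesis unfolding \<alpha>1_def[abs_def] using ip_diff_left[OF a(1) p(1) F(1)] by simp
  qed
  show thesis
  proof (rule that[OF H1])
    show "dgr q (\<alpha>1 x)" for x using a(2)[of x] p(2)[of x] by (simp add: \<alpha>1_def dgr_def)
    show "(LINT x|lborel. \<alpha>1 x \<bullet> cod b x) = 0" if "tform W (Suc q) b" for b
      using ip_diff_left[OF a(1) p(1) HT[of b]] p(3)[of b] that unfolding ip_T[symmetric] \<alpha>1_def[abs_def] by simp
    show "ip \<alpha>1 (dext u) = ip \<alpha> (dext u)" if u: "cform W u" for u
    proof (rule orth[OF H_dext[OF u]])
      fix n
      obtain K where K: "compact K" "\<And>x. x \<notin> K \<Longrightarrow> s n x = 0" and C: "C1 UNIV (s n)"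
        using s(1)[of n] unfolding tform_def cform_def by blast
      obtain L where L: "compact L" "\<And>x. x \<notin> L \<Longrightarrow> u x = 0" and Cu: "C1 UNIV u" using u unfolding cform_def by blast
      have "ip (T (s n)) (dext u) = (LINT x|lborel. dext u x \<bullet> cod (s n) x)" by (simp add: ip_commute[of "T (s n)"] ip_T)
      then show "ip (T (s n)) (dext u) = 0" using cod_dext_orthogonal[OF C K Cu L] by (simp add: inner_commute)
    qed
    show "ip \<alpha>1 F = ip \<alpha> F" if "H F" "\<And>b. tform W (Suc q) b \<Longrightarrow> (LINT x|lborel. F x \<bullet> cod b x) = 0" for F
      by (rule orth[OF that(1)]) (use that(2) s(1) in \<open>simp add: ip_commute[of "T _"] ip_T\<close>)
  qed
qed

end

section \<open>The a priori estimate\<close>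

lemma uniformly_coercive:
  fixes G :: "'a::metric_space \<Rightarrow> real^'r^'r::finite"
  assumes "compact K" "continuous_on K G" "\<And>x. x \<in> K \<Longrightarrow> posdef (G x)"
  obtains c where "c > 0" "\<And>x (a::real^'r^'n::finite set). x \<in> K \<Longrightarrow> c * (norm a)^2 \<le> gB (G x) a a"
proof -
  let ?S = "sphere (0::real^'r^'n set) 1"
  obtain c where c: "c > 0" "\<And>x a. x \<in> K \<Longrightarrow> a \<in> ?S \<Longrightarrow> c \<le> gB (G x) a a"
  proof (cases "K \<times> ?S = {}")
    case True
    then show thesis by (intro that[of 1]) auto
  next
    case False
    have "continuous_on (K \<times> ?S) (\<lambda>p. G (fst p))"
      by (rule continuous_on_compose2[OF assms(2)]) (auto intro: continuous_intros)
    then have "continuous_on (K \<times> ?S) (\<lambda>p. gB (G (fst p)) (snd p) (snd p))" by (intro continuous_intros)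
    then obtain p where p: "p \<in> K \<times> ?S" "\<And>z. z \<in> K \<times> ?S \<Longrightarrow> gB (G (fst p)) (snd p) (snd p) \<le> gB (G (fst z)) (snd z) (snd z)"
      using continuous_attains_inf[OF compact_Times[OF assms(1) compact_sphere] False] by blast
    have "snd p \<noteq> 0" using p(1) by auto
    then have "gB (G (fst p)) (snd p) (snd p) > 0" using p(1) by (intro gB_pos assms(3)) auto
    moreover have "gB (G (fst p)) (snd p) (snd p) \<le> gB (G x) a a" if "x \<in> K" "a \<in> ?S" for x a
      using p(2)[of "(x, a)"] that by simp
    ultimately show thesis by (rule that)
  qed
  show thesis
  proof (rule that[OF c(1)])
    fix x and a :: "real^'r^'n set" assume x: "x \<in> K"
    show "c * (norm a)^2 \<le> gB (G x) a a"
    proof (cases "a = 0")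
      case False
      have "c \<le> gB (G x) ((1 / norm a) *\<^sub>R a) ((1 / norm a) *\<^sub>R a)" by (rule c(2)[OF x]) (use False in simp)
      also have "\<dots> = gB (G x) a a / (norm a)^2" by (simp add: gB_scaleR_left gB_scaleR_right power2_eq_square)
      finally show ?thesis using False by (simp add: pos_le_divide_eq)
    qed (simp add: gB_zero_left)
  qed
qed

context weighted_forms
begin

lemma H_dominated:
  assumes "z \<in> borel_measurable borel" "H u" "\<And>x. gB (Gx x) (z x) (z x) \<le> M * gB (Gx x) (u x) (u x)"
  shows "H z"
  unfolding H_def
proof
  show "integrable lborel (\<lambda>x. gB (Gx x) (z x) (z x))"
  proof (rule Bochner_Integration.integrable_bound[OF integrable_mult_right[OF H_int[OF assms(2)], of M]])
    have "norm (gB (Gx x) (z x) (z x)) \<le> norm (M * gB (Gx x) (u x) (u x))" for x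
      using assms(3)[of x] B_nonneg[of x "z x"] by simp
    then show "AE x in lborel. norm (gB (Gx x) (z x) (z x)) \<le> norm (M * gB (Gx x) (u x) (u x))" by simp
  qed (use assms(1) in measurable)
qed (rule assms(1))

text \<open>On a compact subset of \<open>W\<close> the metric dominates a multiple of the Euclidean
  norm, and |z| \<le> 1 + |z|^2.\<close>

lemma H_integrable:
  assumes z: "H z" and K: "compact K" "K \<subseteq> W" "\<And>x. x \<notin> K \<Longrightarrow> z x = 0"
  shows "integrable lborel z"
proof -
  obtain c where c: "c > 0" "\<And>x (a::real^'r^'n set). x \<in> K \<Longrightarrow> c * (norm a)^2 \<le> gB (G x) a a"
  proof (rule uniformly_coercive[OF K(1) continuous_on_subset[OF cG K(2)], where 'n='n])
    show "posdef (G x)" if "x \<in> K" for x using pG K(2) that by blast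
  qed (rule that)
  have i: "integrable lborel (\<lambda>x. indicator K x *\<^sub>R (1::real) + (1/c) * gB (Gx x) (z x) (z x))"
    by (intro Bochner_Integration.integrable_add integrable_mult_right H_int[OF z] borel_integrable_compact K(1)) auto
  show ?thesis
  proof (rule Bochner_Integration.integrable_bound[OF i])
    show "z \<in> borel_measurable lborel" using H_meas[OF z] by simp
    have "norm (z x) \<le> norm (indicator K x *\<^sub>R (1::real) + (1/c) * gB (Gx x) (z x) (z x))" for x
    proof (cases "x \<in> K")
      case True
      have "(norm (z x))^2 \<le> (1/c) * gB (Gx x) (z x) (z x)"
        using c(2)[OF True, of "z x"] c(1) True K(2) by (auto simp: Gx_def field_simps)
      moreover have "norm (z x) \<le> 1 + (norm (z x))^2"
      proof -
        have "0 \<le> (norm (z x) - 1)^2" "0 \<le> norm (z x)" by simp_all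
        then show ?thesis unfolding power2_diff by (simp only: power2_eq_square)
      qed
      ultimately show ?thesis using True B_nonneg[of x "z x"] by simp
    qed (use K(3) in simp)
    then show "AE x in lborel. norm (z x) \<le> norm (indicator K x *\<^sub>R (1::real) + (1/c) * gB (Gx x) (z x) (z x))" by simp
  qed
qed

end

lemma dgr_conv:
  assumes "integrable lborel (\<lambda>y. k (x - y) *\<^sub>R w y)" "\<And>y. dgr p (w y)"
  shows "dgr p (conv k w x)"
proof -
  have "conv k w x $ I = 0" if "card I \<noteq> p" for I
  proof -
    have "conv k w x $ I = (LINT y|lborel. (k (x - y) *\<^sub>R w y) $ I)"
      unfolding conv_def by (rule integral_bounded_linear[symmetric, OF bounded_linear_vec_nth assms(1)])
    then show ?thesis using assms(2) that by (simp add: dgr_def)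
  qed
  then show ?thesis by (simp add: dgr_def)
qed

lemma inner_conv:
  assumes "integrable lborel (\<lambda>y. k (x - y) *\<^sub>R w y)"
  shows "conv k w x \<bullet> b = (LINT y|lborel. k (x - y) * (w y \<bullet> b))"
    "integrable lborel (\<lambda>y. k (x - y) * (w y \<bullet> b))"
  using integral_bounded_linear[OF bounded_linear_inner_left[of b] assms]
    integrable_bounded_linear[OF bounded_linear_inner_left[of b] assms] by (simp_all add: conv_def)

lemma mollifier_pd_bounded:
  fixes \<rho> :: "real^'n::finite \<Rightarrow> real"
  assumes "mollifier s \<rho>"
  shows "\<exists>N. \<forall>i x. norm (pd i \<rho> x) \<le> N i"
proof -
  have r: "C1 UNIV \<rho>" "\<And>x. x \<notin> cball 0 s \<Longrightarrow> \<rho> x = 0" using assms by (auto simp: mollifier_def)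
  have "\<exists>N. \<forall>x. norm (pd i \<rho> x) \<le> N" for i
  proof (rule continuous_compact_support_bounded[OF C1_cont_pd[OF r(1)] compact_cball[of 0 s]])
    show "pd i \<rho> x = 0" if "x \<notin> cball 0 s" for x
      by (rule pd_eq_0_outside[of "cball 0 s"]) (use r(2) that in auto)
  qed auto
  then have "\<forall>i. \<exists>N. \<forall>x. norm (pd i \<rho> x) \<le> N" by blast
  from choice[OF this] show ?thesis .
qed

lemma eq_by_inner:
  fixes a c :: "'a::real_inner"
  assumes "\<And>b. a \<bullet> b = c \<bullet> b" shows "a = c"
proof -
  have "(a - c) \<bullet> (a - c) = 0" using assms[of "a - c"] by (simp add: inner_diff_left)
  then show ?thesis by simp
qed

text \<open>One test form \<open>v\<close> and one choice of weights. \<open>F\<close> stands for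
  the given closed form on \<open>W\<close>, extended by zero; its closedness enters through
  pairings with test forms supported in \<open>W\<close>. \<theta> stands for the pointwise value of
  <\<Theta>^(-1) F, F> and is accessible only through \<open>theta\<close> and its integral.\<close>

locale core_estimate = m: metric_connection W g A + w: weight_data "TYPE('r)" W K e \<phi> \<psi> \<eta> C L
  for W :: "((real,'n::{finite,linorder}) vec) set" and g :: "(real,'n) vec \<Rightarrow> real^'r::finite^'r"
    and A :: "'n \<Rightarrow> (real,'n) vec \<Rightarrow> real^'r^'r" and K e \<phi> \<psi> \<eta> C L +
  fixes q :: nat and v F :: "(real,'n) vec \<Rightarrow> real^'r^'n set" and \<theta> :: "(real,'n) vec \<Rightarrow> ennreal" and A0 :: real
  assumes v: "C1 UNIV v" "\<And>x. x \<notin> K \<Longrightarrow> v x = 0" "\<And>x. dgr q (v x)"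
    and F: "continuous_on W F" "\<And>x. x \<notin> W \<Longrightarrow> F x = 0"
    and F_int: "set_integrable lborel W (\<lambda>x. gB (g x) (F x) (F x))"
    and F_closed: "\<And>b. tform W (Suc q) b \<Longrightarrow> (LINT x|lborel. F x \<bullet> cod b x) = 0"
    and nakano: "\<And>x a. x \<in> W \<Longrightarrow> dgr q a \<Longrightarrow> curvform A g x a \<ge> 0"
    and theta: "\<And>x a \<delta>. x \<in> W \<Longrightarrow> dgr q a \<Longrightarrow> \<delta> > 0 \<Longrightarrow>
      ennreal ((gB (g x) (F x) a)^2) \<le> \<theta> x * ennreal (curvform A g x a + \<delta>)"
    and A0: "(\<integral>\<^sup>+x\<in>W. \<theta> x \<partial>lebesgue) \<le> ennreal A0" "A0 \<ge> 0"
begin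

text \<open>In Hoermander's scheme of weights this is the middle one, for the q-forms themselves,
  and \<phi> is the last, in which their derivatives are measured. \<open>G2\<close>,
  \<open>G3\<close> are the corresponding metrics; the Hilbert space and the codifferential belong
  to \<open>G2\<close>.\<close>

definition ph2 where "ph2 x = \<phi> x - \<psi> x"
definition G2 where "G2 x = exp (- ph2 x) *\<^sub>R g x"
definition G3 where "G3 x = exp (- \<phi> x) *\<^sub>R g x"
definition A2 where "A2 j x = A j x - pd j ph2 x *\<^sub>R mat 1"

lemma pd_ph2: assumes "x \<in> W" shows "pd j ph2 x = pd j \<phi> x - pd j \<psi> x"
  unfolding ph2_def[abs_def]
  by (rule hpd_imp_pd[OF hpd_diff[OF C1_hpd[OF w.ph(1) assms] C1_hpd[OF w.ps(1) assms]]])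

sublocale c2: metric_connection W G2 A2
  unfolding G2_def[abs_def] A2_def[abs_def]
proof (rule conn_weight)
  show "metric_connection W g A" by unfold_locales
  show "C1 W ph2" unfolding ph2_def[abs_def] by (intro C1_diff w.ph(1) w.ps(1))
  show "C1 W (pd j ph2)" for j
    by (rule C1_cong[OF w.oW pd_ph2 C1_diff[OF w.ph(2) w.ps(2)]])
qed

sublocale wf: weighted_forms W G2
  by unfold_locales (use w.oW C1_cont[OF c2.G] c2.pG in auto)

lemma G3_cont: "continuous_on W G3"
  unfolding G3_def[abs_def] by (intro continuous_intros C1_cont[OF w.ph(1)] C1_cont[OF m.G])

lemma G3_pos: "x \<in> W \<Longrightarrow> posdef (G3 x)"
  unfolding G3_def by (rule posdef_scaleR[OF m.pG]) auto

lemma ph2_nonneg: "x \<in> W \<Longrightarrow> 0 \<le> ph2 x" and ph2_phi: "x \<in> W \<Longrightarrow> \<phi> x \<le> 2 * ph2 x" and ph2_le: "x \<in> W \<Longrightarrow> ph2 x \<le> \<phi> x"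
  using w.psi_nonneg[of x] w.phi_psi[of x] by (auto simp: ph2_def)

lemma G3_G2: "x \<in> W \<Longrightarrow> gB (G3 x) a a \<le> gB (wf.Gx x) a a"
  unfolding wf.Gx_def G2_def G3_def using ph2_le[of x] gB_nonneg[OF m.pG, of x a]
  by (simp add: gB_scaleR mult_right_mono)

lemma HF: "wf.H F"
  unfolding wf.H_def
proof
  have "F = (\<lambda>x. if x \<in> W then F x else 0)" using F(2) by auto
  also have "\<dots> \<in> borel_measurable borel"
    by (rule borel_measurable_continuous_on_if) (use F(1) w.oW in auto)
  finally show mF [measurable]: "F \<in> borel_measurable borel" .
  show "integrable lborel (\<lambda>x. gB (wf.Gx x) (F x) (F x))"
  proof (rule Bochner_Integration.integrable_bound[OF F_int[unfolded set_integrable_def]])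
    have "norm (gB (wf.Gx x) (F x) (F x)) \<le> norm (indicator W x *\<^sub>R gB (g x) (F x) (F x))" for x
    proof (cases "x \<in> W")
      case True
      then have "exp (- ph2 x) * gB (g x) (F x) (F x) \<le> 1 * gB (g x) (F x) (F x)"
        by (intro mult_right_mono gB_nonneg m.pG) (auto simp: ph2_nonneg)
      then show ?thesis using True gB_nonneg[OF m.pG[OF True], of "F x"]
        by (simp add: wf.Gx_def G2_def gB_scaleR abs_mult)
    qed (simp add: F(2) gB_zero_left)
    then show "AE x in lborel. norm (gB (wf.Gx x) (F x) (F x)) \<le> norm (indicator W x *\<^sub>R gB (g x) (F x) (F x))" by simp
  qed measurable
qed

lemma cv: "cform W v"
  unfolding cform_def using v(1,2) w.K by blast

definition \<alpha> where "\<alpha> x = mact (matrix_inv (wf.Gx x)) (v x)"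

lemma gB_\<alpha>: "gB (wf.Gx x) (\<alpha> x) b = v x \<bullet> b"
proof -
  have "gB (wf.Gx x) (\<alpha> x) b = gB (wf.Gx x) b (\<alpha> x)" by (rule gB_commute[OF wf.Gx_pos])
  also have "\<dots> = b \<bullet> v x" by (simp add: gB_def \<alpha>_def mact_mact posdef_inv[OF wf.Gx_pos])
  finally show ?thesis by (simp add: inner_commute)
qed

lemma H\<alpha>: "wf.H \<alpha>"
proof -
  have "continuous_on W (\<lambda>x. mact (matrix_inv (G2 x)) (v x))"
    by (intro continuous_on_mact continuous_on_matrix_inv C1_cont[OF c2.G] c2.pG continuous_on_subset[OF C1_cont[OF v(1)]]) auto
  then have "continuous_on W \<alpha>"
    by (rule iffD1[OF continuous_on_cong[OF refl], rotated]) (simp add: \<alpha>_def wf.Gx_def)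
  then show ?thesis by (rule wf.H_cont[OF _ w.K]) (simp add: \<alpha>_def v(2) mact_zero_right)
qed

text \<open>The squared norm of the codifferential of \<alpha>. Since both weights vanish on
  \<open>K\<close>, which contains the support of \<open>cod v\<close>, it does not change with the
  metric; a bound by it is therefore a bound in the original metric.\<close>

definition energy where "energy = (LINT x|lborel. cod v x \<bullet> mact (matrix_inv (wf.Gx x)) (cod v x))"

lemma cod_v_outside: "x \<notin> K \<Longrightarrow> cod v x = 0"
  by (rule support_dext_cod(2)[OF w.K(1) v(2)])

text \<open>d commutes with mollification, and a is weakly closed, so only the derivative of the
  cut-off survives. As a has no pointwise derivatives, this is read off from weak closedness by
  testing with a form built from the kernel at the fixed point x. Both sides have degree q + 1,
  hence testing with vectors \<open>b\<close> of that degree is enough.\<close>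

lemma mollified_dext:
  assumes a1: "wf.H a" "\<And>x. dgr q (a x)" "\<And>b. tform W (Suc q) b \<Longrightarrow> (LINT x|lborel. a x \<bullet> cod b x) = 0"
    and mo: "mollifier s \<rho>"
    and iw: "integrable lborel (\<lambda>y. \<eta> n y *\<^sub>R a y)" and iw1: "integrable lborel (\<lambda>y. \<Sum>i\<in>UNIV. pd i (\<eta> n) y *\<^sub>R wdg i (a y))"
  shows "dext (conv \<rho> (\<lambda>y. \<eta> n y *\<^sub>R a y)) x = conv \<rho> (\<lambda>y. \<Sum>i\<in>UNIV. pd i (\<eta> n) y *\<^sub>R wdg i (a y)) x"
proof -
  let ?w = "\<lambda>y. \<eta> n y *\<^sub>R a y" and ?w1 = "\<lambda>y. \<Sum>i\<in>UNIV. pd i (\<eta> n) y *\<^sub>R wdg i (a y)"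
  have r: "C1 UNIV \<rho>" "\<And>x. x \<notin> cball 0 s \<Longrightarrow> \<rho> x = 0" using mo by (auto simp: mollifier_def)
  obtain M where M: "\<And>x. norm (\<rho> x) \<le> M" by (rule mollifier_bounded[OF mo]) blast
  obtain N where N: "\<And>i x. norm (pd i \<rho> x) \<le> N i" using mollifier_pd_bounded[OF mo] by blast
  have pw: "pd i (conv \<rho> ?w) = conv (pd i \<rho>) ?w" for i
    by (rule conv_pd[OF r(1) compact_cball[of 0 s] _ iw]) (rule r(2))
  have i1: "integrable lborel (\<lambda>y. pd i \<rho> (x - y) *\<^sub>R ?w y)" for i
    by (rule conv_integrand_integrable[OF C1_cont_pd[OF r(1)] N iw])
  have i2: "integrable lborel (\<lambda>y. \<rho> (x - y) *\<^sub>R ?w1 y)"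
    by (rule conv_integrand_integrable[OF C1_cont[OF r(1)] M iw1])
  have d1: "dgr (Suc q) (dext (conv \<rho> ?w) x)"
  proof -
    have "dgr q (pd i (conv \<rho> ?w) x)" for i unfolding pw
      by (rule dgr_conv[OF i1]) (use a1(2) in \<open>simp add: dgr_def\<close>)
    then have "dgr (Suc q) (wdg i (pd i (conv \<rho> ?w) x))" for i by (rule dgr_wdg)
    then show ?thesis unfolding dext_def dgr_def by simp
  qed
  have d2: "dgr (Suc q) (conv \<rho> ?w1 x)"
    by (rule dgr_conv[OF i2]) (use dgr_wdg[OF a1(2)] in \<open>simp add: dgr_def\<close>)
  have eq: "dext (conv \<rho> ?w) x \<bullet> b = conv \<rho> ?w1 x \<bullet> b" if b: "dgr (Suc q) b" for b
  proof -
    \<comment> \<open>The product rule on this test form produces the derivative of the kernel,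
      which gives d of the convolution, and the derivative of the cut-off.\<close>
    define \<beta> where "\<beta> y = (\<eta> n y * \<rho> (x - y)) *\<^sub>R b" for y
    have hr: "hpd i (\<lambda>y. \<rho> (x - y)) (- pd i \<rho> (x - y)) y" for i y
      by (rule hpd_reflect[OF C1_hpd[OF r(1) UNIV_I]])
    have h\<beta>: "hpd i \<beta> ((\<eta> n y * (- pd i \<rho> (x - y)) + pd i (\<eta> n) y * \<rho> (x - y)) *\<^sub>R b) y" for i y
      unfolding \<beta>_def[abs_def]
      by (rule hpd_linear[OF bounded_linear_scaleR_left hpd_bilinear[OF bounded_bilinear_mult C1_hpd[OF w.eta(1) UNIV_I] hr]])
    have ce: "continuous_on UNIV (\<eta> n)" "continuous_on UNIV (pd i (\<eta> n))" for i
      using C1_cont[OF w.eta(1)] C1_cont_pd[OF w.eta(1)] by auto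
    have cr: "continuous_on UNIV (\<lambda>y. \<rho> (x - y))" "continuous_on UNIV (\<lambda>y. pd i \<rho> (x - y))" for i
      by (rule continuous_on_compose2[OF C1_cont[OF r(1)]] continuous_on_compose2[OF C1_cont_pd[OF r(1)]]; auto intro!: continuous_intros)+
    have "C1 UNIV \<beta>"
    proof (rule C1I)
      show "continuous_on UNIV \<beta>" unfolding \<beta>_def[abs_def] by (intro continuous_intros ce cr)
      show "continuous_on UNIV (\<lambda>y. (\<eta> n y * (- pd i \<rho> (x - y)) + pd i (\<eta> n) y * \<rho> (x - y)) *\<^sub>R b)" for i
        by (intro continuous_intros ce cr)
    qed (rule h\<beta>)
    then have t: "tform W (Suc q) \<beta>"
      unfolding tform_def cform_def using w.eta(2)[of n] w.eta(3)[of n] w.eta(4)[of _ n] b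
      by (auto simp: \<beta>_def dgr_def intro!: exI[of _ "L n"])
    have cb: "a y \<bullet> cod \<beta> y = (\<Sum>i\<in>UNIV. pd i \<rho> (x - y) * (wdg i (?w y) \<bullet> b)) - \<rho> (x - y) * (?w1 y \<bullet> b)" for y
    proof -
      have t: "a y \<bullet> ctr i b = wdg i (a y) \<bullet> b" for i by (simp only: wdg_ctr_adjoint)
      have "a y \<bullet> cod \<beta> y = (\<Sum>i\<in>UNIV. - ((\<eta> n y * (- pd i \<rho> (x - y)) + pd i (\<eta> n) y * \<rho> (x - y)) * (wdg i (a y) \<bullet> b)))"
        unfolding cod_def hpd_imp_pd[OF h\<beta>] ctr_scaleR inner_minus_right inner_sum_right inner_scaleR_right t sum_negf ..
      also have "\<dots> = (\<Sum>i\<in>UNIV. pd i \<rho> (x - y) * (wdg i (?w y) \<bullet> b) - \<rho> (x - y) * ((pd i (\<eta> n) y *\<^sub>R wdg i (a y)) \<bullet> b))"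
        by (intro sum.cong refl) (simp add: wdg_scaleR algebra_simps)
      finally show ?thesis unfolding sum_subtractf inner_sum_left sum_distrib_left .
    qed
    have iw': "integrable lborel (\<lambda>y. pd i \<rho> (x - y) *\<^sub>R wdg i (?w y))" for i
      using integrable_bounded_linear[OF bl_wdg i1[of i], of i] by (simp add: wdg_scaleR)
    have wc: "wdg i (conv (pd i \<rho>) ?w x) = conv (pd i \<rho>) (\<lambda>y. wdg i (?w y)) x" for i
      unfolding conv_def using integral_bounded_linear[OF bl_wdg i1[of i], of i] by (simp add: wdg_scaleR)
    have "0 = (LINT y|lborel. a y \<bullet> cod \<beta> y)" using a1(3)[OF t] by simp
    also have "\<dots> = (\<Sum>i\<in>UNIV. LINT y|lborel. pd i \<rho> (x - y) * (wdg i (?w y) \<bullet> b)) - (LINT y|lborel. \<rho> (x - y) * (?w1 y \<bullet> b))"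
      unfolding cb using inner_conv(2)[OF iw', of _ b] inner_conv(2)[OF i2, of b] by simp
    also have "\<dots> = dext (conv \<rho> ?w) x \<bullet> b - conv \<rho> ?w1 x \<bullet> b"
      unfolding inner_conv(1)[OF i2] dext_def pw wc inner_sum_left inner_conv(1)[OF iw'] ..
    finally show ?thesis by simp
  qed
  have "dgr (Suc q) (dext (conv \<rho> ?w) x - conv \<rho> ?w1 x)" using d1 d2 by (simp add: dgr_def)
  from eq[OF this] have "(dext (conv \<rho> ?w) x - conv \<rho> ?w1 x) \<bullet> (dext (conv \<rho> ?w) x - conv \<rho> ?w1 x) = 0"
    by (simp add: inner_diff_left)
  then show ?thesis by simp
qed

text \<open>The codifferential has variable coefficients and does not commute with mollification:
  the weak equation sees \<open>A2\<close> at the integration point y, the left-hand side at x. The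
  difference in the last term of \<open>U\<close> is small for a small mollification radius.
  \<open>Ac\<close> cuts \<open>A2\<close> to the support of the cut-off and so makes it
  bounded.\<close>

lemma mollified_codiff:
  assumes a1: "wf.H a" "\<And>u. cform W u \<Longrightarrow> wf.ip a (dext u) = (LINT x|lborel. cod v x \<bullet> u x)"
    and mo: "mollifier s \<rho>" and x: "x \<in> W"
    and iw: "integrable lborel (\<lambda>y. \<eta> n y *\<^sub>R a y)"
    and Ac: "Ac = (\<lambda>i y. if y \<in> L n then A2 i y else 0)"
    and U: "U = (\<lambda>y. (\<eta> n y *\<^sub>R wf.T v y - (\<Sum>i\<in>UNIV. pd i (\<eta> n) y *\<^sub>R ctr i (a y)))
         + (\<Sum>i\<in>UNIV. mact (Ac i y - A2 i x) (ctr i (\<eta> n y *\<^sub>R a y))))" and iU: "integrable lborel U"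
  shows "codiff A2 (conv \<rho> (\<lambda>y. \<eta> n y *\<^sub>R a y)) x = conv \<rho> U x"
proof (rule eq_by_inner)
  fix b :: "real^'r^'n set"
  let ?w = "\<lambda>y. \<eta> n y *\<^sub>R a y"
  have r: "C1 UNIV \<rho>" "\<And>x. x \<notin> cball 0 s \<Longrightarrow> \<rho> x = 0" using mo by (auto simp: mollifier_def)
  obtain M where M: "\<And>x. norm (\<rho> x) \<le> M" by (rule mollifier_bounded[OF mo]) blast
  obtain N where N: "\<And>i x. norm (pd i \<rho> x) \<le> N i" using mollifier_pd_bounded[OF mo] by blast
  have pw: "pd i (conv \<rho> ?w) = conv (pd i \<rho>) ?w" for i
    by (rule conv_pd[OF r(1) compact_cball[of 0 s] _ iw]) (rule r(2))
  have i1: "integrable lborel (\<lambda>y. pd i \<rho> (x - y) *\<^sub>R ?w y)" for i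
    by (rule conv_integrand_integrable[OF C1_cont_pd[OF r(1)] N iw])
  have i0: "integrable lborel (\<lambda>y. \<rho> (x - y) *\<^sub>R ?w y)"
    by (rule conv_integrand_integrable[OF C1_cont[OF r(1)] M iw])
  have i2: "integrable lborel (\<lambda>y. \<rho> (x - y) *\<^sub>R U y)"
    by (rule conv_integrand_integrable[OF C1_cont[OF r(1)] M iU])
  define \<sigma> where "\<sigma> y = \<eta> n y * \<rho> (x - y)" for y
  define Mi where "Mi y = matrix_inv (G2 y)" for y
  \<comment> \<open>The inverse metric turns the pairing with a in \<open>G2\<close> into the
    Euclidean pairing with b; differentiating it brings in \<open>A2\<close> at y.\<close>
  define u0 where "u0 y = \<sigma> y *\<^sub>R mact (Mi y) b" for y
  have hr: "hpd i (\<lambda>y. \<rho> (x - y)) (- pd i \<rho> (x - y)) y" for i y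
    by (rule hpd_reflect[OF C1_hpd[OF r(1) UNIV_I]])
  have h\<sigma>: "hpd i \<sigma> (\<eta> n y * (- pd i \<rho> (x - y)) + pd i (\<eta> n) y * \<rho> (x - y)) y" for i y
    unfolding \<sigma>_def[abs_def] by (rule hpd_bilinear[OF bounded_bilinear_mult C1_hpd[OF w.eta(1) UNIV_I] hr])
  have ce: "continuous_on UNIV (\<eta> n)" "continuous_on UNIV (pd i (\<eta> n))" for i
    using C1_cont[OF w.eta(1)] C1_cont_pd[OF w.eta(1)] by auto
  have cr: "continuous_on UNIV (\<lambda>y. \<rho> (x - y))" "continuous_on UNIV (\<lambda>y. pd i \<rho> (x - y))" for i
    by (rule continuous_on_compose2[OF C1_cont[OF r(1)]] continuous_on_compose2[OF C1_cont_pd[OF r(1)]]; auto intro!: continuous_intros)+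
  have C\<sigma>: "C1 UNIV \<sigma>"
  proof (rule C1I)
    show "continuous_on UNIV \<sigma>" unfolding \<sigma>_def[abs_def] by (intro continuous_intros ce cr)
    show "continuous_on UNIV (\<lambda>y. \<eta> n y * (- pd i \<rho> (x - y)) + pd i (\<eta> n) y * \<rho> (x - y))" for i
      by (intro continuous_intros ce cr)
  qed (rule h\<sigma>)
  have CMi: "C1 W Mi" unfolding Mi_def[abs_def] by (rule C1_matrix_inv[OF w.oW c2.G c2.pG])
  have Cu0: "C1 W u0" unfolding u0_def[abs_def]
    by (intro C1_bilinear[OF bounded_bilinear_scaleR] C1_mact CMi C1_const C1_subset[OF C\<sigma>]) simp
  have u00: "u0 y = 0" if "y \<notin> L n" for y using w.eta(4)[OF that] by (simp add: u0_def \<sigma>_def)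
  define u where "u y = (if y \<in> L n then u0 y else 0)" for y
  have uu: "u = u0" using u00 by (auto simp: u_def)
  note ext = C1_extend[OF w.oW Cu0 compact_imp_closed[OF w.eta(2)] w.eta(3)[of n] u00, folded u_def[abs_def]]
  have Cu: "C1 UNIV u" using ext(1) by simp
  have cu: "cform W u" unfolding cform_def using Cu w.eta(2,3)[of n] by (auto simp: u_def)
  have pMi: "hpd i Mi (- (A2 i y ** Mi y)) y" if y: "y \<in> W" for i y
  proof -
    have "hpd i Mi (- (Mi y ** pd i G2 y ** Mi y)) y"
      unfolding Mi_def[abs_def] by (rule hpd_matrix_inv[OF w.oW c2.G c2.pG y])
    moreover have "Mi y ** pd i G2 y ** Mi y = (Mi y ** G2 y) ** A2 i y ** Mi y"
      by (simp add: c2.GA[OF y] matrix_mul_assoc)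
    ultimately show ?thesis by (simp add: Mi_def posdef_inv[OF c2.pG[OF y]])
  qed
  have pu: "pd i u y = (\<eta> n y * (- pd i \<rho> (x - y)) + pd i (\<eta> n) y * \<rho> (x - y)) *\<^sub>R mact (Mi y) b - \<sigma> y *\<^sub>R mact (A2 i y) (mact (Mi y) b)"
    if y: "y \<in> W" for i y
  proof -
    have "hpd i u0 (\<sigma> y *\<^sub>R mact (- (A2 i y ** Mi y)) b
       + (\<eta> n y * (- pd i \<rho> (x - y)) + pd i (\<eta> n) y * \<rho> (x - y)) *\<^sub>R mact (Mi y) b) y"
      unfolding u0_def[abs_def]
      using hpd_bilinear[OF bounded_bilinear_scaleR h\<sigma>[of i y] hpd_linear[OF bounded_bilinear.bounded_linear_left[OF bounded_bilinear_mact, of b] pMi[OF y]]] .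
    from hpd_imp_pd[OF this] show ?thesis unfolding uu by (simp add: mact_minus_left mact_mact)
  qed
  have gx: "wf.Gx y = G2 y" if "y \<in> W" for y using that by (simp add: wf.Gx_def)
  have g1: "gB (G2 y) c (mact (Mi y) b) = c \<bullet> b" if "y \<in> W" for c y
    by (simp add: gB_def mact_mact Mi_def posdef_inv[OF c2.pG[OF that]])
  have gw: "gB (G2 y) (a y) (wdg i z) = gB (G2 y) (ctr i (a y)) z" if "y \<in> W" for i y z
    by (simp add: gB_def wdg_mact[symmetric] inner_commute[of "a y"] wdg_ctr_adjoint) (simp add: inner_commute)
  have Acy: "\<eta> n y *\<^sub>R mact (Ac i y) z = \<eta> n y *\<^sub>R mact (A2 i y) z" for i y z
    using w.eta(4)[of y n] by (auto simp: Ac)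
  have Tv: "cod v y \<bullet> u y = \<rho> (x - y) * ((\<eta> n y *\<^sub>R wf.T v y) \<bullet> b)" for y
  proof (cases "y \<in> W")
    case True
    have "cod v y \<bullet> mact (Mi y) b = mact (Mi y) (cod v y) \<bullet> b"
      by (simp add: mact_adjoint Mi_def posdef_inv(3)[OF c2.pG[OF True]])
    then show ?thesis unfolding uu u0_def \<sigma>_def wf.T_def gx[OF True] by (simp add: Mi_def mult_ac)
  next
    case False
    then have "y \<notin> L n" using w.eta(3)[of n] by auto
    then show ?thesis using w.eta(4)[of y n] u00[of y] uu by simp
  qed
  have key: "gB (wf.Gx y) (a y) (dext u y)
      = - (\<Sum>i\<in>UNIV. pd i \<rho> (x - y) * (ctr i (?w y) \<bullet> b))
        + \<rho> (x - y) * ((\<Sum>i\<in>UNIV. pd i (\<eta> n) y *\<^sub>R ctr i (a y)) \<bullet> b)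
        - \<rho> (x - y) * ((\<Sum>i\<in>UNIV. mact (Ac i y) (ctr i (?w y))) \<bullet> b)" for y
  proof (cases "y \<in> W")
    case True
    have "gB (wf.Gx y) (a y) (dext u y) = (\<Sum>i\<in>UNIV. gB (G2 y) (ctr i (a y)) (pd i u y))"
      unfolding dext_def gx[OF True] gB_sum_right gw[OF True] ..
    also have "\<dots> = (\<Sum>i\<in>UNIV. (\<eta> n y * (- pd i \<rho> (x - y)) + pd i (\<eta> n) y * \<rho> (x - y)) * (ctr i (a y) \<bullet> b)
        - \<sigma> y * (mact (A2 i y) (ctr i (a y)) \<bullet> b))"
      unfolding pu[OF True] gB_diff_right gB_scaleR_right c2.A_sym[OF True, symmetric] g1[OF True] real_scaleR_def ..
    also have "\<dots> = (\<Sum>i\<in>UNIV. - (pd i \<rho> (x - y) * (ctr i (?w y) \<bullet> b)) + \<rho> (x - y) * ((pd i (\<eta> n) y *\<^sub>R ctr i (a y)) \<bullet> b)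
        - \<rho> (x - y) * ((\<eta> n y *\<^sub>R mact (A2 i y) (ctr i (a y))) \<bullet> b))"
      by (intro sum.cong refl) (simp add: ctr_scaleR \<sigma>_def algebra_simps)
    also have "\<dots> = (\<Sum>i\<in>UNIV. - (pd i \<rho> (x - y) * (ctr i (?w y) \<bullet> b)) + \<rho> (x - y) * ((pd i (\<eta> n) y *\<^sub>R ctr i (a y)) \<bullet> b)
        - \<rho> (x - y) * (mact (Ac i y) (ctr i (?w y)) \<bullet> b))"
      unfolding ctr_scaleR mact_scaleR_right Acy ..
    finally show ?thesis
      unfolding sum_subtractf sum.distrib sum_negf inner_sum_left sum_distrib_left .
  next
    case False
    then have n: "y \<notin> L n" using w.eta(3)[of n] by auto
    have 1: "pd i (\<eta> n) y = 0" for i by (rule pd_eq_0_outside[OF compact_imp_closed[OF w.eta(2)] w.eta(4) n])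
    have 2: "dext u y = 0" by (rule support_dext_cod(1)[OF w.eta(2)[of n] _ n]) (simp add: u_def)
    show ?thesis by (simp add: 1 2 w.eta(4)[OF n] ctr_0 mact_zero_right gB_zero_right)
  qed
  have ic: "integrable lborel (\<lambda>y. pd i \<rho> (x - y) *\<^sub>R ctr i (?w y))" for i
    using integrable_bounded_linear[OF bl_ctr i1[of i], of i] by (simp add: ctr_scaleR)
  have cc: "ctr i (conv (pd i \<rho>) ?w x) = conv (pd i \<rho>) (\<lambda>y. ctr i (?w y)) x" for i
    unfolding conv_def using integral_bounded_linear[OF bl_ctr i1[of i], of i] by (simp add: ctr_scaleR)
  have blm: "bounded_linear (\<lambda>z. ctr i (mact (A2 i x) z))" for i
    by (rule bounded_linear_compose[OF bl_ctr bounded_bilinear.bounded_linear_right[OF bounded_bilinear_mact]])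
  have im: "integrable lborel (\<lambda>y. \<rho> (x - y) *\<^sub>R ctr i (mact (A2 i x) (?w y)))" for i
    using integrable_bounded_linear[OF blm i0, of i] by (simp add: ctr_scaleR mact_scaleR_right)
  have cm: "ctr i (mact (A2 i x) (conv \<rho> ?w x)) = conv \<rho> (\<lambda>y. ctr i (mact (A2 i x) (?w y))) x" for i
    unfolding conv_def using integral_bounded_linear[OF blm i0, of i] by (simp add: ctr_scaleR mact_scaleR_right)
  have lhs: "codiff A2 (conv \<rho> ?w) x \<bullet> b = - (\<Sum>i\<in>UNIV. (LINT y|lborel. pd i \<rho> (x - y) * (ctr i (?w y) \<bullet> b))
      + (LINT y|lborel. \<rho> (x - y) * (ctr i (mact (A2 i x) (?w y)) \<bullet> b)))"
    unfolding codiff_def pw ctr_add cc cm inner_minus_left inner_sum_left inner_add_left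
      inner_conv(1)[OF ic] inner_conv(1)[OF im] ..
  have I1: "integrable lborel (\<lambda>y. pd i \<rho> (x - y) * (ctr i (?w y) \<bullet> b))"
    and I2: "integrable lborel (\<lambda>y. \<rho> (x - y) * (ctr i (mact (A2 i x) (?w y)) \<bullet> b))" for i
    using inner_conv(2)[OF ic] inner_conv(2)[OF im] by blast+
  have I3: "integrable lborel (\<lambda>y. \<rho> (x - y) * (U y \<bullet> b))" by (rule inner_conv(2)[OF i2])
  have pt: "gB (wf.Gx y) (a y) (dext u y) - cod v y \<bullet> u y
     = - (\<Sum>i\<in>UNIV. pd i \<rho> (x - y) * (ctr i (?w y) \<bullet> b) + \<rho> (x - y) * (ctr i (mact (A2 i x) (?w y)) \<bullet> b)) - \<rho> (x - y) * (U y \<bullet> b)" for y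
    unfolding key Tv U
    by (simp add: inner_add_left inner_diff_left inner_sum_left sum_distrib_left sum.distrib sum_subtractf mact_diff_left ctr_mact algebra_simps)
  have iL: "integrable lborel (\<lambda>y. gB (wf.Gx y) (a y) (dext u y))" by (rule wf.B_integrable[OF a1(1) wf.H_dext[OF cu]])
  have iR: "integrable lborel (\<lambda>y. cod v y \<bullet> u y)"
    by (rule continuous_compact_support_integrable[OF continuous_on_inner[OF continuous_cod[OF v(1)] C1_cont[OF Cu]] w.K(1)])
       (simp add: cod_v_outside)
  have "0 = (LINT y|lborel. gB (wf.Gx y) (a y) (dext u y) - cod v y \<bullet> u y)"
    using a1(2)[OF cu] Bochner_Integration.integral_diff[OF iL iR] by (simp add: wf.ip_def)
  also have "\<dots> = codiff A2 (conv \<rho> ?w) x \<bullet> b - conv \<rho> U x \<bullet> b"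
    unfolding pt lhs inner_conv(1)[OF i2] using I1 I2 I3 by simp
  finally show "codiff A2 (conv \<rho> ?w) x \<bullet> b = conv \<rho> U x \<bullet> b" by simp
qed

end

lemma integrable_mact_bounded:
  fixes z :: "real^'n::finite \<Rightarrow> real^'r::finite^'m::finite set"
  assumes M: "M \<in> borel_measurable borel" "\<And>y. norm (M y) \<le> B" and z: "integrable lborel z"
  shows "integrable lborel (\<lambda>y. mact (M y) (z y))"
proof -
  obtain k where k: "k \<ge> 0" "\<And>(a::real^'r^'r) (b::real^'r^'m set). norm (mact a b) \<le> norm a * norm b * k"
    using bounded_bilinear.nonneg_bounded[OF bounded_bilinear_mact] by blast
  show ?thesis
  proof (rule Bochner_Integration.integrable_bound[where f="\<lambda>y. (B * k) * norm (z y)"])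
    show "integrable lborel (\<lambda>y. (B * k) * norm (z y))" using z by simp
    have "norm (mact (M y) (z y)) \<le> norm ((B * k) * norm (z y))" for y
    proof -
      have "norm (mact (M y) (z y)) \<le> norm (M y) * norm (z y) * k" by (rule k(2))
      also have "\<dots> \<le> B * norm (z y) * k" by (intro mult_right_mono M(2) k(1)) simp
      finally show ?thesis by (simp add: mult_ac)
    qed
    then show "AE y in lborel. norm (mact (M y) (z y)) \<le> norm ((B * k) * norm (z y))" by simp
    show "(\<lambda>y. mact (M y) (z y)) \<in> borel_measurable lborel"
      using measurable_mact[OF M(1)] borel_measurable_integrable[OF z] by simp
  qed
qed

section \<open>Cut-offs of the projection and their limit\<close>

context core_estimate
begin

definition G3x where "G3x x = (if x \<in> W then G3 x else mat 1)"

lemma G3x_meas [measurable]: "G3x \<in> borel_measurable borel"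
  unfolding G3x_def[abs_def] by (rule borel_measurable_continuous_on_if) (auto simp: G3_cont w.oW)

lemma G3x_pos: "posdef (G3x x)"
  by (simp add: G3x_def G3_pos posdef_mat_1)

lemma G3x_le: "gB (G3x x) a a \<le> gB (wf.Gx x) a a"
  using G3_G2[of x a] by (simp add: G3x_def wf.Gx_def)

lemma G3x_integrable: "wf.H z \<Longrightarrow> integrable lborel (\<lambda>x. gB (G3x x) (z x) (z x))"
proof (rule Bochner_Integration.integrable_bound[OF wf.H_int])
  assume z: "wf.H z"
  then show "wf.H z" .
  have [measurable]: "z \<in> borel_measurable borel" by (rule wf.H_meas[OF z])
  show "(\<lambda>x. gB (G3x x) (z x) (z x)) \<in> borel_measurable lborel" by measurable
  have "norm (gB (G3x x) (z x) (z x)) \<le> norm (gB (wf.Gx x) (z x) (z x))" for x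
    using G3x_le[of x "z x"] gB_nonneg[OF G3x_pos, of x "z x"] by simp
  then show "AE x in lborel. norm (gB (G3x x) (z x) (z x)) \<le> norm (gB (wf.Gx x) (z x) (z x))" by simp
qed

lemma eta_meas [measurable]: "\<eta> n \<in> borel_measurable borel" "pd i (\<eta> n) \<in> borel_measurable borel"
  using C1_cont[OF w.eta(1)[of n]] C1_cont_pd[OF w.eta(1)[of n]] by (auto intro: borel_measurable_continuous_onI)

lemma pd_eta_outside: assumes "x \<notin> L n" shows "pd i (\<eta> n) x = 0"
  by (rule pd_eq_0_outside[OF compact_imp_closed[OF w.eta(2)] _ assms]) (rule w.eta(4))

lemma pd_eta_bounded: "\<exists>M. \<forall>i x. (pd i (\<eta> n) x)^2 \<le> M i"
proof -
  have "\<exists>M. \<forall>x. (pd i (\<eta> n) x)^2 \<le> M" for i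
  proof -
    obtain M where M: "M > 0" "\<And>x. norm (pd i (\<eta> n) x) \<le> M"
      by (rule continuous_compact_support_bounded[OF C1_cont_pd[OF w.eta(1)[of n]] w.eta(2)[of n]])
         (use pd_eta_outside in auto)
    have "(pd i (\<eta> n) x)^2 \<le> M^2" for x
      using power_mono[OF M(2) norm_ge_zero, of x 2] by simp
    then show ?thesis by blast
  qed
  then have "\<forall>i. \<exists>M. \<forall>x. (pd i (\<eta> n) x)^2 \<le> M" by blast
  from choice[OF this] show ?thesis .
qed

lemma grad_forms_le:
  fixes M :: "real^'r^'r" and c :: "'n \<Rightarrow> real" and a :: "real^'r^'n set"
  assumes "posdef M"
  shows "gB M (\<Sum>i\<in>UNIV. c i *\<^sub>R wdg i a) (\<Sum>i\<in>UNIV. c i *\<^sub>R wdg i a) \<le> real CARD('n) * (\<Sum>i\<in>UNIV. (c i)^2) * gB M a a"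
    and "gB M (\<Sum>i\<in>UNIV. c i *\<^sub>R ctr i a) (\<Sum>i\<in>UNIV. c i *\<^sub>R ctr i a) \<le> real CARD('n) * (\<Sum>i\<in>UNIV. (c i)^2) * gB M a a"
proof -
  have 1: "gB M (c i *\<^sub>R wdg i a) (c i *\<^sub>R wdg i a) \<le> (c i)^2 * gB M a a"
    "gB M (c i *\<^sub>R ctr i a) (c i *\<^sub>R ctr i a) \<le> (c i)^2 * gB M a a" for i
    using mult_left_mono[OF gB_ctr_wdg_le(2)[OF assms, of i a], of "(c i)^2"]
      mult_left_mono[OF gB_ctr_wdg_le(1)[OF assms, of i a], of "(c i)^2"]
    by (simp_all add: gB_scaleR_left gB_scaleR_right power2_eq_square mult.assoc)
  have "(\<Sum>i\<in>UNIV. gB M (c i *\<^sub>R wdg i a) (c i *\<^sub>R wdg i a)) \<le> (\<Sum>i\<in>UNIV. (c i)^2) * gB M a a"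
    "(\<Sum>i\<in>UNIV. gB M (c i *\<^sub>R ctr i a) (c i *\<^sub>R ctr i a)) \<le> (\<Sum>i\<in>UNIV. (c i)^2) * gB M a a"
    unfolding sum_distrib_right by (intro sum_mono 1)+
  then show "gB M (\<Sum>i\<in>UNIV. c i *\<^sub>R wdg i a) (\<Sum>i\<in>UNIV. c i *\<^sub>R wdg i a) \<le> real CARD('n) * (\<Sum>i\<in>UNIV. (c i)^2) * gB M a a"
    "gB M (\<Sum>i\<in>UNIV. c i *\<^sub>R ctr i a) (\<Sum>i\<in>UNIV. c i *\<^sub>R ctr i a) \<le> real CARD('n) * (\<Sum>i\<in>UNIV. (c i)^2) * gB M a a"
    using gB_sum_le[OF assms, of "\<lambda>i. c i *\<^sub>R wdg i a"] gB_sum_le[OF assms, of "\<lambda>i. c i *\<^sub>R ctr i a"]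
    by (auto simp: mult.assoc elim!: order_trans intro!: mult_left_mono)
qed

lemma cutoff_H:
  assumes a: "wf.H a"
  shows "wf.H (\<lambda>y. \<eta> n y *\<^sub>R a y)" "wf.H (\<lambda>y. \<Sum>i\<in>UNIV. pd i (\<eta> n) y *\<^sub>R wdg i (a y))"
    "wf.H (\<lambda>y. \<Sum>i\<in>UNIV. pd i (\<eta> n) y *\<^sub>R ctr i (a y))"
proof -
  have [measurable]: "a \<in> borel_measurable borel" by (rule wf.H_meas[OF a])
  obtain M where M: "\<And>i x. (pd i (\<eta> n) x)^2 \<le> M i" using pd_eta_bounded[of n] by blast
  have s: "real CARD('n) * (\<Sum>i\<in>UNIV. (pd i (\<eta> n) x)^2) * gB (wf.Gx x) (a x) (a x)
      \<le> real CARD('n) * (\<Sum>i\<in>UNIV. M i) * gB (wf.Gx x) (a x) (a x)" for x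
    by (intro mult_right_mono mult_left_mono sum_mono M wf.B_nonneg) simp
  show "wf.H (\<lambda>y. \<eta> n y *\<^sub>R a y)"
  proof (rule wf.H_dominated[OF _ a, of _ 1])
    have "(\<eta> n x)^2 * gB (wf.Gx x) (a x) (a x) \<le> 1 * gB (wf.Gx x) (a x) (a x)" for x
      by (intro mult_right_mono wf.B_nonneg power_le_one) (use w.eta(5) in auto)
    then show "gB (wf.Gx x) (\<eta> n x *\<^sub>R a x) (\<eta> n x *\<^sub>R a x) \<le> 1 * gB (wf.Gx x) (a x) (a x)" for x
      by (simp add: gB_scaleR_left gB_scaleR_right power2_eq_square mult.assoc)
  qed measurable
  show "wf.H (\<lambda>y. \<Sum>i\<in>UNIV. pd i (\<eta> n) y *\<^sub>R wdg i (a y))"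
    by (rule wf.H_dominated[OF _ a], measurable) (rule order_trans[OF grad_forms_le(1)[OF wf.Gx_pos] s])
  show "wf.H (\<lambda>y. \<Sum>i\<in>UNIV. pd i (\<eta> n) y *\<^sub>R ctr i (a y))"
    by (rule wf.H_dominated[OF _ a], measurable) (rule order_trans[OF grad_forms_le(2)[OF wf.Gx_pos] s])
qed

text \<open>\<open>w1\<close> and \<open>w2\<close> are the weak exterior derivative and
  codifferential of \<eta>_n a. Its mollifications are C2 with compact support, so
  \<open>weighted_basic_estimate\<close> and the Cauchy-Schwarz inequality for the curvature form
  apply to them; letting the radius tend to 0 gives the bound for \<eta>_n a itself.\<close>

lemma cutoff_bound:
  fixes n :: nat
  assumes a: "wf.H a" "\<And>x. dgr q (a x)" "\<And>b. tform W (Suc q) b \<Longrightarrow> (LINT x|lborel. a x \<bullet> cod b x) = 0"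
    "\<And>u. cform W u \<Longrightarrow> wf.ip a (dext u) = (LINT x|lborel. cod v x \<bullet> u x)"
  defines "w1 \<equiv> \<lambda>y. \<Sum>i\<in>UNIV. pd i (\<eta> n) y *\<^sub>R wdg i (a y)"
    and "w2 \<equiv> \<lambda>y. \<eta> n y *\<^sub>R wf.T v y - (\<Sum>i\<in>UNIV. pd i (\<eta> n) y *\<^sub>R ctr i (a y))"
  shows "(LINT x|lborel. \<eta> n x * gB (wf.Gx x) (F x) (a x))^2
     \<le> A0 * ((1 + e) * (LINT x|lborel. gB (G3x x) (w2 x) (w2 x)) + (LINT x|lborel. gB (G3x x) (w1 x) (w1 x)))"
proof -
  define ww where "ww y = \<eta> n y *\<^sub>R a y" for y
  have Hw: "wf.H ww" unfolding ww_def[abs_def] by (rule cutoff_H(1)[OF a(1)])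
  have Hw1: "wf.H w1" unfolding w1_def by (rule cutoff_H(2)[OF a(1)])
  have Hw2: "wf.H w2" unfolding w2_def by (rule wf.H_diff[OF cutoff_H(1)[OF wf.H_T[OF cv]] cutoff_H(3)[OF a(1)]])
  have out: "ww y = 0" "w1 y = 0" "w2 y = 0" if "y \<notin> L n" for y
    using w.eta(4)[OF that] pd_eta_outside[OF that] by (simp_all add: ww_def w1_def w2_def)
  have iw: "integrable lborel ww" "integrable lborel w1" "integrable lborel w2"
    by (rule wf.H_integrable[OF _ w.eta(2)[of n] w.eta(3)[of n]]; use Hw Hw1 Hw2 out in blast)+
  obtain r where r: "r > 0" "(\<Union>x\<in>L n. cball x r) \<subseteq> W"
    by (rule compact_subset_open_imp_cball_epsilon_subset[OF w.eta(2)[of n] w.oW w.eta(3)[of n]])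
  \<comment> \<open>A neighbourhood of the support of the cut-off, still inside \<open>W\<close>;
    for radii below \<open>r\<close> it contains the support of the mollified form.\<close>
  define K2 where "K2 = (\<Union>x\<in>L n. cball x r)"
  have K2: "compact K2" "K2 \<subseteq> W" unfolding K2_def using r by (auto intro: compact_minkowski_sum_cball w.eta(2))
  have nK2: "x \<in> K2" if "y \<in> L n" "norm (x - y) < r" for x y
    using that by (auto simp: K2_def dist_norm norm_minus_commute intro!: bexI[of _ y])
  have LK2: "L n \<subseteq> K2" using nK2[of x x for x] r(1) by auto
  note cK = continuous_on_subset[OF _ K2(2)]
  have cA2: "continuous_on K2 (A2 i)" for i by (rule cK[OF C1_cont[OF c2.A]])
  have cG3: "continuous_on K2 G3" by (rule cK[OF G3_cont])
  have pG3: "posdef (G3 x)" if "x \<in> K2" for x using that K2(2) G3_pos by blast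
  \<comment> \<open>The error from moving the connection matrices from x to y, in the form that
    \<open>near_diagonal\<close> handles.\<close>
  define E where "E x y z = (\<Sum>i\<in>UNIV. mact (A2 i y - A2 i x) (ctr i z))" for x y and z :: "real^'r^'n set"
  have cE: "continuous_on (K2 \<times> K2 \<times> UNIV) (\<lambda>(x, y, z). E x y z)"
  proof -
    have "continuous_on (K2 \<times> K2 \<times> UNIV) (\<lambda>p. A2 i (fst (snd p)))" "continuous_on (K2 \<times> K2 \<times> UNIV) (\<lambda>p. A2 i (fst p))" for i
      by (rule continuous_on_compose2[OF cA2]; auto intro!: continuous_intros)+
    then show ?thesis unfolding E_def split_beta' by (intro continuous_intros)
  qed
  have E0: "E x x z = 0" "E x y (c *\<^sub>R z) = c *\<^sub>R E x y z" "E x y 0 = 0" for x y c z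
    by (simp_all add: E_def mact_zero_left mact_zero_right ctr_0 ctr_scaleR mact_scaleR_right scaleR_sum_right)
  define N1 where "N1 = (LINT x|lborel. gB (G3x x) (w1 x) (w1 x))"
  define N2 where "N2 = (LINT x|lborel. gB (G3x x) (w2 x) (w2 x))"
  define Nw where "Nw = (LINT x|lborel. gB (G3x x) (ww x) (ww x))"
  define I where "I = (LINT x|lborel. \<eta> n x * gB (wf.Gx x) (F x) (a x))"
  \<comment> \<open>With the metric applied to F, the pairing in \<open>G2\<close> becomes the
    Euclidean one of \<open>conv_weak_limit\<close>.\<close>
  define v' where "v' x = mact (G2 x) (F x)" for x
  have cv': "continuous_on K2 v'" unfolding v'_def[abs_def]
    by (intro continuous_intros cK[OF C1_cont[OF c2.G]] cK[OF F(1)])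
  have I: "(LINT x:L n|lborel. v' x \<bullet> ww x) = I"
    unfolding I_def set_lebesgue_integral_def
  proof (rule Bochner_Integration.integral_cong[OF refl])
    fix x
    show "indicator (L n) x *\<^sub>R (v' x \<bullet> ww x) = \<eta> n x * gB (wf.Gx x) (F x) (a x)"
    proof (cases "x \<in> L n")
      case True
      then have x: "x \<in> W" using w.eta(3)[of n] by auto
      have "v' x \<bullet> ww x = \<eta> n x * gB (G2 x) (a x) (F x)" by (simp add: v'_def ww_def gB_def inner_commute)
      then show ?thesis using True x gB_commute[OF c2.pG[OF x], of "a x" "F x"] by (simp add: wf.Gx_def)
    qed (use w.eta(4) in simp)
  qed
  \<comment> \<open>\<open>X\<close> is the pairing of F with a mollification whose radius is small
    enough for both \<open>near_diagonal\<close> and \<open>conv_weak_limit\<close> at tolerance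
    \<kappa>.\<close>
  have main: "\<exists>X. X^2 \<le> A0 * ((1 + e) * ((1 + \<kappa>) * N2 + \<kappa> * Nw) + (1 + \<kappa>) * N1) \<and> \<bar>X - I\<bar> \<le> \<kappa>" if k: "\<kappa> > 0" for \<kappa>
  proof -
    obtain \<delta>1 where d1: "\<delta>1 > 0" "\<And>x y w z. x \<in> K2 \<Longrightarrow> y \<in> K2 \<Longrightarrow> dist x y < \<delta>1 \<Longrightarrow>
        gB (G3 x) (w + E x y z) (w + E x y z) \<le> (1 + \<kappa>) * gB (G3 y) w w + \<kappa> * gB (G3 y) z z"
    proof (rule near_diagonal[OF K2(1) cG3 pG3 k cE E0(1,2)])
      fix \<delta> assume "\<delta> > 0" "\<And>x y w z. x \<in> K2 \<Longrightarrow> y \<in> K2 \<Longrightarrow> dist x y < \<delta> \<Longrightarrow>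
        gB (G3 x) (w + E x y z) (w + E x y z) \<le> (1 + \<kappa>) * gB (G3 y) w w + \<kappa> * gB (G3 y) z z"
      then show thesis by (rule that)
    qed
    obtain \<delta>3 where d3: "\<delta>3 > 0" "\<And>s \<rho>. s < \<delta>3 \<Longrightarrow> mollifier s \<rho> \<Longrightarrow>
        \<bar>(LINT x:K2|lborel. v' x \<bullet> conv \<rho> ww x) - (LINT x:L n|lborel. v' x \<bullet> ww x)\<bar> \<le> \<kappa>"
    proof (rule conv_weak_limit[OF K2(1) cv' iw(1) out(1) w.eta(2)[of n] nK2 r(1) k])
      fix \<delta> assume "\<delta> > 0" "\<And>s \<rho>. s < \<delta> \<Longrightarrow> mollifier s \<rho> \<Longrightarrow>
        \<bar>(LINT x:K2|lborel. v' x \<bullet> conv \<rho> ww x) - (LINT x:L n|lborel. v' x \<bullet> ww x)\<bar> \<le> \<kappa>"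
      then show thesis by (rule that)
    qed
    define s where "s = min \<delta>1 (min \<delta>3 r) / 2"
    have s: "s > 0" "s < \<delta>1" "s < \<delta>3" "s < r" using d1(1) d3(1) r(1) by (auto simp: s_def)
    obtain \<rho> :: "(real,'n) vec \<Rightarrow> real" where mo: "mollifier s \<rho>" using mollifier_exists[OF s(1)] by blast
    have rC: "C1 UNIV \<rho>" "\<And>j. C1 UNIV (pd j \<rho>)" "\<And>i j. pd i (pd j \<rho>) = pd j (pd i \<rho>)" "\<And>x. x \<notin> cball 0 s \<Longrightarrow> \<rho> x = 0"
      using mo by (auto simp: mollifier_def)
    have pr0: "pd i \<rho> x = 0" if "x \<notin> cball 0 s" for i x
      by (rule pd_eq_0_outside[of "cball 0 s"]) (use rC(4) that in auto)
    define c where "c = conv \<rho> ww"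
    have pc: "pd i c = conv (pd i \<rho>) ww" for i unfolding c_def
      by (rule conv_pd[OF rC(1) compact_cball[of 0 s] _ iw(1)]) (rule rC(4))
    have ppc: "pd j (pd i c) = conv (pd j (pd i \<rho>)) ww" for i j unfolding pc
      by (rule conv_pd[OF rC(2) compact_cball[of 0 s] _ iw(1)]) (rule pr0)
    have Cc: "C1 UNIV c" unfolding c_def
      by (rule conv_C1[OF rC(1) compact_cball[of 0 s] _ iw(1)]) (rule rC(4))
    have Cpc: "C1 UNIV (pd i c)" for i unfolding pc
      by (rule conv_C1[OF rC(2) compact_cball[of 0 s] _ iw(1)]) (rule pr0)
    have C2c: "C2 c" unfolding C2_def using Cc Cpc by (auto simp: ppc rC(3))
    have c0: "c x = 0" if "x \<notin> K2" for x
      unfolding c_def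
    proof (rule conv_support[OF mo, of "L n"])
      show "s \<le> norm (x - y)" if "y \<in> L n" for y using nK2[OF that, of x] \<open>x \<notin> K2\<close> s(4) by force
    qed (rule out(1))
    obtain M where M: "\<And>x. norm (\<rho> x) \<le> M" by (rule mollifier_bounded[OF mo]) blast
    have dc: "dgr q (c x)" for x
      unfolding c_def
      by (rule dgr_conv[OF conv_integrand_integrable[OF C1_cont[OF rC(1)] M iw(1)]])
         (use a(2) in \<open>simp add: ww_def dgr_def\<close>)
    have cdc: "continuous_on K2 (dext c)" by (rule continuous_on_subset[OF continuous_dext[OF Cc] subset_UNIV])
    have ccc: "continuous_on K2 (codiff A2 c)"
      unfolding codiff_def[abs_def]
      by (intro continuous_intros cA2 continuous_on_subset[OF C1_cont_pd[OF Cc] subset_UNIV] continuous_on_subset[OF C1_cont[OF Cc] subset_UNIV])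
    have B1: "(LINT x:K2|lborel. gB (G3 x) (dext c x) (dext c x)) \<le> (1 + \<kappa>) * N1"
    proof -
      have "(LINT x:K2|lborel. gB (G3 x) (dext c x) (dext c x)) \<le> integral\<^sup>L lborel (\<lambda>y. (1 + \<kappa>) * gB (G3x y) (w1 y) (w1 y))"
      proof (rule set_integral_gB_conv_le[OF mo K2(1) cG3 pG3 cdc, of "\<lambda>x. w1"])
        show "dext c x = conv \<rho> w1 x" for x
          unfolding c_def ww_def[abs_def] w1_def
          by (rule mollified_dext[OF a(1,2,3) mo iw(1)[unfolded ww_def[abs_def]] iw(2)[unfolded w1_def]])
        show "integrable lborel w1" by (rule iw(2))
        show "integrable lborel (\<lambda>y. (1 + \<kappa>) * gB (G3x y) (w1 y) (w1 y))" by (rule integrable_mult_right[OF G3x_integrable[OF Hw1]])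
        show "(1 + \<kappa>) * gB (G3x y) (w1 y) (w1 y) \<ge> 0" for y using k gB_nonneg[OF G3x_pos, of y "w1 y"] by simp
        show "gB (G3 x) (w1 y) (w1 y) \<le> (1 + \<kappa>) * gB (G3x y) (w1 y) (w1 y)" if "x \<in> K2" "norm (x - y) < s" for x y
        proof (cases "y \<in> L n")
          case True
          have y: "y \<in> K2" "y \<in> W" using True LK2 K2(2) by auto
          have "dist x y < \<delta>1" using that(2) s(2) by (simp add: dist_norm)
          from d1(2)[OF that(1) y(1) this, of "w1 y" 0] show ?thesis
            using y(2) by (simp add: E0(3) gB_zero_left G3x_def)
        qed (simp add: out(2) gB_zero_left)
      qed
      also have "\<dots> = (1 + \<kappa>) * N1" by (simp add: N1_def)
      finally show ?thesis .
    qed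
    define Ac where "Ac i y = (if y \<in> L n then A2 i y else 0)" for i y
    have mAc: "Ac i \<in> borel_measurable borel" for i
      unfolding Ac_def[abs_def]
      by (intro borel_measurable_continuous_on_if borel_compact w.eta(2) continuous_on_const continuous_on_subset[OF cA2 LK2])
    have "\<exists>B. \<forall>y. norm (Ac i y) \<le> B" for i
    proof -
      have "bounded (A2 i ` L n)" by (intro compact_imp_bounded compact_continuous_image w.eta(2) continuous_on_subset[OF cA2 LK2])
      then obtain B where "B > 0" "\<forall>z\<in>A2 i ` L n. norm z \<le> B" unfolding bounded_pos by blast
      then have "norm (Ac i y) \<le> B" for y by (auto simp: Ac_def)
      then show ?thesis by blast
    qed
    then have "\<forall>i. \<exists>B. \<forall>y. norm (Ac i y) \<le> B" by blast
    from choice[OF this] obtain Bc where Bc: "\<And>i y. norm (Ac i y) \<le> Bc i" by blast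
    \<comment> \<open>On the support of the cut-off this is \<open>w2\<close> plus the freezing
      error \<open>E\<close> of \<open>ww\<close> (fact \<open>U1\<close>); off it everything
      vanishes.\<close>
    define U where "U x = (\<lambda>y. (\<eta> n y *\<^sub>R wf.T v y - (\<Sum>i\<in>UNIV. pd i (\<eta> n) y *\<^sub>R ctr i (a y)))
         + (\<Sum>i\<in>UNIV. mact (Ac i y - A2 i x) (ctr i (\<eta> n y *\<^sub>R a y))))" for x
    have iU: "integrable lborel (U x)" for x
    proof -
      have "integrable lborel (\<lambda>y. mact (Ac i y - A2 i x) (ctr i (ww y)))" for i
      proof (rule integrable_mact_bounded[where B="Bc i + norm (A2 i x)"])
        show "(\<lambda>y. Ac i y - A2 i x) \<in> borel_measurable borel" using mAc[of i] by measurable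
        show "norm (Ac i y - A2 i x) \<le> Bc i + norm (A2 i x)" for y
          using norm_triangle_ineq4[of "Ac i y" "A2 i x"] Bc[of i y] by linarith
        show "integrable lborel (\<lambda>y. ctr i (ww y))" by (rule integrable_bounded_linear[OF bl_ctr iw(1)])
      qed
      then have "integrable lborel (\<lambda>y. w2 y + (\<Sum>i\<in>UNIV. mact (Ac i y - A2 i x) (ctr i (ww y))))"
        by (intro Bochner_Integration.integrable_add Bochner_Integration.integrable_sum iw(3))
      then show ?thesis by (simp add: U_def w2_def ww_def)
    qed
    have U1: "U x y = w2 y + E x y (ww y)" if "y \<in> L n" for x y
      using that by (simp add: U_def w2_def ww_def E_def Ac_def)
    have U0: "U x y = 0" if "y \<notin> L n" for x y
      using w.eta(4)[OF that] pd_eta_outside[OF that] by (simp add: U_def ctr_0 mact_zero_right)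
    have B2: "(LINT x:K2|lborel. gB (G3 x) (codiff A2 c x) (codiff A2 c x)) \<le> (1 + \<kappa>) * N2 + \<kappa> * Nw"
    proof -
      have "(LINT x:K2|lborel. gB (G3 x) (codiff A2 c x) (codiff A2 c x))
          \<le> integral\<^sup>L lborel (\<lambda>y. (1 + \<kappa>) * gB (G3x y) (w2 y) (w2 y) + \<kappa> * gB (G3x y) (ww y) (ww y))"
      proof (rule set_integral_gB_conv_le[OF mo K2(1) cG3 pG3 ccc, of U])
        show "codiff A2 c x = conv \<rho> (U x) x" if "x \<in> K2" for x
          unfolding c_def ww_def[abs_def]
          by (rule mollified_codiff[OF a(1,4) mo subsetD[OF K2(2) that] iw(1)[unfolded ww_def[abs_def]] _ U_def iU]) (simp_all add: Ac_def[abs_def])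
        show "integrable lborel (U x)" for x by (rule iU)
        show "integrable lborel (\<lambda>y. (1 + \<kappa>) * gB (G3x y) (w2 y) (w2 y) + \<kappa> * gB (G3x y) (ww y) (ww y))"
          by (intro Bochner_Integration.integrable_add integrable_mult_right G3x_integrable Hw Hw2)
        show "(1 + \<kappa>) * gB (G3x y) (w2 y) (w2 y) + \<kappa> * gB (G3x y) (ww y) (ww y) \<ge> 0" for y
          using k gB_nonneg[OF G3x_pos, of y "w2 y"] gB_nonneg[OF G3x_pos, of y "ww y"] by simp
        show "gB (G3 x) (U x y) (U x y) \<le> (1 + \<kappa>) * gB (G3x y) (w2 y) (w2 y) + \<kappa> * gB (G3x y) (ww y) (ww y)"
          if "x \<in> K2" "norm (x - y) < s" for x y
        proof (cases "y \<in> L n")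
          case True
          have y: "y \<in> K2" "y \<in> W" using True LK2 K2(2) by auto
          have "dist x y < \<delta>1" using that(2) s(2) by (simp add: dist_norm)
          from d1(2)[OF that(1) y(1) this, of "w2 y" "ww y"] show ?thesis
            using y(2) by (simp add: U1[OF True] G3x_def)
        qed (simp add: U0 out gB_zero_left)
      qed
      also have "\<dots> = (1 + \<kappa>) * N2 + \<kappa> * Nw"
        using integrable_mult_right[OF G3x_integrable[OF Hw2], of "1 + \<kappa>"] integrable_mult_right[OF G3x_integrable[OF Hw], of \<kappa>]
        by (simp add: N2_def Nw_def)
      finally show ?thesis .
    qed
    have mc: "metric_connection W g A" by unfold_locales
    have hess: "(1 + 1/e) * gB (g x) (\<Sum>j\<in>UNIV. pd j \<psi> x *\<^sub>R ctr j z) (\<Sum>j\<in>UNIV. pd j \<psi> x *\<^sub>R ctr j z)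
        \<le> (\<Sum>i\<in>UNIV. \<Sum>j\<in>UNIV. pd j (pd i \<phi>) x * gB (g x) (ctr i z) (ctr j z))" if "x \<in> W" for x z
      by (rule w.hess[OF that m.pG[OF that]])
    have cod_eq: "codiff (\<lambda>j x. A j x - (pd j \<phi> x - pd j \<psi> x) *\<^sub>R mat 1) c x = codiff A2 c x" if "x \<in> K2" for x
      using that K2(2) pd_ph2[of x] by (auto simp: codiff_def A2_def)
    have est: "(LINT x:K2|lborel. exp (- \<phi> x) * curvform A g x (c x))
       \<le> (1 + e) * (LINT x:K2|lborel. gB (G3 x) (codiff A2 c x) (codiff A2 c x)) + (LINT x:K2|lborel. gB (G3 x) (dext c x) (dext c x))"
    proof -
      have 1: "(LINT x:K2|lborel. exp (- \<phi> x) * gB (g x) (codiff (\<lambda>j x. A j x - (pd j \<phi> x - pd j \<psi> x) *\<^sub>R mat 1) c x) (codiff (\<lambda>j x. A j x - (pd j \<phi> x - pd j \<psi> x) *\<^sub>R mat 1) c x))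
        = (LINT x:K2|lborel. gB (G3 x) (codiff A2 c x) (codiff A2 c x))"
        by (rule set_lebesgue_integral_cong) (use cod_eq K2(1) in \<open>auto simp: borel_compact G3_def gB_scaleR\<close>)
      have 2: "(LINT x:K2|lborel. exp (- \<phi> x) * gB (g x) (dext c x) (dext c x)) = (LINT x:K2|lborel. gB (G3 x) (dext c x) (dext c x))"
        by (simp add: G3_def gB_scaleR)
      show ?thesis using weighted_basic_estimate[OF mc w.ph w.ps(1) w.e hess K2 C2c c0] unfolding 1 2 .
    qed
    define h where "h x = gB (g x) (F x) (c x)" for x
    define Q where "Q x = curvform A g x (c x)" for x
    define X where "X = (LINT x:K2|lborel. exp (- ph2 x) * h x)"
    have cc: "continuous_on K2 c" by (rule continuous_on_subset[OF C1_cont[OF Cc] subset_UNIV])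
    have cg: "continuous_on K2 g" by (rule cK[OF C1_cont[OF m.G]])
    have cph: "continuous_on K2 \<phi>" "continuous_on K2 ph2"
      using cK[OF C1_cont[OF w.ph(1)]] cK[OF C1_cont[OF w.ps(1)]] by (auto simp: ph2_def[abs_def] intro!: continuous_intros)
    have ch: "continuous_on K2 h" unfolding h_def[abs_def] by (intro continuous_intros cg cK[OF F(1)] cc)
    have cQ: "continuous_on K2 Q" unfolding Q_def[abs_def] curvform_def
      by (intro continuous_intros cg cc cK[OF C1_cont_pd[OF m.A]])
    have Q0: "Q x \<ge> 0" if "x \<in> K2" for x unfolding Q_def by (rule nakano[OF subsetD[OF K2(2) that] dc])
    have cb: "continuous_on K2 (\<lambda>x. exp (- ph2 x))" by (intro continuous_intros cph)
    have "X^2 \<le> A0 * (LINT x:K2|lborel. (exp (- ph2 x))^2 * Q x)"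
      unfolding X_def
    proof (rule dual_form_cauchy_schwarz[OF K2(1) ch cQ Q0 cb])
      show "ennreal ((h x)^2) \<le> \<theta> x * ennreal (Q x + \<delta>)" if "x \<in> K2" "\<delta> > 0" for x \<delta>
        unfolding h_def Q_def by (rule theta[OF subsetD[OF K2(2) that(1)] dc that(2)])
      have "(\<integral>\<^sup>+x\<in>K2. \<theta> x \<partial>lebesgue) \<le> (\<integral>\<^sup>+x\<in>W. \<theta> x \<partial>lebesgue)"
        by (rule nn_integral_mono) (use K2(2) in \<open>auto simp: indicator_def\<close>)
      then show "(\<integral>\<^sup>+x\<in>K2. \<theta> x \<partial>lebesgue) \<le> ennreal A0" using A0(1) by (rule order_trans)
    qed (use A0(2) in auto)
    \<comment> \<open>The pairing carries the weight \<phi> - \<psi>, and Cauchy-Schwarz squares it.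
      Because \<phi> \<le> 2 (\<phi> - \<psi>) and the curvature form is nonnegative, the weight of
      the basic estimate takes over.\<close>
    also have "(LINT x:K2|lborel. (exp (- ph2 x))^2 * Q x) \<le> (LINT x:K2|lborel. exp (- \<phi> x) * Q x)"
    proof (rule set_integral_mono)
      show "set_integrable lborel K2 (\<lambda>x. (exp (- ph2 x))^2 * Q x)"
        by (intro set_integrable_compact[OF K2(1)] continuous_intros cph cQ)
      show "set_integrable lborel K2 (\<lambda>x. exp (- \<phi> x) * Q x)"
        by (intro set_integrable_compact[OF K2(1)] continuous_intros cph cQ)
      show "(exp (- ph2 x))^2 * Q x \<le> exp (- \<phi> x) * Q x" if "x \<in> K2" for x
      proof (rule mult_right_mono[OF _ Q0[OF that]])
        have "(exp (- ph2 x))^2 = exp (- (2 * ph2 x))" by (simp add: power2_eq_square exp_add[symmetric])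
        then show "(exp (- ph2 x))^2 \<le> exp (- \<phi> x)" using ph2_phi[of x] K2(2) that by auto
      qed
    qed
    also have "(LINT x:K2|lborel. exp (- \<phi> x) * Q x) \<le> (1 + e) * ((1 + \<kappa>) * N2 + \<kappa> * Nw) + (1 + \<kappa>) * N1"
      using est B1 mult_left_mono[OF B2, of "1 + e"] w.e unfolding Q_def by linarith
    finally have XX: "X^2 \<le> A0 * ((1 + e) * ((1 + \<kappa>) * N2 + \<kappa> * Nw) + (1 + \<kappa>) * N1)"
      using A0(2) by (auto intro: mult_left_mono)
    have "X = (LINT x:K2|lborel. v' x \<bullet> conv \<rho> ww x)"
      unfolding X_def
    proof (rule set_lebesgue_integral_cong)
      show "K2 \<in> sets lborel" using K2(1) by (simp add: borel_compact)
      show "\<forall>x. x \<in> K2 \<longrightarrow> exp (- ph2 x) * h x = v' x \<bullet> conv \<rho> ww x"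
      proof (intro allI impI)
        fix x assume "x \<in> K2"
        then have x: "x \<in> W" using K2(2) by auto
        show "exp (- ph2 x) * h x = v' x \<bullet> conv \<rho> ww x"
          using gB_commute[OF m.pG[OF x], of "F x" "c x"]
          by (simp add: h_def v'_def G2_def gB_def mact_scaleR_left c_def[symmetric] inner_commute)
      qed
    qed
    then have "\<bar>X - I\<bar> \<le> \<kappa>" using d3(2)[OF s(3) mo] by (simp add: I)
    with XX show ?thesis by blast
  qed
  define R where "R \<kappa> = A0 * ((1 + e) * ((1 + \<kappa>) * N2 + \<kappa> * Nw) + (1 + \<kappa>) * N1)" for \<kappa>
  \<comment> \<open>From |I| \<le> |X| + \<kappa> and 2 |X| \<le> X^2 + 1; the right-hand side is
    continuous in \<kappa>, which then tends to 0.\<close>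
  have "I^2 \<le> (1 + \<kappa>) * R \<kappa> + \<kappa> + \<kappa>^2" if k: "\<kappa> > 0" for \<kappa>
  proof -
    obtain X where X: "X^2 \<le> R \<kappa>" "\<bar>X - I\<bar> \<le> \<kappa>" using main[OF k] by (auto simp: R_def)
    have "\<bar>I\<bar> \<le> \<bar>X\<bar> + \<kappa>" using X(2) by linarith
    then have "\<bar>I\<bar>^2 \<le> (\<bar>X\<bar> + \<kappa>)^2" by (intro power_mono) auto
    then have "I^2 \<le> X^2 + \<kappa> * (2 * \<bar>X\<bar>) + \<kappa>^2" by (simp add: power2_sum algebra_simps)
    moreover have "2 * \<bar>X\<bar> \<le> X^2 + 1" using zero_le_power2[of "\<bar>X\<bar> - 1"] by (simp add: power2_diff)
    ultimately have "I^2 \<le> X^2 + \<kappa> * (X^2 + 1) + \<kappa>^2" using mult_left_mono[of "2 * \<bar>X\<bar>" "X^2 + 1" \<kappa>] k by linarith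
    also have "\<dots> = (1 + \<kappa>) * X^2 + \<kappa> + \<kappa>^2" by (simp add: algebra_simps)
    also have "\<dots> \<le> (1 + \<kappa>) * R \<kappa> + \<kappa> + \<kappa>^2" using mult_left_mono[OF X(1), of "1 + \<kappa>"] k by simp
    finally show ?thesis .
  qed
  then have ev: "\<forall>\<^sub>F \<kappa> in at_right 0. I^2 \<le> (1 + \<kappa>) * R \<kappa> + \<kappa> + \<kappa>^2"
    by (auto simp: eventually_at_filter)
  have "((\<lambda>\<kappa>. (1 + \<kappa>) * R \<kappa> + \<kappa> + \<kappa>^2) \<longlongrightarrow> (1 + 0) * R 0 + 0 + 0^2) (at_right 0)"
    unfolding R_def by (intro tendsto_intros)
  from tendsto_lowerbound[OF this ev] have "I^2 \<le> R 0" by simp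
  then show ?thesis by (simp add: I_def R_def N1_def N2_def)
qed

text \<open>\<open>cutoff_bound\<close> for the closed projection a of \<alpha>, as n grows. The
  terms with derivatives of the cut-offs tend to 0, and the pairing tends to <F, a> = <F, \<alpha>>,
  the integral of F \<bullet> v. One factor 1 + e comes from the basic estimate, the other from
  splitting \<open>w2\<close> into the codifferential and the cut-off term.\<close>

lemma core_bound: "(LINT x|lborel. F x \<bullet> v x)^2 \<le> A0 * ((1 + e) * ((1 + e) * energy))"
proof -
  obtain a where a: "wf.H a" "\<And>x. dgr q (a x)"
    "\<And>b. tform W (Suc q) b \<Longrightarrow> (LINT x|lborel. a x \<bullet> cod b x) = 0"
    "\<And>u. cform W u \<Longrightarrow> wf.ip a (dext u) = wf.ip \<alpha> (dext u)"
    "\<And>F. wf.H F \<Longrightarrow> (\<And>b. tform W (Suc q) b \<Longrightarrow> (LINT x|lborel. F x \<bullet> cod b x) = 0) \<Longrightarrow> wf.ip a F = wf.ip \<alpha> F"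
  proof (rule wf.closed_projection[OF H\<alpha>, of q])
    show "dgr q (\<alpha> x)" for x unfolding \<alpha>_def by (rule dgr_mact[OF v(3)])
  qed blast
  have ipa: "wf.ip \<alpha> z = (LINT x|lborel. v x \<bullet> z x)" for z unfolding wf.ip_def gB_\<alpha> ..
  have a4: "wf.ip a (dext u) = (LINT x|lborel. cod v x \<bullet> u x)" if "cform W u" for u
    unfolding a(4)[OF that] ipa by (rule dext_cod_adjoint[OF v(1) w.K(1) v(2) cform_C1[OF that]])
  have am [measurable]: "a \<in> borel_measurable borel" by (rule wf.H_meas[OF a(1)])
  have Fm [measurable]: "F \<in> borel_measurable borel" by (rule wf.H_meas[OF HF])
  define P where "P n i = (LINT x|lborel. (pd i (\<eta> n) x)^2 * gB (G3x x) (a x) (a x))" for n i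
  define N where "N = real CARD('n)"
  \<comment> \<open>The factor exp \<psi> by which \<open>G2\<close> exceeds \<open>G3\<close> is
    exactly what the gradient bound of the cut-offs consumes, so a single integrable function
    dominates for all n.\<close>
  have Pdom: "(pd i (\<eta> n) x)^2 * gB (G3x x) (a x) (a x) \<le> C * gB (wf.Gx x) (a x) (a x)" if "x \<in> W" for n i x
  proof -
    have "(pd i (\<eta> n) x)^2 * gB (G3x x) (a x) (a x) \<le> (C * exp (\<psi> x)) * gB (G3x x) (a x) (a x)"
      by (intro mult_right_mono w.eta_grad that gB_nonneg G3x_pos)
    also have "\<dots> = C * gB (wf.Gx x) (a x) (a x)"
      using that by (simp add: G3x_def G3_def wf.Gx_def G2_def ph2_def gB_scaleR mult_exp_exp)
    finally show ?thesis .
  qed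
  have pd0: "pd i (\<eta> n) x = 0" if "x \<notin> W" for i n x
    using pd_eta_outside[of x n] w.eta(3)[of n] that by blast
  have Pb: "norm ((pd i (\<eta> n) x)^2 * gB (G3x x) (a x) (a x)) \<le> norm (C * gB (wf.Gx x) (a x) (a x))" for n i x
  proof (cases "x \<in> W")
    case True
    have "0 \<le> (pd i (\<eta> n) x)^2 * gB (G3x x) (a x) (a x)" by (intro mult_nonneg_nonneg gB_nonneg G3x_pos) simp
    then show ?thesis using Pdom[OF True, of i n] by simp
  qed (simp add: pd0)
  have iC: "integrable lborel (\<lambda>x. norm (C * gB (wf.Gx x) (a x) (a x)))"
    by (intro Bochner_Integration.integrable_norm integrable_mult_right wf.H_int a(1))
  have iP: "integrable lborel (\<lambda>x. (pd i (\<eta> n) x)^2 * gB (G3x x) (a x) (a x))" for n i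
    by (rule Bochner_Integration.integrable_bound[OF iC]) (use Pb in auto)
  have Plim: "(\<lambda>n. P n i) \<longlonglongrightarrow> 0" for i
  proof -
    have "(\<lambda>n. P n i) \<longlonglongrightarrow> (LINT x::(real,'n) vec|lborel. (0::real))"
      unfolding P_def
    proof (rule integral_dominated_convergence[where w="\<lambda>x. norm (C * gB (wf.Gx x) (a x) (a x))"])
      show "integrable lborel (\<lambda>x. norm (C * gB (wf.Gx x) (a x) (a x)))" by (rule iC)
      have "(\<lambda>n. (pd i (\<eta> n) x)^2 * gB (G3x x) (a x) (a x)) \<longlonglongrightarrow> 0" for x
      proof (cases "x \<in> W")
        case True
        have "(\<lambda>n. (pd i (\<eta> n) x)^2 * gB (G3x x) (a x) (a x)) \<longlonglongrightarrow> 0^2 * gB (G3x x) (a x) (a x)"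
          by (intro tendsto_mult tendsto_power w.eta_lim(2)[OF True] tendsto_const)
        then show ?thesis by simp
      qed (simp add: pd0)
      then show "AE x in lborel. (\<lambda>n. (pd i (\<eta> n) x)^2 * gB (G3x x) (a x) (a x)) \<longlonglongrightarrow> 0" by simp
      show "AE x in lborel. norm ((pd i (\<eta> n) x)^2 * gB (G3x x) (a x) (a x)) \<le> norm (C * gB (wf.Gx x) (a x) (a x))" for n
        using Pb by simp
    qed measurable
    then show ?thesis by simp
  qed
  define S where "S n = N * (\<Sum>i\<in>UNIV. P n i)" for n
  have Slim: "S \<longlonglongrightarrow> 0"
  proof -
    have "(\<lambda>n. N * (\<Sum>i\<in>UNIV. P n i)) \<longlonglongrightarrow> N * (\<Sum>i\<in>(UNIV::'n set). 0)"
      by (intro tendsto_mult tendsto_const tendsto_sum Plim)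
    then show ?thesis by (simp add: S_def[abs_def])
  qed
  have sumP: "integrable lborel (\<lambda>x. N * (\<Sum>i\<in>UNIV. (pd i (\<eta> n) x)^2) * gB (G3x x) (a x) (a x))"
    "(LINT x|lborel. N * (\<Sum>i\<in>UNIV. (pd i (\<eta> n) x)^2) * gB (G3x x) (a x) (a x)) = S n" for n
  proof -
    have e: "N * (\<Sum>i\<in>UNIV. (pd i (\<eta> n) x)^2) * gB (G3x x) (a x) (a x)
        = N * (\<Sum>i\<in>UNIV. (pd i (\<eta> n) x)^2 * gB (G3x x) (a x) (a x))" for x
      by (simp only: mult.assoc sum_distrib_right)
    show "integrable lborel (\<lambda>x. N * (\<Sum>i\<in>UNIV. (pd i (\<eta> n) x)^2) * gB (G3x x) (a x) (a x))"
      unfolding e by (intro integrable_mult_right Bochner_Integration.integrable_sum iP)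
    show "(LINT x|lborel. N * (\<Sum>i\<in>UNIV. (pd i (\<eta> n) x)^2) * gB (G3x x) (a x) (a x)) = S n"
      unfolding e S_def P_def using iP by simp
  qed
  define T where "T = wf.T v"
  have HT: "wf.H T" unfolding T_def by (rule wf.H_T[OF cv])
  have ipT: "wf.ip T T = energy"
    unfolding T_def wf.ip_T energy_def wf.T_def by (simp add: inner_commute)
  let ?w1 = "\<lambda>n y. \<Sum>i\<in>UNIV. pd i (\<eta> n) y *\<^sub>R wdg i (a y)"
  let ?w3 = "\<lambda>n y. \<Sum>i\<in>UNIV. pd i (\<eta> n) y *\<^sub>R ctr i (a y)"
  let ?w2 = "\<lambda>n y. \<eta> n y *\<^sub>R T y - ?w3 n y"
  have N1: "(LINT x|lborel. gB (G3x x) (?w1 n x) (?w1 n x)) \<le> S n" for n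
    unfolding sumP(2)[symmetric]
    by (rule integral_mono[OF G3x_integrable[OF cutoff_H(2)[OF a(1)]] sumP(1)])
       (unfold N_def, rule grad_forms_le(1)[OF G3x_pos])
  have N2: "(LINT x|lborel. gB (G3x x) (?w2 n x) (?w2 n x)) \<le> (1 + e) * energy + (1 + 1/e) * S n" for n
  proof -
    have "(LINT x|lborel. gB (G3x x) (?w2 n x) (?w2 n x))
      \<le> (LINT x|lborel. (1 + e) * gB (wf.Gx x) (T x) (T x) + (1 + 1/e) * (N * (\<Sum>i\<in>UNIV. (pd i (\<eta> n) x)^2) * gB (G3x x) (a x) (a x)))"
    proof (rule integral_mono)
      show "integrable lborel (\<lambda>x. gB (G3x x) (?w2 n x) (?w2 n x))"
        by (rule G3x_integrable[OF wf.H_diff[OF cutoff_H(1)[OF HT] cutoff_H(3)[OF a(1)]]])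
      show "integrable lborel (\<lambda>x. (1 + e) * gB (wf.Gx x) (T x) (T x) + (1 + 1/e) * (N * (\<Sum>i\<in>UNIV. (pd i (\<eta> n) x)^2) * gB (G3x x) (a x) (a x)))"
        by (intro Bochner_Integration.integrable_add integrable_mult_right wf.H_int HT sumP(1))
      fix x
      have "gB (G3x x) (\<eta> n x *\<^sub>R T x) (\<eta> n x *\<^sub>R T x) \<le> gB (wf.Gx x) (T x) (T x)"
      proof -
        have "(\<eta> n x)^2 * gB (G3x x) (T x) (T x) \<le> 1 * gB (wf.Gx x) (T x) (T x)"
          by (intro mult_mono power_le_one G3x_le gB_nonneg G3x_pos) (use w.eta(5) in auto)
        then show ?thesis by (simp add: gB_scaleR_left gB_scaleR_right power2_eq_square mult.assoc)
      qed
      then have "(1 + e) * gB (G3x x) (\<eta> n x *\<^sub>R T x) (\<eta> n x *\<^sub>R T x) \<le> (1 + e) * gB (wf.Gx x) (T x) (T x)"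
        by (rule mult_left_mono) (use w.e in simp)
      moreover have "(1 + 1/e) * gB (G3x x) (?w3 n x) (?w3 n x)
          \<le> (1 + 1/e) * (N * (\<Sum>i\<in>UNIV. (pd i (\<eta> n) x)^2) * gB (G3x x) (a x) (a x))"
        by (rule mult_left_mono) (use w.e grad_forms_le(2)[OF G3x_pos] in \<open>auto simp: N_def\<close>)
      moreover have "gB (G3x x) (?w2 n x) (?w2 n x)
        \<le> (1 + e) * gB (G3x x) (\<eta> n x *\<^sub>R T x) (\<eta> n x *\<^sub>R T x) + (1 + 1/e) * gB (G3x x) (?w3 n x) (?w3 n x)"
        using gB_young[OF G3x_pos w.e, of x "\<eta> n x *\<^sub>R T x" "- ?w3 n x"] by (simp add: gB_minus_left gB_minus_right)
      ultimately show "gB (G3x x) (?w2 n x) (?w2 n x) \<le> (1 + e) * gB (wf.Gx x) (T x) (T x)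
          + (1 + 1/e) * (N * (\<Sum>i\<in>UNIV. (pd i (\<eta> n) x)^2) * gB (G3x x) (a x) (a x))"
        by linarith
    qed
    also have "\<dots> = (1 + e) * energy + (1 + 1/e) * S n"
      using Bochner_Integration.integral_add[OF integrable_mult_right[OF wf.H_int[OF HT], of "1 + e"] integrable_mult_right[OF sumP(1)[of n], of "1 + 1/e"]]
      by (simp add: sumP(2) ipT[symmetric] wf.ip_def)
    finally show ?thesis .
  qed
  define I where "I n = (LINT x|lborel. \<eta> n x * gB (wf.Gx x) (F x) (a x))" for n
  have In: "(I n)^2 \<le> A0 * ((1 + e) * ((1 + e) * energy + (1 + 1/e) * S n) + S n)" for n
  proof -
    have "(I n)^2 \<le> A0 * ((1 + e) * (LINT x|lborel. gB (G3x x) (?w2 n x) (?w2 n x)) + (LINT x|lborel. gB (G3x x) (?w1 n x) (?w1 n x)))"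
      unfolding I_def T_def by (rule cutoff_bound[OF a(1,2,3) a4])
    also have "\<dots> \<le> A0 * ((1 + e) * ((1 + e) * energy + (1 + 1/e) * S n) + S n)"
      using w.e A0(2) by (intro mult_left_mono add_mono N1 N2) auto
    finally show ?thesis .
  qed
  have iFa: "integrable lborel (\<lambda>x. gB (wf.Gx x) (F x) (a x))" by (rule wf.B_integrable[OF HF a(1)])
  have Ilim: "I \<longlonglongrightarrow> wf.ip F a"
    unfolding I_def[abs_def] wf.ip_def
  proof (rule integral_dominated_convergence[where w="\<lambda>x. norm (gB (wf.Gx x) (F x) (a x))"])
    show "integrable lborel (\<lambda>x. norm (gB (wf.Gx x) (F x) (a x)))" using iFa by simp
    have "(\<lambda>n. \<eta> n x * gB (wf.Gx x) (F x) (a x)) \<longlonglongrightarrow> gB (wf.Gx x) (F x) (a x)" for x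
    proof (cases "x \<in> W")
      case True
      from tendsto_mult[OF w.eta_lim(1)[OF True] tendsto_const[of "gB (wf.Gx x) (F x) (a x)"]] show ?thesis by simp
    qed (simp add: F(2) gB_zero_left)
    then show "AE x in lborel. (\<lambda>n. \<eta> n x * gB (wf.Gx x) (F x) (a x)) \<longlonglongrightarrow> gB (wf.Gx x) (F x) (a x)" by simp
    have "norm (\<eta> n x * gB (wf.Gx x) (F x) (a x)) \<le> norm (gB (wf.Gx x) (F x) (a x))" for n x
      using w.eta(5)[of n x] mult_right_mono[of "\<bar>\<eta> n x\<bar>" 1 "\<bar>gB (wf.Gx x) (F x) (a x)\<bar>"] by (simp add: abs_mult)
    then show "AE x in lborel. norm (\<eta> n x * gB (wf.Gx x) (F x) (a x)) \<le> norm (gB (wf.Gx x) (F x) (a x))" for n by simp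
  qed measurable
  have "(wf.ip F a)^2 \<le> A0 * ((1 + e) * ((1 + e) * energy + (1 + 1/e) * 0) + 0)"
    by (rule LIMSEQ_le[OF tendsto_power[OF Ilim]
          tendsto_mult[OF tendsto_const tendsto_add[OF tendsto_mult[OF tendsto_const tendsto_add[OF tendsto_const tendsto_mult[OF tendsto_const Slim]]] Slim]]])
       (use In in auto)
  moreover have "wf.ip F a = (LINT x|lborel. F x \<bullet> v x)"
    using a(5)[OF HF F_closed] by (simp add: wf.ip_commute[of F a] ipa inner_commute)
  ultimately show ?thesis by simp
qed

end

section \<open>Coefficient families as vectors\<close>

text \<open>Coefficient families leave their values at sets of other cardinalities arbitrary;
  setting these to zero yields a genuine element of degree p.\<close>

definition enc :: "nat \<Rightarrow> ('n::finite, 'r::finite) coeffs \<Rightarrow> real^'r^'n set" where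
  "enc p a = (\<chi> I \<tau>. if card I = p then a I \<tau> else 0)"

definition dec :: "real^'r^'n set \<Rightarrow> ('n::finite, 'r::finite) coeffs" where
  "dec a I \<tau> = a $ I $ \<tau>"

lemma enc_dec: "dgr p a \<Longrightarrow> enc p (dec a) = a"
  by (auto simp: dgr_def enc_def dec_def vec_eq_iff)

lemma gip_enc: "gip G p a b = gB G (enc p a) (enc p b)"
proof -
  have "gB G (enc p a) (enc p b) = (\<Sum>I\<in>UNIV. if card I = p then \<Sum>\<tau>\<in>UNIV. \<Sum>\<xi>\<in>UNIV. a I \<tau> * b I \<xi> * G $ \<tau> $ \<xi> else 0)"
    unfolding gB_alt
    by (rule sum.cong) (auto simp: enc_def inner_vec_def matrix_vector_mult_def sum_distrib_left intro!: sum.cong)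
  then show ?thesis by (simp add: gip_def sum.If_cases)
qed

lemma enc_matact: "enc p (matact M a) = mact M (enc p a)"
  by (simp add: vec_eq_iff enc_def matact_def mact_def matrix_vector_mult_def)

lemma enc_contr: "enc p (contr j a) = ctr j (enc (Suc p) a)"
  by (auto simp: vec_eq_iff enc_def contr_def ctr_def)

lemma enc_wedge:
  fixes i :: "'n::{finite,linorder}"
  shows "enc (Suc p) (wedge i a) = wdg i (enc p a)"
proof -
  have "card K = Suc p \<longleftrightarrow> card (K - {i}) = p" if "i \<in> K" for K :: "'n set"
    using that card_Suc_Diff1[of K i] by auto
  then show ?thesis by (auto simp: vec_eq_iff enc_def wedge_def wdg_def)
qed

lemma enc_Theta: "enc (Suc p) (Theta g x a)
    = - (\<Sum>i\<in>UNIV. \<Sum>j\<in>UNIV. mact (curv_mat g i j x) (wdg i (ctr j (enc (Suc p) a))))"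
proof -
  have "enc (Suc p) (Theta g x a)
      = - (\<Sum>i\<in>UNIV. \<Sum>j\<in>UNIV. enc (Suc p) (matact (curv_mat g i j x) (wedge i (contr j a))))"
    by (auto simp: vec_eq_iff enc_def Theta_def sum_component)
  then show ?thesis by (simp add: enc_matact enc_wedge enc_contr)
qed

lemma gB_wdg_left: "gB G (wdg i a) b = gB G a (ctr i b)"
  by (simp add: gB_def wdg_ctr_adjoint ctr_mact)

text \<open>Adjointness moves the exterior product across as a contraction, and the two summation
  indices trade places.\<close>

lemma gip_Theta:
  "gip (g x) (Suc p) (Theta g x a) a = curvform (\<lambda>j y. matrix_inv (g y) ** pd j g y) g x (enc (Suc p) a)"
proof -
  let ?a = "enc (Suc p) a"
  have "gip (g x) (Suc p) (Theta g x a) a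
      = - (\<Sum>i\<in>UNIV. \<Sum>j\<in>UNIV. gB (g x) (mact (curv_mat g i j x) (ctr j ?a)) (ctr i ?a))"
    unfolding gip_enc enc_Theta
    by (simp add: gB_minus_left gB_sum_left wdg_mact[symmetric] gB_wdg_left)
  also have "\<dots> = curvform (\<lambda>j y. matrix_inv (g y) ** pd j g y) g x ?a"
    unfolding curvform_def curv_mat_def by (subst sum.swap) (rule refl)
  finally show ?thesis .
qed

text \<open>Dividing by the positive number Q + \<delta> makes the left-hand side a lower bound of
  the set in \<open>theta_inv\<close>. For \<delta> = 0 the claim can fail: where Q = 0 and the
  pairing is nonzero the set is empty, its infimum is \<infinity>, and \<infinity> * 0 = 0.\<close>

lemma theta_inv_le:
  fixes f a :: "('n::{finite,linorder}, 'r::finite) coeffs"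
  assumes "\<delta> > 0" "gip (g x) q (Theta g x a) a \<ge> 0"
  shows "ennreal ((gip (g x) q f a)^2) \<le> theta_inv g q x f * ennreal (gip (g x) q (Theta g x a) a + \<delta>)"
proof -
  let ?Q = "gip (g x) q (Theta g x a) a" and ?h = "ennreal ((gip (g x) q f a)^2)"
  have r: "?Q + \<delta> > 0" using assms by simp
  have "?h / ennreal (?Q + \<delta>) \<le> theta_inv g q x f"
    unfolding theta_inv_def
  proof (rule Inf_greatest)
    fix c assume "c \<in> {c. \<forall>a. ennreal ((gip (g x) q f a)^2) \<le> c * ennreal (gip (g x) q (Theta g x a) a)}"
    then have "?h \<le> c * ennreal ?Q" by simp
    also have "\<dots> \<le> c * ennreal (?Q + \<delta>)" using assms by (intro mult_left_mono ennreal_leI) auto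
    finally have "?h / ennreal (?Q + \<delta>) \<le> c * ennreal (?Q + \<delta>) / ennreal (?Q + \<delta>)"
      by (rule divide_right_mono_ennreal)
    also have "\<dots> = c" using r by (intro ennreal_mult_divide_eq) auto
    finally show "?h / ennreal (?Q + \<delta>) \<le> c" .
  qed
  then have "?h / ennreal (?Q + \<delta>) * ennreal (?Q + \<delta>) \<le> theta_inv g q x f * ennreal (?Q + \<delta>)"
    by (rule mult_right_mono) simp
  moreover have "?h / ennreal (?Q + \<delta>) * ennreal (?Q + \<delta>) = ?h"
    using r by (simp add: divide_ennreal ennreal_mult[symmetric])
  ultimately show ?thesis by simp
qed

lemma enc_expand:
  "enc p a = (\<Sum>I\<in>UNIV. \<Sum>\<tau>\<in>UNIV. (if card I = p then a I \<tau> else 0) *\<^sub>R axis I (axis \<tau> 1))"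
proof (rule V_eqI)
  fix J
  have "(\<Sum>I\<in>UNIV. \<Sum>\<tau>\<in>UNIV. (if card I = p then a I \<tau> else 0) *\<^sub>R axis I (axis \<tau> 1)) $ J $ \<sigma>
      = (\<Sum>I\<in>UNIV. if J = I then (\<Sum>\<tau>\<in>UNIV. if \<sigma> = \<tau> then (if card I = p then a I \<tau> else 0) else 0) else 0)" for \<sigma>
    unfolding sum_component by (rule sum.cong) (auto simp: axis_def if_distrib[of "\<lambda>x. _ * x"] cong: if_cong)
  then show "enc p a $ J = (\<Sum>I\<in>UNIV. \<Sum>\<tau>\<in>UNIV. (if card I = p then a I \<tau> else 0) *\<^sub>R axis I (axis \<tau> 1)) $ J"
    by (simp add: vec_eq_iff enc_def)
qed

lemma enc_C1:
  assumes "open D" "smooth_upto_boundary D f"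
  shows "C1 D (\<lambda>x. enc p (f x))"
proof -
  obtain U F where U: "open U" "closure D \<subseteq> U" "\<And>I \<tau>. Cinf_on U (\<lambda>x. F x I \<tau>)"
    "\<And>I \<tau> x. x \<in> closure D \<Longrightarrow> F x I \<tau> = f x I \<tau>"
    using assms(2) unfolding smooth_upto_boundary_def by blast
  have c: "C1 D (\<lambda>x. f x I \<tau>)" for I \<tau>
  proof (rule C1_cong[OF assms(1)])
    show "f x I \<tau> = F x I \<tau>" if "x \<in> D" for x using U(4) closure_subset that by (metis subsetD)
    show "C1 D (\<lambda>x. F x I \<tau>)"
      using C1_subset[OF conjunct1[OF Cinf_C2[OF U(3)[of I \<tau>]]], of D] U(2) closure_subset[of D] by blast
  qed
  then have "C1 D (\<lambda>x. if card I = p then f x I \<tau> else 0)" for I \<tau> by (cases "card I = p") auto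
  then show ?thesis unfolding enc_expand
    by (intro C1_sum C1_linear[OF bounded_linear_scaleR_left])
qed

text \<open>Weak derivatives are stated with \<open>lebesgue_on D\<close>, whereas translation and
  Fubini arguments run in \<open>lborel\<close>; a Borel representative \<open>k\<close> that
  vanishes off \<open>D\<close> carries integrals from one to the other.\<close>

lemma lebesgue_on_lborel:
  fixes h k :: "'a::euclidean_space \<Rightarrow> real"
  assumes D: "open D" and k: "k \<in> borel_measurable borel" "\<And>x. x \<notin> D \<Longrightarrow> k x = 0" "\<And>x. x \<in> D \<Longrightarrow> h x = k x"
  shows "integral\<^sup>L (lebesgue_on D) h = integral\<^sup>L lborel k"
    "integrable (lebesgue_on D) h \<longleftrightarrow> integrable lborel k"
proof -
  have "D \<in> sets lebesgue" using D by (simp add: sets_completionI_sets)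
  then have D': "D \<inter> space lebesgue \<in> sets lebesgue" by simp
  have e: "(\<lambda>x. indicator D x *\<^sub>R h x) = k" using k(2,3) by (auto simp: indicator_def fun_eq_iff)
  show "integral\<^sup>L (lebesgue_on D) h = integral\<^sup>L lborel k"
    unfolding integral_restrict_space[OF D'] e by (rule integral_completion) (use k(1) in simp)
  show "integrable (lebesgue_on D) h \<longleftrightarrow> integrable lborel k"
    unfolding integrable_restrict_space[OF D'] e by (rule integrable_completion) (use k(1) in simp)
qed

section \<open>Smooth closed forms\<close>

lemma test_fun_C1: "test_fun D \<phi> \<Longrightarrow> C1 UNIV \<phi>"
  using Cinf_C2 by (auto simp: test_fun_def)

lemma tform_test:
  assumes "test_fun D \<phi>" "card I = p"
  shows "tform D p (\<lambda>x. \<phi> x *\<^sub>R axis I (axis \<tau> (1::real)))"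
proof -
  obtain K where K: "compact K" "K \<subseteq> D" "\<And>x. x \<notin> K \<Longrightarrow> \<phi> x = 0" using assms(1) by (auto simp: test_fun_def)
  have "C1 UNIV (\<lambda>x. \<phi> x *\<^sub>R axis I (axis \<tau> (1::real)))"
    by (rule C1_linear[OF bounded_linear_scaleR_left test_fun_C1[OF assms(1)]])
  then show ?thesis
    unfolding tform_def cform_def using K assms(2) by (auto simp: dgr_def axis_def)
qed

text \<open>For a test function times one basis covector, the pairing with \<open>cod\<close> is the
  integrand on the right-hand side of \<open>weak_d\<close>.\<close>

lemma cod_test:
  assumes "C1 UNIV \<phi>"
  shows "cod (\<lambda>x. \<phi> x *\<^sub>R axis I (axis \<tau> 1)) x \<bullet> a = - (\<Sum>i\<in>I. sgnpos i (I - {i}) * (a $ (I - {i}) $ \<tau> * pd i \<phi> x))"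
proof -
  have p: "pd i (\<lambda>x. \<phi> x *\<^sub>R axis I (axis \<tau> 1)) x = pd i \<phi> x *\<^sub>R axis I (axis \<tau> 1)" for i
    by (rule hpd_imp_pd[OF hpd_linear[OF bounded_linear_scaleR_left C1_hpd[OF assms UNIV_I]]])
  have "cod (\<lambda>x. \<phi> x *\<^sub>R axis I (axis \<tau> 1)) x \<bullet> a = - (\<Sum>i\<in>UNIV. (pd i \<phi> x *\<^sub>R axis I (axis \<tau> 1)) \<bullet> wdg i a)"
    unfolding cod_def p inner_minus_left inner_sum_left
    by (intro arg_cong[of _ _ uminus] sum.cong refl) (simp add: inner_commute[of _ a] wdg_ctr_adjoint[symmetric] inner_commute)
  also have "(\<Sum>i\<in>UNIV. (pd i \<phi> x *\<^sub>R axis I (axis \<tau> 1)) \<bullet> wdg i a)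
      = (\<Sum>i\<in>UNIV. if i \<in> I then sgnpos i (I - {i}) * (a $ (I - {i}) $ \<tau> * pd i \<phi> x) else 0)"
    by (intro sum.cong refl) (simp add: inner_axis' wdg_def)
  also have "\<dots> = (\<Sum>i\<in>I. sgnpos i (I - {i}) * (a $ (I - {i}) $ \<tau> * pd i \<phi> x))"
    by (simp add: sum.If_cases)
  finally show ?thesis .
qed

lemma inner_test: "(\<phi> *\<^sub>R axis I (axis \<tau> 1)) \<bullet> a = \<phi> * a $ I $ (\<tau>::'r::finite)"
  by (simp add: inner_axis')

text \<open>\<open>weak_d\<close> tests with smooth functions, while the test forms of the estimate
  have one derivative only. Upgrading to pointwise closedness bridges this. The argument is the
  fundamental lemma of the calculus of variations: if a coefficient of df is nonzero at x0, it keeps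
  its sign on a ball, and a bump there has nonzero integral against it.\<close>

lemma closed_form_classical:
  fixes f :: "(real,'n::{finite,linorder}) vec \<Rightarrow> ('n, 'r::finite) coeffs"
  assumes D: "open D" and s: "smooth_upto_boundary D f" and w: "weak_d D q f (\<lambda>x I \<tau>. 0)" and x0: "x0 \<in> D"
  shows "dext (\<lambda>x. enc q (f x)) x0 = 0"
proof -
  let ?F = "\<lambda>x. enc q (f x)"
  have C: "C1 D ?F" by (rule enc_C1[OF D s])
  have "dext ?F x0 $ I $ \<tau> = 0" for I \<tau>
  proof (cases "card I = Suc q")
    case False
    have "dgr q (pd i ?F x0)" for i
    proof -
      have "pd i ?F x0 $ J = 0" if "card J \<noteq> q" for J
      proof -
        have "hpd i (\<lambda>x. ?F x $ J) (pd i ?F x0 $ J) x0"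
          by (rule hpd_linear[OF bounded_linear_vec_nth C1_hpd[OF C x0]])
        moreover have "(\<lambda>x. ?F x $ J) = (\<lambda>x. 0)" using that by (simp add: enc_def vec_eq_iff fun_eq_iff)
        ultimately have h: "hpd i (\<lambda>x. 0) (pd i ?F x0 $ J) x0" by simp
        show ?thesis using hpd_imp_pd[OF h] hpd_imp_pd[OF hpd_const, of i "0 :: real^'r" x0] by simp
      qed
      then show ?thesis by (simp add: dgr_def)
    qed
    then have "dgr (Suc q) (dext ?F x0)"
      unfolding dext_def using subspace_sum[OF dgr_subspace] dgr_wdg by (metis (no_types, lifting) mem_Collect_eq)
    then show ?thesis using False by (simp add: dgr_def)
  next
    case True
    define c where "c x = dext ?F x $ I $ \<tau>" for x
    have cc: "continuous_on D c"
      unfolding c_def by (intro continuous_on_component continuous_dext[OF C])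
    show ?thesis
    proof (rule ccontr)
      assume "dext ?F x0 $ I $ \<tau> \<noteq> 0"
      then have c0: "\<bar>c x0\<bar> / 2 > 0" by (simp add: c_def)
      obtain d where d: "d > 0" "\<And>x. x \<in> D \<Longrightarrow> dist x x0 < d \<Longrightarrow> dist (c x) (c x0) < \<bar>c x0\<bar> / 2"
        using cc c0 x0 unfolding continuous_on_iff by meson
      obtain d' where d': "d' > 0" "cball x0 d' \<subseteq> D" using D x0 open_contains_cball by blast
      define r where "r = min (d/2) d'"
      define K where "K = cball x0 r"
      have r: "r > 0" "K \<subseteq> D" using d(1) d' by (auto simp: r_def K_def)
      \<comment> \<open>The sign factor treats positive and negative values at once; half of |c x0|
        is lost to the oscillation on the ball.\<close>
      have cK: "sgn (c x0) * c x \<ge> \<bar>c x0\<bar> / 2" if "x \<in> K" for x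
      proof -
        have "dist x x0 < d" using that d(1) by (auto simp: K_def r_def dist_commute)
        then have "\<bar>c x - c x0\<bar> < \<bar>c x0\<bar> / 2" using d(2) that r(2) by (auto simp: dist_real_def)
        then show ?thesis by (auto simp: sgn_if abs_if split: if_splits)
      qed
      have Kc: "compact K" by (simp add: K_def)
      obtain \<phi> :: "(real,'n) vec \<Rightarrow> real" where ph: "Cinf_on UNIV \<phi>" "\<And>x. \<phi> x \<ge> 0" "\<phi> x0 > 0"
        "\<And>x. r \<le> norm (x - x0) \<Longrightarrow> \<phi> x = 0" by (rule bump_exists[OF r(1), of x0]) blast
      have pK: "\<phi> x = 0" if "x \<notin> K" for x
        using that ph(4)[of x] by (auto simp: K_def dist_norm norm_minus_commute)
      have t: "test_fun D \<phi>" unfolding test_fun_def using ph(1) Kc r(2) pK by blast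
      let ?v = "\<lambda>x. \<phi> x *\<^sub>R axis I (axis \<tau> (1::real)) :: real^'r^'n set"
      have Cp: "C1 UNIV \<phi>" by (rule test_fun_C1[OF t])
      have Cv: "C1 UNIV ?v" by (rule C1_linear[OF bounded_linear_scaleR_left Cp])
      have cF: "continuous_on K ?F" by (rule continuous_on_subset[OF C1_cont[OF C] r(2)])
      have cpd: "continuous_on K (pd i \<phi>)" for i by (rule continuous_on_subset[OF C1_cont_pd[OF Cp]]) simp
      have cph: "continuous_on K \<phi>" by (rule continuous_on_subset[OF C1_cont[OF Cp]]) simp
      have w0: "(LINT x:K|lborel. ?F x $ (I - {i}) $ \<tau> * pd i \<phi> x)
          = integral\<^sup>L (lebesgue_on D) (\<lambda>x. f x (I - {i}) \<tau> * pd i \<phi> x)" if "i \<in> I" for i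
      proof -
        let ?k = "\<lambda>x. indicator K x *\<^sub>R (?F x $ (I - {i}) $ \<tau> * pd i \<phi> x)"
        have p0: "pd i \<phi> x = 0" if "x \<notin> K" for x
          by (rule pd_eq_0_outside[OF compact_imp_closed[OF Kc] pK that])
        have "card (I - {i}) = q" using True that by simp
        then have e: "f x (I - {i}) \<tau> * pd i \<phi> x = ?k x" for x
          using p0[of x] by (cases "x \<in> K") (auto simp: enc_def)
        have "set_integrable lborel K (\<lambda>x. ?F x $ (I - {i}) $ \<tau> * pd i \<phi> x)"
          by (intro set_integrable_compact[OF Kc] continuous_intros cF cpd)
        then have m: "?k \<in> borel_measurable borel"
          using borel_measurable_integrable unfolding set_integrable_def by force
        have "integral\<^sup>L (lebesgue_on D) (\<lambda>x. f x (I - {i}) \<tau> * pd i \<phi> x) = integral\<^sup>L lborel ?k"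
          by (rule lebesgue_on_lborel(1)[OF D m]) (use e r(2) in \<open>auto simp: indicator_def\<close>)
        then show ?thesis by (simp add: set_lebesgue_integral_def)
      qed
      have "(LINT x:K|lborel. \<phi> x * c x) = (LINT x:K|lborel. ?v x \<bullet> dext ?F x)"
        unfolding c_def inner_test ..
      also have "\<dots> = (LINT x:K|lborel. cod ?v x \<bullet> ?F x)"
        by (rule dext_cod_adjoint_on[OF D C Cv Kc r(2)]) (simp add: pK)
      also have "\<dots> = (LINT x:K|lborel. - (\<Sum>i\<in>I. sgnpos i (I - {i}) * (?F x $ (I - {i}) $ \<tau> * pd i \<phi> x)))"
        unfolding cod_test[OF Cp] ..
      also have "\<dots> = - (\<Sum>i\<in>I. LINT x:K|lborel. sgnpos i (I - {i}) * (?F x $ (I - {i}) $ \<tau> * pd i \<phi> x))"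
        unfolding set_integral_uminus[OF set_integrable_compact[OF Kc]] set_lebesgue_integral_def scaleR_minus_right scaleR_sum_right Bochner_Integration.integral_minus
        by (intro arg_cong[of _ _ uminus] Bochner_Integration.integral_sum
            set_integrable_compact[OF Kc, unfolded set_integrable_def] continuous_intros cF cpd)
      also have "\<dots> = - (\<Sum>i\<in>I. sgnpos i (I - {i}) * integral\<^sup>L (lebesgue_on D) (\<lambda>x. f x (I - {i}) \<tau> * pd i \<phi> x))"
        using w0 by simp
      also have "\<dots> = 0"
        using w[unfolded weak_d_def, rule_format, OF True t, of \<tau>] by simp
      finally have z: "(LINT x:K|lborel. \<phi> x * c x) = 0" .
      have cK': "continuous_on K c" by (rule continuous_on_subset[OF cc r(2)])
      have "(LINT x:K|lborel. (\<bar>c x0\<bar> / 2) * \<phi> x) \<le> (LINT x:K|lborel. sgn (c x0) * (\<phi> x * c x))"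
      proof (rule set_integral_mono)
        show "set_integrable lborel K (\<lambda>x. (\<bar>c x0\<bar> / 2) * \<phi> x)" "set_integrable lborel K (\<lambda>x. sgn (c x0) * (\<phi> x * c x))"
          by (intro set_integrable_compact[OF Kc] continuous_on_mult continuous_on_const cK' cph)+
        show "(\<bar>c x0\<bar> / 2) * \<phi> x \<le> sgn (c x0) * (\<phi> x * c x)" if "x \<in> K" for x
          using mult_right_mono[OF cK[OF that] ph(2)[of x]] by (simp add: mult_ac)
      qed
      also have "\<dots> = 0" by (simp add: z)
      finally have "(\<bar>c x0\<bar> / 2) * (LINT x:K|lborel. \<phi> x) \<le> 0" by simp
      moreover have "(LINT x:K|lborel. \<phi> x) > 0"
      proof -
        have "integral\<^sup>L lborel \<phi> > 0"
          by (rule integral_pos_continuous[OF C1_cont[OF Cp] ph(2,3)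
                continuous_compact_support_integrable[OF C1_cont[OF Cp] Kc pK]])
        also have "integral\<^sup>L lborel \<phi> = (LINT x:K|lborel. \<phi> x)"
          by (rule set_integral_outside[symmetric]) (rule pK)
        finally show ?thesis .
      qed
      ultimately show False using c0 by (simp add: mult_le_0_iff)
    qed
  qed
  then show ?thesis by (simp add: vec_eq_iff)
qed

lemma closed_form_orthogonal:
  fixes f :: "(real,'n::{finite,linorder}) vec \<Rightarrow> ('n, 'r::finite) coeffs"
  assumes D: "open D" and s: "smooth_upto_boundary D f" and w: "weak_d D q f (\<lambda>x I \<tau>. 0)"
    and W: "W \<subseteq> D" and b: "cform W b"
  shows "(LINT x|lborel. (if x \<in> W then enc q (f x) else 0) \<bullet> cod b x) = 0"
proof -
  obtain K where K: "compact K" "K \<subseteq> W" "\<And>x. x \<notin> K \<Longrightarrow> b x = 0" using b by (auto simp: cform_def)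
  have b0: "cod b x = 0" if "x \<notin> K" for x by (rule support_dext_cod(2)[OF K(1,3) that])
  have "(LINT x|lborel. (if x \<in> W then enc q (f x) else 0) \<bullet> cod b x)
      = (LINT x:K|lborel. (if x \<in> W then enc q (f x) else 0) \<bullet> cod b x)"
    by (rule set_integral_outside[symmetric]) (simp add: b0)
  also have "\<dots> = (LINT x:K|lborel. cod b x \<bullet> enc q (f x))"
    by (rule set_lebesgue_integral_cong) (use K in \<open>auto simp: borel_compact inner_commute\<close>)
  also have "\<dots> = (LINT x:K|lborel. b x \<bullet> dext (\<lambda>x. enc q (f x)) x)"
    by (rule dext_cod_adjoint_on[symmetric, OF D enc_C1[OF D s] cform_C1[OF b] K(1)]) (use K W in auto)
  also have "\<dots> = (LINT x:K|lborel. 0)"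
    by (rule set_lebesgue_integral_cong) (use K W closed_form_classical[OF D s w] in \<open>auto simp: borel_compact\<close>)
  finally show ?thesis by simp
qed

section \<open>The main inequality and its dual\<close>

lemma riem_metric_posdef: "riem_metric D g \<Longrightarrow> x \<in> D \<Longrightarrow> posdef (g x)"
  by (simp add: riem_metric_def posdef_def)

lemma riem_metric_connection:
  fixes D :: "((real,'n::{finite,linorder}) vec) set"
  assumes D: "open D" and g: "riem_metric D g"
  shows "metric_connection D g (\<lambda>j y. matrix_inv (g y) ** pd j g y)"
proof
  have C: "C1 D g" "C1 D (pd j g)" for j using g Ck_on_2_C1 by (auto simp: riem_metric_def)
  show "C1 D g" by (rule C)
  show p: "posdef (g x)" if "x \<in> D" for x by (rule riem_metric_posdef[OF g that])
  show "C1 D (\<lambda>y. matrix_inv (g y) ** pd j g y)" for j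
    by (rule C1_bilinear[OF bounded_bilinear_mm C1_matrix_inv[OF D C(1) p] C(2)])
  show "pd j g x = g x ** (matrix_inv (g x) ** pd j g x)" if "x \<in> D" for j x
    by (simp add: matrix_mul_assoc posdef_inv(2)[OF p[OF that]])
qed (rule D)

lemma metric_connection_subset:
  assumes "metric_connection D g A" "open W" "W \<subseteq> D"
  shows "metric_connection W g A"
proof -
  interpret metric_connection D g A by (rule assms(1))
  show ?thesis
    by unfold_locales (use assms(2,3) C1_subset[OF G] C1_subset[OF A] pG GA in auto)
qed

lemma L2_set_integrable:
  fixes f :: "(real,'n::{finite,linorder}) vec \<Rightarrow> ('n, 'r::finite) coeffs"
  assumes D: "open D" and g: "continuous_on D g" "\<And>x. x \<in> D \<Longrightarrow> posdef (g x)"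
    and f: "continuous_on D (\<lambda>x. enc q (f x))" "L2 D g q f"
  shows "set_integrable lborel D (\<lambda>x. gB (g x) (enc q (f x)) (enc q (f x)))"
  unfolding set_integrable_def
proof (rule integrableI_bounded)
  let ?h = "\<lambda>x. indicator D x *\<^sub>R gB (g x) (enc q (f x)) (enc q (f x))"
  show m: "?h \<in> borel_measurable lborel"
    using borel_measurable_continuous_on_indicator[OF borel_open[OF D] continuous_on_gB[OF g(1) f(1) f(1)]] by simp
  have "(\<integral>\<^sup>+x. ennreal (norm (?h x)) \<partial>lborel) = (\<integral>\<^sup>+x. ennreal (norm (?h x)) \<partial>lebesgue)"
    by (rule nn_integral_completion[symmetric])
  also have "\<dots> = (\<integral>\<^sup>+x\<in>D. ennreal (gip (g x) q (f x) (f x)) \<partial>lebesgue)"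
    by (rule nn_integral_cong) (auto simp: gip_enc indicator_def gB_nonneg g(2))
  also have "\<dots> < \<infinity>" using f(2) by (simp add: L2_def)
  finally show "(\<integral>\<^sup>+x. ennreal (norm (?h x)) \<partial>lborel) < \<infinity>" .
qed

text \<open>The polytope and the weights depend on e and on the support of \<open>v\<close>, but
  both sides of \<open>core_bound\<close> live on that support, where the weights vanish. So they
  equal quantities of the original metric, and e can tend to 0.\<close>

lemma main_inequality:
  fixes D :: "((real,'n::{finite,linorder}) vec) set" and g :: "(real,'n) vec \<Rightarrow> real^'r::finite^'r"
  assumes D: "open D" "convex D" and g: "riem_metric D g" and N: "nakano_q_semipositive D g (Suc p)"
    and s: "smooth_upto_boundary D f" and f2: "L2 D g (Suc p) f" and cl: "weak_d D (Suc p) f (\<lambda>x I \<tau>. 0)"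
    and A0: "(\<integral>\<^sup>+x\<in>D. theta_inv g (Suc p) x (f x) \<partial>lebesgue) \<le> ennreal A0" "A0 \<ge> 0"
    and v: "tform D (Suc p) v"
  shows "(LINT x|lborel. (if x \<in> D then enc (Suc p) (f x) else 0) \<bullet> v x)^2
    \<le> A0 * (LINT x|lborel. cod v x \<bullet> mact (matrix_inv (if x \<in> D then g x else mat 1)) (cod v x))"
proof -
  let ?q = "Suc p"
  let ?I = "LINT x|lborel. (if x \<in> D then enc ?q (f x) else 0) \<bullet> v x"
  let ?E = "LINT x|lborel. cod v x \<bullet> mact (matrix_inv (if x \<in> D then g x else mat 1)) (cod v x)"
  let ?A = "\<lambda>j y. matrix_inv (g y) ** pd j g y"
  interpret mD: metric_connection D g ?A by (rule riem_metric_connection[OF D(1) g])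
  obtain K where K: "compact K" "K \<subseteq> D" "\<And>x. x \<notin> K \<Longrightarrow> v x = 0" using v by (auto simp: tform_def cform_def)
  have vC: "C1 UNIV v" "\<And>x. dgr ?q (v x)" using v by (auto simp: tform_def cform_def)
  have cF: "continuous_on D (\<lambda>x. enc ?q (f x))" by (rule C1_cont[OF enc_C1[OF D(1) s]])
  have curv: "gip (g x) ?q (Theta g x (dec a)) (dec a) = curvform ?A g x a" if "dgr ?q a" for x a
    using gip_Theta[of g x p "dec a"] by (simp add: enc_dec[OF that])
  have nak: "curvform ?A g x a \<ge> 0" if "x \<in> D" "dgr ?q a" for x a
    using N curv[OF that(2)] that(1) by (metis nakano_q_semipositive_def)
  have main: "?I^2 \<le> A0 * ((1 + e) * ((1 + e) * ?E))" if e: "e > 0" for e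
  proof -
    obtain W \<phi> \<psi> \<eta> C L where W: "W \<subseteq> D" "weight_data (TYPE('r)) W K e \<phi> \<psi> \<eta> C L"
      by (rule weights_exist[OF K(1) D K(2) e, where 'r='r])
    interpret w: weight_data "TYPE('r)" W K e \<phi> \<psi> \<eta> C L by (rule W(2))
    interpret m: metric_connection W g ?A
      by (rule metric_connection_subset[OF mD.metric_connection_axioms w.oW W(1)])
    let ?F = "\<lambda>x. if x \<in> W then enc ?q (f x) else 0"
    interpret ce: core_estimate W g ?A K e \<phi> \<psi> \<eta> C L ?q v ?F "\<lambda>x. theta_inv g ?q x (f x)" A0
    proof
      show "continuous_on W ?F"
        using continuous_on_subset[OF cF W(1)] by (simp cong: continuous_on_cong)
      have "set_integrable lborel W (\<lambda>x. gB (g x) (enc ?q (f x)) (enc ?q (f x)))"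
        by (rule set_integrable_subset[OF L2_set_integrable[OF D(1) C1_cont[OF mD.G] mD.pG cF f2]])
           (use W(1) w.oW in auto)
      moreover have "(\<lambda>x. indicator W x *\<^sub>R gB (g x) (?F x) (?F x))
          = (\<lambda>x. indicator W x *\<^sub>R gB (g x) (enc ?q (f x)) (enc ?q (f x)))" by (auto simp: indicator_def fun_eq_iff)
      ultimately show "set_integrable lborel W (\<lambda>x. gB (g x) (?F x) (?F x))"
        unfolding set_integrable_def by simp
      show "(LINT x|lborel. ?F x \<bullet> cod b x) = 0" if "tform W (Suc ?q) b" for b
        by (rule closed_form_orthogonal[OF D(1) s cl W(1)]) (use that in \<open>simp add: tform_def\<close>)
      show "0 \<le> curvform ?A g x a" if "x \<in> W" "dgr ?q a" for x a using nak that W(1) by blast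
      show "ennreal ((gB (g x) (?F x) a)^2) \<le> theta_inv g ?q x (f x) * ennreal (curvform ?A g x a + \<delta>)"
        if "x \<in> W" "dgr ?q a" "\<delta> > 0" for x a \<delta>
      proof -
        have "gip (g x) ?q (f x) (dec a) = gB (g x) (?F x) a"
          using that(1) by (simp add: gip_enc enc_dec[OF that(2)])
        then show ?thesis
          using theta_inv_le[OF that(3), of g x ?q "dec a" "f x"] nak[OF _ that(2), of x] that(1) W(1)
          by (auto simp: curv[OF that(2)])
      qed
      have "(\<integral>\<^sup>+x\<in>W. theta_inv g ?q x (f x) \<partial>lebesgue) \<le> (\<integral>\<^sup>+x\<in>D. theta_inv g ?q x (f x) \<partial>lebesgue)"
        by (rule nn_integral_mono) (use W(1) in \<open>auto simp: indicator_def\<close>)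
      then show "(\<integral>\<^sup>+x\<in>W. theta_inv g ?q x (f x) \<partial>lebesgue) \<le> ennreal A0" using A0(1) by (rule order_trans)
    qed (use vC K(3) A0(2) in auto)
    have I: "(LINT x|lborel. ?F x \<bullet> v x) = ?I"
    proof (rule Bochner_Integration.integral_cong[OF refl])
      show "?F x \<bullet> v x = (if x \<in> D then enc ?q (f x) else 0) \<bullet> v x" for x
        using K(2,3) w.K(2) by (cases "x \<in> K") auto
    qed
    \<comment> \<open>On \<open>K\<close> the weights are 0 and the weighted metric is g; off
      \<open>K\<close> the factor \<open>cod v x\<close> vanishes.\<close>
    have E: "ce.energy = ?E"
      unfolding ce.energy_def
    proof (rule Bochner_Integration.integral_cong[OF refl])
      show "cod v x \<bullet> mact (matrix_inv (ce.wf.Gx x)) (cod v x)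
          = cod v x \<bullet> mact (matrix_inv (if x \<in> D then g x else mat 1)) (cod v x)" for x
      proof (cases "x \<in> K")
        case True
        then have "ce.wf.Gx x = g x" "x \<in> D"
          using K(2) w.K(2) w.zero by (auto simp: ce.wf.Gx_def ce.G2_def ce.ph2_def)
        then show ?thesis by simp
      next
        case False
        then show ?thesis using support_dext_cod(2)[OF K(1,3) False] by simp
      qed
    qed
    show ?thesis using ce.core_bound unfolding I E .
  qed
  have "((\<lambda>e. A0 * ((1 + e) * ((1 + e) * ?E))) \<longlongrightarrow> A0 * ((1 + 0) * ((1 + 0) * ?E))) (at_right 0)"
    by (intro tendsto_intros)
  moreover have "\<forall>\<^sub>F e in at_right 0. ?I^2 \<le> A0 * ((1 + e) * ((1 + e) * ?E))"
    using main by (auto simp: eventually_at_filter)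
  ultimately have "?I^2 \<le> A0 * ((1 + 0) * ((1 + 0) * ?E))"
    by (rule tendsto_lowerbound) simp
  then show ?thesis by simp
qed

lemma measurable_entry:
  "h \<in> borel_measurable M \<Longrightarrow> (\<lambda>x. h x $ I $ \<tau> :: real) \<in> borel_measurable M"
  by (erule measurable_compose) (intro borel_measurable_continuous_onI continuous_intros)

lemma integrable_inner_cform:
  assumes "continuous_on D F" "cform D v"
  shows "integrable lborel (\<lambda>x. (if x \<in> D then F x else 0) \<bullet> v x)"
proof -
  obtain K where K: "compact K" "K \<subseteq> D" "\<And>x. x \<notin> K \<Longrightarrow> v x = 0" using assms(2) by (auto simp: cform_def)
  have "set_integrable lborel K (\<lambda>x. F x \<bullet> v x)"
    by (intro set_integrable_compact[OF K(1)] continuous_on_inner continuous_on_subset[OF assms(1) K(2)]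
        continuous_on_subset[OF C1_cont[OF cform_C1[OF assms(2)]]]) simp
  moreover have "(\<lambda>x. indicator K x *\<^sub>R (F x \<bullet> v x)) = (\<lambda>x. (if x \<in> D then F x else 0) \<bullet> v x)"
    using K(2,3) by (auto simp: indicator_def fun_eq_iff)
  ultimately show ?thesis by (simp add: set_integrable_def)
qed

context weighted_forms
begin

text \<open>The duality is applied to test functions times basis covectors, for which it spells out
  the defining identity of \<open>weak_d\<close>. The integrability clauses need local integrability
  of u, obtained on the compact support of the test function.\<close>

lemma weak_d_dual:
  assumes f: "continuous_on W (\<lambda>x. enc (Suc p) (f x))"
    and u: "H u"
    and dual: "\<And>v. tform W (Suc p) v \<Longrightarrow>
      (LINT x|lborel. u x \<bullet> cod v x) = (LINT x|lborel. (if x \<in> W then enc (Suc p) (f x) else 0) \<bullet> v x)"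
  shows "weak_d W p (\<lambda>x. dec (u x)) f"
  unfolding weak_d_def
proof (intro allI impI)
  fix I :: "'n set" and \<tau> :: 'r and \<phi> :: "(real,'n) vec \<Rightarrow> real"
  assume I: "card I = Suc p" and t: "test_fun W \<phi>"
  obtain K where K: "compact K" "K \<subseteq> W" "\<And>x. x \<notin> K \<Longrightarrow> \<phi> x = 0" using t by (auto simp: test_fun_def)
  have Cp: "C1 UNIV \<phi>" by (rule test_fun_C1[OF t])
  have p0: "pd i \<phi> x = 0" if "x \<notin> K" for i x
    by (rule pd_eq_0_outside[OF compact_imp_closed[OF K(1)] K(3) that])
  let ?F = "\<lambda>x. if x \<in> W then enc (Suc p) (f x) else 0"
  let ?v = "\<lambda>x. \<phi> x *\<^sub>R axis I (axis \<tau> (1::real)) :: real^'r^'n set"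
  have iF: "integrable lborel (\<lambda>x. ?F x \<bullet> ?v x)"
    by (rule integrable_inner_cform[OF f tform_test[OF t I, unfolded tform_def, THEN conjunct1]])
  have f1: "f x I \<tau> * \<phi> x = ?F x \<bullet> ?v x" if "x \<in> W" for x
    using that I by (simp add: inner_axis enc_def)
  have mF: "(\<lambda>x. ?F x \<bullet> ?v x) \<in> borel_measurable borel" using borel_measurable_integrable[OF iF] by simp
  have F_f: "integrable (lebesgue_on W) (\<lambda>x. f x I \<tau> * \<phi> x)"
    "integral\<^sup>L (lebesgue_on W) (\<lambda>x. f x I \<tau> * \<phi> x) = (LINT x|lborel. ?F x \<bullet> ?v x)"
    using lebesgue_on_lborel[OF oW mF _ f1] iF by auto
  \<comment> \<open>A member of \<open>H\<close> need not be integrable over the whole of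
    \<open>W\<close>, but its restriction to a compact subset is, by
    \<open>H_integrable\<close>.\<close>
  define z where "z x = indicator K x *\<^sub>R u x" for x
  have mu: "u \<in> borel_measurable borel" by (rule H_meas[OF u])
  have mz: "z \<in> borel_measurable borel"
    unfolding z_def[abs_def] using borel_compact[OF K(1)] mu by measurable
  have "H z"
    by (rule H_dominated[OF mz u, of 1]) (auto simp: z_def indicator_def gB_zero_left B_nonneg)
  then have iz: "integrable lborel z" by (rule H_integrable[OF _ K(1,2)]) (simp add: z_def)
  have iu: "integrable lborel (\<lambda>x. u x $ J $ \<tau> * pd i \<phi> x)" for i J
  proof -
    obtain M where M: "\<And>x. norm (pd i \<phi> x) \<le> M"
    proof (rule continuous_compact_support_bounded[OF C1_cont_pd[OF Cp, of i] K(1)])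
      show "pd i \<phi> x = 0" if "x \<notin> K" for x by (rule p0[OF that])
    qed (rule that)
    have e: "u x $ J $ \<tau> * pd i \<phi> x = z x $ J $ \<tau> * pd i \<phi> x" for x
      using p0[of x i] by (cases "x \<in> K") (auto simp: z_def)
    have mp: "pd i \<phi> \<in> borel_measurable borel"
      using C1_cont_pd[OF Cp] by (rule borel_measurable_continuous_onI)
    show ?thesis unfolding e
    proof (rule Bochner_Integration.integrable_bound[OF integrable_mult_right[OF integrable_norm[OF iz], of M]])
      show "(\<lambda>x. z x $ J $ \<tau> * pd i \<phi> x) \<in> borel_measurable lborel"
        using borel_measurable_times[OF measurable_entry[OF mz] mp] by simp
      have "norm (z x $ J $ \<tau> * pd i \<phi> x) \<le> norm (M * norm (z x))" for x
      proof -
        have "\<bar>z x $ J $ \<tau>\<bar> \<le> norm (z x)"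
          by (rule order_trans[OF component_le_norm_cart Finite_Cartesian_Product.norm_nth_le])
        then have "\<bar>z x $ J $ \<tau>\<bar> * \<bar>pd i \<phi> x\<bar> \<le> norm (z x) * \<bar>M\<bar>"
          using order_trans[OF M[of x] abs_ge_self] by (intro mult_mono) auto
        then show ?thesis by (simp add: abs_mult mult.commute)
      qed
      then show "AE x in lborel. norm (z x $ J $ \<tau> * pd i \<phi> x) \<le> norm (M * norm (z x))" by simp
    qed
  qed
  have U: "integrable (lebesgue_on W) (\<lambda>x. dec (u x) J \<tau> * pd i \<phi> x)"
    "integral\<^sup>L (lebesgue_on W) (\<lambda>x. dec (u x) J \<tau> * pd i \<phi> x) = (LINT x|lborel. u x $ J $ \<tau> * pd i \<phi> x)" for J i
  proof -
    have m: "(\<lambda>x. u x $ J $ \<tau> * pd i \<phi> x) \<in> borel_measurable borel" using borel_measurable_integrable[OF iu] by simp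
    have 0: "u x $ J $ \<tau> * pd i \<phi> x = 0" if "x \<notin> W" for x using p0[of x i] K(2) that by auto
    show "integrable (lebesgue_on W) (\<lambda>x. dec (u x) J \<tau> * pd i \<phi> x)"
      using lebesgue_on_lborel(2)[OF oW m 0, of "\<lambda>x. dec (u x) J \<tau> * pd i \<phi> x"] iu by (simp add: dec_def)
    show "integral\<^sup>L (lebesgue_on W) (\<lambda>x. dec (u x) J \<tau> * pd i \<phi> x) = (LINT x|lborel. u x $ J $ \<tau> * pd i \<phi> x)"
      by (rule lebesgue_on_lborel(1)[OF oW m 0]) (simp_all add: dec_def)
  qed
  have "(LINT x|lborel. ?F x \<bullet> ?v x) = (LINT x|lborel. u x \<bullet> cod ?v x)"
    by (rule dual[symmetric, OF tform_test[OF t I]])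
  also have "\<dots> = (LINT x|lborel. - (\<Sum>i\<in>I. sgnpos i (I - {i}) * (u x $ (I - {i}) $ \<tau> * pd i \<phi> x)))"
    by (simp add: inner_commute[of "u _"] cod_test[OF Cp])
  also have "\<dots> = - (\<Sum>i\<in>I. sgnpos i (I - {i}) * (LINT x|lborel. u x $ (I - {i}) $ \<tau> * pd i \<phi> x))"
    using iu by simp
  finally have E: "(LINT x|lborel. ?F x \<bullet> ?v x)
      = - (\<Sum>i\<in>I. sgnpos i (I - {i}) * (LINT x|lborel. u x $ (I - {i}) $ \<tau> * pd i \<phi> x))" .
  show "integrable (lebesgue_on W) (\<lambda>x. f x I \<tau> * \<phi> x) \<and>
    (\<forall>i\<in>I. integrable (lebesgue_on W) (\<lambda>x. dec (u x) (I - {i}) \<tau> * pd i \<phi> x)) \<and>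
    integral\<^sup>L (lebesgue_on W) (\<lambda>x. f x I \<tau> * \<phi> x) =
    - (\<Sum>i\<in>I. sgnpos i (I - {i}) * integral\<^sup>L (lebesgue_on W) (\<lambda>x. dec (u x) (I - {i}) \<tau> * pd i \<phi> x))"
    using F_f U E by simp
qed

text \<open>An inequality because \<open>ip\<close> integrates over the whole space, with the
  identity as metric outside \<open>W\<close>.\<close>

lemma L2_of_H:
  assumes u: "H u" "\<And>x. dgr p (u x)"
  shows "L2norm_sq W G p (\<lambda>x. dec (u x)) \<le> ennreal (ip u u)"
    and "L2 W G p (\<lambda>x. dec (u x))"
proof -
  have mu: "u \<in> borel_measurable borel" by (rule H_meas[OF u(1)])
  have "L2norm_sq W G p (\<lambda>x. dec (u x)) \<le> (\<integral>\<^sup>+x. ennreal (gB (Gx x) (u x) (u x)) \<partial>lebesgue)"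
    unfolding L2norm_sq_def
    by (rule nn_integral_mono) (auto simp: gip_enc enc_dec[OF u(2)] Gx_def indicator_def)
  also have "\<dots> = (\<integral>\<^sup>+x. ennreal (gB (Gx x) (u x) (u x)) \<partial>lborel)" by (rule nn_integral_completion)
  also have "\<dots> = ennreal (ip u u)"
    unfolding ip_def by (rule nn_integral_eq_integral[OF H_int[OF u(1)]]) (simp add: B_nonneg)
  finally show n: "L2norm_sq W G p (\<lambda>x. dec (u x)) \<le> ennreal (ip u u)" .
  have "(\<lambda>x. dec (u x) I \<tau>) \<in> borel_measurable (lebesgue_on W)" for I \<tau>
  proof -
    have "(\<lambda>x. u x $ I $ \<tau>) \<in> borel_measurable lborel"
      using measurable_entry[OF mu] by simp
    then show ?thesis unfolding dec_def by (intro measurable_restrict_space1 measurable_completion)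
  qed
  then show "L2 W G p (\<lambda>x. dec (u x))"
    using n order_le_less_trans[OF n ennreal_less_top] by (simp add: L2_def L2norm_sq_def)
qed

end

theorem theorem1p3:
  fixes D :: "((real,'n::{finite,linorder}) vec) set"
    and g :: "(real,'n) vec \<Rightarrow> real^('r::finite)^'r"
    and q :: nat
    and f :: "(real,'n) vec \<Rightarrow> ('n, 'r) coeffs"
  assumes "open D" and "convex D" and "D \<noteq> {}"
    and "1 \<le> q" and "q \<le> CARD('n)"
    and "riem_metric D g"
    and "nakano_q_semipositive D g q"
    and "smooth_upto_boundary D f"
    and "L2 D g q f" and "weak_d D q f (\<lambda>x I \<tau>. 0)"
    and "dom_dstar D g q f"
    and "(\<integral>\<^sup>+x\<in>D. theta_inv g q x (f x) \<partial>lebesgue) < \<infinity>"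
  shows "\<exists>u. L2 D g (q - 1) u \<and> weak_d D (q - 1) u f \<and>
           L2norm_sq D g (q - 1) u \<le> (\<integral>\<^sup>+x\<in>D. theta_inv g q x (f x) \<partial>lebesgue)"
proof -
  obtain p where q: "q = Suc p" using assms(4) by (cases q) auto
  obtain A0 where A0: "A0 \<ge> 0" "(\<integral>\<^sup>+x\<in>D. theta_inv g q x (f x) \<partial>lebesgue) = ennreal A0"
    using assms(12) by (cases "\<integral>\<^sup>+x\<in>D. theta_inv g q x (f x) \<partial>lebesgue" rule: ennreal_cases) auto
  have g: "continuous_on D g" "\<And>x. x \<in> D \<Longrightarrow> posdef (g x)"
    using C1_cont[OF conjunct1[OF Ck_on_2_C1]] assms(6) riem_metric_posdef[OF assms(6)] by (auto simp: riem_metric_def)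
  interpret wf: weighted_forms D g by unfold_locales (use assms(1) g in auto)
  have cF: "continuous_on D (\<lambda>x. enc q (f x))" by (rule C1_cont[OF enc_C1[OF assms(1,8)]])
  let ?F = "\<lambda>x. if x \<in> D then enc q (f x) else 0"
  let ?X = "{v. tform D q v} :: ((real,'n) vec \<Rightarrow> real^'r^'n set) set"
  define \<Lambda> where "\<Lambda> v = (LINT x|lborel. ?F x \<bullet> v x)" for v :: "(real,'n) vec \<Rightarrow> real^'r^'n set"
  have iF: "integrable lborel (\<lambda>x. ?F x \<bullet> v x)" if "v \<in> ?X" for v
    by (rule integrable_inner_cform[OF cF]) (use that in \<open>simp add: tform_def\<close>)
  \<comment> \<open>Applying Riesz to T v \<mapsto> \<Lambda> v: the identity <u, T v> = \<Lambda> v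
    is the weak form of du = f, and the constant in \<open>main_inequality\<close> becomes the norm
    bound for u.\<close>
  obtain u s where u: "wf.H u" "\<And>x. u x \<in> {a. dgr p a}" "\<And>v. v \<in> ?X \<Longrightarrow> wf.ip u (wf.T v) = \<Lambda> v" "wf.ip u u \<le> A0"
    "\<And>n::nat. s n \<in> ?X" "(\<lambda>n. wf.ip (\<lambda>x. u x - wf.T (s n) x) (\<lambda>x. u x - wf.T (s n) x)) \<longlonglongrightarrow> 0"
  proof (rule wf.riesz[of ?X wf.T \<Lambda> A0 "{a. dgr p a}"])
    show "?X \<noteq> {}" using tform_zero by blast
    show "wf.H (wf.T v)" if "v \<in> ?X" for v using that by (intro wf.H_T) (simp add: tform_def)
    show "\<exists>l\<in>?X. (\<forall>x. wf.T l x = wf.T i x + c *\<^sub>R wf.T k x) \<and> \<Lambda> l = \<Lambda> i + c * \<Lambda> k"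
      if ik: "i \<in> ?X" "k \<in> ?X" for c i k
    proof (rule bexI[of _ "\<lambda>x. i x + c *\<^sub>R k x"], intro conjI allI)
      have C: "C1 UNIV i" "C1 UNIV k" using ik by (auto simp: tform_def cform_def)
      show "wf.T (\<lambda>x. i x + c *\<^sub>R k x) x = wf.T i x + c *\<^sub>R wf.T k x" for x
        by (simp add: wf.T_def cod_comb[OF C] mact_add_right mact_scaleR_right)
      show "\<Lambda> (\<lambda>x. i x + c *\<^sub>R k x) = \<Lambda> i + c * \<Lambda> k"
        unfolding \<Lambda>_def inner_add_right inner_scaleR_right
        using iF[OF ik(1)] iF[OF ik(2)] by simp
      show "(\<lambda>x. i x + c *\<^sub>R k x) \<in> ?X" using ik by (simp add: tform_comb)
    qed
    show "(\<Lambda> v)^2 \<le> A0 * wf.ip (wf.T v) (wf.T v)" if "v \<in> ?X" for v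
    proof -
      have "wf.ip (wf.T v) (wf.T v) = (LINT x|lborel. cod v x \<bullet> mact (matrix_inv (if x \<in> D then g x else mat 1)) (cod v x))"
        unfolding wf.ip_T by (simp add: wf.T_def wf.Gx_def inner_commute)
      moreover have "tform D (Suc p) v" using that by (simp add: q)
      ultimately show ?thesis
        unfolding \<Lambda>_def q using main_inequality[OF assms(1,2,6) assms(7-10)[unfolded q] _ A0(1)] A0(2) by (simp add: q)
    qed
    show "0 \<le> A0" by (rule A0(1))
    show "subspace {a. dgr p a}" by (rule dgr_subspace)
    show "wf.T v x \<in> {a. dgr p a}" if "v \<in> ?X" for v x using that wf.dgr_T[of p v x] by (simp add: q)
  qed (rule that)
  have d: "dgr p (u x)" for x using u(2) by simp
  show ?thesis
  proof (intro exI conjI)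
    show "L2 D g (q - 1) (\<lambda>x. dec (u x))" using wf.L2_of_H(2)[OF u(1) d] by (simp add: q)
    have "(LINT x|lborel. u x \<bullet> cod v x) = (LINT x|lborel. (if x \<in> D then enc (Suc p) (f x) else 0) \<bullet> v x)"
      if "tform D (Suc p) v" for v
      using u(3)[of v] that unfolding \<Lambda>_def wf.ip_T q by simp
    from wf.weak_d_dual[OF cF[unfolded q] u(1) this] show "weak_d D (q - 1) (\<lambda>x. dec (u x)) f"
      by (simp add: q)
    have "L2norm_sq D g p (\<lambda>x. dec (u x)) \<le> ennreal A0"
      using wf.L2_of_H(1)[OF u(1) d] ennreal_leI[OF u(4)] by (rule order_trans)
    then show "L2norm_sq D g (q - 1) (\<lambda>x. dec (u x)) \<le> (\<integral>\<^sup>+x\<in>D. theta_inv g q x (f x) \<partial>lebesgue)"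
      unfolding A0(2) by (simp add: q)
  qed
qed

end
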